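(* Let $R_{\alpha,\gamma}$ be the nonstandard half-collar about a boundary geodesic $\alpha$ of length $\ell(\alpha)>1$ on a geodesic pair of pants. Then $$\lambda(R_{\alpha,\gamma})\asymp\ell(\eta),$$ i.e. there is a universal constant $C\ge1$ such that $C^{-1}\ell(\eta)\le\lambda(R_{\alpha,\gamma})\le C\,\ell(\eta)$ for all such half-collars, where $\ell(\eta)$ is given by $\tanh\ell(\eta)=\dfrac{\tanh\ell(\gamma)}{\cosh(\ell(\alpha)/2)}$.
   Context: A geodesic pair of pants $P$ is a complete hyperbolic (curvature $-1$) surface homeomorphic to a sphere minus three disks whose boundary components are closed geodesics or punctures, at least one being a closed geodesic. Let $\alpha$ be a boundary geodesic of $P$ and $\alpha_1,\alpha_2$ the other two boundary components (geodesics or punctures). Let $\gamma$ be the simple orthogeodesic in $P$ from $\alpha$ to $\alpha_1$. If $\alpha_1$ is a geodesic, let $b$ be the endpoint of $\gamma$ on $\alpha_1$; in each of the two hexagons into which the simple orthogeodesics cut $P$, drop the perpendicular from $b$ to the simple orthogeodesic from $\alpha$ to $\alpha_2$. The union of the two perpendiculars is a piecewise geodesic loop $\beta$ with corner $b$. If $\alpha_1$ is a puncture, $\gamma$ is the simple geodesic ray from $\alpha$ orthogonal to $\alpha$ going out the puncture, $\ell(\gamma)=\infty$ (with $\tanh\infty=1$), and $\beta$ is the simple bi-infinite geodesic going out the puncture $\alpha_1$ in both directions and orthogonal to the simple orthogeodesic from $\alpha$ to $\alpha_2$. The nonstandard half-collar $R_{\alpha,\gamma}$ is the annular region of $P$ between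 $\alpha$ and $\beta$. The segment $\eta$ is the part, between $\alpha$ and $\beta$, of the orthogeodesic from $\alpha$ to $\alpha_2$; $\ell(\cdot)$ is hyperbolic length. For a doubly connected region $R$, $\lambda(R)$ is the extremal length of the family of curves in $R$ connecting its two boundary components. *)

theory Defs
  imports "HOL-Complex_Analysis.Complex_Analysis" "HOL-Algebra.Bij"
begin

section \<open>The hyperbolic plane\<close>

text \<open>
  We use the Poincare disc with the metric \<open>2|dz| / (1 - |z|^2)\<close> of curvature \<open>-1\<close>.  Its
  orientation preserving isometries are the Moebius transformations \<open>Moebius_function \<theta> w\<close> with
  \<open>|w| < 1\<close>, and its ideal boundary is the unit circle.
\<close>

abbreviation hdisc :: "complex set" where
  "hdisc \<equiv> ball 0 1"

text \<open>
  The complete geodesics parametrized by arc length over the whole real line: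
  \<open>t \<mapsto> tanh (t/2)\<close> runs at unit speed along the real diameter.
\<close>

definition unit_geodesic :: "(real \<Rightarrow> complex) \<Rightarrow> bool" where
  "unit_geodesic g \<longleftrightarrow>
     (\<exists>\<theta> w. norm w < 1 \<and> g = (\<lambda>t. Moebius_function \<theta> w (of_real (tanh (t / 2)))))"

definition hconvex :: "complex set \<Rightarrow> bool" where
  "hconvex K \<longleftrightarrow> K \<subseteq> hdisc \<and>
     (\<forall>g s t u. unit_geodesic g \<and> s \<le> t \<and> t \<le> u \<and> g s \<in> K \<and> g u \<in> K \<longrightarrow> g t \<in> K)"

text \<open>The disc model is conformal, so hyperbolic right angles are Euclidean right angles.\<close>

definition meets_perp ::
  "(real \<Rightarrow> complex) \<Rightarrow> real \<Rightarrow> (real \<Rightarrow> complex) \<Rightarrow> real \<Rightarrow> bool" where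
  "meets_perp g s c t \<longleftrightarrow>
     g s = c t \<and> vector_derivative g (at s) \<bullet> vector_derivative c (at t) = 0"

text \<open>
  The part of a geodesic with parameters from \<open>s\<close> to \<open>u\<close>; infinite values give rays and lines.
  Its hyperbolic length is \<open>u - s\<close>.
\<close>

definition params :: "ereal \<Rightarrow> ereal \<Rightarrow> real set" where
  "params s u = {t. s \<le> ereal t \<and> ereal t \<le> u}"

definition arc_of :: "(real \<Rightarrow> complex) \<Rightarrow> ereal \<Rightarrow> ereal \<Rightarrow> complex set" where
  "arc_of g s u = g ` params s u"

definition horoball :: "complex \<Rightarrow> real \<Rightarrow> complex set" where
  "horoball \<xi> r = ball (of_real (1 - r) * \<xi>) r"

section \<open>Geodesic pairs of pants\<close>

text \<open>
  A complete hyperbolic surface with geodesic boundary is the quotient of its universal cover,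
  a closed convex region \<open>cover\<close> of the hyperbolic plane bounded by complete geodesics, by a
  discrete group \<open>deck\<close> of isometries acting freely.  The map \<open>proj\<close> identifies this quotient
  with a set of points \<open>pts\<close>: the unit sphere minus three disjoint round discs with centres
  \<open>ctr i\<close> and (chordal) radii \<open>rad i\<close>, \<open>i = 0, 1, 2\<close>.  The removed disc is open where the boundary
  component is a geodesic, and closed where it is a puncture (\<open>i \<in> punct\<close>).
\<close>

record pants =
  deck :: "(complex \<Rightarrow> complex) set"
  cover :: "complex set"
  proj :: "complex \<Rightarrow> real ^ 3"
  ctr :: "nat \<Rightarrow> real ^ 3"
  rad :: "nat \<Rightarrow> real"
  punct :: "nat set"

definition pts :: "pants \<Rightarrow> (real ^ 3) set" where
  "pts P = sphere 0 1 -
     (\<Union>i\<in>{0, 1, 2}. if i \<in> punct P then cball (ctr P i) (rad P i) else ball (ctr P i) (rad P i))"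

definition bdry :: "pants \<Rightarrow> nat \<Rightarrow> (real ^ 3) set" where
  "bdry P i = sphere 0 1 \<inter> sphere (ctr P i) (rad P i)"

definition torsion_free_fuchsian :: "(complex \<Rightarrow> complex) set \<Rightarrow> bool" where
  "torsion_free_fuchsian \<Gamma> \<longleftrightarrow>
     subgroup \<Gamma> (BijGroup hdisc) \<and>
     (\<forall>f\<in>\<Gamma>. \<exists>\<theta> w. norm w < 1 \<and> f = restrict (Moebius_function \<theta> w) hdisc) \<and>
     (\<forall>f\<in>\<Gamma>. \<forall>z\<in>hdisc. f z = z \<longrightarrow> f = restrict id hdisc) \<and>
     (\<forall>K. compact K \<and> K \<subseteq> hdisc \<longrightarrow> finite {f \<in> \<Gamma>. f ` K \<inter> K \<noteq> {}})"

text \<open>Being closed in the hyperbolic plane makes the region, and hence its quotient, complete.\<close>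

definition geodesic_region :: "complex set \<Rightarrow> bool" where
  "geodesic_region S \<longleftrightarrow>
     hconvex S \<and> closedin (top_of_set hdisc) S \<and> interior S \<noteq> {} \<and>
     (\<forall>z\<in>S - interior S. \<exists>g. unit_geodesic g \<and> z \<in> range g \<and> range g \<subseteq> S - interior S)"

text \<open>
  The ideal points over the puncture \<open>i\<close>: fixed points of parabolic deck transformations (those
  preserving a horoball) whose horoballs project into arbitrarily small neighbourhoods of the
  \<open>i\<close>-th end.
\<close>

definition cusp_lift :: "pants \<Rightarrow> nat \<Rightarrow> complex \<Rightarrow> bool" where
  "cusp_lift P i \<xi> \<longleftrightarrow> norm \<xi> = 1 \<and>
     (\<exists>r. 0 < r \<and> r < 1 \<and> horoball \<xi> r \<subseteq> cover P \<and>
        (\<exists>f\<in>deck P. f \<noteq> restrict id hdisc \<and> f ` horoball \<xi> r = horoball \<xi> r) \<and>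
        (\<forall>\<epsilon>>0. \<exists>s. 0 < s \<and> s \<le> r \<and>
           proj P ` horoball \<xi> s \<subseteq> {x. dist x (ctr P i) < rad P i + \<epsilon>}))"

definition geodesic_pants :: "pants \<Rightarrow> bool" where
  "geodesic_pants P \<longleftrightarrow>
     torsion_free_fuchsian (deck P) \<and>
     geodesic_region (cover P) \<and> (\<forall>f\<in>deck P. f ` cover P = cover P) \<and>
     (\<forall>i\<in>{0, 1, 2}. norm (ctr P i) = 1 \<and> 0 < rad P i) \<and>
     (\<forall>i\<in>{0, 1, 2}. \<forall>j\<in>{0, 1, 2}. i \<noteq> j \<longrightarrow>
        sphere 0 1 \<inter> cball (ctr P i) (rad P i) \<inter> cball (ctr P j) (rad P j) = {}) \<and>
     quotient_map (top_of_set (cover P)) (top_of_set (pts P)) (proj P) \<and>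
     (\<forall>z\<in>cover P. \<forall>w\<in>cover P. proj P z = proj P w \<longleftrightarrow> (\<exists>f\<in>deck P. w = f z)) \<and>
     punct P \<subset> {0, 1, 2} \<and> (\<forall>i\<in>punct P. \<exists>\<xi>. cusp_lift P i \<xi>)"

section \<open>Orthogeodesics and the two hexagons\<close>

text \<open>A lift of a boundary component: a boundary geodesic of the cover, or an ideal point.\<close>

datatype bdry_lift = Geod "real \<Rightarrow> complex" | Cusp complex

fun is_lift :: "pants \<Rightarrow> nat \<Rightarrow> bdry_lift \<Rightarrow> bool" where
  "is_lift P i (Geod c) \<longleftrightarrow>
     i \<notin> punct P \<and> unit_geodesic c \<and> range c \<subseteq> cover P \<and> proj P ` range c \<subseteq> bdry P i"
| "is_lift P i (Cusp \<xi>) \<longleftrightarrow> i \<in> punct P \<and> cusp_lift P i \<xi>"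

text \<open>The closed geodesic \<open>proj P \<circ> c\<close> has length \<open>L\<close>.\<close>

definition closed_length :: "pants \<Rightarrow> (real \<Rightarrow> complex) \<Rightarrow> real \<Rightarrow> bool" where
  "closed_length P c L \<longleftrightarrow> 0 < L \<and>
     (\<forall>t. proj P (c (t + L)) = proj P (c t)) \<and> inj_on (proj P \<circ> c) {0..<L}"

text \<open>The geodesic \<open>g\<close> ends orthogonally on a boundary lift, or in an ideal point, at \<open>s\<close>.\<close>

fun ends_on :: "(real \<Rightarrow> complex) \<Rightarrow> ereal \<Rightarrow> bdry_lift \<Rightarrow> bool" where
  "ends_on g s (Geod c) \<longleftrightarrow> (\<exists>r t. s = ereal r \<and> meets_perp g r c t)"
| "ends_on g s (Cusp \<xi>) \<longleftrightarrow>
     (s = \<infinity> \<and> (g \<longlongrightarrow> \<xi>) at_top) \<or> (s = -\<infinity> \<and> (g \<longlongrightarrow> \<xi>) at_bot)"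

text \<open>
  The arc of \<open>g\<close> from \<open>s\<close> to \<open>u\<close> is a lift, going from \<open>A\<close> to \<open>B\<close>, of a simple orthogeodesic.
\<close>

definition simple_orthogeodesic ::
  "pants \<Rightarrow> bdry_lift \<Rightarrow> (real \<Rightarrow> complex) \<Rightarrow> ereal \<Rightarrow> ereal \<Rightarrow> bdry_lift \<Rightarrow> bool" where
  "simple_orthogeodesic P A g s u B \<longleftrightarrow>
     unit_geodesic g \<and> s < u \<and> arc_of g s u \<subseteq> cover P \<and>
     inj_on (proj P \<circ> g) (params s u) \<and> ends_on g s A \<and> ends_on g u B"

text \<open>
  \<open>Q\<close> is a closed right-angled hexagon in the cover (ideal vertices replace the sides that lie on
  punctures).  Three alternating sides lie on lifts \<open>A0\<close>, \<open>A1\<close>, \<open>A2\<close> of the boundary components;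
  the other three, of which \<open>Q\<close> is the convex hull, are lifts of the simple orthogeodesics, \<open>g\<close>
  from \<open>A0\<close> to \<open>A1\<close>, \<open>d\<close> from \<open>A0\<close> to \<open>A2\<close> and \<open>e\<close> from \<open>A1\<close> to \<open>A2\<close>.
\<close>

definition hexagon ::
  "pants \<Rightarrow> bdry_lift \<Rightarrow> bdry_lift \<Rightarrow> bdry_lift \<Rightarrow> (real \<Rightarrow> complex) \<Rightarrow> ereal \<Rightarrow>
   (real \<Rightarrow> complex) \<Rightarrow> ereal \<Rightarrow> (real \<Rightarrow> complex) \<Rightarrow> ereal \<Rightarrow> ereal \<Rightarrow> complex set \<Rightarrow> bool" where
  "hexagon P A0 A1 A2 g lg d ld e s u Q \<longleftrightarrow>
     is_lift P 0 A0 \<and> is_lift P 1 A1 \<and> is_lift P 2 A2 \<and>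
     simple_orthogeodesic P A0 g 0 lg A1 \<and>
     simple_orthogeodesic P A0 d 0 ld A2 \<and>
     simple_orthogeodesic P A1 e s u A2 \<and>
     Q = hconvex hull (arc_of g 0 lg \<union> arc_of d 0 ld \<union> arc_of e s u)"

text \<open>
  The simple orthogeodesics cut the pants into two hexagons.  These are lifted to hexagons \<open>Q\<close> and
  \<open>Q'\<close> adjacent along the lift \<open>g\<close> of \<open>\<gamma>\<close>; their sides \<open>d\<close>, \<open>d'\<close> are lifts of the same
  orthogeodesic, and so are \<open>e\<close>, \<open>e'\<close>.
\<close>

definition cut_into_hexagons ::
  "pants \<Rightarrow> (real \<Rightarrow> complex) \<Rightarrow> bdry_lift \<Rightarrow> (real \<Rightarrow> complex) \<Rightarrow> ereal \<Rightarrow>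
   (real \<Rightarrow> complex) \<Rightarrow> (real \<Rightarrow> complex) \<Rightarrow> ereal \<Rightarrow> complex set \<Rightarrow> complex set \<Rightarrow> bool" where
  "cut_into_hexagons P a A1 g lg d d' ld Q Q' \<longleftrightarrow>
     (\<exists>A2 A2' e e' s u.
        hexagon P (Geod a) A1 A2 g lg d ld e s u Q \<and>
        hexagon P (Geod a) A1 A2' g lg d' ld e' s u Q' \<and>
        (\<exists>f\<in>deck P. \<forall>t. d' t = f (d t)) \<and> (\<exists>f\<in>deck P. \<forall>t. e' t = f (e t))) \<and>
     interior Q \<inter> interior Q' = {} \<and> inj_on (proj P) (interior Q \<union> interior Q') \<and>
     proj P ` (Q \<union> Q') = pts P"

section \<open>Nonstandard half-collars\<close>

text \<open>
  In the hexagon \<open>Q\<close> the segment \<open>p\<close>, of length \<open>m\<close>, is the perpendicular from \<open>b\<close> to the side \<open>d\<close>,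
  with foot at distance \<open>x\<close> from the start of \<open>d\<close>.
\<close>

definition perpendicular_in ::
  "complex set \<Rightarrow> complex \<Rightarrow> (real \<Rightarrow> complex) \<Rightarrow> ereal \<Rightarrow>
   (real \<Rightarrow> complex) \<Rightarrow> real \<Rightarrow> real \<Rightarrow> bool" where
  "perpendicular_in Q b d ld p m x \<longleftrightarrow>
     unit_geodesic p \<and> 0 < m \<and> arc_of p 0 m \<subseteq> Q \<and> p 0 = b \<and>
     0 < x \<and> ereal x \<le> ld \<and> meets_perp p m d x"

text \<open>The perpendiculars from the endpoint \<open>b\<close> of \<open>\<gamma>\<close>, when the component 1 is a geodesic.\<close>

definition geodesic_beta ::
  "pants \<Rightarrow> (real \<Rightarrow> complex) \<Rightarrow> ereal \<Rightarrow> (real \<Rightarrow> complex) \<Rightarrow> (real \<Rightarrow> complex) \<Rightarrow> ereal \<Rightarrow>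
   complex set \<Rightarrow> complex set \<Rightarrow> real \<Rightarrow> (real ^ 3) set \<Rightarrow> bool" where
  "geodesic_beta P g lg d d' ld Q Q' x \<beta> \<longleftrightarrow>
     (\<exists>r p m p' m' x'. lg = ereal r \<and>
        perpendicular_in Q (g r) d ld p m x \<and> perpendicular_in Q' (g r) d' ld p' m' x' \<and>
        proj P (p m) = proj P (p' m') \<and>
        \<beta> = proj P ` (arc_of p 0 m \<union> arc_of p' 0 m'))"

text \<open>The simple bi-infinite geodesic orthogonal to \<open>d\<close>, when the component 1 is a puncture.\<close>

definition puncture_beta ::
  "pants \<Rightarrow> (real \<Rightarrow> complex) \<Rightarrow> ereal \<Rightarrow> real \<Rightarrow> (real ^ 3) set \<Rightarrow> bool" where
  "puncture_beta P d ld x \<beta> \<longleftrightarrow>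
     (\<exists>p t. unit_geodesic p \<and> range p \<subseteq> cover P \<and> inj (proj P \<circ> p) \<and>
        ((\<lambda>t. dist (proj P (p t)) (ctr P 1)) \<longlongrightarrow> rad P 1) at_top \<and>
        ((\<lambda>t. dist (proj P (p t)) (ctr P 1)) \<longlongrightarrow> rad P 1) at_bot \<and>
        0 < x \<and> ereal x \<le> ld \<and> meets_perp p t d x \<and> \<beta> = proj P ` range p)"

text \<open>
  \<open>R\<close> is the nonstandard half-collar about the boundary geodesic \<open>\<alpha> = bdry P 0\<close> of length \<open>L\<close>,
  determined by the simple orthogeodesic \<open>\<gamma>\<close> of length \<open>lg\<close> from \<open>\<alpha>\<close> to the component 1; its other
  boundary curve is \<open>\<beta>\<close>, and \<open>x\<close> is the length of \<open>\<eta>\<close>.  Since the labels 0, 1, 2 of the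
  boundary components are arbitrary, so is the choice of \<open>\<alpha>\<close> and of \<open>\<alpha>\<^sub>1\<close>.
\<close>

definition nonstandard_half_collar ::
  "pants \<Rightarrow> real \<Rightarrow> ereal \<Rightarrow> (real ^ 3) set \<Rightarrow> real \<Rightarrow> (real ^ 3) set \<Rightarrow> bool" where
  "nonstandard_half_collar P L lg \<beta> x R \<longleftrightarrow>
     geodesic_pants P \<and>
     (\<exists>a A1 g d d' ld Q Q'.
        closed_length P a L \<and> cut_into_hexagons P a A1 g lg d d' ld Q Q' \<and>
        (if 1 \<in> punct P then puncture_beta P d ld x \<beta>
         else geodesic_beta P g lg d d' ld Q Q' x \<beta>)) \<and>
     R \<in> components (pts P - (bdry P 0 \<union> \<beta>)) \<and> bdry P 0 \<union> \<beta> \<subseteq> closure R"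

section \<open>Extremal length\<close>

text \<open>
  Conformal metrics on the pants are written as \<open>\<rho> ds\<close> with \<open>ds\<close> the hyperbolic line element.
  Curves in the pants are given by their lifts to the cover.
\<close>

definition rho_length :: "pants \<Rightarrow> (real ^ 3 \<Rightarrow> ennreal) \<Rightarrow> (real \<Rightarrow> complex) \<Rightarrow> ennreal" where
  "rho_length P \<rho> c =
     (\<integral>\<^sup>+t\<in>{0..1}. \<rho> (proj P (c t)) *
        ennreal (2 * norm (vector_derivative c (at t)) / (1 - (norm (c t))\<^sup>2)) \<partial>lborel)"

text \<open>
  The integral of \<open>\<rho>^2\<close> over \<open>E\<close> for the hyperbolic area of the pants, computed in the cover.
  The supremum is attained at a Borel set \<open>F\<close> containing exactly one lift of every point of \<open>E\<close>.
\<close>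

definition rho_area :: "pants \<Rightarrow> (real ^ 3 \<Rightarrow> ennreal) \<Rightarrow> (real ^ 3) set \<Rightarrow> ennreal" where
  "rho_area P \<rho> E =
     (SUP F\<in>{F. F \<in> sets borel \<and> F \<subseteq> cover P \<and> proj P ` F \<subseteq> E \<and> inj_on (proj P) F}.
        \<integral>\<^sup>+z\<in>F. (\<rho> (proj P z))\<^sup>2 * ennreal (4 / (1 - (norm z)\<^sup>2)\<^sup>2) \<partial>lborel)"

definition connecting_curves ::
  "pants \<Rightarrow> (real ^ 3) set \<Rightarrow> (real ^ 3) set \<Rightarrow> (real ^ 3) set \<Rightarrow> (real \<Rightarrow> complex) set" where
  "connecting_curves P \<alpha> \<beta> R =
     {c. valid_path c \<and> path_image c \<subseteq> cover P \<and> proj P (pathstart c) \<in> \<alpha> \<and>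
         proj P (pathfinish c) \<in> \<beta> \<and> (\<forall>t\<in>{0<..<1}. proj P (c t) \<in> R)}"

text \<open>The extremal length of the family of curves in \<open>R\<close> connecting \<open>\<alpha>\<close> with \<open>\<beta>\<close>.\<close>

definition extremal_length ::
  "pants \<Rightarrow> (real ^ 3) set \<Rightarrow> (real ^ 3) set \<Rightarrow> (real ^ 3) set \<Rightarrow> ennreal" where
  "extremal_length P \<alpha> \<beta> R =
     (SUP \<rho>\<in>{\<rho> \<in> borel_measurable borel. 0 < rho_area P \<rho> R \<and> rho_area P \<rho> R < \<infinity>}.
        (INF c\<in>connecting_curves P \<alpha> \<beta> R. rho_length P \<rho> c)\<^sup>2 / rho_area P \<rho> R)"

definition tanh_ext :: "ereal \<Rightarrow> real" where
  "tanh_ext l = (if l = \<infinity> then 1 else tanh (real_of_ereal l))"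

end

theory Submission
  imports Defs "HOL-Homology.Homology"
begin

text \<open>
  The half-collar is unrolled along \<open>\<alpha>\<close>.  Let \<open>\<Psi>\<close> (\<open>strip_map\<close>) map the strip \<open>|Im \<zeta>| < \<pi>/2\<close> conformally
  onto the disc, so that the real axis runs along a lift of \<open>\<alpha>\<close> by arc length, the cover lies above it,
  and the lift \<open>d\<close> of the orthogeodesic to \<open>\<alpha>\<^sub>2\<close> stands over the point \<open>0\<close>.  With \<open>\<zeta> = t + i\<theta>\<close> the
  hyperbolic metric is \<open>|d\<zeta>| / cos \<theta>\<close>, and the geodesic that meets \<open>d\<close> at right angles at height \<open>x\<close> is
  the curve \<open>sin \<theta> = k cosh t\<close> with \<open>k = tanh x\<close>.  This curve is a lift of \<open>\<beta>\<close> over \<open>|t| \<le> L/2\<close>, where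
  \<open>L\<close> is the length of \<open>\<alpha>\<close> and \<open>x\<close> that of \<open>\<eta>\<close>; the half-collar is the cell between it and the real
  axis, with the two vertical ends identified.

  Extremal length is conformally invariant, so it can be estimated in the cell.  It is at most a
  multiple of \<open>k\<close> because already the vertical segments over \<open>0 < t < 1/2\<close>, which lie in the cell since
  \<open>L > 1\<close>, join \<open>\<alpha>\<close> to \<open>\<beta>\<close>, and the area below \<open>\<theta> = arcsin (k cosh t)\<close> over this interval is of order
  \<open>k\<close> (\<open>collar.extremal_length_upper\<close>).  It is at least a multiple of \<open>k\<close> because of the metric given by
  the gradient of \<open>sin \<theta> / (k cosh t)\<close>: this function rises from 0 on \<open>\<alpha>\<close> to 1 on \<open>\<beta>\<close>, and its Dirichlet
  integral is at most a multiple of the integral of \<open>1 / (k cosh t)\<close> (\<open>collar.extremal_length_lower\<close>).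
  A curve may wind around the annulus, where the function is not single-valued; the comparison with
  the translates of the function by multiples of \<open>L\<close> takes care of this.  Finally, \<open>k = tanh x\<close> is
  comparable to \<open>x\<close>, because \<open>tanh x \<le> 1 / cosh (L/2) < 1 / cosh (1/2)\<close>.

  The rest of the proof justifies this picture (\<open>half_collar_is_collar\<close>).  The cover lies on one side of
  the lift of \<open>\<alpha>\<close>, since interior points of the cover cannot project to a boundary circle; this is
  invariance of domain.  The orthogeodesics \<open>d\<close>, \<open>g\<close>, \<open>d'\<close> that start on \<open>\<alpha>\<close> stand over points \<open>0\<close>, \<open>\<delta>\<close>, \<open>c\<close>,
  and the deck transformation that carries \<open>d\<close> to \<open>d'\<close> is the translation by \<open>c\<close>.  The main point is the
  symmetry \<open>cosh \<delta> = cosh (\<delta> - c)\<close>, which yields \<open>c = 2 \<delta>\<close> as the two hexagons do not overlap, and then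
  \<open>|c| = L\<close> as they cover each point only once.  If \<open>\<alpha>\<^sub>1\<close> is a geodesic, the symmetry follows from the two
  perpendiculars dropped from the same point of \<open>g\<close>, whose feet have the same distance \<open>x\<close> from \<open>\<alpha>\<close>;
  the height of that point gives \<open>tanh \<ell>(\<gamma>) = tanh x cosh (L/2)\<close>.  If \<open>\<alpha>\<^sub>1\<close> is a puncture, the symmetry
  comes from the third sides \<open>e\<close>, \<open>e'\<close> of the hexagons, which correspond to each other under a deck
  transformation and have the same position relative to the cusp and to \<open>\<alpha>\<^sub>2\<close>.  In that case \<open>\<beta>\<close>
  must run into the puncture, that is \<open>tanh x cosh (L/2) = 1\<close>: a lower perpendicular would meet its own
  translate, and a higher one would cross \<open>e\<close>, so neither would be simple in the pants.

  All computations with geodesics are done in the hyperboloid model, where a geodesic is a pair of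
  orthonormal vectors, orthogonality is vanishing of a Minkowski product, and ideal points are null
  vectors.
\<close>

section \<open>Area under conformal maps\<close>

lemma complex_lborel_distr_prod:
  "(lborel :: complex measure) = distr (lborel :: (real \<times> real) measure) borel (\<lambda>(x, y). Complex x y)"
proof (rule lborel_eqI)
  have m: "(\<lambda>(x, y). Complex x y) \<in> borel_measurable (borel :: (real \<times> real) measure)"
    unfolding Complex_eq case_prod_beta
    by (intro borel_measurable_continuous_onI continuous_intros)
  fix l u :: complex
  assume lu: "\<And>b. b \<in> Basis \<Longrightarrow> l \<bullet> b \<le> u \<bullet> b"
  have le: "Re l \<le> Re u" "Im l \<le> Im u"
    using lu[of 1] lu[of \<i>] by (auto simp: Basis_complex_def)
  have pre: "(\<lambda>(x, y). Complex x y) -` box l u = {Re l<..<Re u} \<times> {Im l<..<Im u}"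
    by (auto simp: in_box_complex_iff)
  have "emeasure (distr lborel borel (\<lambda>(x, y). Complex x y)) (box l u)
      = emeasure (lborel :: (real \<times> real) measure) ({Re l<..<Re u} \<times> {Im l<..<Im u})"
    using m by (subst emeasure_distr) (auto simp: pre)
  also have "\<dots> = emeasure (lborel \<Otimes>\<^sub>M lborel) ({Re l<..<Re u} \<times> {Im l<..<Im u})"
    by (simp add: lborel_prod)
  also have "\<dots> = ennreal (Re u - Re l) * ennreal (Im u - Im l)"
    using le by (subst lborel.emeasure_pair_measure_Times) auto
  finally show "emeasure (distr lborel borel (\<lambda>(x, y). Complex x y)) (box l u)
      = (\<Prod>b\<in>Basis. (u - l) \<bullet> b)"
    using le by (simp add: Basis_complex_def ennreal_mult')
qed simp

lemma complex_lborel_distr_vec: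
  "(lborel :: complex measure) = distr (lborel :: (real^2) measure) borel (\<lambda>v. Complex (v$1) (v$2))"
proof (rule lborel_eqI)
  have m: "(\<lambda>v. Complex (v$1) (v$2)) \<in> borel_measurable (borel :: (real^2) measure)"
    unfolding Complex_eq
    by (intro borel_measurable_continuous_onI continuous_intros)
  fix l u :: complex
  assume lu: "\<And>b. b \<in> Basis \<Longrightarrow> l \<bullet> b \<le> u \<bullet> b"
  have le: "Re l \<le> Re u" "Im l \<le> Im u"
    using lu[of 1] lu[of \<i>] by (auto simp: Basis_complex_def)
  have pre: "(\<lambda>v::real^2. Complex (v$1) (v$2)) -` box l u
      = box (vector [Re l, Im l]) (vector [Re u, Im u])"
    by (auto simp: in_box_complex_iff mem_box_cart forall_2)
  have B: "(Basis :: (real^2) set) = {axis 1 1, axis 2 1}"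
    by (auto simp: Basis_vec_def exhaust_2 UNIV_2)
  have "emeasure (distr lborel borel (\<lambda>v::real^2. Complex (v$1) (v$2))) (box l u)
      = emeasure (lborel :: (real^2) measure) (box (vector [Re l, Im l]) (vector [Re u, Im u]))"
    using m by (subst emeasure_distr) (auto simp: pre)
  also have "\<dots> = ennreal (\<Prod>b\<in>(Basis :: (real^2) set). (vector [Re u, Im u] - vector [Re l, Im l]) \<bullet> b)"
    by (rule emeasure_lborel_box) (use le in \<open>auto simp: B inner_axis\<close>)
  also have "(\<Prod>b\<in>(Basis :: (real^2) set). (vector [Re u, Im u] - vector [Re l, Im l]) \<bullet> b)
     = (Re u - Re l) * (Im u - Im l)"
    unfolding B by (subst prod.insert) (auto simp: inner_axis axis_eq_axis)
  finally show "emeasure (distr lborel borel (\<lambda>v::real^2. Complex (v$1) (v$2))) (box l u)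
      = (\<Prod>b\<in>Basis. (u - l) \<bullet> b)"
    by (simp add: Basis_complex_def)
qed simp

text \<open>
  A holomorphic map is a differentiable map of the plane whose Jacobian determinant is
  \<open>|f'|^2\<close>, so this is the change of variables formula in \<open>real ^ 2\<close> read in the complex plane.
\<close>

lemma emeasure_holomorphic_image:
  assumes der: "\<And>z. z \<in> B \<Longrightarrow> (f has_field_derivative f' z) (at z)"
    and inj: "inj_on f B" and B: "B \<in> sets borel" and fB: "f ` B \<in> sets borel"
    and f': "(\<lambda>z. indicator B z * ennreal ((cmod (f' z))\<^sup>2)) \<in> borel_measurable borel"
  shows "emeasure lborel (f ` B) = (\<integral>\<^sup>+z\<in>B. ennreal ((cmod (f' z))\<^sup>2) \<partial>lborel)"
proof -
  define j where "j = (\<lambda>v::real^2. Complex (v$1) (v$2))"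
  define i :: "complex \<Rightarrow> real^2" where "i = (\<lambda>z. vector [Re z, Im z])"
  have ji [simp]: "j (i z) = z" for z by (simp add: j_def i_def)
  have ij [simp]: "i (j v) = v" for v by (simp add: j_def i_def vec_eq_iff forall_2)
  have "linear j"
    by (intro linearI) (auto simp: j_def complex_eq_iff)
  then have lj: "bounded_linear j" by (simp add: linear_conv_bounded_linear)
  have li: "linear i"
    by (intro linearI) (auto simp: i_def vec_eq_iff forall_2)
  then have li: "bounded_linear i" by (simp add: linear_conv_bounded_linear)
  have mj: "j \<in> borel_measurable borel"
    by (intro borel_measurable_continuous_onI linear_continuous_on lj)
  have mi: "i \<in> borel_measurable borel"
    by (intro borel_measurable_continuous_onI linear_continuous_on li)
  define S where "S = j -` B"
  define F where "F = i \<circ> f \<circ> j"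
  define F' where "F' = (\<lambda>v w. i (f' (j v) * j w))"
  have S: "S \<in> sets borel" unfolding S_def using mj B by (simp add: measurable_sets_borel)
  have FS: "F ` S = j -` (f ` B)"
  proof (intro equalityI subsetI)
    fix v assume "v \<in> j -` (f ` B)"
    then obtain z where z: "z \<in> B" "j v = f z" by auto
    then have "v = F (i z)" by (metis F_def comp_apply ij ji)
    then show "v \<in> F ` S" using z by (auto simp: S_def)
  qed (auto simp: F_def S_def)
  have FSb: "F ` S \<in> sets borel" unfolding FS using mj fB by (simp add: measurable_sets_borel)
  have dF: "(F has_derivative F' v) (at v within S)" if "v \<in> S" for v
  proof -
    have "(f has_derivative (\<lambda>w. f' (j v) * w)) (at (j v))"
      using der[of "j v"] that by (simp add: S_def has_field_derivative_def)
    then have "(f has_derivative (\<lambda>w. f' (j v) * w)) (at (j v) within j ` S)"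
      by (rule has_derivative_at_withinI)
    moreover have "(j has_derivative j) (at v within S)"
      using lj by (rule bounded_linear.has_derivative[OF _ has_derivative_ident])
    ultimately have "(f \<circ> j has_derivative (\<lambda>w. f' (j v) * w) \<circ> j) (at v within S)"
      by (intro diff_chain_within)
    then have "((\<lambda>x. i ((f \<circ> j) x)) has_derivative (\<lambda>x. i (((\<lambda>w. f' (j v) * w) \<circ> j) x))) (at v within S)"
      by (rule bounded_linear.has_derivative[OF li])
    then show ?thesis by (simp add: F_def F'_def o_def)
  qed
  have injF: "inj_on F S"
    by (intro inj_onI) (metis F_def S_def comp_apply ij inj inj_on_eq_iff ji vimageE)
  have det: "\<bar>det (matrix (F' v))\<bar> = (cmod (f' (j v)))\<^sup>2" for v
  proof -
    have "det (matrix (F' v)) = (Re (f' (j v)))\<^sup>2 + (Im (f' (j v)))\<^sup>2"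
      by (simp add: det_2 matrix_def F'_def i_def j_def axis_def power2_eq_square)
    then show ?thesis by (simp add: cmod_power2)
  qed
  have hm: "F ` S \<in> lmeasurable \<and> measure lebesgue (F ` S) = m
     \<longleftrightarrow> ((\<lambda>v. (cmod (f' (j v)))\<^sup>2) has_integral m) S" for m
    using has_measure_differentiable_image[of S F F' m, OF _ dF injF] S by (simp add: det)
  define g where "g = (\<lambda>v. indicator S v * (cmod (f' (j v)))\<^sup>2)"
  have ge: "indicator S v * ennreal ((cmod (f' (j v)))\<^sup>2) = ennreal (g v)" for v
    by (auto simp: g_def indicator_def)
  have ind: "(indicator B (j v) :: ennreal) = indicator S v" for v
    by (auto simp: S_def indicator_def)
  have eg: "(\<lambda>v. ennreal (g v)) \<in> borel_measurable borel"
    using measurable_compose[OF mj f'] by (simp add: ind ge)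
  have "(\<lambda>v. enn2real (ennreal (g v))) \<in> borel_measurable borel"
    using eg by (rule measurable_compose) simp
  then have mg: "g \<in> borel_measurable borel" by (simp add: g_def)
  have g0: "g v \<ge> 0" for v by (simp add: g_def)
  have hg: "((\<lambda>v. (cmod (f' (j v)))\<^sup>2) has_integral m) S \<longleftrightarrow> (g has_integral m) UNIV" for m
  proof -
    have "g = (\<lambda>v. if v \<in> S then (cmod (f' (j v)))\<^sup>2 else 0)"
      by (auto simp: g_def)
    then show ?thesis by (simp only: has_integral_restrict_UNIV)
  qed
  have "emeasure lborel (f ` B) = emeasure lborel (F ` S)"
    using fB mj by (subst complex_lborel_distr_vec, subst emeasure_distr)
      (auto simp: FS[symmetric] j_def[symmetric])
  also have "\<dots> = emeasure lebesgue (F ` S)" using FSb by simp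
  also have "\<dots> = (\<integral>\<^sup>+v. ennreal (g v) \<partial>lborel)"
  proof (cases "(\<integral>\<^sup>+v. ennreal (g v) \<partial>lborel) = \<infinity>")
    case False
    then obtain m where m: "m \<ge> 0" "(\<integral>\<^sup>+v. ennreal (g v) \<partial>lborel) = ennreal m"
      by (metis ennreal_cases infinity_ennreal_def)
    then have "(g has_integral m) UNIV"
      by (intro nn_integral_has_integral) (use mg g0 in auto)
    then have "F ` S \<in> lmeasurable" "measure lebesgue (F ` S) = m"
      using hm[of m] hg by auto
    then show ?thesis using m by (simp add: emeasure_eq_measure2 fmeasurableD2)
  next
    case True
    have "emeasure lebesgue (F ` S) = \<infinity>"
    proof (rule ccontr)
      assume "emeasure lebesgue (F ` S) \<noteq> \<infinity>"
      then have "F ` S \<in> lmeasurable"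
        using FSb by (intro fmeasurableI) (auto simp: less_top)
      then have "(g has_integral (measure lebesgue (F ` S))) UNIV" using hm hg by blast
      then have "(\<integral>\<^sup>+v. ennreal (g v) \<partial>lborel) = ennreal (measure lebesgue (F ` S))"
        by (intro nn_integral_has_integral_lborel) (use mg g0 in auto)
      then show False using True by simp
    qed
    then show ?thesis using True by simp
  qed
  also have "\<dots> = (\<integral>\<^sup>+v. (indicator B (j v)) * ennreal ((cmod (f' (j v)))\<^sup>2) \<partial>lborel)"
    by (simp add: ind ge)
  also have "\<dots> = (\<integral>\<^sup>+z\<in>B. ennreal ((cmod (f' z))\<^sup>2) \<partial>lborel)"
  proof -
    have "(\<integral>\<^sup>+z\<in>B. ennreal ((cmod (f' z))\<^sup>2) \<partial>lborel)
        = (\<integral>\<^sup>+z. indicator B z * ennreal ((cmod (f' z))\<^sup>2) \<partial>(distr lborel borel j))"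
      unfolding j_def complex_lborel_distr_vec[symmetric] by (simp add: mult.commute)
    then show ?thesis using f' mj by (subst (asm) nn_integral_distr) auto
  qed
  finally show ?thesis .
qed

text \<open>
  The formula for sets says that the measure with density \<open>|f'|^2\<close> on \<open>U\<close> has Lebesgue measure on \<open>V\<close> as its
  image; integrating against both measures gives the formula for functions.
\<close>

lemma nn_integral_conformal:
  assumes oU: "open U" and oV: "open V"
    and der: "\<And>z. z \<in> U \<Longrightarrow> (f has_field_derivative f' z) (at z)"
    and cf': "continuous_on U f'" and cg: "continuous_on V g"
    and fg: "\<And>z. z \<in> U \<Longrightarrow> f z \<in> V \<and> g (f z) = z" and gf: "\<And>w. w \<in> V \<Longrightarrow> g w \<in> U \<and> f (g w) = w"
    and B: "B \<in> sets borel" "B \<subseteq> U" and h: "(\<lambda>w. h w * indicator (f ` B) w) \<in> borel_measurable borel"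
  shows "f ` B \<in> sets borel"
    "(\<integral>\<^sup>+w\<in>f ` B. h w \<partial>lborel) = (\<integral>\<^sup>+z\<in>B. h (f z) * ennreal ((cmod (f' z))\<^sup>2) \<partial>lborel)"
proof -
  have cf: "continuous_on U f"
    using der by (meson DERIV_isCont continuous_at_imp_continuous_on)
  have mR: "f \<in> borel_measurable (restrict_space borel U)"
    using cf by (rule borel_measurable_continuous_on_restrict)
  have mV: "g \<in> borel_measurable (restrict_space borel V)"
    using cg by (rule borel_measurable_continuous_on_restrict)
  have Ub: "U \<in> sets borel" "V \<in> sets borel" using oU oV by auto
  have im: "f ` D \<in> sets borel" if "D \<in> sets borel" "D \<subseteq> U" for D
  proof -
    have "f ` D = g -` D \<inter> V" using that fg gf by force
    also have "\<dots> = g -` D \<inter> space (restrict_space borel V)" by (simp add: space_restrict_space)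
    also have "\<dots> \<in> sets (restrict_space borel V)" using measurable_sets[OF mV] that by blast
    finally show ?thesis using Ub by (auto simp: sets_restrict_space_iff)
  qed
  then show fB: "f ` B \<in> sets borel" using B by blast
  have f'm: "(\<lambda>z. indicator U z * ennreal ((cmod (f' z))\<^sup>2)) \<in> borel_measurable borel"
  proof -
    have "(\<lambda>z. ennreal ((cmod (f' z))\<^sup>2)) \<in> borel_measurable (restrict_space borel U)"
      using borel_measurable_continuous_on_restrict[OF cf'] by measurable
    then show ?thesis
      using Ub by (subst (asm) borel_measurable_restrict_space_iff_ennreal) (auto simp: mult.commute)
  qed
  define \<mu> where "\<mu> = distr (restrict_space (density lborel (\<lambda>z. indicator U z * ennreal ((cmod (f' z))\<^sup>2))) U) borel f"
  have mf: "f \<in> restrict_space (density lborel (\<lambda>z. indicator U z * ennreal ((cmod (f' z))\<^sup>2))) U \<rightarrow>\<^sub>M borel"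
    using mR by (simp cong: measurable_cong_sets sets_restrict_space_cong)
  have eq: "density lborel (indicator V) = \<mu>"
  proof (rule measure_eqI)
    show "sets (density lborel (indicator V)) = sets \<mu>" by (simp add: \<mu>_def)
    fix A :: "complex set" assume "A \<in> sets (density lborel (indicator V))"
    then have A: "A \<in> sets borel" by simp
    define D where "D = f -` A \<inter> U"
    have D: "D \<in> sets borel" "D \<subseteq> U"
      using measurable_sets[OF mR A] Ub by (auto simp: D_def sets_restrict_space_iff space_restrict_space)
    have fD: "f ` D = A \<inter> V" using fg gf by (force simp: D_def)
    have "emeasure (density lborel (indicator V)) A = emeasure lborel (A \<inter> V)"
      using A Ub by (subst emeasure_density) (auto simp: nn_integral_indicator[symmetric] indicator_inter_arith mult.commute simp del: nn_integral_indicator)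
    also have "\<dots> = emeasure lborel (f ` D)" by (simp add: fD)
    also have "\<dots> = (\<integral>\<^sup>+z\<in>D. ennreal ((cmod (f' z))\<^sup>2) \<partial>lborel)"
    proof (rule emeasure_holomorphic_image)
      show "\<And>z. z \<in> D \<Longrightarrow> (f has_field_derivative f' z) (at z)" using der D by auto
      show "inj_on f D" using fg D by (metis inj_onI subsetD)
      show "f ` D \<in> sets borel" using im D by blast
      have "(\<lambda>z. indicator D z * (indicator U z * ennreal ((cmod (f' z))\<^sup>2))) \<in> borel_measurable borel"
        using f'm D by measurable
      also have "(\<lambda>z. indicator D z * (indicator U z * ennreal ((cmod (f' z))\<^sup>2))) = (\<lambda>z. indicator D z * ennreal ((cmod (f' z))\<^sup>2))"
        using D by (intro ext) (auto split: split_indicator)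
      finally show "(\<lambda>z. indicator D z * ennreal ((cmod (f' z))\<^sup>2)) \<in> borel_measurable borel" .
    qed (use D in auto)
    also have "\<dots> = (\<integral>\<^sup>+z. indicator U z * ennreal ((cmod (f' z))\<^sup>2) * indicator D z \<partial>lborel)"
      using D by (intro nn_integral_cong) (auto simp: indicator_def)
    also have "\<dots> = emeasure (density lborel (\<lambda>z. indicator U z * ennreal ((cmod (f' z))\<^sup>2))) D"
      using D f'm by (subst emeasure_density) auto
    also have "\<dots> = emeasure \<mu> A"
      unfolding \<mu>_def using A mf Ub D
      by (subst emeasure_distr) (auto simp: emeasure_restrict_space space_restrict_space D_def[symmetric])
    finally show "emeasure (density lborel (indicator V)) A = emeasure \<mu> A" .
  qed
  have fBV: "f ` B \<subseteq> V" using fg B by auto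
  have "(\<integral>\<^sup>+w\<in>f ` B. h w \<partial>lborel) = (\<integral>\<^sup>+w. indicator V w * (h w * indicator (f ` B) w) \<partial>lborel)"
    using fBV by (intro nn_integral_cong) (auto simp: indicator_def)
  also have "\<dots> = (\<integral>\<^sup>+w. h w * indicator (f ` B) w \<partial>(density lborel (indicator V)))"
    using Ub h by (subst nn_integral_density) auto
  also have "\<dots> = (\<integral>\<^sup>+z. h (f z) * indicator (f ` B) (f z) \<partial>restrict_space (density lborel (\<lambda>z. indicator U z * ennreal ((cmod (f' z))\<^sup>2))) U)"
    unfolding eq \<mu>_def by (rule nn_integral_distr[OF mf]) (use h in simp)
  also have "\<dots> = (\<integral>\<^sup>+z. h (f z) * indicator (f ` B) (f z) * indicator U z \<partial>(density lborel (\<lambda>z. indicator U z * ennreal ((cmod (f' z))\<^sup>2))))"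
    using Ub by (subst nn_integral_restrict_space) auto
  also have "\<dots> = (\<integral>\<^sup>+z. (indicator U z * ennreal ((cmod (f' z))\<^sup>2)) * (h (f z) * indicator (f ` B) (f z) * indicator U z) \<partial>lborel)"
  proof (rule nn_integral_density)
    have "(\<lambda>z. h (f z) * indicator (f ` B) (f z)) \<in> borel_measurable (restrict_space borel U)"
      using mR h by (rule measurable_compose)
    then show "(\<lambda>z. h (f z) * indicator (f ` B) (f z) * indicator U z) \<in> borel_measurable lborel"
      using Ub by (subst (asm) borel_measurable_restrict_space_iff_ennreal) auto
  qed (use f'm in auto)
  also have "\<dots> = (\<integral>\<^sup>+z\<in>B. h (f z) * ennreal ((cmod (f' z))\<^sup>2) \<partial>lborel)"
  proof (intro nn_integral_cong)
    fix z
    have "f z \<in> f ` B \<longleftrightarrow> z \<in> B" if "z \<in> U" using that B fg by (metis image_iff subsetD)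
    then show "(indicator U z * ennreal ((cmod (f' z))\<^sup>2)) * (h (f z) * indicator (f ` B) (f z) * indicator U z)
      = h (f z) * ennreal ((cmod (f' z))\<^sup>2) * indicator B z"
      using B by (cases "z \<in> U") (auto simp: indicator_def mult.commute)
  qed
  finally show "(\<integral>\<^sup>+w\<in>f ` B. h w \<partial>lborel) = (\<integral>\<^sup>+z\<in>B. h (f z) * ennreal ((cmod (f' z))\<^sup>2) \<partial>lborel)" .
qed

section \<open>The hyperboloid model\<close>

text \<open>
  The bilinear form of signature (2,1) on three-dimensional Minkowski space, time coordinate first.
\<close>

definition mink :: "real \<times> complex \<Rightarrow> real \<times> complex \<Rightarrow> real" where
  "mink x y = snd x \<bullet> snd y - fst x * fst y"

text \<open>
  Stereographic projection of the Poincare disc onto the upper sheet of the hyperboloid \<open>mink y y = - 1\<close>.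
\<close>

definition hyp :: "complex \<Rightarrow> real \<times> complex" where
  "hyp z = ((1 + (norm z)\<^sup>2) / (1 - (norm z)\<^sup>2), (2 / (1 - (norm z)\<^sup>2)) *\<^sub>R z)"

lemma mink_add_left [simp]: "mink (x + y) z = mink x z + mink y z"
  and mink_add_right [simp]: "mink z (x + y) = mink z x + mink z y"
  and mink_diff_left [simp]: "mink (x - y) z = mink x z - mink y z"
  and mink_diff_right [simp]: "mink z (x - y) = mink z x - mink z y"
  and mink_scaleR_left [simp]: "mink (c *\<^sub>R x) z = c * mink x z"
  and mink_scaleR_right [simp]: "mink z (c *\<^sub>R x) = c * mink z x"
  and mink_minus_left [simp]: "mink (- x) z = - mink x z"
  and mink_minus_right [simp]: "mink z (- x) = - mink z x"
  by (auto simp: mink_def inner_simps algebra_simps)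

lemma mink_zero [simp]: "mink 0 x = 0" "mink x 0 = 0"
  by (auto simp: mink_def)

lemma mink_commute: "mink x y = mink y x"
  by (simp add: mink_def inner_commute)

lemma hyp_pos: "norm z < 1 \<Longrightarrow> 1 - (norm z)\<^sup>2 > 0"
  by (simp add: power_less_one_iff abs_square_less_1)

lemma hyp_fst_ge: "norm z < 1 \<Longrightarrow> fst (hyp z) \<ge> 1"
  using hyp_pos[of z] by (simp add: hyp_def field_simps)

lemma mink_hyp_dist:
  assumes "norm z < 1" "norm w < 1"
  shows "mink (hyp z) (hyp w) = - 1 - 2 * (norm (z - w))\<^sup>2 / ((1 - (norm z)\<^sup>2) * (1 - (norm w)\<^sup>2))"
proof -
  have "(norm (z - w))\<^sup>2 = (norm z)\<^sup>2 + (norm w)\<^sup>2 - 2 * (z \<bullet> w)"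
    by (simp add: power2_norm_eq_inner inner_simps inner_commute)
  moreover define A B where "A = 1 - (norm z)\<^sup>2" and "B = 1 - (norm w)\<^sup>2"
  ultimately have 1: "(norm (z - w))\<^sup>2 = 2 - A - B - 2 * (z \<bullet> w)" by simp
  have 2: "A > 0" "B > 0" and 3: "(norm z)\<^sup>2 = 1 - A" "(norm w)\<^sup>2 = 1 - B"
    using hyp_pos[OF assms(1)] hyp_pos[OF assms(2)] by (auto simp: A_def B_def)
  show ?thesis
    unfolding mink_def hyp_def 1 3 using 2 by (simp add: field_simps)
qed

lemma mink_hyp_self: "norm z < 1 \<Longrightarrow> mink (hyp z) (hyp z) = - 1"
  by (simp add: mink_hyp_dist)

lemma hyp_inverse: 
  assumes "norm z < 1" shows "z = (1 / (1 + fst (hyp z))) *\<^sub>R snd (hyp z)"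
proof -
  define D where "D = 1 - (norm z)\<^sup>2"
  have D: "D > 0" and n: "(norm z)\<^sup>2 = 1 - D" using hyp_pos[OF assms] by (auto simp: D_def)
  have "1 + fst (hyp z) = 2 / D"
    using D by (simp add: hyp_def n field_simps)
  then show ?thesis using D by (simp add: hyp_def n)
qed

lemma hyp_surj:
  assumes "mink y y = - 1" "fst y > 0"
  obtains z where "norm z < 1" "hyp z = y"
proof -
  obtain a u where y: "y = (a, u)" by (cases y)
  have a: "(norm u)\<^sup>2 = a\<^sup>2 - 1" "a > 0"
    using assms unfolding y mink_def power2_norm_eq_inner by (auto simp: power2_eq_square)
  define z where "z = (1 / (1 + a)) *\<^sub>R u"
  have nz: "(norm z)\<^sup>2 = (a - 1) / (a + 1)"
  proof -
    have "(norm z)\<^sup>2 = (a\<^sup>2 - 1) / (1 + a)\<^sup>2" using a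
      by (simp add: z_def power_mult_distrib power_divide field_simps)
    also have "a\<^sup>2 - 1 = (a - 1) * (1 + a)" by (simp add: power2_eq_square algebra_simps)
    also have "(a - 1) * (1 + a) / (1 + a)\<^sup>2 = (a - 1) / (a + 1)" using a(2)
      by (simp add: power2_eq_square add.commute)
    finally show ?thesis .
  qed
  have "(norm z)\<^sup>2 < 1" unfolding nz using a(2) by simp
  then have "norm z < 1" by (simp add: power_less_one_iff abs_square_less_1)
  moreover have "1 - (norm z)\<^sup>2 = 2 / (1 + a)" "1 + (norm z)\<^sup>2 = 2 * a / (1 + a)"
    using nz a(2) by (auto simp: field_simps)
  then have "hyp z = y" using a(2) by (simp add: hyp_def y z_def)
  ultimately show ?thesis using that by blast
qed

text \<open>The linear action of a Moebius transformation on the hyperboloid.\<close>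

definition lorentz :: "real \<Rightarrow> complex \<Rightarrow> real \<times> complex \<Rightarrow> real \<times> complex" where
  "lorentz \<theta> w x =
     (((1 + (norm w)\<^sup>2) * fst x - 2 * (w \<bullet> snd x)) / (1 - (norm w)\<^sup>2),
      (1 / (1 - (norm w)\<^sup>2)) *\<^sub>R (cis \<theta> * (snd x + w\<^sup>2 * cnj (snd x) - of_real (2 * fst x) * w)))"

lemma lorentz_linear: "linear (lorentz \<theta> w)"
  by (intro linearI) (auto simp: lorentz_def complex_eq_iff inner_complex_def algebra_simps
      add_divide_distrib diff_divide_distrib)

lemma mink_lorentz:
  assumes "norm w < 1"
  shows "mink (lorentz \<theta> w x) (lorentz \<theta> w y) = mink x y"
proof -
  have D: "1 - (norm w)\<^sup>2 \<noteq> 0" using hyp_pos[OF assms] by simp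
  have rot: "(cis \<theta> * u) \<bullet> (cis \<theta> * v) = u \<bullet> v" for u v
  proof -
    have "x \<bullet> y = Re (cnj x * y)" for x y :: complex
      by (simp add: inner_complex_def)
    then have "(cis \<theta> * u) \<bullet> (cis \<theta> * v) = Re (cnj (cis \<theta> * u) * (cis \<theta> * v))" .
    also have "cnj (cis \<theta> * u) * (cis \<theta> * v) = (cnj (cis \<theta>) * cis \<theta>) * (cnj u * v)"
      by simp
    also have "cnj (cis \<theta>) * cis \<theta> = 1"
      by (simp add: cis_cnj cis_mult)
    finally show ?thesis by (simp add: inner_complex_def)
  qed
  define p q where "p = Re w" and "q = Im w"
  obtain a u1 u2 where x: "fst x = a" "Re (snd x) = u1" "Im (snd x) = u2" by auto
  obtain b v1 v2 where y: "fst y = b" "Re (snd y) = v1" "Im (snd y) = v2" by auto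
  have N: "(norm w)\<^sup>2 = p\<^sup>2 + q\<^sup>2" by (simp add: cmod_power2 p_def q_def)
  define d where "d = 1 - (p\<^sup>2 + q\<^sup>2)"
  have d: "d \<noteq> 0" using D by (simp add: N d_def)
  have "mink (lorentz \<theta> w x) (lorentz \<theta> w y) =
     ((snd x + w\<^sup>2 * cnj (snd x) - of_real (2 * fst x) * w) \<bullet> (snd y + w\<^sup>2 * cnj (snd y) - of_real (2 * fst y) * w)
     - ((1 + (norm w)\<^sup>2) * fst x - 2 * (w \<bullet> snd x)) * ((1 + (norm w)\<^sup>2) * fst y - 2 * (w \<bullet> snd y))) / d\<^sup>2"
  proof -
    have nd: "1 - (norm w)\<^sup>2 = d" by (simp add: N d_def)
    have "(1 / d) * ((1 / d) * r) - (s / d) * (t / d) = (r - s * t) / d\<^sup>2" for r s t :: real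
      using d by (simp add: power2_eq_square field_simps)
    then show ?thesis
      by (simp only: mink_def lorentz_def fst_conv snd_conv inner_scaleR_left inner_scaleR_right rot nd)
  qed
  also have "(snd x + w\<^sup>2 * cnj (snd x) - of_real (2 * fst x) * w) \<bullet> (snd y + w\<^sup>2 * cnj (snd y) - of_real (2 * fst y) * w)
     - ((1 + (norm w)\<^sup>2) * fst x - 2 * (w \<bullet> snd x)) * ((1 + (norm w)\<^sup>2) * fst y - 2 * (w \<bullet> snd y))
     = d\<^sup>2 * mink x y"
    unfolding mink_def inner_complex_def N d_def
    by (simp add: x y p_def[symmetric] q_def[symmetric] power2_eq_square algebra_simps)
  finally show ?thesis using d by simp
qed

lemma moebius_denom: 
  assumes "norm w < 1" "norm z < 1" shows "1 - cnj w * z \<noteq> 0"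
proof
  assume "1 - cnj w * z = 0"
  then have "norm (cnj w * z) = 1" by (metis eq_iff_diff_eq_0 norm_one)
  moreover have "norm w * norm z < 1 * 1" by (rule mult_strict_mono) (use assms in auto)
  ultimately show False by (simp add: norm_mult)
qed

lemma moebius_norm_eq:
  assumes "norm w < 1" "norm z < 1"
  shows "1 - (norm (Moebius_function \<theta> w z))\<^sup>2
     = (1 - (norm w)\<^sup>2) * (1 - (norm z)\<^sup>2) / (norm (1 - cnj w * z))\<^sup>2"
proof -
  have n: "(norm (1 - cnj w * z))\<^sup>2 \<noteq> 0" using moebius_denom[OF assms] by simp
  have "(norm (1 - cnj w * z))\<^sup>2 - (norm (z - w))\<^sup>2 = (1 - (norm w)\<^sup>2) * (1 - (norm z)\<^sup>2)"
    unfolding cmod_power2 by (simp add: power2_eq_square algebra_simps)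
  moreover have "(norm (Moebius_function \<theta> w z))\<^sup>2 = (norm (z - w))\<^sup>2 / (norm (1 - cnj w * z))\<^sup>2"
    by (simp add: Moebius_function_def norm_divide norm_mult power_divide)
  ultimately show ?thesis using n by (simp add: field_simps)
qed

lemma hyp_moebius:
  assumes "norm w < 1" "norm z < 1"
  shows "hyp (Moebius_function \<theta> w z) = lorentz \<theta> w (hyp z)"
proof -
  define n where "n = (norm (1 - cnj w * z))\<^sup>2"
  define A where "A = 1 - (norm w)\<^sup>2"
  define B where "B = 1 - (norm z)\<^sup>2"
  have n: "n > 0" using moebius_denom[OF assms] by (simp add: n_def)
  have AB: "A > 0" "B > 0" using hyp_pos assms by (auto simp: A_def B_def)
  have nc: "(1 - cnj w * z) * cnj (1 - cnj w * z) = of_real n"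
    unfolding n_def by (rule complex_norm_square[symmetric])
  have M: "Moebius_function \<theta> w z = (1 / n) *\<^sub>R (cis \<theta> * (z - w) * cnj (1 - cnj w * z))"
  proof -
    have "Moebius_function \<theta> w z = cis \<theta> * (z - w) * cnj (1 - cnj w * z) / ((1 - cnj w * z) * cnj (1 - cnj w * z))"
    proof -
      have "cnj (1 - cnj w * z) \<noteq> 0" using moebius_denom[OF assms] by (simp only: complex_cnj_zero_iff) simp
      then have "x / y = x * cnj (1 - cnj w * z) / (y * cnj (1 - cnj w * z))" for x y
        by (metis mult_divide_mult_cancel_right)
      then show ?thesis by (simp only: Moebius_function_def cis_conv_exp)
    qed
    then show ?thesis unfolding nc by (simp add: scaleR_conv_of_real field_simps)
  qed
  have 1: "1 - (norm (Moebius_function \<theta> w z))\<^sup>2 = A * B / n"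
    using moebius_norm_eq[OF assms] by (simp add: A_def B_def n_def)
  have 2: "1 + (norm (Moebius_function \<theta> w z))\<^sup>2 = (2 * n - A * B) / n"
    using 1 n by (simp add: field_simps)
  have nn: "2 * n - A * B = (1 + (norm w)\<^sup>2) * (1 + (norm z)\<^sup>2) - 4 * (w \<bullet> z)"
    unfolding n_def A_def B_def cmod_power2 inner_complex_def by (simp add: power2_eq_square algebra_simps)
  have f: "fst (hyp (Moebius_function \<theta> w z)) = fst (lorentz \<theta> w (hyp z))"
    using n AB unfolding hyp_def lorentz_def 1 2 nn
    by (simp add: A_def[symmetric] B_def[symmetric] field_simps)
  have zz: "z * cnj z = of_real ((norm z)\<^sup>2)" by (rule complex_norm_square[symmetric])
  have e: "(z - w) * cnj (1 - cnj w * z) = z + w\<^sup>2 * cnj z - of_real (1 + (norm z)\<^sup>2) * w"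
  proof -
    have "(z - w) * cnj (1 - cnj w * z) = z + w\<^sup>2 * cnj z - w - w * (z * cnj z)"
      by (simp add: algebra_simps power2_eq_square)
    then show ?thesis unfolding zz by (simp add: algebra_simps)
  qed
  have "snd (hyp (Moebius_function \<theta> w z)) = (2 / (A * B)) *\<^sub>R (cis \<theta> * ((z - w) * cnj (1 - cnj w * z)))"
  proof -
    have "snd (hyp (Moebius_function \<theta> w z)) = (2 / (A * B / n)) *\<^sub>R Moebius_function \<theta> w z"
      by (simp only: hyp_def snd_conv 1)
    then show ?thesis unfolding M using n by (simp add: mult.assoc)
  qed
  also have "\<dots> = snd (lorentz \<theta> w (hyp z))"
    using AB unfolding e lorentz_def hyp_def
    by (simp add: A_def[symmetric] B_def[symmetric] scaleR_conv_of_real field_simps)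
  finally show ?thesis using f by (simp add: prod_eq_iff)
qed

lemma moebius_in_disc: "norm w < 1 \<Longrightarrow> norm z < 1 \<Longrightarrow> norm (Moebius_function \<theta> w z) < 1"
  by (rule Moebius_function_norm_lt_1)

lemma moebius_inverse:
  assumes "norm w < 1" "norm z < 1"
  shows "Moebius_function (- \<theta>) (- cis \<theta> * w) (Moebius_function \<theta> w z) = z"
proof -
  define u where "u = (z - w) / (1 - cnj w * z)"
  have d: "1 - cnj w * z \<noteq> 0" using moebius_denom assms by auto
  have "Moebius_function \<theta> w z = cis \<theta> * u" by (simp add: Moebius_function_def u_def cis_conv_exp)
  then have "Moebius_function (- \<theta>) (- cis \<theta> * w) (Moebius_function \<theta> w z)
     = cis (- \<theta>) * (cis \<theta> * u + cis \<theta> * w) / (1 + cnj w * (cnj (cis \<theta>) * cis \<theta>) * u)"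
    by (simp add: Moebius_function_def cis_conv_exp mult.assoc mult.left_commute)
  also have "cnj (cis \<theta>) * cis \<theta> = 1" by (simp add: cis_cnj cis_mult)
  also have "cis (- \<theta>) * (cis \<theta> * u + cis \<theta> * w) = u + w"
    by (simp add: distrib_left cis_mult flip: mult.assoc)
  also have "(u + w) / (1 + cnj w * 1 * u) = z"
  proof -
    have ww: "cnj w * w = of_real ((norm w)\<^sup>2)" by (metis complex_norm_square mult.commute)
    have "u + w = (z * (1 - of_real ((norm w)\<^sup>2))) / (1 - cnj w * z)"
      unfolding ww[symmetric] u_def using d by (simp add: field_simps)
    moreover have "1 + cnj w * 1 * u = (1 - of_real ((norm w)\<^sup>2)) / (1 - cnj w * z)"
      unfolding ww[symmetric] u_def using d by (simp add: field_simps)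
    moreover have "1 - complex_of_real ((norm w)\<^sup>2) \<noteq> 0"
      using hyp_pos[OF assms(1)] by (metis eq_iff_diff_eq_0 less_irrefl of_real_1 of_real_eq_iff)
    ultimately show ?thesis using d by simp
  qed
  finally show ?thesis .
qed

lemma moebius_inverse':
  assumes "norm w < 1" "norm z < 1"
  shows "Moebius_function \<theta> w (Moebius_function (- \<theta>) (- cis \<theta> * w) z) = z"
proof -
  have "- cis (- \<theta>) * (- cis \<theta> * w) = w" by (simp add: cis_mult flip: mult.assoc)
  then show ?thesis
    using moebius_inverse[of "- cis \<theta> * w" z "- \<theta>"] assms
    by (simp only: minus_minus norm_mult norm_minus_cancel norm_cis mult_1)
qed

lemma moebius_compose:
  assumes "norm w1 < 1" "norm w2 < 1"
  obtains \<theta> w where "norm w < 1"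
    "\<And>z. norm z < 1 \<Longrightarrow> Moebius_function \<theta>2 w2 (Moebius_function \<theta>1 w1 z) = Moebius_function \<theta> w z"
proof -
  define c where "c = cis \<theta>1"
  have cc: "c * cnj c = 1" by (simp add: c_def cis_cnj cis_mult)
  have nc: "norm c = 1" by (simp add: c_def)
  define D where "D = 1 + cnj w2 * c * w1"
  have D: "D \<noteq> 0"
  proof -
    have "norm w2 * norm w1 < 1 * 1" by (rule mult_strict_mono) (use assms in auto)
    then have "norm (- (cnj w2 * c * w1)) < 1" by (simp add: norm_mult nc)
    then show ?thesis unfolding D_def
      by (metis add.inverse_inverse add_eq_0_iff less_irrefl minus_add_cancel norm_minus_cancel norm_one)
  qed
  define w where "w = Moebius_function (- \<theta>1) (- cis \<theta>1 * w1) w2"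
  have w: "norm w < 1" unfolding w_def using assms by (intro moebius_in_disc) (auto simp: norm_mult)
  have cD: "cnj D = 1 + w2 * cnj c * cnj w1" by (simp add: D_def)
  have weq: "w = cnj c * (w2 + c * w1) / cnj D"
    by (simp add: w_def Moebius_function_def cD c_def cis_cnj mult.commute mult.left_commute flip: cis_conv_exp)
  define e where "e = cis \<theta>2 * c * cnj D / D"
  have "norm e = 1" using D by (simp add: e_def norm_mult norm_divide nc)
  then obtain \<theta> where \<theta>: "e = cis \<theta>"
    by (metis complex_norm_eq_1_exp cis_conv_exp)
  show ?thesis
  proof (rule that[OF w])
    fix z :: complex assume z: "norm z < 1"
    have d1: "1 - cnj w1 * z \<noteq> 0" by (rule moebius_denom) (use assms z in auto)
    have d2: "1 - cnj w * z \<noteq> 0" by (rule moebius_denom) (use w z in auto)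
    have M1: "Moebius_function \<theta>1 w1 z = c * (z - w1) / (1 - cnj w1 * z)"
      by (simp add: Moebius_function_def c_def flip: cis_conv_exp)
    have d3: "1 - cnj w2 * (c * (z - w1) / (1 - cnj w1 * z)) \<noteq> 0"
      unfolding M1[symmetric] by (rule moebius_denom) (use assms z moebius_in_disc in auto)
    have num: "c * (z - w1) / (1 - cnj w1 * z) - w2 = c * cnj D * (z - w) / (1 - cnj w1 * z)"
    proof -
      have "cnj D * (z - w) = cnj D * z - cnj c * (w2 + c * w1)"
        using D by (simp add: weq right_diff_distrib)
      then have "c * cnj D * (z - w) = c * cnj D * z - (c * cnj c) * (w2 + c * w1)"
        by (simp add: mult.assoc right_diff_distrib)
      also have "c * cnj D * z = c * z + (c * cnj c) * w2 * cnj w1 * z"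
        by (simp add: cD algebra_simps)
      finally have "c * cnj D * (z - w) = c * (z - w1) - w2 * (1 - cnj w1 * z)"
        unfolding cc by (simp add: algebra_simps)
      then show ?thesis using d1 by (simp add: diff_divide_distrib)
    qed
    have den: "1 - cnj w2 * (c * (z - w1) / (1 - cnj w1 * z)) = D * (1 - cnj w * z) / (1 - cnj w1 * z)"
    proof -
      have "D * (1 - cnj w * z) = D - c * (cnj w2 + cnj c * cnj w1) * z"
        using D by (simp add: weq right_diff_distrib mult.assoc)
      also have "\<dots> = D - c * cnj w2 * z - (c * cnj c) * cnj w1 * z"
        by (simp add: algebra_simps)
      finally have "D * (1 - cnj w * z) = (1 - cnj w1 * z) - cnj w2 * (c * (z - w1))"
        unfolding cc by (simp add: algebra_simps D_def)
      then show ?thesis using d1 by (simp add: diff_divide_distrib)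
    qed
    have "Moebius_function \<theta>2 w2 (Moebius_function \<theta>1 w1 z) =
        cis \<theta>2 * (c * cnj D * (z - w) / (1 - cnj w1 * z)) / (D * (1 - cnj w * z) / (1 - cnj w1 * z))"
      unfolding M1 num[symmetric] den[symmetric] by (simp add: Moebius_function_def flip: cis_conv_exp)
    also have "\<dots> = e * (z - w) / (1 - cnj w * z)"
      using d1 d2 D by (simp add: e_def)
    finally show "Moebius_function \<theta>2 w2 (Moebius_function \<theta>1 w1 z) = Moebius_function \<theta> w z"
      by (simp add: \<theta> Moebius_function_def flip: cis_conv_exp)
  qed
qed

lemma moebius_deriv:
  assumes "norm w < 1" "norm z < 1"
  shows "(Moebius_function \<theta> w has_field_derivative
     cis \<theta> * of_real (1 - (norm w)\<^sup>2) / (1 - cnj w * z)\<^sup>2) (at z)"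
proof -
  have d: "1 - cnj w * z \<noteq> 0" using moebius_denom assms by auto
  have ww: "cnj w * w = of_real ((norm w)\<^sup>2)" by (metis complex_norm_square mult.commute)
  have "((\<lambda>z. cis \<theta> * (z - w) / (1 - cnj w * z)) has_field_derivative
     (cis \<theta> * (1 - cnj w * z) - cis \<theta> * (z - w) * (- cnj w)) / ((1 - cnj w * z) * (1 - cnj w * z))) (at z)"
    using d by (auto intro!: derivative_eq_intros)
  moreover have "cis \<theta> * (1 - cnj w * z) - cis \<theta> * (z - w) * (- cnj w) = cis \<theta> * of_real (1 - (norm w)\<^sup>2)"
    unfolding of_real_diff ww[symmetric] of_real_1 by (simp add: algebra_simps)
  ultimately show ?thesis
    by (simp add: Moebius_function_def[abs_def] power2_eq_square flip: cis_conv_exp)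
qed

lemma moebius_deriv_norm:
  assumes "norm w < 1" "norm z < 1"
  shows "norm (cis \<theta> * of_real (1 - (norm w)\<^sup>2) / (1 - cnj w * z)\<^sup>2)
     = (1 - (norm (Moebius_function \<theta> w z))\<^sup>2) / (1 - (norm z)\<^sup>2)"
proof -
  have "norm (complex_of_real (1 - (norm w)\<^sup>2)) = 1 - (norm w)\<^sup>2"
    using hyp_pos[OF assms(1)] by (simp only: norm_of_real abs_of_pos)
  then show ?thesis using hyp_pos[OF assms(2)] unfolding moebius_norm_eq[OF assms]
    by (simp add: norm_divide norm_mult norm_power del: of_real_diff)
qed

section \<open>Unit geodesics in the hyperboloid model\<close>

text \<open>
  The geodesic with position \<open>p\<close> and unit velocity \<open>v\<close> at time 0, in the coordinates \<open>Y\<close>.  On the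
  hyperboloid geodesics are sections by planes, which turns their geometry into linear algebra.
\<close>

definition hyp_line :: "(complex \<Rightarrow> real \<times> complex) \<Rightarrow> (real \<Rightarrow> complex) \<Rightarrow> real \<times> complex \<Rightarrow> real \<times> complex \<Rightarrow> bool" where
  "hyp_line Y g p v \<longleftrightarrow> mink p p = - 1 \<and> mink v v = 1 \<and> mink p v = 0 \<and>
     (\<forall>t. norm (g t) < 1 \<and> Y (g t) = cosh t *\<^sub>R p + sinh t *\<^sub>R v)"

lemma norm_tanh_lt_1: "norm (complex_of_real (tanh t)) < 1"
  by (simp add: abs_less_iff tanh_real_lt_1 tanh_real_gt_neg1 minus_less_iff)

lemma hyp_tanh_half: "hyp (of_real (tanh (t / 2))) = (cosh t, of_real (sinh t))"
proof -
  have c: "cosh (t/2) > 0" by (rule cosh_real_pos)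
  have e: "(cosh (t/2))\<^sup>2 - (sinh (t/2))\<^sup>2 = 1" by (rule hyperbolic_pythagoras)
  have ch: "cosh t = (cosh (t/2))\<^sup>2 + (sinh (t/2))\<^sup>2" "sinh t = 2 * sinh (t/2) * cosh (t/2)"
    using cosh_double[of "t/2"] sinh_double[of "t/2"] by (auto simp: cosh_square_eq)
  define C S where "C = cosh (t/2)" and "S = sinh (t/2)"
  have C: "C > 0" and CS: "C\<^sup>2 - S\<^sup>2 = 1" using c e by (auto simp: C_def S_def)
  have n: "(norm (complex_of_real (S / C)))\<^sup>2 = S\<^sup>2 / C\<^sup>2"
    unfolding norm_of_real by (simp add: power_divide)
  have 1: "1 - S\<^sup>2 / C\<^sup>2 = 1 / C\<^sup>2"
  proof -
    have "1 - S\<^sup>2 / C\<^sup>2 = (C\<^sup>2 - S\<^sup>2) / C\<^sup>2" using C by (simp add: diff_divide_distrib)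
    then show ?thesis by (simp only: CS)
  qed
  have 2: "1 + S\<^sup>2 / C\<^sup>2 = cosh t / C\<^sup>2"
    using C ch by (simp add: C_def[symmetric] S_def[symmetric] add_divide_distrib)
  have "hyp (of_real (S / C)) = (cosh t, of_real (sinh t))"
    unfolding hyp_def n 1 2 using C ch(2)
    by (simp add: C_def[symmetric] S_def[symmetric] scaleR_conv_of_real power2_eq_square)
  then show ?thesis by (simp add: tanh_def C_def S_def)
qed

lemma unit_geodesic_hyp_line:
  assumes "unit_geodesic g"
  obtains p v where "hyp_line hyp g p v"
proof -
  obtain \<theta> w where w: "norm w < 1" and g: "g = (\<lambda>t. Moebius_function \<theta> w (of_real (tanh (t / 2))))"
    using assms by (auto simp: unit_geodesic_def)
  have "hyp (g t) = cosh t *\<^sub>R lorentz \<theta> w (1, 0) + sinh t *\<^sub>R lorentz \<theta> w (0, 1)" for t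
  proof -
    have e: "(cosh t, complex_of_real (sinh t)) = cosh t *\<^sub>R (1, 0) + sinh t *\<^sub>R (0, 1)"
      by (simp add: scaleR_conv_of_real)
    show ?thesis unfolding g hyp_moebius[OF w norm_tanh_lt_1] hyp_tanh_half e
      using lorentz_linear[of \<theta> w] by (simp only: linear_add linear_scale)
  qed
  moreover have "norm (g t) < 1" for t
    unfolding g by (intro moebius_in_disc w norm_tanh_lt_1)
  ultimately have "hyp_line hyp g (lorentz \<theta> w (1, 0)) (lorentz \<theta> w (0, 1))"
    unfolding hyp_line_def mink_lorentz[OF w] by (simp add: mink_def)
  then show ?thesis by (rule that)
qed

lemma unit_geodesic_moebius:
  assumes "unit_geodesic g" "norm w < 1"
  shows "unit_geodesic (\<lambda>t. Moebius_function \<theta> w (g t))"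
proof -
  obtain \<theta>1 w1 where w: "norm w1 < 1" and g: "g = (\<lambda>t. Moebius_function \<theta>1 w1 (of_real (tanh (t / 2))))"
    using assms by (auto simp: unit_geodesic_def)
  obtain \<theta>2 w2 where "norm w2 < 1" "\<And>z. norm z < 1 \<Longrightarrow> Moebius_function \<theta> w (Moebius_function \<theta>1 w1 z) = Moebius_function \<theta>2 w2 z"
    using moebius_compose[OF w assms(2)] by metis
  then show ?thesis unfolding unit_geodesic_def g using norm_tanh_lt_1 by metis
qed

lemma unit_geodesic_in_disc: "unit_geodesic g \<Longrightarrow> norm (g t) < 1"
  by (metis hyp_line_def unit_geodesic_hyp_line)

lemma unit_geodesic_deriv:
  assumes "unit_geodesic g"
  obtains g' where "(g has_vector_derivative g') (at t)"
proof -
  obtain \<theta> w where w: "norm w < 1" and g: "g = (\<lambda>t. Moebius_function \<theta> w (of_real (tanh (t / 2))))"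
    using assms by (auto simp: unit_geodesic_def)
  have "((\<lambda>t. tanh (t/2)) has_real_derivative (1 - (tanh (t/2))\<^sup>2) * (1/2)) (at t)"
    by (auto intro!: derivative_eq_intros simp: cosh_real_nonzero)
  then have "((\<lambda>t. complex_of_real (tanh (t / 2))) has_vector_derivative of_real ((1 - (tanh (t/2))\<^sup>2) * (1/2))) (at t)"
    by (intro has_vector_derivative_of_real) (auto simp: has_real_derivative_iff_has_vector_derivative)
  from field_vector_diff_chain_at[OF this moebius_deriv[OF w norm_tanh_lt_1]]
  show ?thesis using that by (auto simp: g o_def)
qed

lemma continuous_unit_geodesic: "unit_geodesic g \<Longrightarrow> continuous_on S g"
  by (meson continuous_at_imp_continuous_on has_vector_derivative_continuous unit_geodesic_deriv)

lemma hyp_has_vector_derivative: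
  assumes "(g has_vector_derivative v) (at t)" "norm (g t) < 1"
  defines "D \<equiv> 1 - (norm (g t))\<^sup>2"
  shows "((\<lambda>t. hyp (g t)) has_vector_derivative
     (4 * (g t \<bullet> v) / D\<^sup>2, (2 / D) *\<^sub>R v + (4 * (g t \<bullet> v) / D\<^sup>2) *\<^sub>R g t)) (at t)"
proof -
  have D: "D > 0" using hyp_pos assms by auto
  have n: "((\<lambda>t. g t \<bullet> g t) has_real_derivative 2 * (g t \<bullet> v)) (at t)"
    using assms(1) unfolding has_vector_derivative_def has_field_derivative_def
    by (auto intro!: derivative_eq_intros simp: inner_commute algebra_simps)
  have eq: "g t \<bullet> g t = 1 - D" by (simp add: D_def power2_norm_eq_inner)
  have 1: "((\<lambda>t. (1 + g t \<bullet> g t) / (1 - g t \<bullet> g t)) has_real_derivative 4 * (g t \<bullet> v) / D\<^sup>2) (at t)"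
    using D n by (auto intro!: derivative_eq_intros simp: eq power2_eq_square field_simps)
  have 2: "((\<lambda>t. 2 / (1 - g t \<bullet> g t)) has_real_derivative 4 * (g t \<bullet> v) / D\<^sup>2) (at t)"
    using D n by (auto intro!: derivative_eq_intros simp: eq power2_eq_square field_simps)
  have 3: "((\<lambda>t. (2 / (1 - g t \<bullet> g t)) *\<^sub>R g t) has_vector_derivative
       (2 / (1 - g t \<bullet> g t)) *\<^sub>R v + (4 * (g t \<bullet> v) / D\<^sup>2) *\<^sub>R g t) (at t)"
    using 2 assms(1) by (rule has_vector_derivative_scaleR)
  show ?thesis
    using has_vector_derivative_Pair[OF 1[unfolded has_real_derivative_iff_has_vector_derivative] 3]
    unfolding hyp_def power2_norm_eq_inner eq by simp
qed

lemma mink_hyp_derivative: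
  assumes "norm z < 1"
  defines "D \<equiv> 1 - (norm z)\<^sup>2"
  shows "mink (4 * (z \<bullet> v) / D\<^sup>2, (2 / D) *\<^sub>R v + (4 * (z \<bullet> v) / D\<^sup>2) *\<^sub>R z)
              (4 * (z \<bullet> w) / D\<^sup>2, (2 / D) *\<^sub>R w + (4 * (z \<bullet> w) / D\<^sup>2) *\<^sub>R z) = 4 * (v \<bullet> w) / D\<^sup>2"
proof -
  have D: "D > 0" using hyp_pos assms by auto
  have zz: "z \<bullet> z = 1 - D" by (simp add: D_def power2_norm_eq_inner)
  define a b c where "a = z \<bullet> v" and "b = z \<bullet> w" and "c = v \<bullet> w"
  have "mink (4 * (z \<bullet> v) / D\<^sup>2, (2 / D) *\<^sub>R v + (4 * (z \<bullet> v) / D\<^sup>2) *\<^sub>R z)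
              (4 * (z \<bullet> w) / D\<^sup>2, (2 / D) *\<^sub>R w + (4 * (z \<bullet> w) / D\<^sup>2) *\<^sub>R z)
     = (2/D) * (2/D) * c + (2/D) * (4 * b / D\<^sup>2) * a + (4 * a / D\<^sup>2) * (2/D) * b
       + (4 * a / D\<^sup>2) * (4 * b / D\<^sup>2) * (1 - D) - (4 * a / D\<^sup>2) * (4 * b / D\<^sup>2)"
    by (simp add: mink_def inner_simps a_def b_def c_def zz inner_commute)
  also have "\<dots> = 4 * c / D\<^sup>2"
    using D by (simp add: power2_eq_square field_simps)
  finally show ?thesis by (simp add: c_def)
qed

lemma hyp_line_derivative:
  assumes "hyp_line hyp g p v"
  shows "((\<lambda>t. hyp (g t)) has_vector_derivative sinh t *\<^sub>R p + cosh t *\<^sub>R v) (at t)"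
proof -
  have "(\<lambda>t. hyp (g t)) = (\<lambda>t. cosh t *\<^sub>R p + sinh t *\<^sub>R v)" using assms by (auto simp: hyp_line_def)
  moreover have "((\<lambda>t. cosh t *\<^sub>R p + sinh t *\<^sub>R v) has_vector_derivative sinh t *\<^sub>R p + cosh t *\<^sub>R v) (at t)"
    by (auto intro!: derivative_eq_intros)
  ultimately show ?thesis by simp
qed

text \<open>
  The map to the hyperboloid is conformal (\<open>mink_hyp_derivative\<close>), so right angles in the disc are right angles in
  Minkowski space.
\<close>

lemma meets_perp_hyp:
  assumes g: "unit_geodesic g" "hyp_line hyp g p v" and c: "unit_geodesic c" "hyp_line hyp c p' v'"
    and m: "meets_perp g s c t"
  shows "mink (sinh s *\<^sub>R p + cosh s *\<^sub>R v) (sinh t *\<^sub>R p' + cosh t *\<^sub>R v') = 0"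
proof -
  have eq: "g s = c t" and perp: "vector_derivative g (at s) \<bullet> vector_derivative c (at t) = 0"
    using m by (auto simp: meets_perp_def)
  obtain g' where g': "(g has_vector_derivative g') (at s)" using unit_geodesic_deriv[OF g(1)] .
  obtain c' where c': "(c has_vector_derivative c') (at t)" using unit_geodesic_deriv[OF c(1)] .
  have n: "norm (g s) < 1" using g(2) by (auto simp: hyp_line_def)
  have n': "norm (c t) < 1" using n eq by simp
  have 0: "g' \<bullet> c' = 0" using perp g' c' by (simp add: vector_derivative_at)
  note 1 = vector_derivative_unique_at[OF hyp_line_derivative[OF g(2)] hyp_has_vector_derivative[OF g' n]]
  note 2 = vector_derivative_unique_at[OF hyp_line_derivative[OF c(2)] hyp_has_vector_derivative[OF c' n']]
  show ?thesis unfolding 1 2 using mink_hyp_derivative[OF n, of g' c'] 0 eq by simp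
qed

lemma tanh_surj:
  fixes y :: real assumes "\<bar>y\<bar> < 1" obtains x where "tanh x = y"
proof -
  define q where "q = (1 - y) / (1 + y)"
  have y: "1 + y > 0" "1 - y > 0" using assms by (auto simp: abs_less_iff)
  then have q: "q > 0" by (simp add: q_def)
  have "1 + q = 2 / (1 + y)" "1 - q = 2 * y / (1 + y)" using y by (auto simp: q_def field_simps)
  then have "tanh (- ln q / 2) = y"
    using q y by (simp add: tanh_real_altdef)
  then show ?thesis by (rule that)
qed

lemma unit_geodesic_exists:
  assumes "norm z1 < 1" "norm z2 < 1"
  obtains g s where "unit_geodesic g" "g 0 = z1" "g s = z2" "s \<ge> 0"
proof -
  define u where "u = Moebius_function 0 z1 z2"
  define \<phi> where "\<phi> = - Arg u"
  define M where "M = Moebius_function \<phi> z1"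
  have u: "norm u < 1" unfolding u_def using assms by (intro moebius_in_disc) auto
  have Mz2: "M z2 = of_real (norm u)"
  proof -
    have "M z2 = cis \<phi> * u" by (simp add: M_def u_def Moebius_function_def flip: cis_conv_exp)
    also have "\<dots> = cis \<phi> * (of_real (norm u) * cis (Arg u))" by (metis rcis_cmod_Arg rcis_def)
    also have "\<dots> = of_real (norm u)" by (simp add: \<phi>_def mult.left_commute cis_mult)
    finally show ?thesis .
  qed
  have Mz1: "M z1 = 0" by (simp add: M_def Moebius_function_def)
  obtain x where x: "tanh x = norm u" using tanh_surj[of "norm u"] u by auto
  define s where "s = 2 * x"
  have ts: "tanh (s / 2) = norm u" using x by (simp add: s_def)
  have s0: "s \<ge> 0" using x norm_ge_zero[of u] unfolding s_def
    by (metis mult_nonneg_nonneg tanh_real_nonneg_iff zero_le_numeral)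
  define g where "g = (\<lambda>t. Moebius_function (- \<phi>) (- cis \<phi> * z1) (of_real (tanh (t / 2))))"
  have "unit_geodesic g" unfolding unit_geodesic_def g_def
    using assms(1) by (intro exI conjI refl) (auto simp: norm_mult)
  moreover have "g 0 = z1"
    using moebius_inverse[OF assms(1) assms(1), of \<phi>] Mz1 by (simp add: g_def M_def)
  moreover have "g s = z2"
    using moebius_inverse[OF assms(1) assms(2), of \<phi>] Mz2 by (simp add: g_def M_def ts)
  ultimately show ?thesis using s0 that by blast
qed

section \<open>Hyperboloid coordinates in a moving frame\<close>

text \<open>
  Working up to isometry: any geodesic configuration can be moved to a convenient position by
  composing the embedding with a Moebius transformation.
\<close>

definition hyp_coords :: "(complex \<Rightarrow> real \<times> complex) \<Rightarrow> bool" where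
  "hyp_coords Y \<longleftrightarrow> (\<exists>\<theta> w. norm w < 1 \<and> (\<forall>z. norm z < 1 \<longrightarrow> Y z = hyp (Moebius_function \<theta> w z)))"

lemma coords_lorentz:
  assumes "hyp_coords Y"
  obtains \<theta> w where "norm w < 1" "\<And>z. norm z < 1 \<Longrightarrow> Y z = lorentz \<theta> w (hyp z)"
  using assms by (auto simp: hyp_coords_def hyp_moebius)

lemma coords_mink:
  assumes "hyp_coords Y" "norm z < 1" "norm z' < 1"
  shows "mink (Y z) (Y z') = mink (hyp z) (hyp z')"
  using assms by (metis coords_lorentz mink_lorentz)

lemma coords_self: "hyp_coords Y \<Longrightarrow> norm z < 1 \<Longrightarrow> mink (Y z) (Y z) = - 1"
  by (simp add: coords_mink mink_hyp_self)

lemma coords_fst_ge: "hyp_coords Y \<Longrightarrow> norm z < 1 \<Longrightarrow> fst (Y z) \<ge> 1"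
  unfolding hyp_coords_def by (metis hyp_fst_ge moebius_in_disc)

lemma coords_inject:
  assumes "hyp_coords Y" "norm z < 1" "norm z' < 1" "Y z = Y z'" shows "z = z'"
proof -
  have "mink (hyp z) (hyp z') = - 1"
    using coords_mink[OF assms(1-3)] assms coords_self by metis
  then have "2 * (norm (z - z'))\<^sup>2 / ((1 - (norm z)\<^sup>2) * (1 - (norm z')\<^sup>2)) = 0"
    using mink_hyp_dist[OF assms(2,3)] by linarith
  then show ?thesis using hyp_pos[OF assms(2)] hyp_pos[OF assms(3)] by simp
qed

lemma coords_surj:
  assumes "hyp_coords Y" "mink y y = - 1" "fst y > 0"
  obtains z where "norm z < 1" "Y z = y"
proof -
  obtain \<theta> w where w: "norm w < 1" and Y: "\<And>z. norm z < 1 \<Longrightarrow> Y z = hyp (Moebius_function \<theta> w z)"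
    using assms(1) by (auto simp: hyp_coords_def)
  obtain z where z: "norm z < 1" "hyp z = y" using hyp_surj assms by blast
  have "norm (Moebius_function (- \<theta>) (- cis \<theta> * w) z) < 1"
    using w z by (intro moebius_in_disc) (auto simp: norm_mult)
  then show ?thesis using that Y moebius_inverse'[OF w z(1)] z by metis
qed

lemma coords_moebius_inverse:
  assumes "norm w < 1"
  shows "hyp_coords (\<lambda>z. hyp (Moebius_function (- \<theta>) (- cis \<theta> * w) z))"
  unfolding hyp_coords_def using assms by (intro exI[of _ "- \<theta>"] exI[of _ "- cis \<theta> * w"]) (auto simp: norm_mult)

lemma coords_continuous: 
  assumes "hyp_coords Y" shows "continuous_on (ball 0 1) Y"
proof -
  obtain \<theta> w where w: "norm w < 1" "\<And>z. norm z < 1 \<Longrightarrow> Y z = lorentz \<theta> w (hyp z)"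
    using coords_lorentz[OF assms] by blast
  have "continuous_on (ball 0 1) hyp"
  proof -
    have "1 - (norm z)\<^sup>2 \<noteq> 0" if "z \<in> ball 0 1" for z :: complex
      using hyp_pos[of z] that by simp
    then show ?thesis unfolding hyp_def[abs_def]
      by (intro continuous_intros ballI) auto
  qed
  then have "continuous_on (ball 0 1) (\<lambda>z. lorentz \<theta> w (hyp z))"
    using linear_continuous_on_compose lorentz_linear by blast
  then show ?thesis by (rule continuous_on_eq) (use w in auto)
qed

subsection \<open>Geodesics\<close>

lemma hyp_line_in_disc: "hyp_line Y g p v \<Longrightarrow> norm (g t) < 1"
  by (auto simp: hyp_line_def)

lemma hyp_line_at: "hyp_line Y g p v \<Longrightarrow> Y (g t) = cosh t *\<^sub>R p + sinh t *\<^sub>R v"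
  by (auto simp: hyp_line_def)

lemma hyp_line_0: "hyp_line Y g p v \<Longrightarrow> Y (g 0) = p"
  by (auto simp: hyp_line_def)

lemma hyp_line_lorentz:
  assumes "norm w < 1" "\<And>z. norm z < 1 \<Longrightarrow> Y z = lorentz \<theta> w (hyp z)" "hyp_line hyp g p v"
  shows "hyp_line Y g (lorentz \<theta> w p) (lorentz \<theta> w v)"
  using assms lorentz_linear[of \<theta> w]
  by (simp add: hyp_line_def mink_lorentz linear_add linear_scale)

lemma coords_line:
  assumes "hyp_coords Y" "unit_geodesic g"
  obtains p v where "hyp_line Y g p v"
  using assms coords_lorentz hyp_line_lorentz unit_geodesic_hyp_line by metis

lemma cosh_sinh_basis_unique:
  fixes p v :: "'a::real_vector"
  assumes "s \<noteq> t" "cosh s *\<^sub>R p + sinh s *\<^sub>R v = cosh s *\<^sub>R p' + sinh s *\<^sub>R v'"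
    "cosh t *\<^sub>R p + sinh t *\<^sub>R v = cosh t *\<^sub>R p' + sinh t *\<^sub>R v'"
  shows "p = p'" "v = v'"
proof -
  define a b where "a = p - p'" and "b = v - v'"
  have 1: "cosh s *\<^sub>R a + sinh s *\<^sub>R b = 0" "cosh t *\<^sub>R a + sinh t *\<^sub>R b = 0"
    using assms by (auto simp: a_def b_def algebra_simps)
  have "sinh t *\<^sub>R (cosh s *\<^sub>R a + sinh s *\<^sub>R b) - sinh s *\<^sub>R (cosh t *\<^sub>R a + sinh t *\<^sub>R b)
      = sinh (t - s) *\<^sub>R a"
    by (simp add: sinh_diff algebra_simps)
  then have "a = 0" using 1 assms(1) by simp
  moreover have "cosh t *\<^sub>R (cosh s *\<^sub>R a + sinh s *\<^sub>R b) - cosh s *\<^sub>R (cosh t *\<^sub>R a + sinh t *\<^sub>R b)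
      = sinh (s - t) *\<^sub>R b"
    by (simp add: sinh_diff algebra_simps)
  then have "b = 0" using 1 assms(1) by simp
  ultimately show "p = p'" "v = v'" by (auto simp: a_def b_def)
qed

lemma hyp_line_unique:
  assumes "hyp_line Y g p v" "hyp_line Y g p' v'" shows "p = p'" "v = v'"
proof -
  show p: "p = p'" using hyp_line_0[OF assms(1)] hyp_line_0[OF assms(2)] by simp
  have "cosh 1 *\<^sub>R p + sinh 1 *\<^sub>R v = cosh 1 *\<^sub>R p' + sinh 1 *\<^sub>R v'"
    using hyp_line_at[OF assms(1), of 1] hyp_line_at[OF assms(2), of 1] by metis
  then show "v = v'" using p by simp
qed

lemma hyp_line_eqI:
  assumes "hyp_coords Y" "hyp_line Y g p v" "hyp_line Y h p v" shows "g = h"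
  using assms coords_inject[OF assms(1)] by (intro ext) (auto simp: hyp_line_def)

lemma geodesic_eq_two_points:
  assumes "unit_geodesic g" "unit_geodesic h" "s \<noteq> t" "g s = h s" "g t = h t"
  shows "g = h"
proof -
  have Y: "hyp_coords hyp" unfolding hyp_coords_def
    by (intro exI[of _ 0]) (auto simp: Moebius_function_def)
  obtain p v where g: "hyp_line hyp g p v" using unit_geodesic_hyp_line[OF assms(1)] .
  obtain p' v' where h: "hyp_line hyp h p' v'" using unit_geodesic_hyp_line[OF assms(2)] .
  have "p = p'" "v = v'"
    using cosh_sinh_basis_unique[OF assms(3), of p v p' v'] hyp_line_at[OF g] hyp_line_at[OF h] assms(4,5)
    by metis+
  then show ?thesis using hyp_line_eqI[OF Y g] h by simp
qed

lemma hyp_line_inj: 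
  assumes "hyp_coords Y" "hyp_line Y g p v" "g s = g t" shows "s = t"
proof (rule ccontr)
  assume "s \<noteq> t"
  have "mink (Y (g s)) (Y (g t)) = - cosh (s - t)"
    using assms(2) by (simp add: hyp_line_def cosh_diff algebra_simps mink_commute[of v p])
  moreover have "mink (Y (g s)) (Y (g t)) = - 1"
    using assms(3) coords_self[OF assms(1) hyp_line_in_disc[OF assms(2)]] by metis
  ultimately have "cosh (s - t) = 1" by linarith
  then show False using \<open>s \<noteq> t\<close> by (simp add: cosh_real_one_iff)
qed

lemma unit_geodesic_reverse:
  assumes "unit_geodesic g" shows "unit_geodesic (\<lambda>t. g (- t))"
proof -
  obtain \<theta> w where w: "norm w < 1" and g: "g = (\<lambda>t. Moebius_function \<theta> w (of_real (tanh (t / 2))))"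
    using assms by (auto simp: unit_geodesic_def)
  have "Moebius_function \<theta> w (- z) = Moebius_function (\<theta> + pi) (- w) z" for z
  proof -
    have "cis (\<theta> + pi) = - cis \<theta>" by (simp flip: cis_mult)
    then show ?thesis by (simp add: Moebius_function_def algebra_simps flip: cis_conv_exp)
  qed
  then show ?thesis using w unfolding unit_geodesic_def g
    by (intro exI[of _ "\<theta> + pi"] exI[of _ "- w"]) auto
qed

lemma unit_geodesic_shift:
  assumes "unit_geodesic g" shows "unit_geodesic (\<lambda>t. g (t + c))"
proof -
  obtain \<theta> w where w: "norm w < 1" and g: "g = (\<lambda>t. Moebius_function \<theta> w (of_real (tanh (t / 2))))"
    using assms by (auto simp: unit_geodesic_def)
  define b where "b = tanh (c / 2)"
  have b: "norm (- complex_of_real b) < 1" using norm_tanh_lt_1[of "c/2"] by (simp add: b_def)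
  have "of_real (tanh ((t + c) / 2)) = Moebius_function 0 (- of_real b) (of_real (tanh (t / 2)))" for t
    using tanh_add[of "t/2" "c/2"] cosh_real_nonzero
    by (simp add: Moebius_function_def b_def add_divide_distrib mult.commute)
  then have "(\<lambda>t. g (t + c)) = (\<lambda>t. Moebius_function \<theta> w (Moebius_function 0 (- of_real b) (of_real (tanh (t / 2)))))"
    by (simp add: g)
  moreover obtain \<theta>2 w2 where "norm w2 < 1"
    "\<And>z. norm z < 1 \<Longrightarrow> Moebius_function \<theta> w (Moebius_function 0 (- of_real b) z) = Moebius_function \<theta>2 w2 z"
    using moebius_compose[OF b w] by metis
  ultimately show ?thesis unfolding unit_geodesic_def using norm_tanh_lt_1 by metis
qed

lemma hyp_line_reverse:
  "hyp_line Y g p v \<Longrightarrow> hyp_line Y (\<lambda>t. g (- t)) p (- v)"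
  by (auto simp: hyp_line_def)

lemma hyp_line_shift:
  assumes "hyp_line Y g p v"
  shows "hyp_line Y (\<lambda>t. g (t + c)) (cosh c *\<^sub>R p + sinh c *\<^sub>R v) (sinh c *\<^sub>R p + cosh c *\<^sub>R v)"
proof -
  have e: "cosh c * cosh c - sinh c * sinh c = 1"
    using hyperbolic_pythagoras[of c] by (simp add: power2_eq_square)
  show ?thesis using assms e
    by (auto simp: hyp_line_def mink_commute[of v p] cosh_add sinh_add algebra_simps)
qed

lemma hyp_line_perp:
  assumes "hyp_coords Y" "unit_geodesic g" "hyp_line Y g p v" "unit_geodesic c" "hyp_line Y c p' v'"
    and m: "meets_perp g s c t"
  shows "mink (sinh s *\<^sub>R p + cosh s *\<^sub>R v) (sinh t *\<^sub>R p' + cosh t *\<^sub>R v') = 0" "g s = c t"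
proof -
  show "g s = c t" using m by (simp add: meets_perp_def)
  obtain \<theta> w where w: "norm w < 1" "\<And>z. norm z < 1 \<Longrightarrow> Y z = lorentz \<theta> w (hyp z)"
    using coords_lorentz[OF assms(1)] by blast
  obtain q u where g: "hyp_line hyp g q u" using unit_geodesic_hyp_line[OF assms(2)] .
  obtain q' u' where c: "hyp_line hyp c q' u'" using unit_geodesic_hyp_line[OF assms(4)] .
  have "p = lorentz \<theta> w q" "v = lorentz \<theta> w u" "p' = lorentz \<theta> w q'" "v' = lorentz \<theta> w u'"
    using hyp_line_unique[OF assms(3) hyp_line_lorentz[OF w g]] hyp_line_unique[OF assms(5) hyp_line_lorentz[OF w c]]
    by auto
  then have "mink (sinh s *\<^sub>R p + cosh s *\<^sub>R v) (sinh t *\<^sub>R p' + cosh t *\<^sub>R v') =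
    mink (lorentz \<theta> w (sinh s *\<^sub>R q + cosh s *\<^sub>R u)) (lorentz \<theta> w (sinh t *\<^sub>R q' + cosh t *\<^sub>R u'))"
    using lorentz_linear[of \<theta> w] by (simp only: linear_add linear_scale)
  also have "\<dots> = 0" using meets_perp_hyp[OF assms(2) g assms(4) c m] by (simp only: mink_lorentz[OF w(1)])
  finally show "mink (sinh s *\<^sub>R p + cosh s *\<^sub>R v) (sinh t *\<^sub>R p' + cosh t *\<^sub>R v') = 0" .
qed

subsection \<open>Hyperbolic convexity\<close>

text \<open>
  A positive combination of two points of the hyperboloid, if it lies on the hyperboloid, is on the
  geodesic segment between them, since segments are sections by planes through the origin.
\<close>

lemma hconvex_combination:
  assumes K: "hconvex K" and Y: "hyp_coords Y" and z12: "z1 \<in> K" "z2 \<in> K" and z: "norm z < 1"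
    and comb: "Y z = \<alpha> *\<^sub>R Y z1 + \<beta> *\<^sub>R Y z2" "\<alpha> \<ge> 0" "\<beta> \<ge> 0"
  shows "z \<in> K"
proof -
  have n: "norm z1 < 1" "norm z2 < 1" using K z12 by (auto simp: hconvex_def)
  obtain g s where g: "unit_geodesic g" "g 0 = z1" "g s = z2" "s \<ge> 0"
    using unit_geodesic_exists[OF n] .
  obtain p v where l: "hyp_line Y g p v" using coords_line[OF Y g(1)] .
  have pv: "mink p p = - 1" "mink v v = 1" "mink p v = 0" "mink v p = 0"
    using l by (auto simp: hyp_line_def mink_commute)
  define x y where "x = \<alpha> + \<beta> * cosh s" and "y = \<beta> * sinh s"
  have Yz: "Y z = x *\<^sub>R p + y *\<^sub>R v"
    using comb(1) hyp_line_at[OF l, of 0] hyp_line_at[OF l, of s] g by (simp add: x_def y_def algebra_simps)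
  have "mink (Y z) (Y z) = - 1" by (rule coords_self[OF Y z])
  then have xy: "x * x = 1 + y * y" unfolding Yz by (simp add: pv algebra_simps)
  have "x \<ge> 0" using comb cosh_real_pos[of s] by (simp add: x_def less_imp_le)
  define t where "t = arsinh y"
  have t: "sinh t = y" by (simp add: t_def)
  have "(cosh t)\<^sup>2 = x\<^sup>2" using xy t unfolding cosh_square_eq by (simp add: power2_eq_square)
  then have ct: "cosh t = x" using \<open>x \<ge> 0\<close> by (simp add: power2_eq_iff_nonneg)
  have "g t = z"
    using coords_inject[OF Y hyp_line_in_disc[OF l] z] hyp_line_at[OF l, of t] by (simp add: t ct Yz)
  moreover have "0 \<le> t"
  proof -
    have "sinh t \<ge> 0" using t comb g(4) by (simp add: y_def)
    then show ?thesis by simp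
  qed
  moreover have "t \<le> s"
  proof -
    have "sinh (t - s) = - \<alpha> * sinh s" by (simp add: sinh_diff t ct x_def y_def algebra_simps)
    also have "\<dots> \<le> 0" using comb g(4) by simp
    finally show ?thesis by simp
  qed
  ultimately show ?thesis using K g z12 unfolding hconvex_def by blast
qed

lemma hconvex_subset_disc: "hconvex K \<Longrightarrow> K \<subseteq> ball 0 1"
  by (auto simp: hconvex_def)

subsection \<open>Ideal endpoints\<close>

lemma null_vector:
  assumes n: "mink (p + v) (p + v) = 0" "fst (p + v) > 0"
  shows "norm ((1 / fst (p + v)) *\<^sub>R snd (p + v)) = 1"
proof -
  have "(norm (snd (p + v)))\<^sup>2 = (fst (p + v))\<^sup>2"
    using n unfolding power2_norm_eq_inner by (simp add: mink_def power2_eq_square)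
  then have "norm (snd (p + v)) = fst (p + v)" using n(2) by (simp add: power2_eq_iff_nonneg)
  then show ?thesis using n(2) by simp
qed

lemma fst_null_pos:
  assumes "mink n n = 0" "fst n \<ge> 0" "n \<noteq> 0" shows "fst n > 0"
proof (rule ccontr)
  assume "\<not> fst n > 0"
  then have "fst n = 0" using assms by simp
  then have "snd n \<bullet> snd n = 0" using assms(1) by (simp add: mink_def)
  then show False using \<open>fst n = 0\<close> assms(3) by (simp add: prod_eq_iff)
qed

text \<open>
  As \<open>t\<close> grows, \<open>cosh t p + sinh t v\<close> has the direction of the null vector \<open>p + v\<close>, which therefore
  represents the ideal endpoint.
\<close>

lemma geodesic_end_hyp:
  assumes l: "hyp_line hyp g p v" and lim: "(g \<longlongrightarrow> \<xi>) at_top"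
  shows "norm \<xi> = 1" "fst (p + v) > 0" "p + v = fst (p + v) *\<^sub>R (1, \<xi>)"
proof -
  have Y: "hyp_coords hyp" unfolding hyp_coords_def
    by (intro exI[of _ 0]) (auto simp: Moebius_function_def)
  have pv: "mink p p = - 1" "mink v v = 1" "mink p v = 0" "mink v p = 0"
    using l by (auto simp: hyp_line_def mink_commute)
  have n0: "mink (p + v) (p + v) = 0" by (simp add: pv)
  have th: "((\<lambda>t. tanh t *\<^sub>R v + p) \<longlongrightarrow> 1 *\<^sub>R v + p) at_top"
    by (intro tendsto_intros tanh_real_at_top)
  have eq: "hyp (g t) = cosh t *\<^sub>R (tanh t *\<^sub>R v + p)" for t
    using hyp_line_at[OF l, of t] cosh_real_nonzero[of t] by (simp add: tanh_def scaleR_add_right)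
  have pos: "fst (tanh t *\<^sub>R v + p) \<ge> 0" for t
  proof -
    have "cosh t * fst (tanh t *\<^sub>R v + p) \<ge> 1"
      using coords_fst_ge[OF Y hyp_line_in_disc[OF l], of t] unfolding eq fst_scaleR by simp
    then show ?thesis using cosh_real_pos[of t] by (smt (verit) mult_pos_neg)
  qed
  have "fst (1 *\<^sub>R v + p) \<ge> 0"
    using tendsto_fst[OF th] pos by (intro tendsto_lowerbound[OF tendsto_fst[OF th]]) auto
  moreover have "p + v \<noteq> 0"
  proof
    assume "p + v = 0"
    then have "mink p (p + v) = 0" by simp
    then show False by (simp add: pv)
  qed
  ultimately show f: "fst (p + v) > 0" using n0 by (intro fst_null_pos) (auto simp: add.commute)
  have "g t = (1 / (1 / cosh t + fst (tanh t *\<^sub>R v + p))) *\<^sub>R snd (tanh t *\<^sub>R v + p)" for t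
  proof -
    have c: "cosh t \<noteq> 0" by (rule cosh_real_nonzero)
    have "g t = (1 / (1 + cosh t * fst (tanh t *\<^sub>R v + p))) *\<^sub>R (cosh t *\<^sub>R snd (tanh t *\<^sub>R v + p))"
      using hyp_inverse[OF hyp_line_in_disc[OF l], of t] unfolding eq by (simp only: fst_scaleR snd_scaleR real_scaleR_def)
    also have "\<dots> = (cosh t / (1 + cosh t * fst (tanh t *\<^sub>R v + p))) *\<^sub>R snd (tanh t *\<^sub>R v + p)" by simp
    also have "cosh t / (1 + cosh t * fst (tanh t *\<^sub>R v + p)) = 1 / ((1 + cosh t * fst (tanh t *\<^sub>R v + p)) / cosh t)"
      by simp
    also have "(1 + cosh t * fst (tanh t *\<^sub>R v + p)) / cosh t = 1 / cosh t + fst (tanh t *\<^sub>R v + p)"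
      using c by (simp add: add_divide_distrib)
    finally show ?thesis .
  qed
  moreover have "((\<lambda>t. (1 / (1 / cosh t + fst (tanh t *\<^sub>R v + p))) *\<^sub>R snd (tanh t *\<^sub>R v + p)) \<longlongrightarrow>
     (1 / (0 + fst (1 *\<^sub>R v + p))) *\<^sub>R snd (1 *\<^sub>R v + p)) at_top"
  proof (intro tendsto_scaleR tendsto_divide tendsto_add tendsto_const tendsto_fst[OF th] tendsto_snd[OF th])
    show "((\<lambda>t::real. 1 / cosh t) \<longlongrightarrow> 0) at_top"
      by (intro tendsto_divide_0[OF tendsto_const] filterlim_at_top_imp_at_infinity cosh_real_at_top)
    show "0 + fst (1 *\<^sub>R v + p) \<noteq> 0" using f by (simp add: add.commute)
  qed
  ultimately have "(g \<longlongrightarrow> (1 / (0 + fst (1 *\<^sub>R v + p))) *\<^sub>R snd (1 *\<^sub>R v + p)) at_top"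
    by presburger
  then have "(g \<longlongrightarrow> (1 / fst (p + v)) *\<^sub>R snd (p + v)) at_top"
    by (simp add: add.commute)
  then have \<xi>: "\<xi> = (1 / fst (p + v)) *\<^sub>R snd (p + v)"
    using tendsto_unique[OF _ lim] by simp
  show "norm \<xi> = 1" unfolding \<xi> by (rule null_vector[OF n0 f])
  show "p + v = fst (p + v) *\<^sub>R (1, \<xi>)" using f by (simp add: \<xi> prod_eq_iff)
qed

lemma geodesic_end:
  assumes Y: "norm w < 1" "\<And>z. norm z < 1 \<Longrightarrow> Y z = lorentz \<theta> w (hyp z)"
    and g: "unit_geodesic g" "hyp_line Y g p v" and lim: "(g \<longlongrightarrow> \<xi>) at_top"
  obtains C where "C > 0" "p + v = C *\<^sub>R lorentz \<theta> w (1, \<xi>)" "norm \<xi> = 1"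
proof -
  obtain q u where l: "hyp_line hyp g q u" using unit_geodesic_hyp_line[OF g(1)] .
  have "p = lorentz \<theta> w q" "v = lorentz \<theta> w u"
    using hyp_line_unique[OF g(2) hyp_line_lorentz[OF Y l]] by auto
  then have "p + v = lorentz \<theta> w (q + u)" using lorentz_linear[of \<theta> w] by (simp only: linear_add)
  also have "\<dots> = lorentz \<theta> w (fst (q + u) *\<^sub>R (1, \<xi>))" using geodesic_end_hyp(3)[OF l lim] by simp
  also have "\<dots> = fst (q + u) *\<^sub>R lorentz \<theta> w (1, \<xi>)" using lorentz_linear[of \<theta> w] by (simp only: linear_scale)
  finally show ?thesis using that geodesic_end_hyp[OF l lim] by blast
qed

lemma mink_ideal:
  assumes "norm \<xi> = 1" "norm z < 1"
  shows "mink (hyp z) (1, \<xi>) = - ((norm (z - \<xi>))\<^sup>2 / (1 - (norm z)\<^sup>2))"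
proof -
  define D where "D = 1 - (norm z)\<^sup>2"
  have D: "D > 0" and n: "(norm z)\<^sup>2 = 1 - D" using hyp_pos[OF assms(2)] by (auto simp: D_def)
  have "\<xi> \<bullet> \<xi> = 1" using assms(1) by (simp add: norm_eq_1)
  then have e: "(norm (z - \<xi>))\<^sup>2 = 2 - D - 2 * (z \<bullet> \<xi>)"
    using n by (simp add: power2_norm_eq_inner inner_simps inner_commute)
  show ?thesis unfolding mink_def hyp_def n e using D by (simp add: field_simps)
qed

text \<open>
  Horoballs are the sublevel sets of the product with a null vector, by \<open>mink_ideal\<close>.
\<close>

lemma horoball_iff:
  assumes "norm \<xi> = 1" "0 < r" "r < 1" "norm z < 1"
  shows "z \<in> horoball \<xi> r \<longleftrightarrow> (norm (z - \<xi>))\<^sup>2 / (1 - (norm z)\<^sup>2) < r / (1 - r)"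
proof -
  define D where "D = 1 - (norm z)\<^sup>2"
  have D: "D > 0" and n: "(norm z)\<^sup>2 = 1 - D" using hyp_pos[OF assms(4)] by (auto simp: D_def)
  have xx: "\<xi> \<bullet> \<xi> = 1" using assms(1) by (simp add: norm_eq_1)
  have e: "(norm (z - \<xi>))\<^sup>2 = 2 - D - 2 * (z \<bullet> \<xi>)"
    using n xx by (simp add: power2_norm_eq_inner inner_simps inner_commute)
  have "z \<in> horoball \<xi> r \<longleftrightarrow> norm (z - of_real (1 - r) * \<xi>) < r"
    by (simp add: horoball_def dist_norm norm_minus_commute)
  also have "\<dots> \<longleftrightarrow> (norm (z - (1 - r) *\<^sub>R \<xi>))\<^sup>2 < r\<^sup>2"
    using assms(2) abs_less_iff by (simp add: scaleR_conv_of_real abs_le_square_iff flip: not_le)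
  also have "(norm (z - (1 - r) *\<^sub>R \<xi>))\<^sup>2 = (1 - D) - 2 * (1 - r) * (z \<bullet> \<xi>) + (1 - r)\<^sup>2"
  proof -
    have zz: "z \<bullet> z = 1 - D" using n by (simp only: power2_norm_eq_inner)
    have "(z - q *\<^sub>R \<xi>) \<bullet> (z - q *\<^sub>R \<xi>) = z \<bullet> z - 2 * q * (z \<bullet> \<xi>) + q\<^sup>2 * (\<xi> \<bullet> \<xi>)" for q
      by (simp only: inner_diff_left inner_diff_right inner_scaleR_left inner_scaleR_right inner_commute[of \<xi> z])
        (simp add: power2_eq_square algebra_simps)
    then show ?thesis unfolding power2_norm_eq_inner zz xx by simp
  qed
  also have "(1 - D) - 2 * (1 - r) * (z \<bullet> \<xi>) + (1 - r)\<^sup>2 < r\<^sup>2 \<longleftrightarrow> (1 - r) * (2 - D - 2 * (z \<bullet> \<xi>)) < r * D"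
    by (simp add: power2_eq_square algebra_simps)
  also have "\<dots> \<longleftrightarrow> (norm (z - \<xi>))\<^sup>2 / D < r / (1 - r)"
    unfolding e using D assms by (simp add: field_simps)
  finally show ?thesis by (simp add: D_def)
qed

section \<open>The strip around a geodesic\<close>

definition strip :: "complex set" where
  "strip = {\<zeta>. \<bar>Im \<zeta>\<bar> < pi / 2}"

text \<open>
  On the real axis \<open>(exp t - 1) / (exp t + 1) = tanh (t / 2)\<close>, so the real axis becomes a geodesic parametrized by
  arc length; the vertical segments become the geodesics orthogonal to it.
\<close>

definition strip_map :: "real \<Rightarrow> complex \<Rightarrow> complex \<Rightarrow> complex" where
  "strip_map \<theta> w \<zeta> = Moebius_function \<theta> w ((exp \<zeta> - 1) / (exp \<zeta> + 1))"

definition strip_inv :: "real \<Rightarrow> complex \<Rightarrow> complex \<Rightarrow> complex" where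
  "strip_inv \<theta> w z = Ln ((1 + Moebius_function (- \<theta>) (- cis \<theta> * w) z) / (1 - Moebius_function (- \<theta>) (- cis \<theta> * w) z))"

lemma open_strip: "open strip"
  unfolding strip_def by (intro open_Collect_less continuous_intros)

lemma shift_strip: "\<zeta> + of_real t \<in> strip \<longleftrightarrow> \<zeta> \<in> strip"
  by (simp add: strip_def)

lemma strip_cos_pos: "\<zeta> \<in> strip \<Longrightarrow> cos (Im \<zeta>) > 0"
  by (auto simp: strip_def intro: cos_gt_zero_pi)

lemma strip_exp:
  assumes "\<zeta> \<in> strip"
  defines "e \<equiv> exp \<zeta>"
  shows "Re e > 0" "e + 1 \<noteq> 0" "norm e = exp (Re \<zeta>)" "Re e = exp (Re \<zeta>) * cos (Im \<zeta>)"
    "1 - (norm ((e - 1) / (e + 1)))\<^sup>2 = 4 * Re e / (norm (e + 1))\<^sup>2" "norm ((e - 1) / (e + 1)) < 1"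
proof -
  show Re: "Re e = exp (Re \<zeta>) * cos (Im \<zeta>)" by (simp add: e_def Re_exp)
  then show pos: "Re e > 0" using strip_cos_pos[OF assms(1)] by simp
  show ne: "e + 1 \<noteq> 0" using pos by (auto simp: complex_eq_iff)
  show "norm e = exp (Re \<zeta>)" by (simp add: e_def)
  have "(norm (e + 1))\<^sup>2 - (norm (e - 1))\<^sup>2 = 4 * Re e"
    unfolding cmod_power2 by (simp add: power2_eq_square algebra_simps)
  moreover have "(norm (e + 1))\<^sup>2 \<noteq> 0" using ne by simp
  ultimately show eq: "1 - (norm ((e - 1) / (e + 1)))\<^sup>2 = 4 * Re e / (norm (e + 1))\<^sup>2"
    by (simp add: norm_divide power_divide field_simps)
  have "4 * Re e / (norm (e + 1))\<^sup>2 > 0" using pos ne by simp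
  then have "(norm ((e - 1) / (e + 1)))\<^sup>2 < 1" using eq by linarith
  then show "norm ((e - 1) / (e + 1)) < 1" by (simp add: abs_square_less_1)
qed

lemma strip_map_in_disc: "norm w < 1 \<Longrightarrow> \<zeta> \<in> strip \<Longrightarrow> norm (strip_map \<theta> w \<zeta>) < 1"
  unfolding strip_map_def by (intro moebius_in_disc strip_exp)

lemma strip_map_real: "strip_map \<theta> w (of_real t) = Moebius_function \<theta> w (of_real (tanh (t / 2)))"
proof -
  have "exp t + 1 > 0" by (intro add_pos_pos) auto
  have "tanh (t/2) = (1 - exp (- t)) / (1 + exp (- t))" by (simp add: tanh_real_altdef)
  also have "\<dots> = (exp t - 1) / (exp t + 1)"
  proof -
    define E where "E = exp t"
    have E: "E > 0" by (simp add: E_def)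
    have "(1 - inverse E) / (1 + inverse E) = (E * (1 - inverse E)) / (E * (1 + inverse E))" using E by simp
    also have "\<dots> = (E - 1) / (E + 1)" using E by (simp add: algebra_simps)
    finally show ?thesis by (simp add: exp_minus E_def)
  qed
  finally have "complex_of_real (tanh (t/2)) = (exp (of_real t) - 1) / (exp (of_real t) + 1)"
    by (simp flip: exp_of_real)
  then show ?thesis by (simp add: strip_map_def)
qed

lemma strip_inv_map:
  assumes "norm w < 1" "\<zeta> \<in> strip" shows "strip_inv \<theta> w (strip_map \<theta> w \<zeta>) = \<zeta>"
proof -
  define T where "T = (exp \<zeta> - 1) / (exp \<zeta> + 1)"
  have T: "norm T < 1" "exp \<zeta> + 1 \<noteq> 0" using strip_exp[OF assms(2)] by (auto simp: T_def)
  have "1 + T = 2 * exp \<zeta> / (exp \<zeta> + 1)" "1 - T = 2 / (exp \<zeta> + 1)"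
    using T(2) by (auto simp: T_def field_simps)
  then have "(1 + T) / (1 - T) = exp \<zeta>" using T(2) by simp
  moreover have "Moebius_function (- \<theta>) (- cis \<theta> * w) (strip_map \<theta> w \<zeta>) = T"
    unfolding strip_map_def T_def[symmetric] by (rule moebius_inverse[OF assms(1) T(1)])
  ultimately have "strip_inv \<theta> w (strip_map \<theta> w \<zeta>) = Ln (exp \<zeta>)"
    by (simp only: strip_inv_def)
  also have "\<dots> = \<zeta>"
    using assms(2) by (intro Ln_exp) (auto simp: strip_def abs_less_iff)
  finally show ?thesis .
qed

lemma cayley_pos:
  fixes T :: complex assumes "norm T < 1" shows "Re ((1 + T) / (1 - T)) > 0" "1 - T \<noteq> 0"
proof -
  show ne: "1 - T \<noteq> 0" using assms by auto
  have "Re ((1 + T) * cnj (1 - T)) = 1 - (norm T)\<^sup>2"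
    unfolding cmod_power2 by (simp add: power2_eq_square algebra_simps)
  then have "Re ((1 + T) * cnj (1 - T)) > 0" using hyp_pos[OF assms] by simp
  then show "Re ((1 + T) / (1 - T)) > 0" using ne
    by (simp only: Re_complex_div_gt_0)
qed

lemma strip_map_inv:
  assumes "norm w < 1" "norm z < 1"
  shows "strip_inv \<theta> w z \<in> strip" "strip_map \<theta> w (strip_inv \<theta> w z) = z"
proof -
  define T where "T = Moebius_function (- \<theta>) (- cis \<theta> * w) z"
  have T: "norm T < 1" unfolding T_def using assms by (intro moebius_in_disc) (auto simp: norm_mult)
  define q where "q = (1 + T) / (1 - T)"
  have q: "Re q > 0" "1 - T \<noteq> 0" using cayley_pos[OF T] by (auto simp: q_def)
  then have "q \<noteq> 0" by auto
  have s: "strip_inv \<theta> w z = Ln q" by (simp only: strip_inv_def q_def T_def)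
  show "strip_inv \<theta> w z \<in> strip"
    unfolding s strip_def using q(1) \<open>q \<noteq> 0\<close> Re_Ln_pos_lt by blast
  have "q - 1 = 2 * T / (1 - T)" "q + 1 = 2 / (1 - T)" using q(2) by (auto simp: q_def field_simps)
  then have "(q - 1) / (q + 1) = T" using q(2) by simp
  then have "strip_map \<theta> w (strip_inv \<theta> w z) = Moebius_function \<theta> w T"
    unfolding strip_map_def s using \<open>q \<noteq> 0\<close> by simp
  then show "strip_map \<theta> w (strip_inv \<theta> w z) = z"
    unfolding T_def using moebius_inverse'[OF assms] by simp
qed

text \<open>
  The formula for the derivative says that the hyperbolic metric is \<open>|d\<zeta>| / cos (Im \<zeta>)\<close> in the strip.
\<close>

lemma strip_map_deriv:
  assumes "norm w < 1"
  obtains D where "\<And>\<zeta>. \<zeta> \<in> strip \<Longrightarrow> (strip_map \<theta> w has_field_derivative D \<zeta>) (at \<zeta>)"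
    "\<And>\<zeta>. \<zeta> \<in> strip \<Longrightarrow> norm (D \<zeta>) = (1 - (norm (strip_map \<theta> w \<zeta>))\<^sup>2) / (2 * cos (Im \<zeta>))"
    "continuous_on strip D"
proof -
  define T where "T = (\<lambda>\<zeta>::complex. (exp \<zeta> - 1) / (exp \<zeta> + 1))"
  define E where "E = (\<lambda>\<zeta>. cis \<theta> * of_real (1 - (norm w)\<^sup>2) / (1 - cnj w * T \<zeta>)\<^sup>2)"
  define D where "D = (\<lambda>\<zeta>. E \<zeta> * (2 * exp \<zeta> / (exp \<zeta> + 1)\<^sup>2))"
  show ?thesis
  proof (rule that)
    fix \<zeta> assume z: "\<zeta> \<in> strip"
    have T1: "norm (T \<zeta>) < 1" and ne: "exp \<zeta> + 1 \<noteq> 0" using strip_exp[OF z] by (auto simp: T_def)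
    have "(T has_field_derivative (exp \<zeta> * (exp \<zeta> + 1) - (exp \<zeta> - 1) * exp \<zeta>) / ((exp \<zeta> + 1) * (exp \<zeta> + 1))) (at \<zeta>)"
      unfolding T_def using ne by (auto intro!: derivative_eq_intros)
    also have "exp \<zeta> * (exp \<zeta> + 1) - (exp \<zeta> - 1) * exp \<zeta> = 2 * exp \<zeta>" by (simp add: algebra_simps)
    finally have dT: "(T has_field_derivative 2 * exp \<zeta> / (exp \<zeta> + 1)\<^sup>2) (at \<zeta>)"
      by (simp add: power2_eq_square)
    show "(strip_map \<theta> w has_field_derivative D \<zeta>) (at \<zeta>)"
      using DERIV_chain[OF moebius_deriv[OF assms T1, of \<theta>] dT]
      by (simp add: D_def E_def strip_map_def[abs_def] T_def o_def)
    have "norm (D \<zeta>) = norm (E \<zeta>) * (2 * norm (exp \<zeta>) / (norm (exp \<zeta> + 1))\<^sup>2)"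
      by (simp add: D_def norm_mult norm_divide norm_power)
    also have "norm (E \<zeta>) = (1 - (norm (strip_map \<theta> w \<zeta>))\<^sup>2) / (1 - (norm (T \<zeta>))\<^sup>2)"
      unfolding E_def moebius_deriv_norm[OF assms T1] by (simp add: strip_map_def T_def)
    also have "1 - (norm (T \<zeta>))\<^sup>2 = 4 * Re (exp \<zeta>) / (norm (exp \<zeta> + 1))\<^sup>2"
      unfolding T_def by (rule strip_exp(5)[OF z])
    also have "Re (exp \<zeta>) = norm (exp \<zeta>) * cos (Im \<zeta>)" by (simp add: Re_exp)
    also have "x / (4 * (norm (exp \<zeta>) * cos (Im \<zeta>)) / (norm (exp \<zeta> + 1))\<^sup>2) * (2 * norm (exp \<zeta>) / (norm (exp \<zeta> + 1))\<^sup>2)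
        = x / (2 * cos (Im \<zeta>))" for x
    proof -
      have "x / (4 * (r * c) / n) * (2 * r / n) = x / (2 * c)" if "r > 0" "c > 0" "n > 0" for r c n :: real
        using that by (simp add: field_simps)
      then show ?thesis using ne strip_cos_pos[OF z] by simp
    qed
    finally show "norm (D \<zeta>) = (1 - (norm (strip_map \<theta> w \<zeta>))\<^sup>2) / (2 * cos (Im \<zeta>))" .
  next
    have T1: "norm (T \<zeta>) < 1" "exp \<zeta> + 1 \<noteq> 0" if "\<zeta> \<in> strip" for \<zeta>
      using strip_exp[OF that] by (auto simp: T_def)
    have cT: "continuous_on strip T" unfolding T_def
      by (intro continuous_intros) (use T1 in auto)
    show "continuous_on strip D" unfolding D_def E_def
      by (intro continuous_intros cT) (use T1 moebius_denom[OF assms] in \<open>auto simp del: of_real_diff\<close>)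
  qed
qed

lemma strip_map_coords:
  assumes "norm w < 1" "\<zeta> \<in> strip"
  shows "hyp (Moebius_function (- \<theta>) (- cis \<theta> * w) (strip_map \<theta> w \<zeta>)) =
     (1 / cos (Im \<zeta>)) *\<^sub>R (cosh (Re \<zeta>), Complex (sinh (Re \<zeta>)) (sin (Im \<zeta>)))"
proof -
  define e where "e = exp \<zeta>"
  define T where "T = (e - 1) / (e + 1)"
  define a where "a = exp (Re \<zeta>)"
  have a: "a > 0" by (simp add: a_def)
  note se = strip_exp[OF assms(2), folded e_def]
  have c: "cos (Im \<zeta>) > 0" by (rule strip_cos_pos[OF assms(2)])
  have T: "norm T < 1" using se by (simp add: T_def)
  define n where "n = (norm (e + 1))\<^sup>2"
  have n: "n > 0" using se(2) by (simp add: n_def)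
  have eRe: "Re e = a * cos (Im \<zeta>)" "Im e = a * sin (Im \<zeta>)" by (auto simp: e_def Re_exp Im_exp a_def)
  have 1: "1 - (norm T)\<^sup>2 = 4 * Re e / n" using se(5) by (simp add: T_def n_def)
  have n': "n = a\<^sup>2 + 1 + 2 * Re e"
  proof -
    have "n = (norm e)\<^sup>2 + 1 + 2 * Re e"
      unfolding n_def cmod_power2 by (simp add: power2_eq_square algebra_simps)
    then show ?thesis using se(3) by (simp add: a_def)
  qed
  have 2: "1 + (norm T)\<^sup>2 = 2 * (a\<^sup>2 + 1) / n"
  proof -
    have "1 + (norm T)\<^sup>2 = 2 - 4 * Re e / n" using 1 by simp
    also have "\<dots> = (2 * n - 4 * Re e) / n" using n by (simp add: diff_divide_distrib)
    also have "2 * n - 4 * Re e = 2 * (a\<^sup>2 + 1)" using n' by simp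
    finally show ?thesis .
  qed
  have ch: "cosh (Re \<zeta>) = (a\<^sup>2 + 1) / (2 * a)" "sinh (Re \<zeta>) = (a\<^sup>2 - 1) / (2 * a)"
    using a by (auto simp: cosh_field_def sinh_field_def a_def exp_minus power2_eq_square field_simps)
  have f: "fst (hyp T) = cosh (Re \<zeta>) / cos (Im \<zeta>)"
    unfolding hyp_def 1 2 eRe ch using n a c by (simp add: field_simps)
  have Tn: "T = (1 / n) *\<^sub>R ((e - 1) * cnj (e + 1))"
  proof -
    have "(e + 1) * cnj (e + 1) = of_real n" unfolding n_def by (rule complex_norm_square[symmetric])
    moreover have "T = (e - 1) * cnj (e + 1) / ((e + 1) * cnj (e + 1))"
    proof -
      have "cnj (e + 1) \<noteq> 0" using se(2) by (simp only: complex_cnj_zero_iff) simp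
      then show ?thesis unfolding T_def by (metis mult_divide_mult_cancel_right)
    qed
    ultimately show ?thesis by (simp add: scaleR_conv_of_real field_simps)
  qed
  then have T': "T = (1 / n) *\<^sub>R Complex (a\<^sup>2 - 1) (2 * a * sin (Im \<zeta>))"
  proof -
    have "(norm e)\<^sup>2 = a\<^sup>2" using se(3) by (simp add: a_def)
    then have "Re e * Re e + Im e * Im e = a\<^sup>2" unfolding cmod_power2 by (simp add: power2_eq_square)
    then have "(e - 1) * cnj (e + 1) = Complex (a\<^sup>2 - 1) (2 * a * sin (Im \<zeta>))"
      using eRe(2) by (simp add: complex_eq_iff algebra_simps)
    then show ?thesis using Tn by simp
  qed
  have "snd (hyp T) = (2 / (4 * Re e / n)) *\<^sub>R T" by (simp only: hyp_def snd_conv 1)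
  also have "\<dots> = (1 / cos (Im \<zeta>)) *\<^sub>R Complex (sinh (Re \<zeta>)) (sin (Im \<zeta>))"
    unfolding T' ch eRe using n a c by (simp add: complex_eq_iff field_simps)
  finally have "hyp T = (1 / cos (Im \<zeta>)) *\<^sub>R (cosh (Re \<zeta>), Complex (sinh (Re \<zeta>)) (sin (Im \<zeta>)))"
    using f by (simp add: prod_eq_iff)
  moreover have "Moebius_function (- \<theta>) (- cis \<theta> * w) (strip_map \<theta> w \<zeta>) = T"
    unfolding strip_map_def e_def[symmetric] T_def[symmetric] by (rule moebius_inverse[OF assms(1) T])
  ultimately show ?thesis by simp
qed

lemma strip_inv_deriv:
  assumes "norm w < 1" "norm z < 1"
  obtains D where "(strip_inv \<theta> w has_field_derivative D) (at z)"
    "norm D = 2 * cos (Im (strip_inv \<theta> w z)) / (1 - (norm z)\<^sup>2)"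
proof -
  obtain E where E: "\<And>\<zeta>. \<zeta> \<in> strip \<Longrightarrow> (strip_map \<theta> w has_field_derivative E \<zeta>) (at \<zeta>)"
    "\<And>\<zeta>. \<zeta> \<in> strip \<Longrightarrow> norm (E \<zeta>) = (1 - (norm (strip_map \<theta> w \<zeta>))\<^sup>2) / (2 * cos (Im \<zeta>))"
    using strip_map_deriv[OF assms(1)] by metis
  define \<zeta> where "\<zeta> = strip_inv \<theta> w z"
  have \<zeta>: "\<zeta> \<in> strip" "strip_map \<theta> w \<zeta> = z" using strip_map_inv[OF assms] by (auto simp: \<zeta>_def)
  have nE: "norm (E \<zeta>) = (1 - (norm z)\<^sup>2) / (2 * cos (Im \<zeta>))" using E(2)[OF \<zeta>(1)] \<zeta>(2) by simp
  then have "norm (E \<zeta>) > 0" using strip_cos_pos[OF \<zeta>(1)] hyp_pos[OF assms(2)] by simp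
  then have "E \<zeta> \<noteq> 0" by auto
  have "continuous_on strip (strip_map \<theta> w)"
    using E(1) by (meson DERIV_isCont continuous_at_imp_continuous_on)
  then have "(strip_inv \<theta> w has_field_derivative inverse (E \<zeta>)) (at (strip_map \<theta> w \<zeta>))"
    using \<zeta> E(1) \<open>E \<zeta> \<noteq> 0\<close> open_strip strip_inv_map[OF assms(1)]
    by (intro has_field_derivative_inverse_strong[of "strip_map \<theta> w" "E \<zeta>" \<zeta> strip]) auto
  then show ?thesis
    using that[of "inverse (E \<zeta>)"] \<zeta> by (simp add: norm_inverse nE flip: \<zeta>_def)
qed

lemma continuous_strip_map: 
  assumes "norm w < 1" shows "continuous_on strip (strip_map \<theta> w)"
  using strip_map_deriv[OF assms] by (meson DERIV_isCont continuous_at_imp_continuous_on)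

lemma continuous_strip_inv: 
  assumes "norm w < 1" shows "continuous_on (ball 0 1) (strip_inv \<theta> w)"
  using strip_inv_deriv[OF assms] by (metis DERIV_isCont continuous_at_imp_continuous_on mem_ball_0)

lemma strip_map_open_image:
  assumes w: "norm w < 1" and U: "open U" "U \<subseteq> strip" shows "open (strip_map \<theta> w ` U)"
proof -
  have "strip_map \<theta> w ` U = ball 0 1 \<inter> strip_inv \<theta> w -` U"
  proof (intro equalityI subsetI)
    fix z assume "z \<in> strip_map \<theta> w ` U"
    then obtain \<zeta> where z: "\<zeta> \<in> U" "z = strip_map \<theta> w \<zeta>" by blast
    have "\<zeta> \<in> strip" using z(1) U(2) by blast
    then show "z \<in> ball 0 1 \<inter> strip_inv \<theta> w -` U"
      using strip_map_in_disc[OF w, of \<zeta> \<theta>] strip_inv_map[OF w, of \<zeta> \<theta>] z by simp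
  next
    fix z assume z: "z \<in> ball 0 1 \<inter> strip_inv \<theta> w -` U"
    then have "z = strip_map \<theta> w (strip_inv \<theta> w z)" using strip_map_inv(2)[OF w, of z \<theta>] by simp
    then show "z \<in> strip_map \<theta> w ` U" using z by blast
  qed
  then show ?thesis
    using continuous_open_preimage[OF continuous_strip_inv[OF w] open_ball U(1)] by simp
qed

section \<open>Hyperbolic area\<close>

definition area_density :: "complex \<Rightarrow> ennreal" where
  "area_density z = ennreal (4 / (1 - (norm z)\<^sup>2)\<^sup>2)"

lemma area_density_measurable [measurable]: "area_density \<in> borel_measurable borel"
  unfolding area_density_def by measurable

lemma nn_integral_strip:
  assumes w: "norm w < 1" and B: "B \<in> sets borel" "B \<subseteq> strip"
    and h: "(\<lambda>z. h z * indicator (strip_map \<theta> w ` B) z) \<in> borel_measurable borel"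
  shows "(\<integral>\<^sup>+z\<in>strip_map \<theta> w ` B. h z * area_density z \<partial>lborel) =
    (\<integral>\<^sup>+\<zeta>\<in>B. h (strip_map \<theta> w \<zeta>) * ennreal (1 / (cos (Im \<zeta>))\<^sup>2) \<partial>lborel)"
    "strip_map \<theta> w ` B \<in> sets borel"
proof -
  obtain D where D: "\<And>\<zeta>. \<zeta> \<in> strip \<Longrightarrow> (strip_map \<theta> w has_field_derivative D \<zeta>) (at \<zeta>)"
    "\<And>\<zeta>. \<zeta> \<in> strip \<Longrightarrow> norm (D \<zeta>) = (1 - (norm (strip_map \<theta> w \<zeta>))\<^sup>2) / (2 * cos (Im \<zeta>))"
    "continuous_on strip D"
    using strip_map_deriv[OF w] by metis
  have h': "(\<lambda>z. h z * area_density z * indicator (strip_map \<theta> w ` B) z) \<in> borel_measurable borel"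
  proof -
    have "(\<lambda>z. area_density z * (h z * indicator (strip_map \<theta> w ` B) z)) \<in> borel_measurable borel"
      using h by measurable
    then show ?thesis by (simp add: mult_ac)
  qed
  note C = nn_integral_conformal[OF open_strip open_ball D(1) D(3) continuous_strip_inv[OF w] _ _ B h']
  show "strip_map \<theta> w ` B \<in> sets borel"
    by (rule C(1)) (use w strip_map_in_disc strip_inv_map strip_map_inv in auto)
  have "(\<integral>\<^sup>+z\<in>strip_map \<theta> w ` B. h z * area_density z \<partial>lborel) =
     (\<integral>\<^sup>+\<zeta>\<in>B. h (strip_map \<theta> w \<zeta>) * area_density (strip_map \<theta> w \<zeta>) * ennreal ((norm (D \<zeta>))\<^sup>2) \<partial>lborel)"
    by (rule C(2)) (use w strip_map_in_disc strip_inv_map strip_map_inv in auto)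
  also have "\<dots> = (\<integral>\<^sup>+\<zeta>\<in>B. h (strip_map \<theta> w \<zeta>) * ennreal (1 / (cos (Im \<zeta>))\<^sup>2) \<partial>lborel)"
  proof (intro nn_integral_cong)
    fix \<zeta>
    have "area_density (strip_map \<theta> w \<zeta>) * ennreal ((norm (D \<zeta>))\<^sup>2) = ennreal (1 / (cos (Im \<zeta>))\<^sup>2)" if "\<zeta> \<in> B"
    proof -
      have z: "\<zeta> \<in> strip" using that B by auto
      define q where "q = 1 - (norm (strip_map \<theta> w \<zeta>))\<^sup>2"
      have q: "q > 0" unfolding q_def by (rule hyp_pos[OF strip_map_in_disc[OF w z]])
      have c: "cos (Im \<zeta>) > 0" by (rule strip_cos_pos[OF z])
      have "area_density (strip_map \<theta> w \<zeta>) * ennreal ((norm (D \<zeta>))\<^sup>2) = ennreal (4 / q\<^sup>2 * (q / (2 * cos (Im \<zeta>)))\<^sup>2)"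
        unfolding area_density_def D(2)[OF z] q_def[symmetric] by (subst ennreal_mult) auto
      also have "4 / q\<^sup>2 * (q / (2 * cos (Im \<zeta>)))\<^sup>2 = 1 / (cos (Im \<zeta>))\<^sup>2"
        using q c by (simp add: power_divide power_mult_distrib)
      finally show ?thesis .
    qed
    then show "h (strip_map \<theta> w \<zeta>) * area_density (strip_map \<theta> w \<zeta>) * ennreal ((norm (D \<zeta>))\<^sup>2) * indicator B \<zeta>
       = h (strip_map \<theta> w \<zeta>) * ennreal (1 / (cos (Im \<zeta>))\<^sup>2) * indicator B \<zeta>"
      by (auto simp: mult.assoc split: split_indicator)
  qed
  finally show "(\<integral>\<^sup>+z\<in>strip_map \<theta> w ` B. h z * area_density z \<partial>lborel) =
    (\<integral>\<^sup>+\<zeta>\<in>B. h (strip_map \<theta> w \<zeta>) * ennreal (1 / (cos (Im \<zeta>))\<^sup>2) \<partial>lborel)" .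
qed

lemma nn_integral_moebius:
  assumes w: "norm w < 1" and B: "B \<in> sets borel" "B \<subseteq> ball 0 1"
    and h: "(\<lambda>z. h z * indicator (Moebius_function \<theta> w ` B) z) \<in> borel_measurable borel"
  shows "(\<integral>\<^sup>+z\<in>Moebius_function \<theta> w ` B. h z * area_density z \<partial>lborel) =
    (\<integral>\<^sup>+z\<in>B. h (Moebius_function \<theta> w z) * area_density z \<partial>lborel)"
    "Moebius_function \<theta> w ` B \<in> sets borel"
proof -
  define D where "D = (\<lambda>z. cis \<theta> * of_real (1 - (norm w)\<^sup>2) / (1 - cnj w * z)\<^sup>2)"
  have D: "(Moebius_function \<theta> w has_field_derivative D z) (at z)"
    "norm (D z) = (1 - (norm (Moebius_function \<theta> w z))\<^sup>2) / (1 - (norm z)\<^sup>2)" if "z \<in> ball 0 1" for z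
    using moebius_deriv[OF w] moebius_deriv_norm[OF w] that unfolding D_def by auto
  have cD: "continuous_on (ball 0 1) D" unfolding D_def
    by (intro continuous_intros) (use moebius_denom[OF w] in \<open>auto simp del: of_real_diff\<close>)
  have cg: "continuous_on (ball 0 1) (Moebius_function (- \<theta>) (- cis \<theta> * w))"
    using w by (intro holomorphic_on_imp_continuous_on Moebius_function_holomorphic) (auto simp: norm_mult)
  have h': "(\<lambda>z. h z * area_density z * indicator (Moebius_function \<theta> w ` B) z) \<in> borel_measurable borel"
  proof -
    have "(\<lambda>z. area_density z * (h z * indicator (Moebius_function \<theta> w ` B) z)) \<in> borel_measurable borel"
      using h by measurable
    then show ?thesis by (simp add: mult_ac)
  qed
  have i1: "Moebius_function \<theta> w z \<in> ball 0 1 \<and> Moebius_function (- \<theta>) (- cis \<theta> * w) (Moebius_function \<theta> w z) = z"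
    if "z \<in> ball 0 1" for z
    using that w moebius_inverse[of w z] moebius_in_disc by auto
  have i2: "Moebius_function (- \<theta>) (- cis \<theta> * w) z \<in> ball 0 1 \<and> Moebius_function \<theta> w (Moebius_function (- \<theta>) (- cis \<theta> * w) z) = z"
    if "z \<in> ball 0 1" for z
    using that w moebius_inverse'[of w z] moebius_in_disc[of "- cis \<theta> * w" z] by (auto simp: norm_mult)
  note C = nn_integral_conformal[OF open_ball open_ball D(1) cD cg i1 i2 B h']
  show "Moebius_function \<theta> w ` B \<in> sets borel" by (rule C(1))
  have "(\<integral>\<^sup>+z\<in>Moebius_function \<theta> w ` B. h z * area_density z \<partial>lborel) =
     (\<integral>\<^sup>+z\<in>B. h (Moebius_function \<theta> w z) * area_density (Moebius_function \<theta> w z) * ennreal ((norm (D z))\<^sup>2) \<partial>lborel)"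
    by (rule C(2))
  also have "\<dots> = (\<integral>\<^sup>+z\<in>B. h (Moebius_function \<theta> w z) * area_density z \<partial>lborel)"
  proof (intro nn_integral_cong)
    fix z
    have "area_density (Moebius_function \<theta> w z) * ennreal ((norm (D z))\<^sup>2) = area_density z" if "z \<in> B"
    proof -
      have z: "z \<in> ball 0 1" using that B by auto
      define q where "q = 1 - (norm (Moebius_function \<theta> w z))\<^sup>2"
      have q: "q > 0" unfolding q_def by (rule hyp_pos) (use i1[OF z] in simp)
      have c: "1 - (norm z)\<^sup>2 > 0" by (rule hyp_pos) (use z in simp)
      have "area_density (Moebius_function \<theta> w z) * ennreal ((norm (D z))\<^sup>2) = ennreal (4 / q\<^sup>2 * (q / (1 - (norm z)\<^sup>2))\<^sup>2)"
        unfolding area_density_def D(2)[OF z] q_def[symmetric] by (subst ennreal_mult) auto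
      also have "4 / q\<^sup>2 * (q / (1 - (norm z)\<^sup>2))\<^sup>2 = 4 / (1 - (norm z)\<^sup>2)\<^sup>2"
        using q c by (simp add: power_divide power_mult_distrib)
      finally show ?thesis by (simp add: area_density_def)
    qed
    then show "h (Moebius_function \<theta> w z) * area_density (Moebius_function \<theta> w z) * ennreal ((norm (D z))\<^sup>2) * indicator B z
       = h (Moebius_function \<theta> w z) * area_density z * indicator B z"
      by (auto simp: mult.assoc split: split_indicator)
  qed
  finally show "(\<integral>\<^sup>+z\<in>Moebius_function \<theta> w ` B. h z * area_density z \<partial>lborel) =
    (\<integral>\<^sup>+z\<in>B. h (Moebius_function \<theta> w z) * area_density z \<partial>lborel)" .
qed

lemma nn_integral_complex_iterated:
  assumes [measurable]: "f \<in> borel_measurable (borel :: complex measure)"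
  shows "(\<integral>\<^sup>+\<zeta>. f \<zeta> \<partial>lborel) = (\<integral>\<^sup>+t. \<integral>\<^sup>+\<theta>. f (Complex t \<theta>) \<partial>lborel \<partial>lborel)"
proof -
  have m: "(\<lambda>(x, y). Complex x y) \<in> borel_measurable (borel :: (real \<times> real) measure)"
    unfolding Complex_eq case_prod_beta
    by (intro borel_measurable_continuous_onI continuous_intros)
  then have m': "(\<lambda>(x, y). Complex x y) \<in> borel_measurable (lborel \<Otimes>\<^sub>M lborel)"
    by (simp add: lborel_prod)
  have "(\<integral>\<^sup>+\<zeta>. f \<zeta> \<partial>lborel) = (\<integral>\<^sup>+x. f (case x of (x, y) \<Rightarrow> Complex x y) \<partial>(lborel \<Otimes>\<^sub>M lborel))"
    unfolding lborel_prod using m by (subst complex_lborel_distr_prod, subst nn_integral_distr) auto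
  also have "\<dots> = (\<integral>\<^sup>+t. \<integral>\<^sup>+\<theta>. f (Complex t \<theta>) \<partial>lborel \<partial>lborel)"
    using m' by (subst lborel.nn_integral_fst[symmetric]) auto
  finally show ?thesis .
qed

section \<open>Variation along a piecewise smooth curve\<close>

text \<open>
  The finite set \<open>S\<close> holds the corners of a piecewise smooth curve.  If the integral on the right is finite,
  the derivative is integrable and the fundamental theorem of calculus applies.
\<close>

lemma variation_le_nn_integral:
  fixes F D :: "real \<Rightarrow> real"
  assumes "a \<le> b" "continuous_on {a..b} F" "finite S"
    and F: "\<And>s. s \<in> {a..b} - S \<Longrightarrow> (F has_real_derivative D s) (at s)"
    and D: "continuous_on ({a..b} - S) D"
  shows "ennreal (F b - F a) \<le> (\<integral>\<^sup>+s\<in>{a..b} - S. ennreal \<bar>D s\<bar> \<partial>lborel)"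
proof (cases "(\<integral>\<^sup>+s\<in>{a..b} - S. ennreal \<bar>D s\<bar> \<partial>lborel) = \<infinity>")
  case False
  have Sb: "{a..b} - S \<in> sets borel" using finite_imp_closed[OF assms(3)] by auto
  define G where "G = (\<lambda>s. indicator ({a..b} - S) s *\<^sub>R D s)"
  have G: "G \<in> borel_measurable borel"
    using borel_measurable_continuous_on_indicator[OF Sb D] by (simp add: G_def)
  have nG: "(\<integral>\<^sup>+s. ennreal (norm (G s)) \<partial>lborel) = (\<integral>\<^sup>+s\<in>{a..b} - S. ennreal \<bar>D s\<bar> \<partial>lborel)"
    by (intro nn_integral_cong) (auto simp: G_def split: split_indicator)
  have int: "integrable lborel G"
    using False G nG by (intro integrableI_bounded) (auto simp: less_top)
  have "(D has_integral (F b - F a)) {a..b}"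
    using F by (intro fundamental_theorem_of_calculus_interior_strong[OF assms(3,1)] assms(2))
      (auto simp: has_real_derivative_iff_has_vector_derivative)
  then have "(G has_integral (F b - F a)) {a..b}"
    by (rule has_integral_spike_finite[OF assms(3), rotated]) (auto simp: G_def)
  then have "(G has_integral (F b - F a)) UNIV"
    by (rule has_integral_on_superset) (auto simp: G_def)
  moreover have "(G has_integral (integral\<^sup>L lborel G)) UNIV"
    using has_integral_integral_lborel[OF int] .
  ultimately have "F b - F a = integral\<^sup>L lborel G" by (rule has_integral_unique)
  also have "\<dots> \<le> integral\<^sup>L lborel (\<lambda>s. norm (G s))"
    using int by (intro integral_mono) auto
  finally have "ennreal (F b - F a) \<le> ennreal (integral\<^sup>L lborel (\<lambda>s. norm (G s)))"
    by (rule ennreal_leI)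
  also have "\<dots> = (\<integral>\<^sup>+s. ennreal (norm (G s)) \<partial>lborel)"
    using int by (subst nn_integral_eq_integral) auto
  finally show ?thesis unfolding nG .
qed auto

text \<open>
  The function that serves as a potential between \<open>\<alpha>\<close> and \<open>\<beta>\<close>.  In the hyperboloid model it is a ratio of two
  linear coordinates, so its level curves are geodesics; they are orthogonal to the vertical line over \<open>c\<close>.
\<close>

definition height :: "real \<Rightarrow> real \<Rightarrow> complex \<Rightarrow> real" where
  "height k c \<zeta> = sin (Im \<zeta>) / (k * cosh (Re \<zeta> - c))"

text \<open>
  Up to the factor \<open>k cosh^2\<close>, the differential of \<open>height\<close> has the coefficients \<open>a = cos \<theta> cosh (t - x)\<close> and
  \<open>b = sin \<theta> sinh (t - x)\<close> with \<open>a^2 + b^2 \<le> cosh^2 (t - x)\<close>; Cauchy-Schwarz bounds its Euclidean norm by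
  \<open>1 / (k cosh (t - x))\<close>, and the factor \<open>cos \<theta>\<close> passes to the hyperbolic metric.
\<close>

lemma height_variation:
  assumes w: "norm w < 1" and k: "k > 0"
    and c: "valid_path c" "path_image c \<subseteq> ball 0 1" and s: "0 \<le> s" "s \<le> 1"
  shows "\<exists>S. finite S \<and>
    ennreal (height k x (strip_inv \<theta> w (c s)) - height k x (strip_inv \<theta> w (c 0))) \<le>
    (\<integral>\<^sup>+t\<in>{0..s} - S. ennreal (cos (Im (strip_inv \<theta> w (c t))) / (k * cosh (Re (strip_inv \<theta> w (c t)) - x)))
        * ennreal (2 * norm (vector_derivative c (at t)) / (1 - (norm (c t))\<^sup>2)) \<partial>lborel)"
proof -
  obtain S where S: "finite S" "c C1_differentiable_on ({0..1} - S)" and cc: "continuous_on {0..1} c"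
    using c(1) by (auto simp: valid_path_def piecewise_C1_differentiable_on_def)
  obtain c' where c': "\<And>t. t \<in> {0..1} - S \<Longrightarrow> (c has_vector_derivative c' t) (at t)" "continuous_on ({0..1} - S) c'"
    using S(2) unfolding C1_differentiable_on_def by blast
  have n: "norm (c t) < 1" if "t \<in> {0..1}" for t
    using c(2) that unfolding path_image_def by (metis imageI mem_ball_0 subsetD)
  define \<Omega> where "\<Omega> = strip_inv \<theta> w"
  define E where "E = (\<lambda>z. deriv \<Omega> z)"
  have dO: "(\<Omega> has_field_derivative E z) (at z)" "norm (E z) = 2 * cos (Im (\<Omega> z)) / (1 - (norm z)\<^sup>2)"
    if z: "norm z < 1" for z
  proof -
    obtain D where D: "(\<Omega> has_field_derivative D) (at z)" "norm D = 2 * cos (Im (\<Omega> z)) / (1 - (norm z)\<^sup>2)"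
      using strip_inv_deriv[OF w z] unfolding \<Omega>_def by metis
    then have "E z = D" unfolding E_def by (simp add: DERIV_imp_deriv)
    then show "(\<Omega> has_field_derivative E z) (at z)" "norm (E z) = 2 * cos (Im (\<Omega> z)) / (1 - (norm z)\<^sup>2)"
      using D by auto
  qed
  have "\<Omega> holomorphic_on ball 0 1"
    using dO(1) by (metis holomorphic_on_open mem_ball_0 open_ball)
  then have cE: "continuous_on (ball 0 1) E"
    unfolding E_def by (intro holomorphic_on_imp_continuous_on holomorphic_deriv) auto
  have cO: "continuous_on (ball 0 1) \<Omega>" unfolding \<Omega>_def by (rule continuous_strip_inv[OF w])
  define \<zeta> where "\<zeta> = (\<lambda>t. \<Omega> (c t))"
  define \<zeta>' where "\<zeta>' = (\<lambda>t. c' t * E (c t))"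
  have ci: "c ` {0..1} \<subseteq> ball 0 1" using n by auto
  have c\<zeta>: "continuous_on {0..1} \<zeta>" unfolding \<zeta>_def by (rule continuous_on_compose2[OF cO cc ci])
  have d\<zeta>: "(\<zeta> has_vector_derivative \<zeta>' t) (at t)" if "t \<in> {0..1} - S" for t
    using field_vector_diff_chain_at[OF c'(1)[OF that] dO(1)[OF n]] that by (auto simp: \<zeta>_def \<zeta>'_def o_def)
  have c\<zeta>': "continuous_on ({0..1} - S) \<zeta>'" unfolding \<zeta>'_def
    by (intro continuous_intros c'(2) continuous_on_compose2[OF cE continuous_on_subset[OF cc]]) (use ci in auto)
  define D where "D = (\<lambda>t. (cos (Im (\<zeta> t)) * Im (\<zeta>' t) * cosh (Re (\<zeta> t) - x) - sin (Im (\<zeta> t)) * (sinh (Re (\<zeta> t) - x) * Re (\<zeta>' t)))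
       / (k * (cosh (Re (\<zeta> t) - x))\<^sup>2))"
  have ch: "cosh y > 0" for y :: real by simp
  have dF: "((\<lambda>t. height k x (\<zeta> t)) has_real_derivative D t) (at t)" if t: "t \<in> {0..1} - S" for t
  proof -
    have r: "((\<lambda>t. Re (\<zeta> t)) has_real_derivative Re (\<zeta>' t)) (at t)"
      and i: "((\<lambda>t. Im (\<zeta> t)) has_real_derivative Im (\<zeta>' t)) (at t)"
      using d\<zeta>[OF t] bounded_linear.has_vector_derivative[OF bounded_linear_Re] bounded_linear.has_vector_derivative[OF bounded_linear_Im]
      by (auto simp: has_real_derivative_iff_has_vector_derivative)
    have "((\<lambda>t. sin (Im (\<zeta> t)) / (k * cosh (Re (\<zeta> t) - x))) has_real_derivative
       (cos (Im (\<zeta> t)) * Im (\<zeta>' t) * (k * cosh (Re (\<zeta> t) - x)) - sin (Im (\<zeta> t)) * (k * (sinh (Re (\<zeta> t) - x) * Re (\<zeta>' t))))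
       / ((k * cosh (Re (\<zeta> t) - x)) * (k * cosh (Re (\<zeta> t) - x)))) (at t)"
    proof -
      have "((\<lambda>t. sin (I t) / (k * cosh (R t - x))) has_real_derivative
         (cos (I t) * i' * (k * cosh (R t - x)) - sin (I t) * (k * (sinh (R t - x) * r')))
         / ((k * cosh (R t - x)) * (k * cosh (R t - x)))) (at t)"
        if "(R has_real_derivative r') (at t)" "(I has_real_derivative i') (at t)" for R I r' i'
        using k that by (auto intro!: derivative_eq_intros)
      then show ?thesis using r i by blast
    qed
    moreover have "(cos (Im (\<zeta> t)) * Im (\<zeta>' t) * (k * cosh (Re (\<zeta> t) - x)) - sin (Im (\<zeta> t)) * (k * (sinh (Re (\<zeta> t) - x) * Re (\<zeta>' t))))
       / ((k * cosh (Re (\<zeta> t) - x)) * (k * cosh (Re (\<zeta> t) - x))) = D t"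
    proof -
      have "(k * a) / (k * q * (k * q)) = a / (k * q\<^sup>2)" for a q :: real
        using k by (simp add: power2_eq_square mult_ac)
      moreover have "cos (Im (\<zeta> t)) * Im (\<zeta>' t) * (k * cosh (Re (\<zeta> t) - x)) - sin (Im (\<zeta> t)) * (k * (sinh (Re (\<zeta> t) - x) * Re (\<zeta>' t)))
        = k * (cos (Im (\<zeta> t)) * Im (\<zeta>' t) * cosh (Re (\<zeta> t) - x) - sin (Im (\<zeta> t)) * (sinh (Re (\<zeta> t) - x) * Re (\<zeta>' t)))"
        by (simp add: algebra_simps)
      ultimately show ?thesis unfolding D_def by metis
    qed
    ultimately show ?thesis unfolding height_def by simp
  qed
  have cF: "continuous_on {0..s} (\<lambda>t. height k x (\<zeta> t))"
    unfolding height_def using k s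
    by (intro continuous_intros continuous_on_subset[OF c\<zeta>]) (auto simp: less_imp_neq[OF ch, symmetric])
  have cD: "continuous_on ({0..s} - S) D"
  proof -
    have "continuous_on ({0..s} - S) \<zeta>" "continuous_on ({0..s} - S) \<zeta>'"
      using s by (auto intro!: continuous_on_subset[OF c\<zeta>] continuous_on_subset[OF c\<zeta>'])
    then show ?thesis unfolding D_def
      by (intro continuous_intros) (use k in \<open>auto simp: less_imp_neq[OF ch, symmetric]\<close>)
  qed
  have "ennreal (height k x (\<zeta> s) - height k x (\<zeta> 0)) \<le> (\<integral>\<^sup>+t\<in>{0..s} - S. ennreal \<bar>D t\<bar> \<partial>lborel)"
    by (rule variation_le_nn_integral[OF s(1) cF S(1) _ cD]) (use dF s in auto)
  also have "\<dots> \<le> (\<integral>\<^sup>+t\<in>{0..s} - S. ennreal (cos (Im (\<zeta> t)) / (k * cosh (Re (\<zeta> t) - x)))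
        * ennreal (2 * norm (vector_derivative c (at t)) / (1 - (norm (c t))\<^sup>2)) \<partial>lborel)"
  proof (intro nn_integral_mono)
    fix t
    have "ennreal \<bar>D t\<bar> \<le> ennreal (cos (Im (\<zeta> t)) / (k * cosh (Re (\<zeta> t) - x)))
        * ennreal (2 * norm (vector_derivative c (at t)) / (1 - (norm (c t))\<^sup>2))" if "t \<in> {0..s} - S"
    proof -
      have t: "t \<in> {0..1} - S" using that s by auto
      have vd: "vector_derivative c (at t) = c' t" using c'(1)[OF t] by (rule vector_derivative_at)
      have st: "\<zeta> t \<in> strip" unfolding \<zeta>_def \<Omega>_def using t by (intro strip_map_inv w n) auto
      define C where "C = cosh (Re (\<zeta> t) - x)"
      define Sh where "Sh = sinh (Re (\<zeta> t) - x)"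
      have C: "C > 0" by (simp add: C_def)
      have Cp: "cos (Im (\<zeta> t)) > 0" by (rule strip_cos_pos[OF st])
      have CS: "Sh\<^sup>2 = C\<^sup>2 - 1" unfolding Sh_def C_def sinh_square_eq by simp
      define a b where "a = cos (Im (\<zeta> t)) * C" and "b = sin (Im (\<zeta> t)) * Sh"
      have ab: "a\<^sup>2 + b\<^sup>2 \<le> C\<^sup>2"
      proof -
        have "a\<^sup>2 + b\<^sup>2 = C\<^sup>2 - (sin (Im (\<zeta> t)))\<^sup>2"
          unfolding a_def b_def power_mult_distrib CS cos_squared_eq by (simp add: algebra_simps)
        then show ?thesis by simp
      qed
      have "\<bar>a * Im (\<zeta>' t) - b * Re (\<zeta>' t)\<bar> \<le> C * norm (\<zeta>' t)"
      proof -
        have "(a * Im (\<zeta>' t) - b * Re (\<zeta>' t))\<^sup>2 + (a * Re (\<zeta>' t) + b * Im (\<zeta>' t))\<^sup>2 = (a\<^sup>2 + b\<^sup>2) * (norm (\<zeta>' t))\<^sup>2"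
          unfolding cmod_power2 by (simp add: power2_eq_square algebra_simps)
        also have "\<dots> \<le> C\<^sup>2 * (norm (\<zeta>' t))\<^sup>2" using ab by (intro mult_right_mono) auto
        finally have "(a * Im (\<zeta>' t) - b * Re (\<zeta>' t))\<^sup>2 \<le> (C * norm (\<zeta>' t))\<^sup>2"
          unfolding power_mult_distrib by (smt (verit) zero_le_power2)
        moreover have "0 \<le> C * cmod (\<zeta>' t)" using C by simp
        ultimately show ?thesis unfolding abs_le_square_iff[symmetric] by simp
      qed
      moreover have "D t = (a * Im (\<zeta>' t) - b * Re (\<zeta>' t)) / (k * C\<^sup>2)"
        unfolding D_def a_def b_def C_def Sh_def by (simp add: mult_ac)
      ultimately have "\<bar>D t\<bar> \<le> C * norm (\<zeta>' t) / (k * C\<^sup>2)"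
        using k C by (simp add: abs_divide divide_right_mono)
      also have "\<dots> = norm (\<zeta>' t) / (k * C)" using C by (simp add: power2_eq_square)
      also have "norm (\<zeta>' t) = norm (c' t) * (2 * cos (Im (\<zeta> t)) / (1 - (norm (c t))\<^sup>2))"
        unfolding \<zeta>'_def norm_mult using dO(2)[OF n, of t] t by (simp add: \<zeta>_def)
      also have "norm (c' t) * (2 * cos (Im (\<zeta> t)) / (1 - (norm (c t))\<^sup>2)) / (k * C)
        = cos (Im (\<zeta> t)) / (k * C) * (2 * norm (c' t) / (1 - (norm (c t))\<^sup>2))"
          by (simp add: mult_ac)
      finally have "ennreal \<bar>D t\<bar> \<le> ennreal (cos (Im (\<zeta> t)) / (k * C) * (2 * norm (c' t) / (1 - (norm (c t))\<^sup>2)))"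
        by (rule ennreal_leI)
      also have "\<dots> = ennreal (cos (Im (\<zeta> t)) / (k * C)) * ennreal (2 * norm (c' t) / (1 - (norm (c t))\<^sup>2))"
        using k C Cp by (intro ennreal_mult') auto
      finally show ?thesis by (simp add: vd C_def)
    qed
    then show "ennreal \<bar>D t\<bar> * indicator ({0..s} - S) t \<le> ennreal (cos (Im (\<zeta> t)) / (k * cosh (Re (\<zeta> t) - x)))
        * ennreal (2 * norm (vector_derivative c (at t)) / (1 - (norm (c t))\<^sup>2)) * indicator ({0..s} - S) t"
      by (auto split: split_indicator)
  qed
  finally show ?thesis using S(1) unfolding \<zeta>_def \<Omega>_def by blast
qed

section \<open>The deck group\<close>

locale pants_surface =
  fixes P :: pants
  assumes pants: "geodesic_pants P"
begin

lemma fuchsian: "torsion_free_fuchsian (deck P)"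
  using pants unfolding geodesic_pants_def by (elim conjE)

lemma deck_moebius:
  assumes "f \<in> deck P"
  obtains \<theta> w where "norm w < 1" "\<And>z. norm z < 1 \<Longrightarrow> f z = Moebius_function \<theta> w z"
    "f = restrict (Moebius_function \<theta> w) hdisc"
proof -
  obtain \<theta> w where w: "norm w < 1" "f = restrict (Moebius_function \<theta> w) hdisc"
    using fuchsian assms unfolding torsion_free_fuchsian_def by blast
  then show ?thesis by (intro that[of w \<theta>]) auto
qed

lemma deck_in_disc: "f \<in> deck P \<Longrightarrow> norm z < 1 \<Longrightarrow> norm (f z) < 1"
  by (metis deck_moebius moebius_in_disc)

lemma deck_id: "restrict id hdisc \<in> deck P"
proof -
  have "subgroup (deck P) (BijGroup hdisc)" using fuchsian by (simp add: torsion_free_fuchsian_def)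
  then have "\<one>\<^bsub>BijGroup hdisc\<^esub> \<in> deck P" by (rule subgroup.one_closed)
  moreover have "\<one>\<^bsub>BijGroup hdisc\<^esub> = restrict id hdisc" by (auto simp: BijGroup_def)
  ultimately show ?thesis by simp
qed

lemma deck_compose:
  assumes "f \<in> deck P" "g \<in> deck P"
  obtains h where "h \<in> deck P" "\<And>z. norm z < 1 \<Longrightarrow> h z = f (g z)"
proof -
  have sg: "subgroup (deck P) (BijGroup hdisc)" using fuchsian by (simp add: torsion_free_fuchsian_def)
  then have "f \<otimes>\<^bsub>BijGroup hdisc\<^esub> g \<in> deck P" using assms by (rule subgroup.m_closed)
  moreover have "f \<in> Bij hdisc" "g \<in> Bij hdisc"
    using subgroup.subset[OF sg] assms by (auto simp: BijGroup_def)
  ultimately have "compose hdisc f g \<in> deck P" by (simp add: BijGroup_def)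
  then show ?thesis by (rule that) (simp add: compose_def)
qed

lemma deck_inverse:
  assumes "f \<in> deck P"
  obtains g where "g \<in> deck P" "\<And>z. norm z < 1 \<Longrightarrow> g (f z) = z" "\<And>z. norm z < 1 \<Longrightarrow> f (g z) = z"
proof -
  have sg: "subgroup (deck P) (BijGroup hdisc)" using fuchsian by (simp add: torsion_free_fuchsian_def)
  have f: "f \<in> Bij hdisc" using subgroup.subset[OF sg] assms by (auto simp: BijGroup_def)
  have "inv\<^bsub>BijGroup hdisc\<^esub> f \<in> deck P" using sg assms by (rule subgroup.m_inv_closed)
  then have "(\<lambda>x\<in>hdisc. (inv_into hdisc f) x) \<in> deck P" by (simp add: inv_BijGroup[OF f])
  moreover have b: "bij_betw f hdisc hdisc" using f by (simp add: Bij_def)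
  ultimately show ?thesis
    by (intro that[of "\<lambda>x\<in>hdisc. (inv_into hdisc f) x"])
      (auto simp: deck_in_disc[OF assms] bij_betw_inv_into_left[OF b] bij_betw_inv_into_right[OF b])
qed

lemma deck_free: "f \<in> deck P \<Longrightarrow> norm z < 1 \<Longrightarrow> f z = z \<Longrightarrow> f = restrict id hdisc"
  using fuchsian by (auto simp: torsion_free_fuchsian_def)

lemma deck_free': "f \<in> deck P \<Longrightarrow> norm z < 1 \<Longrightarrow> f z = z \<Longrightarrow> norm z' < 1 \<Longrightarrow> f z' = z'"
  using deck_free by fastforce

lemma deck_continuous: 
  assumes "f \<in> deck P" shows "continuous_on hdisc f"
proof -
  obtain \<theta> w where w: "norm w < 1" "\<And>z. norm z < 1 \<Longrightarrow> f z = Moebius_function \<theta> w z"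
    using deck_moebius[OF assms] by metis
  have "continuous_on hdisc (Moebius_function \<theta> w)"
    using w by (intro holomorphic_on_imp_continuous_on Moebius_function_holomorphic) auto
  then show ?thesis by (rule continuous_on_eq) (use w in auto)
qed

lemma deck_open_image:
  assumes "f \<in> deck P" "open U" "U \<subseteq> hdisc" shows "open (f ` U)" "f ` U \<subseteq> hdisc"
proof -
  obtain g where g: "g \<in> deck P" "\<And>z. norm z < 1 \<Longrightarrow> g (f z) = z" "\<And>z. norm z < 1 \<Longrightarrow> f (g z) = z"
    using deck_inverse[OF assms(1)] by metis
  have "f ` U = hdisc \<inter> g -` U"
  proof (intro equalityI subsetI)
    fix z assume "z \<in> hdisc \<inter> g -` U"
    then show "z \<in> f ` U" using g(3)[of z] by (metis IntE image_eqI mem_ball_0 vimageE)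
  qed (use assms g deck_in_disc in force)
  then show "open (f ` U)"
    using continuous_open_preimage[OF deck_continuous[OF g(1)] open_ball assms(2)] by simp
  show "f ` U \<subseteq> hdisc" using assms(1,3) deck_in_disc by force
qed

lemma deck_finite: "compact K \<Longrightarrow> K \<subseteq> hdisc \<Longrightarrow> finite {f \<in> deck P. f ` K \<inter> K \<noteq> {}}"
  using fuchsian by (auto simp: torsion_free_fuchsian_def)

lemma deck_countable: "countable (deck P)"
proof -
  define K where "K = (\<lambda>n::nat. cball (0::complex) (1 - 1 / Suc n))"
  have K: "K n \<subseteq> hdisc" for n
  proof
    fix x assume "x \<in> K n"
    moreover have "1 - 1 / real (Suc n) < 1" by simp
    ultimately show "x \<in> hdisc" unfolding K_def mem_cball mem_ball by linarith
  qed
  have "deck P \<subseteq> (\<Union>n. {f \<in> deck P. f ` K n \<inter> K n \<noteq> {}})"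
  proof
    fix f assume f: "f \<in> deck P"
    have "1 - norm (f 0) > 0" using deck_in_disc[OF f, of 0] by simp
    then obtain n where n: "inverse (real (Suc n)) < 1 - norm (f 0)"
      using reals_Archimedean by blast
    then have "f 0 \<in> K n" "0 \<in> K n" by (auto simp: K_def inverse_eq_divide)
    then show "f \<in> (\<Union>n. {f \<in> deck P. f ` K n \<inter> K n \<noteq> {}})" using f by blast
  qed
  moreover have "countable (\<Union>n. {f \<in> deck P. f ` K n \<inter> K n \<noteq> {}})"
    by (intro countable_UN countable_finite deck_finite K countableI_type) (simp add: K_def)
  ultimately show ?thesis by (rule countable_subset)
qed

text \<open>Freeness and proper discontinuity make the deck group act with small disjoint translates.\<close>

lemma deck_small_ball:
  assumes "norm z < 1"
  obtains r where "r > 0" "ball z r \<subseteq> hdisc"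
    "\<And>f x y. f \<in> deck P \<Longrightarrow> x \<in> ball z r \<Longrightarrow> y \<in> ball z r \<Longrightarrow> f x = y \<Longrightarrow> f = restrict id hdisc"
proof -
  obtain s where s: "s > 0" "cball z s \<subseteq> hdisc"
    using open_contains_cball[of hdisc] assms by (metis mem_ball_0 open_ball)
  define A where "A = {f \<in> deck P. f ` cball z s \<inter> cball z s \<noteq> {}} - {restrict id hdisc}"
  have A: "finite A" using deck_finite[OF compact_cball s(2)] by (simp add: A_def)
  have "\<forall>f\<in>A. \<exists>d>0. \<forall>x\<in>ball z d. \<forall>y\<in>ball z d. x \<in> hdisc \<longrightarrow> f x \<noteq> y"
  proof
    fix f assume f: "f \<in> A"
    then have fd: "f \<in> deck P" "f z \<noteq> z" using deck_free assms by (auto simp: A_def)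
    define e where "e = dist (f z) z / 2"
    have e: "e > 0" using fd by (simp add: e_def)
    have "continuous (at z within hdisc) f" using deck_continuous[OF fd(1)] assms
      by (simp add: continuous_on_eq_continuous_within)
    then obtain d where d: "d > 0" "\<And>x. x \<in> hdisc \<Longrightarrow> dist x z < d \<Longrightarrow> dist (f x) (f z) < e"
      unfolding continuous_within_eps_delta using e by metis
    show "\<exists>d>0. \<forall>x\<in>ball z d. \<forall>y\<in>ball z d. x \<in> hdisc \<longrightarrow> f x \<noteq> y"
    proof (intro exI[of _ "min d e"] conjI ballI impI)
      fix x y assume xy: "x \<in> ball z (min d e)" "y \<in> ball z (min d e)" "x \<in> hdisc"
      then have "dist (f x) (f z) < e" "dist y z < e" using d by (auto simp: dist_commute)
      then show "f x \<noteq> y" using dist_triangle[of "f z" z y] by (auto simp: e_def dist_commute)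
    qed (use d e in auto)
  qed
  then obtain D where D: "\<And>f. f \<in> A \<Longrightarrow> D f > 0"
    "\<And>f x y. f \<in> A \<Longrightarrow> x \<in> ball z (D f) \<Longrightarrow> y \<in> ball z (D f) \<Longrightarrow> x \<in> hdisc \<Longrightarrow> f x \<noteq> y"
    by metis
  define r where "r = Min (insert s (D ` A))"
  have r: "r > 0" "r \<le> s" "\<And>f. f \<in> A \<Longrightarrow> r \<le> D f"
    using A s D by (auto simp: r_def)
  show ?thesis
  proof (rule that[OF r(1)])
    show sub: "ball z r \<subseteq> hdisc" using r(2) s(2) by (meson ball_subset_cball cball_subset_cball_iff dual_order.trans less_eq_real_def subset_ball subset_trans)
    fix f x y assume f: "f \<in> deck P" "x \<in> ball z r" "y \<in> ball z r" "f x = y"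
    show "f = restrict id hdisc"
    proof (rule ccontr)
      assume "f \<noteq> restrict id hdisc"
      moreover have "x \<in> cball z s" "y \<in> cball z s" using f r(2) by auto
      moreover have "y \<in> f ` cball z s \<inter> cball z s" using \<open>x \<in> cball z s\<close> \<open>y \<in> cball z s\<close> f(4) by blast
      ultimately have fA: "f \<in> A" using f(1) unfolding A_def by blast
      have "x \<in> ball z (D f)" "y \<in> ball z (D f)" using f r(3)[OF fA] by auto
      then show False using D(2)[OF fA] f sub by blast
    qed
  qed
qed

section \<open>The projection\<close>

lemma cover_subset: "cover P \<subseteq> hdisc" and cover_hconvex: "hconvex (cover P)"
proof -
  have "geodesic_region (cover P)" using pants unfolding geodesic_pants_def by (elim conjE)
  then show h: "hconvex (cover P)" by (simp add: geodesic_region_def)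
  show "cover P \<subseteq> hdisc" by (rule hconvex_subset_disc[OF h])
qed

lemma cover_norm: "z \<in> cover P \<Longrightarrow> norm z < 1"
  using cover_subset by auto

lemma deck_cover: 
  assumes "f \<in> deck P" "z \<in> cover P" shows "f z \<in> cover P"
proof -
  have "\<forall>f\<in>deck P. f ` cover P = cover P" using pants unfolding geodesic_pants_def by (elim conjE)
  then show ?thesis using assms by blast
qed

lemma proj_eq_iff:
  assumes "z \<in> cover P" "w \<in> cover P" shows "proj P z = proj P w \<longleftrightarrow> (\<exists>f\<in>deck P. w = f z)"
proof -
  have "\<forall>z\<in>cover P. \<forall>w\<in>cover P. proj P z = proj P w \<longleftrightarrow> (\<exists>f\<in>deck P. w = f z)"
    using pants unfolding geodesic_pants_def by (elim conjE)
  then show ?thesis using assms by blast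
qed

lemma proj_deck: "f \<in> deck P \<Longrightarrow> z \<in> cover P \<Longrightarrow> proj P (f z) = proj P z"
  using proj_eq_iff deck_cover by metis

lemma deck_cover_iff: 
  assumes "f \<in> deck P" "norm z < 1" shows "f z \<in> cover P \<longleftrightarrow> z \<in> cover P"
  using deck_inverse[OF assms(1)] assms deck_cover by metis

lemma proj_quotient: "quotient_map (top_of_set (cover P)) (top_of_set (pts P)) (proj P)"
  using pants unfolding geodesic_pants_def by (elim conjE)

lemma proj_continuous: "continuous_on (cover P) (proj P)"
  using quotient_imp_continuous_map[OF proj_quotient] by simp

lemma proj_image: "proj P ` cover P = pts P"
  using quotient_imp_surjective_map[OF proj_quotient] by simp

lemma proj_in_pts: "z \<in> cover P \<Longrightarrow> proj P z \<in> pts P"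
  using proj_image by blast

text \<open>
  The full preimage of the image is the union of the translates of \<open>U\<close>, which is open.
\<close>

lemma proj_open:
  assumes "open U" obtains W where "open W" "proj P ` (U \<inter> cover P) = W \<inter> pts P"
proof -
  let ?V = "proj P ` (U \<inter> cover P)"
  have V: "?V \<subseteq> topspace (top_of_set (pts P))" using proj_image by auto
  have "{z \<in> cover P. proj P z \<in> ?V} = cover P \<inter> (\<Union>f\<in>deck P. f ` (U \<inter> hdisc))"
  proof (intro equalityI subsetI)
    fix z assume z: "z \<in> {z \<in> cover P. proj P z \<in> ?V}"
    then obtain u where u: "u \<in> U" "u \<in> cover P" "proj P z = proj P u" by auto
    then obtain f where "f \<in> deck P" "z = f u" using z proj_eq_iff[of u z] by auto
    then show "z \<in> cover P \<inter> (\<Union>f\<in>deck P. f ` (U \<inter> hdisc))" using u z cover_subset by auto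
  next
    fix z assume z: "z \<in> cover P \<inter> (\<Union>f\<in>deck P. f ` (U \<inter> hdisc))"
    then obtain f u where f: "f \<in> deck P" "u \<in> U" "norm u < 1" "z = f u" by auto
    then have "u \<in> cover P" using z deck_cover_iff by auto
    then show "z \<in> {z \<in> cover P. proj P z \<in> ?V}" using f z proj_deck by auto
  qed
  moreover have "open (\<Union>f\<in>deck P. f ` (U \<inter> hdisc))"
    by (intro open_UN ballI deck_open_image open_Int assms open_ball Int_lower2)
  ultimately have "openin (top_of_set (cover P)) {z \<in> cover P. proj P z \<in> ?V}"
    by (simp add: openin_open_Int)
  then have "openin (top_of_set (pts P)) ?V"
    using proj_quotient V by (simp add: quotient_map_def)
  then show ?thesis using that by (auto simp: openin_open Int_commute)
qed

section \<open>Boundary geodesics\<close>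

lemma ctr_norm: "i \<in> {0, 1, 2} \<Longrightarrow> norm (ctr P i) = 1"
  and rad_pos: "i \<in> {0, 1, 2} \<Longrightarrow> rad P i > 0"
proof -
  have *: "\<forall>i\<in>{0, 1, 2}. norm (ctr P i) = 1 \<and> 0 < rad P i"
    using pants unfolding geodesic_pants_def by (elim conjE)
  show "i \<in> {0, 1, 2} \<Longrightarrow> norm (ctr P i) = 1" "i \<in> {0, 1, 2} \<Longrightarrow> rad P i > 0"
    using * by auto
qed

lemma discs_disjoint:
  assumes "i \<in> {0, 1, 2}" "j \<in> {0, 1, 2}" "i \<noteq> j"
  shows "sphere 0 1 \<inter> cball (ctr P i) (rad P i) \<inter> cball (ctr P j) (rad P j) = {}"
proof -
  have "\<forall>i\<in>{0, 1, 2}. \<forall>j\<in>{0, 1, 2}. i \<noteq> j \<longrightarrow>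
      sphere 0 1 \<inter> cball (ctr P i) (rad P i) \<inter> cball (ctr P j) (rad P j) = {}"
    using pants unfolding geodesic_pants_def by (elim conjE)
  then show ?thesis using assms by blast
qed

lemma rad_less_2: 
  assumes "i \<in> {0, 1, 2}" shows "rad P i < 2"
proof (rule ccontr)
  assume r: "\<not> rad P i < 2"
  define j :: nat where "j = (if i = 0 then 1 else 0)"
  have j: "j \<in> {0, 1, 2}" "i \<noteq> j" by (auto simp: j_def)
  have "dist (ctr P i) (ctr P j) \<le> 2"
    using norm_triangle_ineq4[of "ctr P i" "ctr P j"] ctr_norm assms j by (simp add: dist_norm)
  then have "ctr P j \<in> sphere 0 1 \<inter> cball (ctr P i) (rad P i) \<inter> cball (ctr P j) (rad P j)"
    using r ctr_norm[OF j(1)] rad_pos[OF j(1)] by auto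
  then show False using discs_disjoint[OF assms j] by blast
qed

lemma pts_norm: "x \<in> pts P \<Longrightarrow> norm x = 1"
  by (auto simp: pts_def)

lemma pts_dist: 
  assumes "x \<in> pts P" "i \<in> {0, 1, 2}" 
  shows "rad P i \<le> dist (ctr P i) x" "i \<in> punct P \<Longrightarrow> rad P i < dist (ctr P i) x"
proof -
  have "x \<notin> (if i \<in> punct P then cball (ctr P i) (rad P i) else ball (ctr P i) (rad P i))"
    using assms unfolding pts_def by blast
  then show "rad P i \<le> dist (ctr P i) x" "i \<in> punct P \<Longrightarrow> rad P i < dist (ctr P i) x"
    by (auto split: if_splits)
qed

lemma bdry_inner:
  assumes "x \<in> bdry P i" "i \<in> {0, 1, 2}"
  shows "norm x = 1" "x \<bullet> ctr P i = 1 - (rad P i)\<^sup>2 / 2" "\<bar>x \<bullet> ctr P i\<bar> < 1"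
proof -
  show n: "norm x = 1" using assms by (auto simp: bdry_def)
  have "(dist (ctr P i) x)\<^sup>2 = 2 - 2 * (x \<bullet> ctr P i)"
    using n ctr_norm[OF assms(2)] by (simp add: dist_norm power2_norm_eq_inner inner_simps inner_commute norm_eq_1)
  moreover have "dist (ctr P i) x = rad P i" using assms by (auto simp: bdry_def)
  ultimately have "(rad P i)\<^sup>2 = 2 - 2 * (x \<bullet> ctr P i)" by simp
  then show e: "x \<bullet> ctr P i = 1 - (rad P i)\<^sup>2 / 2" by linarith
  have "(rad P i)\<^sup>2 < 2\<^sup>2" by (rule power_strict_mono[OF rad_less_2[OF assms(2)]]) (use rad_pos[OF assms(2)] in auto)
  moreover have "(rad P i)\<^sup>2 > 0" using rad_pos[OF assms(2)] by simp
  ultimately show "\<bar>x \<bullet> ctr P i\<bar> < 1" unfolding e by (simp add: abs_less_iff)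
qed

text \<open>
  Near an interior point of the cover the projection is injective, hence open as a map into the
  sphere, whereas every neighbourhood of a boundary point of the pants contains points of the removed
  disc.  Openness is invariance of domain for the cone over the projection, a map between spaces of
  dimension three.
\<close>

lemma bdry_not_interior:
  assumes z: "z \<in> interior (cover P)" and i: "i \<in> {0, 1, 2}" shows "proj P z \<notin> bdry P i"
proof
  assume b: "proj P z \<in> bdry P i"
  define x where "x = proj P z"
  define c where "c = ctr P i"
  define m where "m = x \<bullet> c"
  have x: "norm x = 1" "\<bar>m\<bar> < 1" using bdry_inner[OF b i] by (auto simp: x_def c_def m_def)
  have mr: "m = 1 - (rad P i)\<^sup>2 / 2" using bdry_inner(2)[OF b i] by (simp add: x_def c_def m_def)
  have cn: "c \<bullet> c = 1" "x \<bullet> x = 1" using ctr_norm[OF i] x by (auto simp: c_def norm_eq_1)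
  have cx: "x \<bullet> c = m" "c \<bullet> x = m" by (simp_all add: m_def inner_commute)
  have zc: "z \<in> cover P" using z interior_subset by blast
  obtain r where r: "r > 0"
    "\<And>f x y. f \<in> deck P \<Longrightarrow> x \<in> ball z r \<Longrightarrow> y \<in> ball z r \<Longrightarrow> f x = y \<Longrightarrow> f = restrict id hdisc"
    using deck_small_ball[OF cover_norm[OF zc]] by metis
  define B where "B = ball z r \<inter> interior (cover P)"
  have B: "open B" "z \<in> B" "B \<subseteq> cover P" using z r interior_subset[of "cover P"] by (auto simp: B_def)
  have inj: "inj_on (proj P) B"
  proof (rule inj_onI)
    fix u v assume uv: "u \<in> B" "v \<in> B" "proj P u = proj P v"
    have "u \<in> cover P" "v \<in> cover P" using uv(1,2) B(3) by blast+
    then obtain f where f: "f \<in> deck P" "v = f u" using proj_eq_iff[of u v] uv(3) by blast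
    have "u \<in> ball z r" "v \<in> ball z r" using uv(1,2) by (simp_all add: B_def)
    then have id: "f = restrict id hdisc" by (rule r(2)[OF f(1) _ _ f(2)[symmetric]])
    have "norm u < 1" using uv(1) B(3) cover_norm by blast
    then show "u = v" unfolding f(2) id by simp
  qed
  define F where "F = (\<lambda>(u, s). s *\<^sub>R proj P u)"
  define U where "U = B \<times> {1/2<..<3/2::real}"
  have nB: "norm (proj P u) = 1" if "u \<in> B" for u using that B proj_in_pts pts_norm by auto
  have "open (F ` U)"
  proof (rule invariance_of_domain_gen)
    show "open U" unfolding U_def using B by (intro open_Times) auto
    show "continuous_on U F" unfolding F_def U_def case_prod_beta
      by (intro continuous_intros continuous_on_compose2[OF proj_continuous]) (use B in auto)
    show "inj_on F U"
    proof (rule inj_onI, clarify)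
      fix u s v t assume h: "(u, s) \<in> U" "(v, t) \<in> U" "F (u, s) = F (v, t)"
      then have "norm (s *\<^sub>R proj P u) = norm (t *\<^sub>R proj P v)" by (simp add: F_def)
      then have st: "s = t" using h nB by (auto simp: U_def)
      then have "proj P u = proj P v" using h by (auto simp: F_def U_def)
      then show "u = v \<and> s = t" using inj h st by (auto simp: U_def inj_on_def)
    qed
  qed simp
  moreover have "x \<in> F ` U" using B by (intro image_eqI[of _ _ "(z, 1)"]) (auto simp: F_def U_def x_def)
  ultimately obtain e where e: "e > 0" "ball x e \<subseteq> F ` U" by (meson open_contains_ball)
  \<comment> \<open>\<open>y\<close> is moved from \<open>x\<close> towards the centre of the removed disc, tangentially to the sphere.\<close>
  define q where "q = 1 - m\<^sup>2"
  have q: "q > 0" using x(2) by (simp add: q_def abs_square_less_1)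
  have q1: "q \<le> 1" by (simp add: q_def)
  define \<epsilon> where "\<epsilon> = min 1 (e / 2)"
  have \<epsilon>: "\<epsilon> > 0" "\<epsilon> \<le> 1" "\<epsilon> < e" using e by (auto simp: \<epsilon>_def)
  define y where "y = x + \<epsilon> *\<^sub>R (c - m *\<^sub>R x)"
  have nq: "(norm (c - m *\<^sub>R x))\<^sup>2 = q"
    unfolding power2_norm_eq_inner using cn
    by (simp add: inner_diff_left inner_diff_right cx q_def power2_eq_square)
  have "norm (c - m *\<^sub>R x) \<le> 1"
  proof -
    have "(norm (c - m *\<^sub>R x))\<^sup>2 \<le> 1\<^sup>2" unfolding nq using q1 by simp
    then show ?thesis by (rule power2_le_imp_le) simp
  qed
  then have "dist x y \<le> \<epsilon>" using \<epsilon> by (simp add: y_def dist_norm mult_left_le)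
  then have "y \<in> ball x e" using \<epsilon> by simp
  then have "y \<in> F ` U" using e by blast
  then obtain u s where u: "u \<in> B" "s > 1/2" "y = s *\<^sub>R proj P u" by (auto simp: F_def U_def)
  have ys: "norm y = s" using u nB by simp
  have yc: "y \<bullet> c = m + \<epsilon> * q" using cn by (simp add: y_def inner_add_left inner_diff_left cx q_def power2_eq_square)
  have "(norm y)\<^sup>2 = 1 + \<epsilon>\<^sup>2 * q"
  proof -
    have orth: "x \<bullet> (c - m *\<^sub>R x) = 0" "(c - m *\<^sub>R x) \<bullet> x = 0"
      using cn by (simp_all add: inner_diff_left inner_diff_right cx)
    have "(x + \<epsilon> *\<^sub>R d) \<bullet> (x + \<epsilon> *\<^sub>R d) = x \<bullet> x + \<epsilon>\<^sup>2 * (d \<bullet> d)" if "x \<bullet> d = 0" "d \<bullet> x = 0" for d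
      using that by (simp add: inner_add_left inner_add_right power2_eq_square)
    then show ?thesis using nq cn orth unfolding power2_norm_eq_inner y_def by simp
  qed
  then have s2: "s\<^sup>2 = 1 + \<epsilon>\<^sup>2 * q" using ys by simp
  have "m * s < m + \<epsilon> * q"
  proof (cases "m \<le> 0")
    case True
    have "s\<^sup>2 \<ge> 1\<^sup>2" using s2 q by simp
    then have "s \<ge> 1" using u(2) power2_le_imp_le[of 1 s] by simp
    then have "m * s \<le> m" using mult_left_mono_neg[of 1 s m] True by simp
    moreover have "\<epsilon> * q > 0" using \<epsilon>(1) q by simp
    ultimately show ?thesis by linarith
  next
    case False
    have "(m * s)\<^sup>2 = m\<^sup>2 + m * (m * \<epsilon>) * (\<epsilon> * q)" unfolding power_mult_distrib s2
      by (simp add: power2_eq_square algebra_simps)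
    also have "\<dots> \<le> m\<^sup>2 + m * 1 * (\<epsilon> * q)"
    proof -
      have "m * \<epsilon> \<le> 1 * 1" using False x \<epsilon> by (intro mult_mono) auto
      then show ?thesis using False \<epsilon> q by (intro add_left_mono mult_right_mono mult_left_mono) auto
    qed
    also have "\<dots> < m\<^sup>2 + 2 * m * (\<epsilon> * q) + (\<epsilon> * q)\<^sup>2"
      using False \<epsilon> q by (simp add: add_pos_pos)
    also have "\<dots> = (m + \<epsilon> * q)\<^sup>2" by (simp add: power2_sum)
    finally have "(m * s)\<^sup>2 < (m + \<epsilon> * q)\<^sup>2" .
    moreover have "m + \<epsilon> * q \<ge> 0" using False \<epsilon>(1) q by simp
    ultimately show ?thesis by (rule power2_less_imp_less)
  qed
  then have "proj P u \<bullet> c > m"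
  proof -
    have "s * (proj P u \<bullet> c) = y \<bullet> c" by (simp add: u(3))
    then have "s * m < s * (proj P u \<bullet> c)" using yc \<open>m * s < m + \<epsilon> * q\<close> by (simp add: mult.commute)
    moreover have "s > 0" using u(2) by simp
    ultimately show ?thesis by (simp only: mult_less_cancel_left_pos)
  qed
  moreover have "(dist c (proj P u))\<^sup>2 = 2 - 2 * (proj P u \<bullet> c)"
    using nB[OF u(1)] cn by (simp add: dist_norm power2_norm_eq_inner inner_diff_left inner_diff_right inner_commute norm_eq_1)
  ultimately have "(dist c (proj P u))\<^sup>2 < (rad P i)\<^sup>2" using mr by simp
  then have "dist c (proj P u) < rad P i" by (rule power2_less_imp_less) (use rad_pos[OF i] in simp)
  moreover have "proj P u \<in> pts P" using u(1) B(3) proj_in_pts by blast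
  ultimately show False using pts_dist(1)[OF _ i, of "proj P u"] unfolding c_def by linarith
qed

text \<open>
  The circle is the relative frontier of a disc, the section of the closed ball by a plane.
\<close>

lemma bdry_connected:
  assumes "i \<in> {0, 1, 2}" "bdry P i \<noteq> {}"
  shows "connected (bdry P i)"
proof -
  define c where "c = ctr P i"
  define m where "m = 1 - (rad P i)\<^sup>2 / 2"
  have c1: "norm c = 1" "c \<noteq> 0" using ctr_norm[OF assms(1)] by (auto simp: c_def)
  define H where "H = {x. c \<bullet> x = m}"
  have m: "\<bar>m\<bar> < 1" using bdry_inner[OF _ assms(1)] assms(2) by (auto simp: m_def)
  have eq: "bdry P i = sphere 0 1 \<inter> H"
  proof (intro equalityI subsetI)
    fix x assume "x \<in> bdry P i"
    then show "x \<in> sphere 0 1 \<inter> H" using bdry_inner[of x i] assms by (auto simp: H_def m_def c_def inner_commute)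
  next
    fix x assume x: "x \<in> sphere 0 1 \<inter> H"
    have "(dist c x)\<^sup>2 = 2 - 2 * (c \<bullet> x)"
      using x c1 by (simp add: dist_norm power2_norm_eq_inner inner_simps inner_commute norm_eq_1)
    then have "(dist c x)\<^sup>2 = (rad P i)\<^sup>2" using x by (simp add: H_def m_def)
    then have "dist c x = rad P i" using rad_pos[OF assms(1)] by simp
    then show "x \<in> bdry P i" using x by (auto simp: bdry_def c_def)
  qed
  have aH: "affine H" unfolding H_def by (rule affine_hyperplane)
  have int: "interior (cball 0 1) \<inter> H \<noteq> {}"
  proof -
    have "m *\<^sub>R c \<in> interior (cball 0 1) \<inter> H"
      using m c1(1) power2_norm_eq_inner[of c] by (simp add: H_def)
    then show ?thesis by blast
  qed
  have "rel_frontier (cball 0 1 \<inter> H) = frontier (cball 0 1) \<inter> H"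
    by (rule convex_affine_rel_frontier_Int[OF convex_cball aH int])
  then have "bdry P i = rel_frontier (cball 0 1 \<inter> H)" unfolding eq by simp
  moreover have "aff_dim (cball 0 1 \<inter> H) = aff_dim H"
  proof -
    have "aff_dim (H \<inter> ball (0::real^3) 1) = aff_dim H"
      using int by (intro aff_dim_convex_Int_open affine_imp_convex aH) (auto simp: Int_commute)
    moreover have "aff_dim (H \<inter> ball 0 1) \<le> aff_dim (cball 0 1 \<inter> H)" by (intro aff_dim_subset) auto
    moreover have "aff_dim (cball 0 1 \<inter> H) \<le> aff_dim H" by (intro aff_dim_subset) auto
    ultimately show ?thesis by simp
  qed
  moreover have "aff_dim H = 2" unfolding H_def using c1 by (simp add: aff_dim_hyperplane)
  ultimately show ?thesis
    using connected_sphere_gen[of "cball 0 1 \<inter> H"] affine_imp_convex[OF aH]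
    by (simp add: convex_Int bounded_Int)
qed

text \<open>
  The image is closed in the circle because it is compact, and open in the circle by invariance of
  domain, again after thickening to dimension three; and the circle is connected.
\<close>

lemma closed_geodesic_onto:
  assumes l: "is_lift P i (Geod c)" and cl: "closed_length P c L" and i: "i \<in> {0, 1, 2}"
  shows "proj P ` range c = bdry P i"
proof -
  have c: "unit_geodesic c" "range c \<subseteq> cover P" "proj P ` range c \<subseteq> bdry P i" using l by auto
  have L: "L > 0" "\<And>t. proj P (c (t + L)) = proj P (c t)" "inj_on (proj P \<circ> c) {0..<L}"
    using cl by (auto simp: closed_length_def)
  define h where "h = (\<lambda>t. proj P (c t))"
  have per: "h (t + of_int n * L) = h t" for t n
  proof (induction n rule: int_induct[where k = 0])
    case (step1 n)
    then show ?case using L(2)[of "t + of_int n * L"] by (simp add: h_def algebra_simps)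
  next
    case (step2 n)
    then show ?case using L(2)[of "t + of_int (n - 1) * L"] by (simp add: h_def algebra_simps)
  qed simp
  have ch: "continuous_on UNIV h" unfolding h_def
    by (intro continuous_on_compose2[OF proj_continuous continuous_unit_geodesic[OF c(1)]] c)
  have hb: "h t \<in> bdry P i" for t using c(3) by (auto simp: h_def)
  have range_eq: "proj P ` range c = range h" by (auto simp: h_def)
  have red: "\<exists>n. t + of_int n * L \<in> {0..<L}" for t
  proof -
    define n where "n = - \<lfloor>t / L\<rfloor>"
    have "of_int \<lfloor>t / L\<rfloor> * L \<le> t" "t < (of_int \<lfloor>t / L\<rfloor> + 1) * L"
      using floor_divide_lower[OF L(1)] floor_divide_upper[OF L(1)] by auto
    then have "of_int \<lfloor>t / L\<rfloor> * L \<le> t" "t < of_int \<lfloor>t / L\<rfloor> * L + L" by (auto simp: algebra_simps)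
    then show ?thesis by (intro exI[of _ n]) (auto simp: n_def)
  qed
  have inj: "inj_on h {a<..<a + L}" for a
  proof (rule inj_onI)
    fix s t assume st: "s \<in> {a<..<a + L}" "t \<in> {a<..<a + L}" "h s = h t"
    obtain n where n: "s + of_int n * L \<in> {0..<L}" using red by blast
    obtain k where k: "t + of_int k * L \<in> {0..<L}" using red by blast
    have "h (s + of_int n * L) = h (t + of_int k * L)" using st by (simp add: per)
    then have eq: "s + of_int n * L = t + of_int k * L" using L(3) n k by (auto simp: inj_on_def h_def)
    have "\<bar>s - t\<bar> < L" using st by auto
    moreover have "s - t = of_int (k - n) * L" using eq by (simp add: algebra_simps)
    ultimately have "\<bar>of_int (k - n)\<bar> * L < 1 * L" using L(1) by (simp add: abs_mult)
    then have "\<bar>of_int (k - n) :: real\<bar> < 1" using L(1) by (simp only: mult_less_cancel_right_pos)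
    then have "k = n" by linarith
    then show "s = t" using eq by simp
  qed
  have "compact (range h)"
  proof -
    have "range h = h ` {0..L}"
    proof (intro equalityI subsetI)
      fix x assume "x \<in> range h"
      then obtain t where t: "x = h t" by auto
      obtain n where "t + of_int n * L \<in> {0..<L}" using red by blast
      then show "x \<in> h ` {0..L}" using per[of t n] t by (metis atLeastAtMost_iff atLeastLessThan_iff image_eqI less_imp_le)
    qed auto
    moreover have "compact (h ` {0..L})"
      by (intro compact_continuous_image continuous_on_subset[OF ch]) auto
    ultimately show ?thesis by simp
  qed
  then have cls: "closedin (top_of_set (bdry P i)) (range h)"
    using hb by (intro closed_subset) (auto simp: compact_imp_closed)
  define m where "m = 1 - (rad P i)\<^sup>2 / 2"
  define e where "e = ctr P i"
  have ee: "e \<bullet> e = 1" using ctr_norm[OF i] by (simp add: e_def norm_eq_1)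
  have he: "h t \<bullet> e = m" "\<bar>m\<bar> < 1" "h t \<bullet> h t = 1" for t
    using bdry_inner[OF hb i, of t] by (auto simp: e_def m_def norm_eq_1)
  have opn: "openin (top_of_set (bdry P i)) (range h)"
  proof (subst openin_subopen, clarify)
    fix t0
    define a where "a = t0 - L / 2"
    \<comment> \<open>cylindrical coordinates around the axis through the centre of the circle\<close>
    define G where "G = (\<lambda>(t, r, k). m *\<^sub>R e + r *\<^sub>R (h t - m *\<^sub>R e) + k *\<^sub>R e)"
    define U where "U = {a<..<a + L} \<times> {0::real<..} \<times> (UNIV :: real set)"
    have Ge: "G (t, r, k) \<bullet> e = m + k" for t r k
      using ee he by (simp add: G_def inner_add_left inner_diff_left)
    have nh: "(norm (h t - m *\<^sub>R e))\<^sup>2 = 1 - m\<^sup>2" for t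
    proof -
      have "e \<bullet> h t = m" using he by (simp add: inner_commute)
      then show ?thesis using ee he unfolding power2_norm_eq_inner
        by (simp add: inner_diff_left inner_diff_right power2_eq_square)
    qed
    have np: "1 - m\<^sup>2 > 0" using he(2) by (simp add: abs_square_less_1)
    have "open (G ` U)"
    proof (rule invariance_of_domain_gen)
      show "open U" unfolding U_def by (intro open_Times) auto
      show "continuous_on U G" unfolding G_def U_def case_prod_beta
        by (intro continuous_intros continuous_on_compose2[OF ch]) auto
      show "inj_on G U"
      proof (rule inj_onI)
        fix X X' assume hX: "X \<in> U" "X' \<in> U" "G X = G X'"
        obtain t r k where X: "X = (t, r, k)" by (cases X)
        obtain t' r' k' where X': "X' = (t', r', k')" by (cases X')
        have h: "(t, r, k) \<in> U" "(t', r', k') \<in> U" "G (t, r, k) = G (t', r', k')" using hX by (simp_all only: X X')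
        then have k: "k = k'" using Ge[of t r k] Ge[of t' r' k'] by simp
        then have v: "r *\<^sub>R (h t - m *\<^sub>R e) = r' *\<^sub>R (h t' - m *\<^sub>R e)" using h(3) by (simp add: G_def)
        then have "(norm (r *\<^sub>R (h t - m *\<^sub>R e)))\<^sup>2 = (norm (r' *\<^sub>R (h t' - m *\<^sub>R e)))\<^sup>2" by simp
        then have "r\<^sup>2 * (1 - m\<^sup>2) = r'\<^sup>2 * (1 - m\<^sup>2)" unfolding norm_scaleR power_mult_distrib nh by simp
        then have "r\<^sup>2 = r'\<^sup>2" using np by simp
        then have r: "r = r'" using h by (auto simp: U_def power2_eq_iff_nonneg)
        then have "h t = h t'" using v h by (auto simp: U_def)
        then have "t = t'" using inj[of a] h(1,2) by (auto simp: U_def inj_on_def)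
        then show "X = X'" using k r by (simp add: X X')
      qed
    qed simp
    moreover have "G ` U \<inter> bdry P i \<subseteq> range h"
    proof
      fix x assume "x \<in> G ` U \<inter> bdry P i"
      then obtain t r k where x: "x = G (t, r, k)" "r > 0" "x \<in> bdry P i" by (auto simp: U_def)
      have "x \<bullet> e = m" "x \<bullet> x = 1" using bdry_inner[OF x(3) i] by (auto simp: m_def e_def norm_eq_1)
      then have "k = 0" using Ge x by simp
      then have xm: "x - m *\<^sub>R e = r *\<^sub>R (h t - m *\<^sub>R e)" using x by (simp add: G_def)
      have "(norm (x - m *\<^sub>R e))\<^sup>2 = 1 - m\<^sup>2"
      proof -
        have "e \<bullet> x = m" using \<open>x \<bullet> e = m\<close> by (simp add: inner_commute)
        then show ?thesis using ee \<open>x \<bullet> e = m\<close> \<open>x \<bullet> x = 1\<close> unfolding power2_norm_eq_inner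
          by (simp add: inner_diff_left inner_diff_right power2_eq_square)
      qed
      then have "r\<^sup>2 * (1 - m\<^sup>2) = 1 * (1 - m\<^sup>2)" unfolding xm norm_scaleR power_mult_distrib nh by simp
      then have "r\<^sup>2 = 1" using np by (simp only: mult_cancel_right) auto
      then have "r = 1" using x(2) by (simp add: power2_eq_1_iff)
      then show "x \<in> range h" using xm by auto
    qed
    moreover have "h t0 \<in> G ` U"
      using L(1) by (intro image_eqI[of _ _ "(t0, 1, 0)"]) (auto simp: G_def U_def a_def)
    ultimately show "\<exists>T. openin (top_of_set (bdry P i)) T \<and> h t0 \<in> T \<and> T \<subseteq> range h"
      using hb by (intro exI[of _ "bdry P i \<inter> G ` U"]) (auto simp: openin_open_Int)
  qed
  have "bdry P i \<noteq> {}" using hb by blast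
  then have "range h = bdry P i"
    using bdry_connected[OF i] opn cls unfolding connected_clopen by blast
  then show ?thesis using range_eq by simp
qed

lemma bdry_lift_point:
  assumes "is_lift P i (Geod c)" "closed_length P c L" "i \<in> {0, 1, 2}"
    and z: "z \<in> cover P" "proj P z \<in> bdry P i"
  obtains f t where "f \<in> deck P" "f z = c t"
proof -
  obtain t where "proj P z = proj P (c t)" using closed_geodesic_onto[OF assms(1-3)] z by (metis imageE rangeE)
  moreover have "c t \<in> cover P" using assms(1) by auto
  ultimately show ?thesis using that proj_eq_iff z(1) by metis
qed

text \<open>
  For every \<open>t\<close> some deck transformation maps \<open>c t\<close> to \<open>c (t + L)\<close>.  As the deck group is countable, one of them
  does so for uncountably many \<open>t\<close>, and two geodesics that agree at two times are equal.
\<close>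

lemma deck_translation:
  assumes c: "unit_geodesic c" "range c \<subseteq> cover P" and per: "\<And>t. proj P (c (t + L)) = proj P (c t)"
  obtains f where "f \<in> deck P" "\<And>t. f (c t) = c (t + L)"
proof -
  have "\<exists>f\<in>deck P. c (t + L) = f (c t)" for t
    using proj_eq_iff[OF subsetD[OF c(2) rangeI] subsetD[OF c(2) rangeI], of t "t + L"] per[of t] by metis
  then have "(UNIV :: real set) \<subseteq> (\<Union>f\<in>deck P. {t. c (t + L) = f (c t)})" by auto
  then have "uncountable (\<Union>f\<in>deck P. {t. c (t + L) = f (c t)})"
    using uncountable_UNIV_real countable_subset by blast
  then obtain f where f: "f \<in> deck P" "uncountable {t. c (t + L) = f (c t)}"
    using deck_countable by blast
  then have "infinite {t. c (t + L) = f (c t)}" using countable_finite by blast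
  then obtain s t where st: "s \<noteq> t" "c (s + L) = f (c s)" "c (t + L) = f (c t)"
    by (metis (mono_tags, lifting) finite.emptyI finite_insert finite_subset insertCI mem_Collect_eq singleton_iff subsetI)
  obtain \<theta> w where w: "norm w < 1" "\<And>z. norm z < 1 \<Longrightarrow> f z = Moebius_function \<theta> w z"
    using deck_moebius[OF f(1)] by metis
  have "(\<lambda>t. f (c t)) = (\<lambda>t. Moebius_function \<theta> w (c t))"
    using w(2) unit_geodesic_in_disc[OF c(1)] by auto
  then have "unit_geodesic (\<lambda>t. f (c t))" using unit_geodesic_moebius[OF c(1) w(1)] by simp
  then have "(\<lambda>t. f (c t)) = (\<lambda>t. c (t + L))"
    using geodesic_eq_two_points[OF _ unit_geodesic_shift[OF c(1)] st(1)] st by metis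
  then show ?thesis using that f(1) by metis
qed

end

section \<open>Extremal length of a collar in strip coordinates\<close>

lemma sin_ge_third:
  assumes "0 \<le> x" "x \<le> pi / 2" shows "x / 3 \<le> sin x"
proof (cases "x \<le> pi / 3")
  case True
  have "(\<lambda>x. sin x - x * cos x) 0 \<le> (\<lambda>x. sin x - x * cos x) x"
  proof (rule DERIV_nonneg_imp_nondecreasing[OF assms(1)])
    fix y assume y: "0 \<le> y" "y \<le> x"
    have "((\<lambda>x. sin x - x * cos x) has_real_derivative y * sin y) (at y)"
      by (auto intro!: derivative_eq_intros)
    moreover have "y * sin y \<ge> 0" using y assms by (intro mult_nonneg_nonneg sin_ge_zero) auto
    ultimately show "\<exists>d. ((\<lambda>x. sin x - x * cos x) has_real_derivative d) (at y) \<and> 0 \<le> d" by blast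
  qed
  then have "x * cos x \<le> sin x" by simp
  moreover have "cos (pi / 3) \<le> cos x" using True assms by (intro cos_monotone_0_pi_le) auto
  then have "x * (1/3) \<le> x * cos x" using assms by (intro mult_left_mono) (auto simp: cos_60)
  ultimately show ?thesis by simp
next
  case False
  have "sin (pi / 3) \<le> sin x" using False assms by (intro sin_monotone_2pi_le) auto
  moreover have "sqrt 3 \<ge> 4/3" by (rule real_le_rsqrt) (simp add: power2_eq_square)
  ultimately have "sin x \<ge> 2/3" by (simp add: sin_60)
  then show ?thesis using assms pi_less_4 by simp
qed

lemma borel_measurable_cosh [measurable]:
  "f \<in> borel_measurable M \<Longrightarrow> (\<lambda>x. cosh (f x :: real)) \<in> borel_measurable M"
  by (rule borel_measurable_continuous_on[of cosh]) (auto intro: continuous_intros)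

lemma nn_integral_inverse_cosh:
  fixes a :: real assumes "a \<ge> 0"
  shows "(\<integral>\<^sup>+t\<in>{-a..a}. ennreal (1 / cosh t) \<partial>lborel) \<le> ennreal pi"
proof -
  have d: "((\<lambda>t. 2 * arctan (exp t)) has_real_derivative 1 / cosh t) (at t)" for t :: real
  proof -
    have "((\<lambda>t. 2 * arctan (exp t)) has_real_derivative 2 * (inverse (1 + (exp t)\<^sup>2) * exp t)) (at t)"
      by (auto intro!: derivative_eq_intros)
    moreover have "2 * (inverse (1 + (exp t)\<^sup>2) * exp t) = 1 / cosh t"
    proof -
      define e where "e = exp t"
      have e: "e > 0" by (simp add: e_def)
      have "cosh t = (e + inverse e) / 2" by (simp add: cosh_field_def e_def exp_minus)
      moreover have "e + inverse e = (1 + e\<^sup>2) / e" using e by (simp add: power2_eq_square field_simps)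
      moreover have "1 + e\<^sup>2 > 0" using e by (intro add_pos_pos) auto
      ultimately show ?thesis using e by (simp add: e_def[symmetric] field_simps)
    qed
    ultimately show ?thesis by simp
  qed
  have "(\<integral>\<^sup>+t\<in>{-a..a}. ennreal (1 / cosh t) \<partial>lborel) = 2 * arctan (exp a) - 2 * arctan (exp (- a))"
    using assms d by (subst nn_integral_FTC_Icc[where F = "\<lambda>t. 2 * arctan (exp t)"])
      (auto intro: has_field_derivative_at_within borel_measurable_divide borel_measurable_cosh)
  also have "\<dots> \<le> ennreal pi"
  proof (rule ennreal_leI)
    have "arctan (exp a) < pi / 2" by (rule arctan_ubound)
    moreover have "arctan (exp (- a)) > 0" by (simp add: zero_less_arctan_iff)
    ultimately show "2 * arctan (exp a) - 2 * arctan (exp (- a)) \<le> pi" by linarith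
  qed
  finally show ?thesis .
qed

text \<open>Distance from \<open>t\<close> to the nearest multiple of \<open>2a\<close>, in a form that is visibly continuous.\<close>

definition lattice_dist :: "real \<Rightarrow> real \<Rightarrow> real" where
  "lattice_dist a t = a / pi * arccos (cos (pi * t / a))"

lemma lattice_dist:
  assumes "a > 0"
  shows "\<bar>t\<bar> \<le> a \<Longrightarrow> lattice_dist a t = \<bar>t\<bar>" "lattice_dist a t \<le> \<bar>t\<bar>" "0 \<le> lattice_dist a t"
    "lattice_dist a (t - 2 * of_int n * a) = lattice_dist a t"
    "\<exists>n::int. \<bar>t - 2 * of_int n * a\<bar> \<le> a" "continuous_on S (lattice_dist a)"
proof -
  show 1: "lattice_dist a t = \<bar>t\<bar>" if "\<bar>t\<bar> \<le> a" for t
  proof -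
    have "cos (pi * t / a) = cos (pi * \<bar>t\<bar> / a)" by (cases "t \<ge> 0") auto
    moreover have "arccos (cos (pi * \<bar>t\<bar> / a)) = pi * \<bar>t\<bar> / a"
      using that assms by (intro arccos_cos) (auto simp: field_simps)
    ultimately show ?thesis using assms by (simp add: lattice_dist_def)
  qed
  have ub: "lattice_dist a t \<le> a"
    using assms arccos_ubound[of "cos (pi * t / a)"] by (simp add: lattice_dist_def field_simps)
  show "0 \<le> lattice_dist a t"
    using assms arccos_lbound[of "cos (pi * t / a)"] by (simp add: lattice_dist_def)
  show "lattice_dist a t \<le> \<bar>t\<bar>" using 1[of t] ub by linarith
  have "cos (pi * (t - 2 * of_int n * a) / a) = cos (pi * t / a)"
  proof -
    have "pi * (t - 2 * of_int n * a) / a = pi * t / a - 2 * of_int n * pi" using assms by (simp add: field_simps)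
    moreover have "cos (2 * of_int n * pi) = 1" "sin (2 * of_int n * pi) = 0"
      using cos_int_2pin[of n] sin_int_2pin[of n] by (simp_all add: mult_ac)
    ultimately show ?thesis by (simp only: cos_diff)
  qed
  then show "lattice_dist a (t - 2 * of_int n * a) = lattice_dist a t" by (simp add: lattice_dist_def)
  show "\<exists>n::int. \<bar>t - 2 * of_int n * a\<bar> \<le> a"
  proof (intro exI[of _ "round (t / (2 * a))"])
    have "\<bar>of_int (round (t / (2 * a))) - t / (2 * a)\<bar> \<le> 1 / 2" by (rule of_int_round_abs_le)
    then have "\<bar>of_int (round (t / (2 * a))) - t / (2 * a)\<bar> * (2 * a) \<le> 1 / 2 * (2 * a)"
      using assms by (intro mult_right_mono) auto
    moreover have "\<bar>of_int (round (t / (2 * a))) - t / (2 * a)\<bar> * (2 * a)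
        = \<bar>(of_int (round (t / (2 * a))) - t / (2 * a)) * (2 * a)\<bar>" using assms by (simp add: abs_mult)
    moreover have "(of_int (round (t / (2 * a))) - t / (2 * a)) * (2 * a) = 2 * of_int (round (t / (2 * a))) * a - t"
      using assms by (simp add: field_simps)
    ultimately show "\<bar>t - 2 * of_int (round (t / (2 * a))) * a\<bar> \<le> a" by (simp add: abs_minus_commute)
  qed
  show "continuous_on S (lattice_dist a)"
    unfolding lattice_dist_def[abs_def] using assms by (intro continuous_intros continuous_on_arccos) auto
qed

text \<open>
  The part over \<open>|t| \<le> a\<close> of the region between the real axis and the geodesic \<open>sin \<theta> = k cosh t\<close>; its upper
  side is \<open>cell_top\<close>.
\<close>

definition cell :: "real \<Rightarrow> real \<Rightarrow> complex set" where
  "cell a k = {\<zeta> \<in> strip. \<bar>Re \<zeta>\<bar> \<le> a \<and> 0 \<le> Im \<zeta> \<and> sin (Im \<zeta>) < k * cosh (Re \<zeta>)}"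

definition cell_top :: "real \<Rightarrow> real \<Rightarrow> complex set" where
  "cell_top a k = {\<zeta> \<in> strip. \<bar>Re \<zeta>\<bar> \<le> a \<and> 0 \<le> Im \<zeta> \<and> sin (Im \<zeta>) = k * cosh (Re \<zeta>)}"

definition half_cell :: "real \<Rightarrow> real \<Rightarrow> complex set" where
  "half_cell a k = {\<zeta> \<in> strip. 0 < Re \<zeta> \<and> Re \<zeta> < a \<and> 0 < Im \<zeta> \<and> sin (Im \<zeta>) < k * cosh (Re \<zeta>)}"

text \<open>
  The line \<open>Re \<zeta> = 0\<close> is left out because it lies between the two hexagons; only their interiors are
  known to embed in the pants.
\<close>

definition open_cell :: "real \<Rightarrow> real \<Rightarrow> complex set" where
  "open_cell a k = {\<zeta> \<in> strip. 0 < \<bar>Re \<zeta>\<bar> \<and> \<bar>Re \<zeta>\<bar> < a \<and> 0 < Im \<zeta> \<and> sin (Im \<zeta>) < k * cosh (Re \<zeta>)}"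

lemma open_half_cell: "open (half_cell a k)"
proof -
  have "half_cell a k = strip \<inter> {\<zeta>. 0 < Re \<zeta>} \<inter> {\<zeta>. Re \<zeta> < a} \<inter> {\<zeta>. 0 < Im \<zeta>} \<inter> {\<zeta>. sin (Im \<zeta>) < k * cosh (Re \<zeta>)}"
    by (auto simp: half_cell_def)
  then show ?thesis
    by (auto intro!: open_Int open_strip open_Collect_less continuous_intros)
qed

lemma open_open_cell: "open (open_cell a k)"
proof -
  have eq: "open_cell a k = strip \<inter> {\<zeta>. 0 < \<bar>Re \<zeta>\<bar>} \<inter> {\<zeta>. \<bar>Re \<zeta>\<bar> < a} \<inter> {\<zeta>. 0 < Im \<zeta>} \<inter> {\<zeta>. sin (Im \<zeta>) < k * cosh (Re \<zeta>)}"
    by (auto simp: open_cell_def)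
  show ?thesis unfolding eq
    by (intro open_Int open_strip open_Collect_less continuous_intros)
qed

text \<open>
  The graph coordinates \<open>(t, v) \<mapsto> t + \<i> arcsin (v k cosh t)\<close> straighten the cell to a rectangle.
\<close>

definition graph_point :: "real \<Rightarrow> real \<times> real \<Rightarrow> complex" where
  "graph_point k = (\<lambda>(t, v). Complex t (arcsin (v * (k * cosh t))))"

lemma cosh_abs_mono: "\<bar>s\<bar> \<le> \<bar>t\<bar> \<Longrightarrow> cosh s \<le> cosh (t::real)"
  using cosh_real_nonneg_le_iff[of "\<bar>s\<bar>" "\<bar>t\<bar>"] by simp

lemma cosh_abs_less: "\<bar>s\<bar> < \<bar>t\<bar> \<Longrightarrow> cosh s < cosh (t::real)"
  using cosh_real_nonneg_less_iff[of "\<bar>s\<bar>" "\<bar>t\<bar>"] by simp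

context
  fixes a k :: real
  assumes a: "a > 0" and k: "k > 0" and ka: "k * cosh a \<le> 1"
begin

lemma kcosh_le: "\<bar>t\<bar> \<le> a \<Longrightarrow> k * cosh t \<le> 1"
  using cosh_abs_mono[of t a] a k ka mult_left_mono[of "cosh t" "cosh a" k] by linarith

lemma kcosh_less: "\<bar>t\<bar> < a \<Longrightarrow> k * cosh t < 1"
  using cosh_abs_less[of t a] a k ka mult_strict_left_mono[of "cosh t" "cosh a" k] by linarith

lemma kcosh_pos: "k * cosh t > 0"
  using k by simp

lemma vkcosh: 
  assumes "\<bar>t\<bar> \<le> a" "0 \<le> v" "v \<le> 1" shows "0 \<le> v * (k * cosh t)" "v * (k * cosh t) \<le> 1"
  using assms kcosh_le[of t] kcosh_pos[of t] mult_mono[of v 1 "k * cosh t" 1] by auto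

lemma continuous_graph_point: "continuous_on ({-a..a} \<times> {0..1}) (graph_point k)"
  unfolding graph_point_def case_prod_beta Complex_eq
proof (intro continuous_intros continuous_on_arcsin ballI)
  fix x :: "real \<times> real" assume x: "x \<in> {-a..a} \<times> {0..1}"
  then have b: "\<bar>fst x\<bar> \<le> a" "0 \<le> snd x" "snd x \<le> 1" by (auto simp: abs_le_iff)
  show "- 1 \<le> snd x * (k * cosh (fst x)) \<and> snd x * (k * cosh (fst x)) \<le> 1"
    using vkcosh[OF b] by auto
qed

lemma graph_point_inverse:
  assumes "\<zeta> \<in> strip" "0 \<le> Im \<zeta>"
  shows "graph_point k (Re \<zeta>, sin (Im \<zeta>) / (k * cosh (Re \<zeta>))) = \<zeta>"
proof -
  have "arcsin (sin (Im \<zeta>)) = Im \<zeta>" using assms by (intro arcsin_sin) (auto simp: strip_def)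
  moreover have "k * cosh (Re \<zeta>) \<noteq> 0" using kcosh_pos[of "Re \<zeta>"] by linarith
  ultimately show ?thesis by (simp add: graph_point_def complex_eq_iff del: mult_eq_0_iff)
qed

lemma graph_point_in:
  assumes "\<bar>t\<bar> < a" "0 < v" "v < 1"
  shows "graph_point k (t, v) \<in> strip" "Re (graph_point k (t, v)) = t" "0 < Im (graph_point k (t, v))"
    "sin (Im (graph_point k (t, v))) < k * cosh t" 
proof -
  define y where "y = v * (k * cosh t)"
  have y: "0 < y" "y < 1" "y < k * cosh t"
  proof -
    show "0 < y" using assms kcosh_pos[of t] by (simp add: y_def)
    show "y < k * cosh t" using mult_strict_right_mono[OF assms(3) kcosh_pos[of t]] by (simp add: y_def)
    then show "y < 1" using kcosh_less[OF assms(1)] by linarith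
  qed
  have im: "Im (graph_point k (t, v)) = arcsin y" by (simp add: graph_point_def y_def)
  have b: "0 < arcsin y" "arcsin y < pi / 2"
    using y arcsin_less_arcsin[of 0 y] arcsin_lt_bounded[of y] by auto
  show "graph_point k (t, v) \<in> strip" using b by (simp add: strip_def im)
  show "Re (graph_point k (t, v)) = t" by (simp add: graph_point_def)
  show "0 < Im (graph_point k (t, v))" "sin (Im (graph_point k (t, v))) < k * cosh t"
    using b y by (auto simp: im)
qed

lemma half_cell_eq: "half_cell a k = graph_point k ` ({0<..<a} \<times> {0<..<1})"
proof (intro equalityI subsetI)
  fix \<zeta> assume z: "\<zeta> \<in> half_cell a k"
  have s: "sin (Im \<zeta>) > 0" using z by (intro sin_gt_zero) (auto simp: half_cell_def strip_def)
  show "\<zeta> \<in> graph_point k ` ({0<..<a} \<times> {0<..<1})"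
    using graph_point_inverse[of \<zeta>] z s kcosh_pos[of "Re \<zeta>"]
    by (intro image_eqI[of _ _ "(Re \<zeta>, sin (Im \<zeta>) / (k * cosh (Re \<zeta>)))"]) (auto simp: half_cell_def)
next
  fix \<zeta> assume "\<zeta> \<in> graph_point k ` ({0<..<a} \<times> {0<..<1})"
  then obtain t v where "\<zeta> = graph_point k (t, v)" "0 < t" "t < a" "0 < v" "v < 1" by auto
  then show "\<zeta> \<in> half_cell a k" using graph_point_in[of t v] by (auto simp: half_cell_def)
qed

lemma connected_half_cell: "connected (half_cell a k)"
  unfolding half_cell_eq using a
  by (intro connected_continuous_image continuous_on_subset[OF continuous_graph_point] connected_Times) auto

lemma cell_subset_closure: "cell a k \<union> cell_top a k \<subseteq> closure (open_cell a k)"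
proof
  fix \<zeta> assume z: "\<zeta> \<in> cell a k \<union> cell_top a k"
  have sub: "graph_point k ` closure S \<subseteq> closure (open_cell a k)"
    if S: "S \<subseteq> ({-a<..<a} - {0}) \<times> {0<..<1}" for S
  proof (rule image_closure_subset)
    have "closure S \<subseteq> {-a..a} \<times> {0..1}"
    proof (rule closure_minimal)
      have "S \<subseteq> {-a<..<a} \<times> {0<..<1}" using S by blast
      also have "\<dots> \<subseteq> {-a..a} \<times> {0..1}" by (intro Sigma_mono) auto
      finally show "S \<subseteq> {-a..a} \<times> {0..1}" .
    qed (intro closed_Times, auto)
    then show "continuous_on (closure S) (graph_point k)" by (rule continuous_on_subset[OF continuous_graph_point])
    have "graph_point k ` S \<subseteq> open_cell a k"
    proof
      fix \<zeta> assume "\<zeta> \<in> graph_point k ` S"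
      then obtain x where x: "\<zeta> = graph_point k x" "x \<in> ({-a<..<a} - {0}) \<times> {0<..<1}" using S by blast
      obtain t v where tv: "x = (t, v)" by (cases x)
      have "\<zeta> = graph_point k (t, v)" "(t, v) \<in> ({-a<..<a} - {0}) \<times> {0<..<1}" using x tv by auto
      then show "\<zeta> \<in> open_cell a k" using graph_point_in[of t v] by (auto simp: open_cell_def abs_less_iff)
    qed
    then show "graph_point k ` S \<subseteq> closure (open_cell a k)" using closure_subset by blast
  qed simp
  define v where "v = sin (Im \<zeta>) / (k * cosh (Re \<zeta>))"
  have zz: "\<zeta> \<in> strip" "0 \<le> Im \<zeta>" "\<bar>Re \<zeta>\<bar> \<le> a" "sin (Im \<zeta>) \<le> k * cosh (Re \<zeta>)"
    using z by (auto simp: cell_def cell_top_def)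
  have "sin (Im \<zeta>) \<ge> 0" using zz by (intro sin_ge_zero) (auto simp: strip_def)
  then have v: "0 \<le> v" "v \<le> 1" using zz(4) kcosh_pos[of "Re \<zeta>"] by (auto simp: v_def)
  have eq: "\<zeta> = graph_point k (Re \<zeta>, v)" using graph_point_inverse[OF zz(1,2)] by (simp add: v_def)
  have "closure ({0<..<a} \<times> {0<..<1::real}) = {0..a} \<times> {0..1}"
    "closure ({-a<..<0} \<times> {0<..<1::real}) = {-a..0} \<times> {0..1}"
    using a by (auto simp: closure_Times)
  moreover have "(Re \<zeta>, v) \<in> {0..a} \<times> {0..1} \<or> (Re \<zeta>, v) \<in> {-a..0} \<times> {0..1}" using v zz(3) by auto
  moreover have "{0<..<a} \<times> {0<..<1} \<subseteq> ({-a<..<a} - {0}) \<times> {0<..<1::real}"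
    "{-a<..<0} \<times> {0<..<1} \<subseteq> ({-a<..<a} - {0}) \<times> {0<..<1::real}" using a by auto
  ultimately show "\<zeta> \<in> closure (open_cell a k)" using sub eq by (metis image_eqI subsetD)
qed

lemma cell_measurable [measurable]: "cell a k \<in> sets borel"
proof -
  have "cell a k = strip \<inter> ({\<zeta>. \<bar>Re \<zeta>\<bar> \<le> a} \<inter> {\<zeta>. 0 \<le> Im \<zeta>}) \<inter> {\<zeta>. sin (Im \<zeta>) < k * cosh (Re \<zeta>)}"
    by (auto simp: cell_def)
  moreover have "open strip" "open {\<zeta>. sin (Im \<zeta>) < k * cosh (Re \<zeta>)}" "closed {\<zeta>. \<bar>Re \<zeta>\<bar> \<le> a}" "closed {\<zeta>. 0 \<le> Im \<zeta>}"
    by (intro open_strip open_Collect_less closed_Collect_le continuous_intros)+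
  ultimately show ?thesis by (simp add: sets.Int)
qed

text \<open>This is the inequality \<open>\<theta> \<le> 3 sin \<theta>\<close>.\<close>

lemma cell_slice: "Complex t \<theta> \<in> cell a k \<Longrightarrow> \<theta> \<in> {0..3 * (k * cosh t)}"
  using sin_ge_third[of \<theta>] by (auto simp: cell_def strip_def)

lemma nn_integral_slice: "(\<integral>\<^sup>+\<theta>. indicator (cell a k) (Complex t \<theta>) \<partial>lborel) \<le> ennreal (3 * (k * cosh t))"
proof -
  have "(\<integral>\<^sup>+\<theta>. indicator (cell a k) (Complex t \<theta>) \<partial>lborel) \<le> (\<integral>\<^sup>+\<theta>. indicator {0..3 * (k * cosh t)} \<theta> \<partial>lborel)"
    using cell_slice[of t] by (intro nn_integral_mono) (auto split: split_indicator)
  also have "\<dots> = ennreal (3 * (k * cosh t))" using kcosh_pos[of t] by simp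
  finally show ?thesis .
qed

text \<open>
  Integrating first over the slices leaves the integral of \<open>3 / (k cosh t)\<close>, and the integral of \<open>1 / cosh\<close> is at
  most \<open>\<pi>\<close>.
\<close>

lemma cell_energy:
  "(\<integral>\<^sup>+\<zeta>\<in>cell a k. ennreal (1 / (k * cosh (Re \<zeta>))\<^sup>2) \<partial>lborel) \<le> ennreal (3 * pi / k)"
proof -
  have "(\<integral>\<^sup>+\<zeta>\<in>cell a k. ennreal (1 / (k * cosh (Re \<zeta>))\<^sup>2) \<partial>lborel)
     = (\<integral>\<^sup>+t. \<integral>\<^sup>+\<theta>. ennreal (1 / (k * cosh t)\<^sup>2) * indicator (cell a k) (Complex t \<theta>) \<partial>lborel \<partial>lborel)"
  proof -
    have "(\<lambda>\<zeta>. ennreal (1 / (k * cosh (Re \<zeta>))\<^sup>2) * indicator (cell a k) \<zeta>) \<in> borel_measurable borel"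
      by measurable
    then show ?thesis by (subst nn_integral_complex_iterated) auto
  qed
  also have "\<dots> \<le> (\<integral>\<^sup>+t\<in>{-a..a}. ennreal (3 / k) * ennreal (1 / cosh t) \<partial>lborel)"
  proof (intro nn_integral_mono)
    fix t
    have mC: "(\<lambda>\<theta>. Complex t \<theta>) \<in> borel_measurable borel"
      unfolding Complex_eq by (intro borel_measurable_continuous_onI continuous_intros)
    have m: "(\<lambda>\<theta>. indicator (cell a k) (Complex t \<theta>) :: ennreal) \<in> borel_measurable borel"
      by (rule measurable_compose[OF mC]) simp
    have "(\<integral>\<^sup>+\<theta>. ennreal (1 / (k * cosh t)\<^sup>2) * indicator (cell a k) (Complex t \<theta>) \<partial>lborel)
       = ennreal (1 / (k * cosh t)\<^sup>2) * (\<integral>\<^sup>+\<theta>. indicator (cell a k) (Complex t \<theta>) \<partial>lborel)"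
      using m by (intro nn_integral_cmult) simp
    also have "\<dots> \<le> ennreal (1 / (k * cosh t)\<^sup>2) * (ennreal (3 * (k * cosh t)) * indicator {-a..a} t)"
    proof (cases "\<bar>t\<bar> \<le> a")
      case True
      then have "indicator {-a..a} t = (1::ennreal)" by (auto simp: abs_le_iff)
      then show ?thesis using nn_integral_slice[of t] by (simp add: mult_left_mono)
    next
      case False
      then have "indicator (cell a k) (Complex t \<theta>) = (0::ennreal)" for \<theta> by (auto simp: cell_def indicator_def)
      then show ?thesis by simp
    qed
    also have "\<dots> = ennreal (1 / (k * cosh t)\<^sup>2 * (3 * (k * cosh t))) * indicator {-a..a} t"
      using k by (subst ennreal_mult) (auto simp: mult.assoc)
    also have "1 / (k * cosh t)\<^sup>2 * (3 * (k * cosh t)) = 3 / k * (1 / cosh t)"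
      using k by (simp add: power2_eq_square)
    also have "ennreal (3 / k * (1 / cosh t)) = ennreal (3 / k) * ennreal (1 / cosh t)"
      using k by (intro ennreal_mult) auto
    finally show "(\<integral>\<^sup>+\<theta>. ennreal (1 / (k * cosh t)\<^sup>2) * indicator (cell a k) (Complex t \<theta>) \<partial>lborel)
       \<le> ennreal (3 / k) * ennreal (1 / cosh t) * indicator {-a..a} t" .
  qed
  also have "\<dots> = (\<integral>\<^sup>+t. ennreal (3 / k) * (ennreal (1 / cosh t) * indicator {-a..a} t) \<partial>lborel)"
    by (simp add: mult.assoc)
  also have "\<dots> = ennreal (3 / k) * (\<integral>\<^sup>+t\<in>{-a..a}. ennreal (1 / cosh t) \<partial>lborel)"
    by (rule nn_integral_cmult) measurable
  also have "\<dots> \<le> ennreal (3 / k) * ennreal pi"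
    using a by (intro mult_left_mono nn_integral_inverse_cosh) auto
  also have "\<dots> = ennreal (3 * pi / k)" using k by (simp add: ennreal_mult'[symmetric])
  finally show ?thesis .
qed

end

lemma closure_meets:
  assumes "x \<in> closure E" "open U" "x \<in> U" obtains y where "y \<in> E" "y \<in> U"
  using open_Int_closure_eq_empty[OF assms(2), of E] assms by blast

section \<open>Collars\<close>

text \<open>
  The half-collar in strip coordinates: \<open>A\<close> is half the length of \<open>\<alpha>\<close>, the translation by \<open>2 A\<close> closes up the
  cell, and \<open>\<beta>\<close> is the image of its upper side.
\<close>

locale collar = pants_surface P for P :: pants +
  fixes \<theta> :: real and w :: complex and A k :: real and \<beta> R :: "(real ^ 3) set"
  assumes w: "norm w < 1" and A: "A > 1/2" and k: "k > 0" and kA: "k * cosh A \<le> 1"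
    and side: "\<And>z. z \<in> cover P \<Longrightarrow> 0 \<le> Im (strip_inv \<theta> w z)"
    and base: "\<And>t. strip_map \<theta> w (of_real t) \<in> cover P \<and> proj P (strip_map \<theta> w (of_real t)) \<in> bdry P 0"
    and base_onto: "\<And>z. z \<in> cover P \<Longrightarrow> proj P z \<in> bdry P 0 \<Longrightarrow> \<exists>f\<in>deck P. \<exists>t. f z = strip_map \<theta> w (of_real t)"
    and trans: "\<exists>f\<in>deck P. \<forall>\<zeta>\<in>strip. f (strip_map \<theta> w \<zeta>) = strip_map \<theta> w (\<zeta> + of_real (2 * A))"
    and cell_cover: "\<And>\<zeta>. \<zeta> \<in> cell A k \<union> cell_top A k \<Longrightarrow> strip_map \<theta> w \<zeta> \<in> cover P"
    and cell_inj: "\<And>\<zeta> \<eta>. \<zeta> \<in> open_cell A k \<Longrightarrow> \<eta> \<in> open_cell A k \<Longrightarrow>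
        proj P (strip_map \<theta> w \<zeta>) = proj P (strip_map \<theta> w \<eta>) \<Longrightarrow> \<zeta> = \<eta>"
    and beta_sub: "\<beta> \<subseteq> (\<lambda>\<zeta>. proj P (strip_map \<theta> w \<zeta>)) ` cell_top A k"
    and beta_sup: "\<And>\<zeta>. \<zeta> \<in> cell_top A k \<Longrightarrow> \<bar>Re \<zeta>\<bar> < A \<Longrightarrow> proj P (strip_map \<theta> w \<zeta>) \<in> \<beta>"
    and comp: "R \<in> components (pts P - (bdry P 0 \<union> \<beta>))" and near: "bdry P 0 \<subseteq> closure R"
begin

abbreviation "\<Psi> \<equiv> strip_map \<theta> w"
abbreviation "\<Omega> \<equiv> strip_inv \<theta> w"

lemma A0: "A > 0" using A by simp

lemmas disc = strip_map_in_disc[OF w, where \<theta> = \<theta>]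
  and inv_map = strip_inv_map[OF w, where \<theta> = \<theta>] and map_inv = strip_map_inv[OF w, where \<theta> = \<theta>]
  and open_image = strip_map_open_image[OF w, where \<theta> = \<theta>]
lemmas cell_closure = cell_subset_closure[OF A0 k kA]

lemma map_inject: "\<zeta> \<in> strip \<Longrightarrow> \<eta> \<in> strip \<Longrightarrow> \<Psi> \<zeta> = \<Psi> \<eta> \<Longrightarrow> \<zeta> = \<eta>"
  using inv_map by metis

lemma trans_int:
  "\<exists>f\<in>deck P. \<forall>\<zeta>\<in>strip. f (\<Psi> \<zeta>) = \<Psi> (\<zeta> + of_real (2 * of_int n * A))"
proof (induction n rule: int_induct[where k = 0])
  case base
  have "\<forall>\<zeta>\<in>strip. restrict id hdisc (\<Psi> \<zeta>) = \<Psi> (\<zeta> + of_real (2 * of_int 0 * A))"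
    using disc by simp
  then show ?case using deck_id by blast
next
  case (step1 n)
  then obtain f where f: "f \<in> deck P" "\<And>\<zeta>. \<zeta> \<in> strip \<Longrightarrow> f (\<Psi> \<zeta>) = \<Psi> (\<zeta> + of_real (2 * of_int n * A))" by metis
  obtain g where g: "g \<in> deck P" "\<And>\<zeta>. \<zeta> \<in> strip \<Longrightarrow> g (\<Psi> \<zeta>) = \<Psi> (\<zeta> + of_real (2 * A))" using trans by metis
  obtain h where h: "h \<in> deck P" "\<And>z. norm z < 1 \<Longrightarrow> h z = g (f z)" using deck_compose[OF g(1) f(1)] by metis
  have "h (\<Psi> \<zeta>) = \<Psi> (\<zeta> + of_real (2 * of_int (n + 1) * A))" if z: "\<zeta> \<in> strip" for \<zeta>
  proof -
    have z': "\<zeta> + of_real (2 * of_int n * A) \<in> strip" using z by (simp only: shift_strip)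
    have "h (\<Psi> \<zeta>) = \<Psi> (\<zeta> + of_real (2 * of_int n * A) + of_real (2 * A))"
      by (simp only: h(2)[OF disc[OF z]] f(2)[OF z] g(2)[OF z'])
    then show ?thesis by (simp add: algebra_simps)
  qed
  then show ?case using h(1) by blast
next
  case (step2 n)
  then obtain f where f: "f \<in> deck P" "\<And>\<zeta>. \<zeta> \<in> strip \<Longrightarrow> f (\<Psi> \<zeta>) = \<Psi> (\<zeta> + of_real (2 * of_int n * A))" by metis
  obtain g where g: "g \<in> deck P" "\<And>\<zeta>. \<zeta> \<in> strip \<Longrightarrow> g (\<Psi> \<zeta>) = \<Psi> (\<zeta> + of_real (2 * A))" using trans by metis
  obtain g' where g': "g' \<in> deck P" "\<And>z. norm z < 1 \<Longrightarrow> g' (g z) = z" using deck_inverse[OF g(1)] by metis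
  obtain h where h: "h \<in> deck P" "\<And>z. norm z < 1 \<Longrightarrow> h z = g' (f z)" using deck_compose[OF g'(1) f(1)] by metis
  have "h (\<Psi> \<zeta>) = \<Psi> (\<zeta> + of_real (2 * of_int (n - 1) * A))" if z: "\<zeta> \<in> strip" for \<zeta>
  proof -
    have z': "\<zeta> + of_real (2 * of_int (n - 1) * A) \<in> strip" using z by (simp only: shift_strip)
    have "f (\<Psi> \<zeta>) = \<Psi> (\<zeta> + of_real (2 * of_int (n - 1) * A) + of_real (2 * A))"
      by (simp add: f(2)[OF z] algebra_simps)
    then have "f (\<Psi> \<zeta>) = g (\<Psi> (\<zeta> + of_real (2 * of_int (n - 1) * A)))" by (simp only: g(2)[OF z'])
    then show ?thesis using h(2)[OF disc[OF z]] g'(2)[OF disc[OF z']] by simp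
  qed
  then show ?case using h(1) by blast
qed

lemma open_cell_subset: "open_cell A k \<subseteq> cell A k"
  by (auto simp: open_cell_def cell_def)

lemma half_cell_subset: "half_cell A k \<subseteq> open_cell A k"
  by (auto simp: half_cell_def open_cell_def)

lemma cell_strip: "cell A k \<subseteq> strip" "cell_top A k \<subseteq> strip" "open_cell A k \<subseteq> strip" "half_cell A k \<subseteq> strip"
  by (auto simp: cell_def cell_top_def open_cell_def half_cell_def)

text \<open>
  Near the point, a nontrivial deck transformation would make two translates of the open cell overlap,
  contradicting injectivity of the projection.
\<close>

lemma deck_cell_trivial:
  assumes f: "f \<in> deck P" and z: "\<zeta> \<in> open_cell A k" and e: "\<eta> \<in> closure (open_cell A k)" "\<eta> \<in> strip"
    and eq: "f (\<Psi> \<zeta>) = \<Psi> \<eta>"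
  shows "\<zeta> = \<eta>" "f = restrict id hdisc"
proof -
  let ?E = "open_cell A k"
  have "\<Psi> ` ?E \<subseteq> hdisc"
  proof (rule image_subsetI)
    fix \<xi> assume "\<xi> \<in> ?E"
    then have "\<xi> \<in> strip" using cell_strip(3) by blast
    then show "\<Psi> \<xi> \<in> hdisc" using disc by simp
  qed
  then have "open (f ` \<Psi> ` ?E)"
    by (rule deck_open_image(1)[OF f open_image[OF open_open_cell cell_strip(3)]])
  then have "open (strip \<inter> \<Psi> -` (f ` \<Psi> ` ?E))"
    by (rule continuous_open_preimage[OF continuous_strip_map[OF w] open_strip])
  moreover have "\<eta> \<in> strip \<inter> \<Psi> -` (f ` \<Psi> ` ?E)" using e(2) z eq by (metis IntI image_eqI vimageI)
  ultimately obtain \<eta>' where e': "\<eta>' \<in> ?E" "\<eta>' \<in> strip \<inter> \<Psi> -` (f ` \<Psi> ` ?E)"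
    using closure_meets[OF e(1)] by metis
  then obtain \<zeta>' where h: "\<eta>' \<in> ?E" "\<zeta>' \<in> ?E" "\<Psi> \<eta>' = f (\<Psi> \<zeta>')" by blast
  have zc: "\<Psi> \<zeta>' \<in> cover P" using h(2) cell_cover open_cell_subset by blast
  have "proj P (\<Psi> \<eta>') = proj P (\<Psi> \<zeta>')" using proj_deck[OF f zc] h(3) by simp
  then have "\<eta>' = \<zeta>'" using cell_inj h by blast
  then show id: "f = restrict id hdisc" using deck_free[OF f cover_norm[OF zc]] h(3) by simp
  have zs: "\<zeta> \<in> strip" using z cell_strip by blast
  then have "\<Psi> \<zeta> = \<Psi> \<eta>" using eq disc[OF zs] unfolding id by simp
  then show "\<zeta> = \<eta>" using map_inject zs e(2) by blast
qed

lemma deck_agree: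
  assumes "f \<in> deck P" "g \<in> deck P" "norm z < 1" "f z = g z" "norm z' < 1"
  shows "f z' = g z'"
proof -
  obtain g' where g': "g' \<in> deck P" "\<And>z. norm z < 1 \<Longrightarrow> g' (g z) = z" "\<And>z. norm z < 1 \<Longrightarrow> g (g' z) = z"
    using deck_inverse[OF assms(2)] by metis
  obtain h where h: "h \<in> deck P" "\<And>z. norm z < 1 \<Longrightarrow> h z = g' (f z)" using deck_compose[OF g'(1) assms(1)] by metis
  have "h z = z" using h g' assms by metis
  then have "h z' = z'" using deck_free'[OF h(1)] assms by blast
  then show ?thesis using h g' assms deck_in_disc by metis
qed

text \<open>The union of the translates of the cell by multiples of \<open>2 A\<close>.\<close>

definition saturated :: "complex set" where
  "saturated = {\<zeta> \<in> strip. 0 \<le> Im \<zeta> \<and> sin (Im \<zeta>) < k * cosh (lattice_dist A (Re \<zeta>))}"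

lemma saturated_cell:
  assumes "\<zeta> \<in> saturated"
  obtains n :: int where "\<zeta> - of_real (2 * of_int n * A) \<in> cell A k"
proof -
  obtain n :: int where n: "\<bar>Re \<zeta> - 2 * of_int n * A\<bar> \<le> A" using lattice_dist(5)[OF A0] by blast
  have "lattice_dist A (Re \<zeta>) = \<bar>Re \<zeta> - 2 * of_int n * A\<bar>"
    using lattice_dist(1)[OF A0 n] lattice_dist(4)[OF A0, of "Re \<zeta>" n] by simp
  then have "\<zeta> - of_real (2 * of_int n * A) \<in> cell A k"
    using assms n by (auto simp: saturated_def cell_def strip_def abs_less_iff)
  then show ?thesis by (rule that)
qed

text \<open>
  A point of the saturated set that projects to \<open>\<beta>\<close> is the image of a point \<open>\<eta>\<close> on the top of the cell under a deck
  transformation.  Nearby points of the open cell then move into the saturated set, which forces the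
  transformation to be a translation, but translations preserve the height relative to \<open>lattice_dist\<close>.
\<close>

lemma saturated_disjoint_beta:
  assumes "\<zeta> \<in> saturated" shows "proj P (\<Psi> \<zeta>) \<notin> \<beta>"
proof
  assume b: "proj P (\<Psi> \<zeta>) \<in> \<beta>"
  have zs: "\<zeta> \<in> strip" using assms by (simp add: saturated_def)
  obtain n :: int where n: "\<zeta> - of_real (2 * of_int n * A) \<in> cell A k" using saturated_cell[OF assms] .
  obtain f0 where f0: "f0 \<in> deck P" "\<And>\<zeta>. \<zeta> \<in> strip \<Longrightarrow> f0 (\<Psi> \<zeta>) = \<Psi> (\<zeta> + of_real (2 * of_int n * A))"
    using trans_int[of n] by metis
  have "\<Psi> \<zeta> = f0 (\<Psi> (\<zeta> - of_real (2 * of_int n * A)))"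
    using f0(2)[OF subsetD[OF cell_strip(1) n]] by (simp only: diff_add_cancel)
  then have zc: "\<Psi> \<zeta> \<in> cover P" using deck_cover[OF f0(1) cell_cover[OF UnI1[OF n]]] by simp
  obtain \<eta> where e: "\<eta> \<in> cell_top A k" "proj P (\<Psi> \<zeta>) = proj P (\<Psi> \<eta>)" using b beta_sub by blast
  have es: "\<eta> \<in> strip" using e cell_strip by blast
  have ec: "\<Psi> \<eta> \<in> cover P" using e cell_cover by blast
  obtain f where f: "f \<in> deck P" "\<Psi> \<zeta> = f (\<Psi> \<eta>)" using proj_eq_iff[OF ec zc] e(2) by metis
  \<comment> \<open>points of the open cell near \<open>\<eta>\<close> are mapped into the saturated set, too\<close>
  define q where "q = (\<lambda>\<xi>. \<Omega> (f (\<Psi> \<xi>)))"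
  have cq: "continuous_on strip q" unfolding q_def
    by (rule continuous_on_compose2[OF continuous_strip_inv[OF w]
          continuous_on_compose2[OF deck_continuous[OF f(1)] continuous_strip_map[OF w]]])
      (use disc deck_in_disc[OF f(1)] in auto)
  define U where "U = {\<xi> \<in> strip. sin (Im (q \<xi>)) < k * cosh (lattice_dist A (Re (q \<xi>)))}"
  have "continuous_on strip (\<lambda>\<xi>. k * cosh (lattice_dist A (Re (q \<xi>))) - sin (Im (q \<xi>)))"
    by (intro continuous_intros cq continuous_on_compose2[OF lattice_dist(6)[OF A0, of UNIV]]) auto
  then have "open (strip \<inter> (\<lambda>\<xi>. k * cosh (lattice_dist A (Re (q \<xi>))) - sin (Im (q \<xi>))) -` {0<..})"
    by (rule continuous_open_preimage[OF _ open_strip]) simp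
  moreover have "strip \<inter> (\<lambda>\<xi>. k * cosh (lattice_dist A (Re (q \<xi>))) - sin (Im (q \<xi>))) -` {0<..} = U"
    by (auto simp: U_def)
  ultimately have oU: "open U" by simp
  have "q \<eta> = \<zeta>" using inv_map[OF zs] f(2) by (simp add: q_def)
  then have "\<eta> \<in> U" using es assms by (simp add: U_def saturated_def)
  moreover have "\<eta> \<in> closure (open_cell A k)" using e(1) cell_closure by blast
  ultimately obtain \<xi> where x: "\<xi> \<in> open_cell A k" "\<xi> \<in> U" using closure_meets[OF _ oU] by metis
  have xs: "\<xi> \<in> strip" using x cell_strip by blast
  have xc: "\<Psi> \<xi> \<in> cover P" using x cell_cover open_cell_subset by blast
  have fx: "f (\<Psi> \<xi>) \<in> cover P" by (rule deck_cover[OF f(1) xc])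
  have qs: "q \<xi> \<in> strip" "\<Psi> (q \<xi>) = f (\<Psi> \<xi>)" unfolding q_def using map_inv cover_norm[OF fx] by auto
  have "q \<xi> \<in> saturated" using x(2) side[OF fx] qs(1) by (simp add: saturated_def U_def q_def)
  then obtain m :: int where m: "q \<xi> - of_real (2 * of_int m * A) \<in> cell A k" using saturated_cell by metis
  obtain g where g: "g \<in> deck P" "\<And>\<zeta>. \<zeta> \<in> strip \<Longrightarrow> g (\<Psi> \<zeta>) = \<Psi> (\<zeta> + of_real (2 * of_int (- m) * A))"
    using trans_int[of "- m"] by metis
  obtain h where h: "h \<in> deck P" "\<And>z. norm z < 1 \<Longrightarrow> h z = g (f z)" using deck_compose[OF g(1) f(1)] by metis
  have hx: "h (\<Psi> \<xi>) = \<Psi> (q \<xi> - of_real (2 * of_int m * A))"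
    using h(2)[OF disc[OF xs]] g(2)[OF qs(1)] qs(2) by simp
  have "h = restrict id hdisc"
    by (rule deck_cell_trivial(2)[OF h(1) x(1) _ _ hx]) (use m cell_closure cell_strip in auto)
  then have "g (f (\<Psi> \<eta>)) = \<Psi> \<eta>" using h(2) disc[OF es] by simp
  then have "\<Psi> (\<zeta> + of_real (2 * of_int (- m) * A)) = \<Psi> \<eta>" using g(2)[OF zs] f(2) by simp
  then have "\<zeta> + of_real (2 * of_int (- m) * A) = \<eta>"
    using map_inject es zs shift_strip by blast
  then have r: "Re \<eta> = Re \<zeta> - 2 * of_int m * A" "Im \<eta> = Im \<zeta>" by auto
  have "lattice_dist A (Re \<zeta>) = \<bar>Re \<eta>\<bar>"
    using lattice_dist(1)[OF A0, of "Re \<eta>"] lattice_dist(4)[OF A0, of "Re \<zeta>" m] e(1) r by (simp add: cell_top_def)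
  then show False using assms e(1) r by (simp add: saturated_def cell_top_def)
qed

lemma cell_saturated: "cell A k \<subseteq> saturated"
  using lattice_dist(1)[OF A0] by (auto simp: cell_def saturated_def)

text \<open>
  The half-cell is connected and misses \<open>\<alpha>\<close> and \<open>\<beta>\<close>, so it projects into one component; this is \<open>R\<close> because \<open>R\<close>
  accumulates at points of \<open>\<alpha>\<close> above which there are only points of the half-cell.
\<close>

lemma half_cell_in_R: "(\<lambda>\<zeta>. proj P (\<Psi> \<zeta>)) ` half_cell A k \<subseteq> R"
proof (rule components_maximal[OF comp])
  have hc: "half_cell A k \<subseteq> cell A k" using half_cell_subset open_cell_subset by blast
  show "connected ((\<lambda>\<zeta>. proj P (\<Psi> \<zeta>)) ` half_cell A k)"
  proof (intro connected_continuous_image connected_half_cell[OF A0 k kA])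
    show "continuous_on (half_cell A k) (\<lambda>\<zeta>. proj P (\<Psi> \<zeta>))"
      by (rule continuous_on_compose2[OF proj_continuous continuous_on_subset[OF continuous_strip_map[OF w] cell_strip(4)]])
        (use hc cell_cover in auto)
  qed
  have "open (\<Psi> ` half_cell A k)" by (rule open_image[OF open_half_cell cell_strip(4)])
  moreover have "\<Psi> ` half_cell A k \<subseteq> cover P" using hc cell_cover by auto
  ultimately have int: "\<Psi> ` half_cell A k \<subseteq> interior (cover P)" by (rule interior_maximal[rotated])
  show "(\<lambda>\<zeta>. proj P (\<Psi> \<zeta>)) ` half_cell A k \<subseteq> pts P - (bdry P 0 \<union> \<beta>)"
  proof
    fix x assume "x \<in> (\<lambda>\<zeta>. proj P (\<Psi> \<zeta>)) ` half_cell A k"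
    then obtain \<zeta> where z: "x = proj P (\<Psi> \<zeta>)" "\<zeta> \<in> half_cell A k" by auto
    have "x \<notin> bdry P 0" using bdry_not_interior[of "\<Psi> \<zeta>" 0] int z by auto
    moreover have "x \<notin> \<beta>" using saturated_disjoint_beta hc cell_saturated z by auto
    moreover have "x \<in> pts P" using proj_in_pts cell_cover hc z by auto
    ultimately show "x \<in> pts P - (bdry P 0 \<union> \<beta>)" by blast
  qed
  show "R \<inter> (\<lambda>\<zeta>. proj P (\<Psi> \<zeta>)) ` half_cell A k \<noteq> {}"
  proof -
    define U where "U = {\<zeta> \<in> strip. 0 < Re \<zeta> \<and> Re \<zeta> < A \<and> sin (Im \<zeta>) < k * cosh (Re \<zeta>)}"
    have "U = strip \<inter> {\<zeta>. 0 < Re \<zeta>} \<inter> {\<zeta>. Re \<zeta> < A} \<inter> {\<zeta>. sin (Im \<zeta>) < k * cosh (Re \<zeta>)}"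
      by (auto simp: U_def)
    then have "open U" by (auto intro!: open_Int open_strip open_Collect_less continuous_intros)
    then have "open (\<Psi> ` U)" by (intro open_image) (auto simp: U_def)
    then obtain W where W: "open W" "proj P ` (\<Psi> ` U \<inter> cover P) = W \<inter> pts P" using proj_open by metis
    have "of_real (A / 2) \<in> U" using A0 k by (simp add: U_def strip_def)
    then have "proj P (\<Psi> (of_real (A/2))) \<in> W" using W(2) base by blast
    moreover have "proj P (\<Psi> (of_real (A/2))) \<in> closure R" using base near by blast
    ultimately obtain x where x: "x \<in> W" "x \<in> R" using closure_meets[OF _ W(1)] by metis
    have xR: "x \<in> pts P" "x \<notin> bdry P 0" using x(2) comp in_components_subset by blast+
    then obtain \<zeta> where z: "\<zeta> \<in> U" "x = proj P (\<Psi> \<zeta>)" "\<Psi> \<zeta> \<in> cover P" using W(2) x(1) by blast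
    have "0 \<le> Im \<zeta>" using side[OF z(3)] inv_map[of \<zeta>] z(1) by (simp add: U_def)
    moreover have "Im \<zeta> \<noteq> 0"
    proof
      assume "Im \<zeta> = 0"
      then have "\<zeta> = of_real (Re \<zeta>)" by (simp add: complex_eq_iff)
      then show False using base xR(2) z(2) by metis
    qed
    ultimately have "\<zeta> \<in> half_cell A k" using z(1) by (simp add: U_def half_cell_def)
    then show ?thesis using x z by blast
  qed
qed

subsection \<open>The lower bound\<close>

definition grad :: "complex \<Rightarrow> real" where
  "grad \<zeta> = cos (Im \<zeta>) / (k * cosh (lattice_dist A (Re \<zeta>)))"

text \<open>
  The metric \<open>grad\<close> of the cell, pushed down to the pants.  Outside the open cell, where several points
  of the cell may have the same projection, the supremum makes it well defined.
\<close>

definition rho :: "real ^ 3 \<Rightarrow> ennreal" where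
  "rho \<xi> = (SUP \<zeta>\<in>{\<zeta> \<in> cell A k. proj P (\<Psi> \<zeta>) = \<xi>}. ennreal (grad \<zeta>))"

lemma continuous_grad: "continuous_on S grad"
proof -
  have "k * cosh y \<noteq> 0" for y :: real using k by simp
  then show ?thesis unfolding grad_def[abs_def]
    by (intro continuous_intros continuous_on_compose2[OF lattice_dist(6)[OF A0, of UNIV]]) auto
qed

lemma grad_pos: "\<zeta> \<in> strip \<Longrightarrow> grad \<zeta> > 0"
  using strip_cos_pos k by (simp add: grad_def)

text \<open>
  A superlevel set of \<open>rho\<close> is the projection of the intersection of an open with a closed set, hence a
  countable union of compact sets.
\<close>

lemma rho_measurable [measurable]: "rho \<in> borel_measurable borel"
proof (rule borel_measurableI_greater)
  fix y :: ennreal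
  define O' where "O' = {\<zeta> \<in> strip. sin (Im \<zeta>) < k * cosh (Re \<zeta>) \<and> y < ennreal (grad \<zeta>)}"
  define C' where "C' = {\<zeta>. \<bar>Re \<zeta>\<bar> \<le> A \<and> 0 \<le> Im \<zeta>}"
  have "open {\<zeta>. y < ennreal (grad \<zeta>)}"
    by (intro open_Collect_less continuous_intros continuous_on_ennreal continuous_grad)
  moreover have "O' = strip \<inter> {\<zeta>. sin (Im \<zeta>) < k * cosh (Re \<zeta>)} \<inter> {\<zeta>. y < ennreal (grad \<zeta>)}" by (auto simp: O'_def)
  ultimately have "open O'" by (auto intro!: open_Int open_strip open_Collect_less continuous_intros)
  then obtain K where K: "\<And>n. compact (K n)" "\<And>n::nat. K n \<subseteq> O'" "\<Union>(range K) = O'"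
    using open_Union_compact_subsets[of O'] by metis
  have "C' = {\<zeta>. \<bar>Re \<zeta>\<bar> \<le> A} \<inter> {\<zeta>. 0 \<le> Im \<zeta>}" by (auto simp: C'_def)
  then have "closed C'" by (auto intro!: closed_Int closed_Collect_le continuous_intros)
  then have cK: "compact (K n \<inter> C')" for n using K(1) by (rule compact_Int_closed[rotated])
  have KC: "K n \<inter> C' \<subseteq> cell A k" for n using K(2)[of n] by (auto simp: O'_def C'_def cell_def)
  have cont: "continuous_on (K n \<inter> C') (\<lambda>\<zeta>. proj P (\<Psi> \<zeta>))" for n
    by (rule continuous_on_compose2[OF proj_continuous continuous_on_subset[OF continuous_strip_map[OF w]]])
      (use KC[of n] cell_cover cell_strip in auto)
  have "{\<xi> \<in> space borel. y < rho \<xi>} = (\<lambda>\<zeta>. proj P (\<Psi> \<zeta>)) ` (O' \<inter> C')"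
    by (auto simp: rho_def less_SUP_iff O'_def C'_def cell_def)
  also have "\<dots> = (\<Union>n. (\<lambda>\<zeta>. proj P (\<Psi> \<zeta>)) ` (K n \<inter> C'))" unfolding K(3)[symmetric] by blast
  also have "\<dots> \<in> sets borel"
    using compact_continuous_image[OF cont cK] by (intro sets.countable_UN) (auto intro: borel_compact)
  finally show "{\<xi> \<in> space borel. y < rho \<xi>} \<in> sets borel" .
qed

lemma rho_ge: 
  assumes "\<zeta> \<in> saturated" shows "ennreal (grad \<zeta>) \<le> rho (proj P (\<Psi> \<zeta>))"
proof -
  obtain n :: int where n: "\<zeta> - of_real (2 * of_int n * A) \<in> cell A k" using saturated_cell[OF assms] .
  define \<eta> where "\<eta> = \<zeta> - of_real (2 * of_int n * A)"
  have e: "\<eta> \<in> cell A k" "\<eta> \<in> strip" using n cell_strip by (auto simp: \<eta>_def)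
  obtain f where f: "f \<in> deck P" "\<And>\<zeta>. \<zeta> \<in> strip \<Longrightarrow> f (\<Psi> \<zeta>) = \<Psi> (\<zeta> + of_real (2 * of_int n * A))"
    using trans_int[of n] by metis
  have "\<Psi> \<zeta> = f (\<Psi> \<eta>)" using f(2)[OF e(2)] by (simp add: \<eta>_def)
  then have "proj P (\<Psi> \<zeta>) = proj P (\<Psi> \<eta>)" using proj_deck[OF f(1)] cell_cover e(1) by auto
  moreover have "grad \<zeta> = grad \<eta>" using lattice_dist(4)[OF A0, of "Re \<zeta>" n] by (simp add: grad_def \<eta>_def)
  ultimately show ?thesis unfolding rho_def using e(1) by (intro SUP_upper2[of \<eta>]) auto
qed

lemma rho_eq: 
  assumes "\<zeta> \<in> open_cell A k" shows "rho (proj P (\<Psi> \<zeta>)) = ennreal (grad \<zeta>)"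
proof (rule antisym)
  show "rho (proj P (\<Psi> \<zeta>)) \<le> ennreal (grad \<zeta>)" unfolding rho_def
  proof (rule SUP_least)
    fix \<eta> assume e: "\<eta> \<in> {\<eta> \<in> cell A k. proj P (\<Psi> \<eta>) = proj P (\<Psi> \<zeta>)}"
    have "\<Psi> \<eta> \<in> cover P" "\<Psi> \<zeta> \<in> cover P" using e assms cell_cover open_cell_subset by auto
    then obtain f where "f \<in> deck P" "\<Psi> \<eta> = f (\<Psi> \<zeta>)" using proj_eq_iff[of "\<Psi> \<zeta>" "\<Psi> \<eta>"] e by auto
    moreover have "\<eta> \<in> closure (open_cell A k)" "\<eta> \<in> strip" using e cell_closure cell_strip by blast+
    ultimately have "\<zeta> = \<eta>" using deck_cell_trivial(1)[of f \<zeta> \<eta>] assms by simp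
    then show "ennreal (grad \<eta>) \<le> ennreal (grad \<zeta>)" by simp
  qed
  show "ennreal (grad \<zeta>) \<le> rho (proj P (\<Psi> \<zeta>))"
    using assms open_cell_subset cell_saturated rho_ge by blast
qed

lemma rho_zero: 
  assumes "\<And>\<zeta>. \<zeta> \<in> cell A k \<Longrightarrow> proj P (\<Psi> \<zeta>) \<noteq> \<xi>" shows "rho \<xi> = 0"
proof -
  have e: "{\<zeta> \<in> cell A k. proj P (\<Psi> \<zeta>) = \<xi>} = {}" using assms by auto
  show ?thesis unfolding rho_def e by (simp add: bot_ennreal)
qed

text \<open>
  Along a curve that starts on \<open>\<alpha>\<close> and ends on \<open>\<beta>\<close>, follow the lift to the strip until it leaves the
  saturated set.  The exit point lies above the cell of some centre \<open>2 n A\<close>, and the height function of that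
  cell, whose gradient is everywhere at most \<open>grad\<close>, has risen from 0 to at least 1.
\<close>

lemma rho_length_ge:
  assumes c: "c \<in> connecting_curves P (bdry P 0) \<beta> R"
  shows "1 \<le> rho_length P rho c"
proof -
  have c: "valid_path c" "path_image c \<subseteq> cover P" "proj P (c 0) \<in> bdry P 0" "proj P (c 1) \<in> \<beta>"
    using c by (auto simp: connecting_curves_def pathstart_def pathfinish_def)
  have cc: "c s \<in> cover P" if "s \<in> {0..1}" for s using c(2) that by (auto simp: path_image_def)
  obtain f t0 where f: "f \<in> deck P" "f (c 0) = \<Psi> (of_real t0)" using base_onto[OF cc[of 0] c(3)] by auto
  obtain g where g: "g \<in> deck P" "\<And>z. norm z < 1 \<Longrightarrow> g (f z) = z" "\<And>z. norm z < 1 \<Longrightarrow> f (g z) = z"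
    using deck_inverse[OF f(1)] by metis
  obtain \<theta>1 w1 where gm: "norm w1 < 1" "\<And>z. norm z < 1 \<Longrightarrow> g z = Moebius_function \<theta>1 w1 z"
    using deck_moebius[OF g(1)] by metis
  obtain \<theta>' w' where w': "norm w' < 1"
    "\<And>z. norm z < 1 \<Longrightarrow> Moebius_function \<theta>1 w1 (Moebius_function \<theta> w z) = Moebius_function \<theta>' w' z"
    using moebius_compose[OF w gm(1)] by metis
  have map': "strip_map \<theta>' w' \<zeta> = g (\<Psi> \<zeta>)" if "\<zeta> \<in> strip" for \<zeta>
    using w'(2)[OF strip_exp(6)[OF that]] gm(2)[OF disc[OF that]] by (simp add: strip_map_def)
  have inv': "strip_inv \<theta>' w' z = \<Omega> (f z)" if z: "norm z < 1" for z
  proof -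
    have fz: "norm (f z) < 1" by (rule deck_in_disc[OF f(1) z])
    have "strip_map \<theta>' w' (\<Omega> (f z)) = z" using map'[OF map_inv(1)[OF fz]] map_inv(2)[OF fz] g(2)[OF z] by simp
    then show ?thesis using strip_inv_map[OF w'(1) map_inv(1)[OF fz], of \<theta>'] by simp
  qed
  define \<zeta> where "\<zeta> = (\<lambda>s. strip_inv \<theta>' w' (c s))"
  have zs: "\<zeta> s \<in> strip" "0 \<le> Im (\<zeta> s)" "proj P (\<Psi> (\<zeta> s)) = proj P (c s)" if s: "s \<in> {0..1}" for s
  proof -
    have n: "norm (c s) < 1" using cover_norm[OF cc[OF s]] .
    have eq: "\<zeta> s = \<Omega> (f (c s))" by (simp add: \<zeta>_def inv'[OF n])
    show "\<zeta> s \<in> strip" unfolding eq by (rule map_inv(1)[OF deck_in_disc[OF f(1) n]])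
    show "0 \<le> Im (\<zeta> s)" unfolding eq by (rule side[OF deck_cover[OF f(1) cc[OF s]]])
    show "proj P (\<Psi> (\<zeta> s)) = proj P (c s)"
      unfolding eq map_inv(2)[OF deck_in_disc[OF f(1) n]] by (rule proj_deck[OF f(1) cc[OF s]])
  qed
  have cz: "continuous_on {0..1} \<zeta>" unfolding \<zeta>_def
    by (rule continuous_on_compose2[OF continuous_strip_inv[OF w'(1)]])
      (use valid_path_imp_path[OF c(1)] cc cover_norm in \<open>auto simp: path_def\<close>)
  have z0: "\<zeta> 0 = of_real t0"
    using inv'[OF cover_norm[OF cc[of 0]]] f(2) inv_map[of "of_real t0"] by (simp add: \<zeta>_def strip_def)
  define V where "V = {s \<in> {0..1}. k * cosh (lattice_dist A (Re (\<zeta> s))) \<le> sin (Im (\<zeta> s))}"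
  have "closed V" unfolding V_def
    by (intro continuous_on_closed_Collect_le continuous_intros cz
          continuous_on_compose2[OF lattice_dist(6)[OF A0, of UNIV]]) auto
  moreover have "1 \<in> V"
  proof (rule ccontr)
    assume "1 \<notin> V"
    then have "\<zeta> 1 \<in> saturated" using zs[of 1] by (auto simp: V_def saturated_def)
    from saturated_disjoint_beta[OF this] zs(3)[of 1] c(4) show False by simp
  qed
  moreover have "bdd_below V" by (rule bdd_belowI[of _ 0]) (auto simp: V_def)
  ultimately have IV: "Inf V \<in> V" using closed_contains_Inf by blast
  define s where "s = Inf V"
  have s: "s \<in> {0..1}" "k * cosh (lattice_dist A (Re (\<zeta> s))) \<le> sin (Im (\<zeta> s))" using IV by (auto simp: V_def s_def)
  have before: "\<zeta> t \<in> saturated" if "t \<in> {0..<s}" for t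
  proof -
    have "t \<notin> V" using that cInf_lower[OF _ \<open>bdd_below V\<close>, of t] by (auto simp: s_def)
    then show ?thesis using zs[of t] that s(1) by (auto simp: V_def saturated_def)
  qed
  obtain n :: int where n: "\<bar>Re (\<zeta> s) - 2 * of_int n * A\<bar> \<le> A" using lattice_dist(5)[OF A0] by blast
  define x where "x = 2 * of_int n * A"
  have ld: "lattice_dist A (Re (\<zeta> s)) = \<bar>Re (\<zeta> s) - x\<bar>"
    using lattice_dist(1)[OF A0 n] lattice_dist(4)[OF A0, of "Re (\<zeta> s)" n] by (simp add: x_def)
  have h1: "1 \<le> height k x (\<zeta> s)"
    using s(2) k unfolding ld height_def by (simp add: le_divide_eq)
  have h0: "height k x (\<zeta> 0) = 0" by (simp add: z0 height_def)
  define sp where "sp = (\<lambda>t. ennreal (2 * norm (vector_derivative c (at t)) / (1 - (norm (c t))\<^sup>2)))"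
  have cb: "path_image c \<subseteq> ball 0 1" using c(2) cover_subset by blast
  obtain S where S: "finite S" "ennreal (height k x (\<zeta> s) - height k x (\<zeta> 0)) \<le>
    (\<integral>\<^sup>+t\<in>{0..s} - S. ennreal (cos (Im (\<zeta> t)) / (k * cosh (Re (\<zeta> t) - x))) * sp t \<partial>lborel)"
    using height_variation[OF w'(1) k c(1) cb, of s x \<theta>'] s(1) unfolding \<zeta>_def sp_def by auto
  have "1 \<le> ennreal (height k x (\<zeta> s) - height k x (\<zeta> 0))" using h1 h0 ennreal_leI[of 1] by simp
  also note S(2)
  also have "(\<integral>\<^sup>+t\<in>{0..s} - S. ennreal (cos (Im (\<zeta> t)) / (k * cosh (Re (\<zeta> t) - x))) * sp t \<partial>lborel)
     \<le> (\<integral>\<^sup>+t\<in>{0..1}. rho (proj P (c t)) * sp t \<partial>lborel)"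
  proof (rule nn_integral_mono_AE)
    have "AE t in lborel. t \<noteq> s" by (rule AE_lborel_singleton)
    then show "AE t in lborel. ennreal (cos (Im (\<zeta> t)) / (k * cosh (Re (\<zeta> t) - x))) * sp t * indicator ({0..s} - S) t
        \<le> rho (proj P (c t)) * sp t * indicator {0..1} t"
    proof eventually_elim
      fix t assume ts: "t \<noteq> s"
      show "ennreal (cos (Im (\<zeta> t)) / (k * cosh (Re (\<zeta> t) - x))) * sp t * indicator ({0..s} - S) t
        \<le> rho (proj P (c t)) * sp t * indicator {0..1} t"
      proof (cases "t \<in> {0..s} - S")
        case True
        then have t: "t \<in> {0..<s}" "t \<in> {0..1}" using ts s(1) by auto
        have "lattice_dist A (Re (\<zeta> t)) = lattice_dist A (Re (\<zeta> t) - x)"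
          using lattice_dist(4)[OF A0, of "Re (\<zeta> t)" n] by (simp add: x_def)
        then have "lattice_dist A (Re (\<zeta> t)) \<le> \<bar>Re (\<zeta> t) - x\<bar>" using lattice_dist(2)[OF A0] by metis
        then have "cosh (lattice_dist A (Re (\<zeta> t))) \<le> cosh (Re (\<zeta> t) - x)"
          using lattice_dist(3)[OF A0] by (intro cosh_abs_mono) auto
        then have "k * cosh (lattice_dist A (Re (\<zeta> t))) \<le> k * cosh (Re (\<zeta> t) - x)" using k by simp
        then have "cos (Im (\<zeta> t)) / (k * cosh (Re (\<zeta> t) - x)) \<le> grad (\<zeta> t)"
          unfolding grad_def using k strip_cos_pos[OF zs(1)[OF t(2)]] by (intro divide_left_mono) auto
        then have "ennreal (cos (Im (\<zeta> t)) / (k * cosh (Re (\<zeta> t) - x))) \<le> rho (proj P (c t))"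
          using rho_ge[OF before[OF t(1)]] zs(3)[OF t(2)] ennreal_leI order_trans by metis
        then show ?thesis using True t by (simp add: mult_right_mono)
      qed simp
    qed
  qed
  finally show ?thesis by (simp add: rho_length_def sp_def)
qed

end

lemma null_hyperplane:
  fixes a :: complex
  assumes "a \<noteq> 0" shows "{x. a \<bullet> x = b} \<in> null_sets lborel"
proof -
  have "{x. a \<bullet> x = b} \<in> null_sets lebesgue"
    using negligible_hyperplane[of a b] assms by (simp add: negligible_iff_null_sets)
  moreover have "{x. a \<bullet> x = b} \<in> sets lborel"
    using closed_hyperplane[of a b] by simp
  ultimately show ?thesis using null_sets_completion_iff[of "{x. a \<bullet> x = b}" lborel] by blast
qed

context collar
begin

lemma proj_measurable:
  assumes F: "F \<in> sets borel" "F \<subseteq> cover P" and r: "r \<in> borel_measurable borel"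
  shows "(\<lambda>z. (r (proj P z) :: ennreal) * indicator F z) \<in> borel_measurable borel"
proof -
  have "proj P \<in> borel_measurable (restrict_space borel F)"
    by (intro borel_measurable_continuous_on_restrict continuous_on_subset[OF proj_continuous F(2)])
  then have "(\<lambda>z. r (proj P z)) \<in> borel_measurable (restrict_space borel F)"
    using r by (rule measurable_compose)
  then show ?thesis using F(1) by (subst (asm) borel_measurable_restrict_space_iff_ennreal) auto
qed

lemma cell_image_measurable: "\<Psi> ` cell A k \<in> sets borel" "\<Psi> ` cell A k \<subseteq> cover P"
proof -
  show "\<Psi> ` cell A k \<in> sets borel"
    by (rule nn_integral_strip(2)[OF w cell_measurable[OF A0 k kA] cell_strip(1), where h = "\<lambda>_. 0"]) simp
  show "\<Psi> ` cell A k \<subseteq> cover P" using cell_cover by blast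
qed

lemma AE_open_cell: "AE \<zeta> in lborel. \<zeta> \<in> cell A k \<longrightarrow> \<zeta> \<in> open_cell A k"
proof -
  define N where "N = {x::complex. 1 \<bullet> x = 0} \<union> {x. 1 \<bullet> x = A} \<union> {x. 1 \<bullet> x = - A} \<union> {x. \<i> \<bullet> x = 0}"
  have "N \<in> null_sets lborel" unfolding N_def by (intro null_sets.Un null_hyperplane) auto
  then have "AE \<zeta> in lborel. \<zeta> \<notin> N" by (rule AE_not_in)
  then show ?thesis
  proof eventually_elim
    fix \<zeta> assume n: "\<zeta> \<notin> N"
    have "Re \<zeta> \<noteq> 0" "Re \<zeta> \<noteq> A" "Re \<zeta> \<noteq> - A" "Im \<zeta> \<noteq> 0"
      using n by (auto simp: N_def inner_complex_def)
    then show "\<zeta> \<in> cell A k \<longrightarrow> \<zeta> \<in> open_cell A k"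
      by (auto simp: cell_def open_cell_def)
  qed
qed

text \<open>
  Up to a null set \<open>rho\<close> is \<open>grad\<close> on the cell, so the area reduces to \<open>cell_energy\<close>.
\<close>

lemma rho_cell_energy:
  "(\<integral>\<^sup>+z\<in>\<Psi> ` cell A k. (rho (proj P z))\<^sup>2 * area_density z \<partial>lborel) \<le> ennreal (3 * pi / k)"
proof -
  have "(\<integral>\<^sup>+z\<in>\<Psi> ` cell A k. (rho (proj P z))\<^sup>2 * area_density z \<partial>lborel)
    = (\<integral>\<^sup>+\<zeta>\<in>cell A k. (rho (proj P (\<Psi> \<zeta>)))\<^sup>2 * ennreal (1 / (cos (Im \<zeta>))\<^sup>2) \<partial>lborel)"
    by (rule nn_integral_strip(1)[OF w cell_measurable[OF A0 k kA] cell_strip(1)])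
      (rule proj_measurable[OF cell_image_measurable], measurable)
  also have "\<dots> = (\<integral>\<^sup>+\<zeta>\<in>cell A k. ennreal (1 / (k * cosh (Re \<zeta>))\<^sup>2) \<partial>lborel)"
  proof (rule nn_integral_cong_AE)
    show "AE \<zeta> in lborel. (rho (proj P (\<Psi> \<zeta>)))\<^sup>2 * ennreal (1 / (cos (Im \<zeta>))\<^sup>2) * indicator (cell A k) \<zeta>
       = ennreal (1 / (k * cosh (Re \<zeta>))\<^sup>2) * indicator (cell A k) \<zeta>"
      using AE_open_cell
    proof eventually_elim
      fix \<zeta> assume o: "\<zeta> \<in> cell A k \<longrightarrow> \<zeta> \<in> open_cell A k"
      show "(rho (proj P (\<Psi> \<zeta>)))\<^sup>2 * ennreal (1 / (cos (Im \<zeta>))\<^sup>2) * indicator (cell A k) \<zeta>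
         = ennreal (1 / (k * cosh (Re \<zeta>))\<^sup>2) * indicator (cell A k) \<zeta>"
      proof (cases "\<zeta> \<in> cell A k")
        case True
        then have z: "\<zeta> \<in> open_cell A k" "\<zeta> \<in> strip" "\<bar>Re \<zeta>\<bar> \<le> A" using o by (auto simp: cell_def)
        have c: "cos (Im \<zeta>) > 0" using strip_cos_pos[OF z(2)] .
        have "lattice_dist A (Re \<zeta>) = \<bar>Re \<zeta>\<bar>" by (rule lattice_dist(1)[OF A0 z(3)])
        then have g: "grad \<zeta> = cos (Im \<zeta>) / (k * cosh (Re \<zeta>))" by (simp add: grad_def)
        have "(rho (proj P (\<Psi> \<zeta>)))\<^sup>2 * ennreal (1 / (cos (Im \<zeta>))\<^sup>2) = ennreal ((grad \<zeta>)\<^sup>2) * ennreal (1 / (cos (Im \<zeta>))\<^sup>2)"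
          using rho_eq[OF z(1)] grad_pos[OF z(2)] by (simp add: ennreal_power less_imp_le)
        also have "\<dots> = ennreal ((grad \<zeta>)\<^sup>2 * (1 / (cos (Im \<zeta>))\<^sup>2))"
          by (rule ennreal_mult[symmetric]) auto
        also have "(grad \<zeta>)\<^sup>2 * (1 / (cos (Im \<zeta>))\<^sup>2) = 1 / (k * cosh (Re \<zeta>))\<^sup>2"
          unfolding g using c by (simp add: power_divide)
        finally show ?thesis by simp
      qed simp
    qed
  qed
  also have "\<dots> \<le> ennreal (3 * pi / k)" by (rule cell_energy[OF A0 k kA])
  finally show ?thesis .
qed

text \<open>
  A set that contains at most one lift of every point is cut by the translates of the cell into pieces;
  moving them back to the cell makes them disjoint, so its \<open>rho\<close>-area is at most that of the cell.
\<close>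

lemma rho_area_le: "rho_area P rho E \<le> ennreal (3 * pi / k)"
  unfolding rho_area_def
proof (rule SUP_least)
  fix F assume "F \<in> {F. F \<in> sets borel \<and> F \<subseteq> cover P \<and> proj P ` F \<subseteq> E \<and> inj_on (proj P) F}"
  then have F: "F \<in> sets borel" "F \<subseteq> cover P" "inj_on (proj P) F" by auto
  let ?C = "\<Psi> ` cell A k"
  let ?D = "count_space (deck P)"
  define g where "g = (\<lambda>z. (rho (proj P z))\<^sup>2 * indicator F z)"
  have g [measurable]: "g \<in> borel_measurable borel"
    unfolding g_def by (rule proj_measurable[OF F(1,2)]) measurable
  have Cd: "?C \<subseteq> ball 0 1" using cell_image_measurable(2) cover_subset by blast
  have im: "(\<integral>\<^sup>+z\<in>f ` ?C. g z * area_density z \<partial>lborel) = (\<integral>\<^sup>+z\<in>?C. g (f z) * area_density z \<partial>lborel)"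
    and fC: "f ` ?C \<in> sets borel" and gf: "(\<lambda>z. g (f z) * area_density z * indicator ?C z) \<in> borel_measurable borel"
    if f: "f \<in> deck P" for f
  proof -
    obtain \<theta>1 w1 where m: "norm w1 < 1" "\<And>z. norm z < 1 \<Longrightarrow> f z = Moebius_function \<theta>1 w1 z"
      using deck_moebius[OF f] by metis
    have eq: "f ` ?C = Moebius_function \<theta>1 w1 ` ?C" by (rule image_cong[OF refl]) (use m(2) Cd in auto)
    show fC': "f ` ?C \<in> sets borel" unfolding eq
      by (rule nn_integral_moebius(2)[OF m(1) cell_image_measurable(1) Cd, where h = "\<lambda>_. 0"]) simp
    have "(\<integral>\<^sup>+z\<in>f ` ?C. g z * area_density z \<partial>lborel) = (\<integral>\<^sup>+z\<in>?C. g (Moebius_function \<theta>1 w1 z) * area_density z \<partial>lborel)"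
      unfolding eq by (rule nn_integral_moebius(1)[OF m(1) cell_image_measurable(1) Cd]) (use fC'[unfolded eq] in measurable)
    also have "\<dots> = (\<integral>\<^sup>+z\<in>?C. g (f z) * area_density z \<partial>lborel)"
      using m(2) Cd by (intro nn_integral_cong) (auto split: split_indicator)
    finally show "(\<integral>\<^sup>+z\<in>f ` ?C. g z * area_density z \<partial>lborel) = (\<integral>\<^sup>+z\<in>?C. g (f z) * area_density z \<partial>lborel)" .
    have "f \<in> borel_measurable (restrict_space borel ?C)"
      by (intro borel_measurable_continuous_on_restrict continuous_on_subset[OF deck_continuous[OF f] Cd])
    then have "(\<lambda>z. g (f z)) \<in> borel_measurable (restrict_space borel ?C)" using g by (rule measurable_compose)
    then have "(\<lambda>z. g (f z) * indicator ?C z) \<in> borel_measurable borel"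
      using cell_image_measurable(1) by (subst (asm) borel_measurable_restrict_space_iff_ennreal) auto
    then have "(\<lambda>z. area_density z * (g (f z) * indicator ?C z)) \<in> borel_measurable borel" by measurable
    then show "(\<lambda>z. g (f z) * area_density z * indicator ?C z) \<in> borel_measurable borel" by (simp add: mult_ac)
  qed
  have "(\<integral>\<^sup>+z\<in>F. (rho (proj P z))\<^sup>2 * ennreal (4 / (1 - (norm z)\<^sup>2)\<^sup>2) \<partial>lborel)
     \<le> (\<integral>\<^sup>+z. \<integral>\<^sup>+f. g z * area_density z * indicator (f ` ?C) z \<partial>?D \<partial>lborel)"
  proof (rule nn_integral_mono)
    fix z :: complex
    show "(rho (proj P z))\<^sup>2 * ennreal (4 / (1 - (norm z)\<^sup>2)\<^sup>2) * indicator F z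
       \<le> (\<integral>\<^sup>+f. g z * area_density z * indicator (f ` ?C) z \<partial>?D)"
    proof (cases "z \<in> F \<and> (\<exists>\<zeta>\<in>cell A k. proj P (\<Psi> \<zeta>) = proj P z)")
      case True
      then obtain \<zeta> where z: "z \<in> F" "\<zeta> \<in> cell A k" "proj P (\<Psi> \<zeta>) = proj P z" by blast
      have "\<Psi> \<zeta> \<in> cover P" "z \<in> cover P" using z F(2) cell_cover by auto
      then obtain f where f: "f \<in> deck P" "z = f (\<Psi> \<zeta>)" using proj_eq_iff[of "\<Psi> \<zeta>" z] z(3) by auto
      have "g z * area_density z * indicator (f ` ?C) z \<le> (\<integral>\<^sup>+f. g z * area_density z * indicator (f ` ?C) z \<partial>?D)"
        by (rule nn_integral_ge_point[OF f(1)])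
      moreover have "z \<in> f ` ?C" using f z by blast
      ultimately show ?thesis using z(1) by (simp add: g_def area_density_def)
    next
      case False
      then have "z \<notin> F \<or> rho (proj P z) = 0" using rho_zero by metis
      then show ?thesis by auto
    qed
  qed
  also have "\<dots> = (\<integral>\<^sup>+f. \<integral>\<^sup>+z. g z * area_density z * indicator (f ` ?C) z \<partial>lborel \<partial>?D)"
  proof (rule nn_integral_count_space_nn_integral[OF deck_countable])
    fix f assume "f \<in> deck P"
    then have [measurable]: "f ` ?C \<in> sets borel" by (rule fC)
    show "(\<lambda>z. g z * area_density z * indicator (f ` ?C) z) \<in> borel_measurable lborel" by measurable
  qed
  also have "\<dots> = (\<integral>\<^sup>+f. \<integral>\<^sup>+z. g (f z) * area_density z * indicator ?C z \<partial>lborel \<partial>?D)"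
    by (rule nn_integral_cong) (simp add: im)
  also have "\<dots> = (\<integral>\<^sup>+z. \<integral>\<^sup>+f. g (f z) * area_density z * indicator ?C z \<partial>?D \<partial>lborel)"
    by (rule nn_integral_count_space_nn_integral[OF deck_countable, symmetric]) (use gf in simp)
  also have "\<dots> \<le> (\<integral>\<^sup>+z\<in>?C. (rho (proj P z))\<^sup>2 * area_density z \<partial>lborel)"
  proof (rule nn_integral_mono)
    fix z
    show "(\<integral>\<^sup>+f. g (f z) * area_density z * indicator ?C z \<partial>?D) \<le> (rho (proj P z))\<^sup>2 * area_density z * indicator ?C z"
    proof (cases "z \<in> ?C \<and> (\<exists>f\<in>deck P. f z \<in> F)")
      case True
      then obtain f0 where z: "z \<in> ?C" "f0 \<in> deck P" "f0 z \<in> F" by blast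
      have zc: "z \<in> cover P" using z(1) cell_image_measurable(2) by blast
      have uniq: "f = f0" if f: "f \<in> deck P" "f z \<in> F" for f
      proof -
        have "proj P (f z) = proj P (f0 z)" using proj_deck zc f(1) z(2) by simp
        then have e: "f z = f0 z" using F(3) f(2) z(3) by (simp add: inj_on_def)
        obtain \<theta>1 w1 where f1: "f = restrict (Moebius_function \<theta>1 w1) hdisc" using deck_moebius[OF f(1)] by metis
        obtain \<theta>2 w2 where f2: "f0 = restrict (Moebius_function \<theta>2 w2) hdisc" using deck_moebius[OF z(2)] by metis
        have ag: "f z' = f0 z'" if "norm z' < 1" for z' by (rule deck_agree[OF f(1) z(2) cover_norm[OF zc] e that])
        show ?thesis
        proof
          fix x show "f x = f0 x" by (cases "norm x < 1") (simp add: ag, simp add: f1 f2)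
        qed
      qed
      have "(\<integral>\<^sup>+f. g (f z) * area_density z * indicator ?C z \<partial>?D) = (\<Sum>f\<in>{f0}. g (f z) * area_density z * indicator ?C z)"
      proof (rule nn_integral_count_space')
        fix f assume "f \<in> deck P" "f \<notin> {f0}"
        then have "f z \<notin> F" using uniq by blast
        then show "g (f z) * area_density z * indicator ?C z = 0" by (simp add: g_def)
      qed (use z(2) in auto)
      also have "\<dots> = (rho (proj P z))\<^sup>2 * area_density z * indicator ?C z"
        using z proj_deck[OF z(2) zc] by (simp add: g_def)
      finally show ?thesis by simp
    next
      case False
      then have "g (f z) * area_density z * indicator ?C z = 0" if "f \<in> deck P" for f
        using that by (auto simp: g_def indicator_def)
      then have "(\<integral>\<^sup>+f. g (f z) * area_density z * indicator ?C z \<partial>?D) = (\<integral>\<^sup>+f. 0 \<partial>?D)"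
        by (intro nn_integral_cong) (simp only: space_count_space)
      then show ?thesis by simp
    qed
  qed
  also have "\<dots> \<le> ennreal (3 * pi / k)" by (rule rho_cell_energy)
  finally show "(\<integral>\<^sup>+z\<in>F. (rho (proj P z))\<^sup>2 * ennreal (4 / (1 - (norm z)\<^sup>2)\<^sup>2) \<partial>lborel) \<le> ennreal (3 * pi / k)" .
qed

lemma lift_set:
  assumes "U \<subseteq> half_cell A k" "open U"
  shows "\<Psi> ` U \<in> {F. F \<in> sets borel \<and> F \<subseteq> cover P \<and> proj P ` F \<subseteq> R \<and> inj_on (proj P) F}"
proof -
  have "U \<subseteq> strip" using assms(1) cell_strip(4) by blast
  then have "open (\<Psi> ` U)" by (rule open_image[OF assms(2)])
  then have "\<Psi> ` U \<in> sets borel" by simp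
  moreover have "\<Psi> ` U \<subseteq> cover P" using assms(1) half_cell_subset open_cell_subset cell_cover by blast
  moreover have "proj P ` \<Psi> ` U \<subseteq> R" using half_cell_in_R assms(1) by blast
  moreover have "inj_on (proj P) (\<Psi> ` U)"
  proof (rule inj_onI)
    fix x y assume "x \<in> \<Psi> ` U" "y \<in> \<Psi> ` U" "proj P x = proj P y"
    then obtain \<zeta> \<eta> where z: "x = \<Psi> \<zeta>" "y = \<Psi> \<eta>" "\<zeta> \<in> U" "\<eta> \<in> U" "proj P (\<Psi> \<zeta>) = proj P (\<Psi> \<eta>)" by auto
    then have "\<zeta> = \<eta>" using cell_inj assms(1) half_cell_subset by blast
    then show "x = y" using z by simp
  qed
  ultimately show ?thesis by blast
qed

lemma half_cell_nonempty: "half_cell A k \<noteq> {}"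
proof -
  have "(A / 2, 1 / 2) \<in> {0<..<A} \<times> {0<..<1::real}" using A0 by simp
  then show ?thesis unfolding half_cell_eq[OF A0 k kA] by blast
qed

lemma rho_area_pos: "0 < rho_area P rho R"
proof -
  let ?F = "\<Psi> ` half_cell A k"
  have F: "?F \<in> {F. F \<in> sets borel \<and> F \<subseteq> cover P \<and> proj P ` F \<subseteq> R \<and> inj_on (proj P) F}"
    by (rule lift_set[OF order_refl open_half_cell])
  have oF: "open ?F" "?F \<noteq> {}" using open_image[OF open_half_cell cell_strip(4)] half_cell_nonempty by auto
  define u where "u = (\<lambda>z. (rho (proj P z))\<^sup>2 * area_density z * indicator ?F z)"
  have "(\<lambda>z. (rho (proj P z))\<^sup>2 * indicator ?F z) \<in> borel_measurable borel"
    by (rule proj_measurable) (use F in \<open>auto intro: borel_measurable_power rho_measurable\<close>)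
  then have "(\<lambda>z. area_density z * ((rho (proj P z))\<^sup>2 * indicator ?F z)) \<in> borel_measurable borel" by measurable
  then have mu: "u \<in> borel_measurable lborel" by (simp add: u_def mult_ac)
  have "(\<integral>\<^sup>+z. u z \<partial>lborel) \<noteq> 0"
  proof
    assume "(\<integral>\<^sup>+z. u z \<partial>lborel) = 0"
    then have "AE z in lborel. u z = 0" using nn_integral_0_iff_AE[OF mu] by simp
    moreover have "u z \<noteq> 0" if zF: "z \<in> ?F" for z
    proof -
      obtain \<zeta> where z: "z = \<Psi> \<zeta>" "\<zeta> \<in> half_cell A k" using zF by blast
      have zs: "\<zeta> \<in> open_cell A k" "\<zeta> \<in> strip" using z(2) half_cell_subset cell_strip by blast+
      have "rho (proj P z) \<noteq> 0" unfolding z(1) rho_eq[OF zs(1)] using grad_pos[OF zs(2)] by simp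
      moreover have "area_density z \<noteq> 0"
        unfolding area_density_def z(1) using hyp_pos[OF disc[OF zs(2)]] by simp
      ultimately show ?thesis using zF by (simp add: u_def)
    qed
    ultimately have "AE z in lborel. z \<notin> ?F" by (auto elim: eventually_mono)
    then have "?F \<in> null_sets lborel" using F by (subst (asm) AE_iff_null) (auto simp: null_sets_def)
    then have "?F \<in> null_sets lebesgue" by (rule null_sets_completionI)
    then have "negligible ?F" by (simp add: negligible_iff_null_sets)
    then show False using open_not_negligible[OF oF] by simp
  qed
  moreover have "(\<integral>\<^sup>+z. u z \<partial>lborel) \<le> rho_area P rho R"
    unfolding rho_area_def by (rule SUP_upper2[OF F]) (simp add: u_def area_density_def)
  ultimately show ?thesis by (metis le_zero_eq zero_less_iff_neq_zero)
qed

theorem extremal_length_lower: "ennreal (k / (3 * pi)) \<le> extremal_length P (bdry P 0) \<beta> R"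
proof -
  define a where "a = rho_area P rho R"
  have a: "0 < a" "a \<le> ennreal (3 * pi / k)" unfolding a_def by (rule rho_area_pos, rule rho_area_le)
  then obtain r where r: "a = ennreal r" "r > 0" by (metis ennreal_cases ennreal_less_zero_iff neq_top_trans ennreal_neq_top)
  have rk: "r \<le> 3 * pi / k" using a(2) r k by (simp add: ennreal_le_iff)
  let ?I = "INF c\<in>connecting_curves P (bdry P 0) \<beta> R. rho_length P rho c"
  have "1 \<le> ?I" by (rule INF_greatest) (rule rho_length_ge)
  then have I: "1 \<le> ?I\<^sup>2" by (simp add: one_le_power)
  have "k / (3 * pi) \<le> 1 / r" using rk r(2) k by (simp add: field_simps)
  then have "ennreal (k / (3 * pi)) \<le> ennreal (1 / r)" by (rule ennreal_leI)
  also have "\<dots> = 1 / a" unfolding r(1) using r(2) divide_ennreal[of 1 r] by simp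
  also have "\<dots> \<le> ?I\<^sup>2 / a" using I by (rule divide_right_mono_ennreal)
  also have "\<dots> \<le> extremal_length P (bdry P 0) \<beta> R"
    unfolding extremal_length_def a_def
  proof (rule SUP_upper)
    have "rho_area P rho R < \<infinity>" using a(2) unfolding a_def by (metis ennreal_less_top infinity_ennreal_def order_le_less_trans)
    then show "rho \<in> {\<rho> \<in> borel_measurable borel. 0 < rho_area P \<rho> R \<and> rho_area P \<rho> R < \<infinity>}"
      using rho_area_pos rho_measurable by blast
  qed
  finally show ?thesis .
qed

subsection \<open>The upper bound\<close>

text \<open>
  As \<open>A > 1/2\<close>, these segments lie over one half of the cell.  Restricting \<open>t\<close> to an interval independent of \<open>A\<close>
  makes the bound obtained from them uniform.
\<close>

lemma vertical_segment:
  assumes t: "0 < t" "t < 1/2"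
  defines "T \<equiv> arcsin (k * cosh t)"
  shows "\<Psi> \<circ> linepath (of_real t) (Complex t T) \<in> connecting_curves P (bdry P 0) \<beta> R"
    "0 < T" "\<And>s. s \<in> {0<..<1} \<Longrightarrow> Complex t (T * s) \<in> half_cell A k"
    "\<And>r. r \<in> borel_measurable borel \<Longrightarrow> rho_length P r (\<Psi> \<circ> linepath (of_real t) (Complex t T))
      = (\<integral>\<^sup>+s\<in>{0<..<1}. r (proj P (\<Psi> (Complex t (T * s)))) * ennreal (T / cos (T * s)) \<partial>lborel)"
proof -
  have tA: "\<bar>t\<bar> < A" using t A by simp
  define y where "y = k * cosh t"
  have y: "0 < y" "y < 1" using kcosh_pos[OF A0 k kA] kcosh_less[OF A0 k kA tA] by (auto simp: y_def)
  have T: "0 < T" "T < pi / 2" "sin T = y"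
    using y arcsin_less_arcsin[of 0 y] arcsin_lt_bounded[of y] by (auto simp: T_def y_def[symmetric])
  show "0 < T" by (rule T)
  have lp: "linepath (of_real t) (Complex t T) s = Complex t (T * s)" for s
    by (simp add: linepath_def complex_eq_iff scaleR_conv_of_real algebra_simps)
  have st: "Complex t (T * s) \<in> strip" "0 \<le> T * s" "T * s \<le> T" if s: "s \<in> {0..1}" for s
  proof -
    show 1: "0 \<le> T * s" "T * s \<le> T" using s T(1) by (auto simp: mult_left_le)
    show "Complex t (T * s) \<in> strip" unfolding strip_def using 1 T(2) by simp
  qed
  show hc: "Complex t (T * s) \<in> half_cell A k" if s: "s \<in> {0<..<1}" for s
  proof -
    have "T * s < T" "0 < T * s" using s T by auto
    then have "sin (T * s) < sin T" using T by (intro sin_monotone_2pi) auto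
    then show ?thesis using st(1)[of s] s t tA \<open>0 < T * s\<close> T(3) by (simp add: half_cell_def y_def)
  qed
  have top: "Complex t T \<in> cell_top A k" using st(1)[of 1] T tA by (simp add: cell_top_def y_def)
  define c where "c = \<Psi> \<circ> linepath (of_real t) (Complex t T)"
  have cs: "c s = \<Psi> (Complex t (T * s))" for s by (simp add: c_def lp)
  obtain D where D: "\<And>\<zeta>. \<zeta> \<in> strip \<Longrightarrow> (\<Psi> has_field_derivative D \<zeta>) (at \<zeta>)"
    "\<And>\<zeta>. \<zeta> \<in> strip \<Longrightarrow> norm (D \<zeta>) = (1 - (norm (\<Psi> \<zeta>))\<^sup>2) / (2 * cos (Im \<zeta>))"
    using strip_map_deriv[OF w, where \<theta> = \<theta>] by metis
  have hol: "\<Psi> holomorphic_on strip" using D(1) open_strip by (metis holomorphic_on_open)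
  have pis: "path_image (linepath (of_real t) (Complex t T)) \<subseteq> strip"
    unfolding path_image_def using st(1) lp by (metis image_subsetI)
  have vp: "valid_path c" unfolding c_def
    by (rule valid_path_compose_holomorphic[OF valid_path_linepath hol open_strip pis])
  have c0: "c 0 = \<Psi> (of_real t)" by (simp add: cs complex_of_real_def)
  have cov: "c s \<in> cover P" if s: "s \<in> {0..1}" for s
  proof -
    consider "s = 0" | "s = 1" | "s \<in> {0<..<1}" using s by fastforce
    then show ?thesis
    proof cases
      case 1 then show ?thesis using base c0 by simp
    next
      case 2 then show ?thesis using cell_cover top by (simp add: cs)
    next
      case 3 then show ?thesis using cell_cover hc[OF 3] half_cell_subset open_cell_subset by (auto simp: cs)
    qed
  qed
  show "c \<in> connecting_curves P (bdry P 0) \<beta> R"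
    unfolding connecting_curves_def mem_Collect_eq
  proof (intro conjI ballI vp)
    show "path_image c \<subseteq> cover P" using cov by (auto simp: path_image_def)
    show "proj P (pathstart c) \<in> bdry P 0" using base c0 by (simp add: pathstart_def)
    show "proj P (pathfinish c) \<in> \<beta>" using beta_sup[OF top] tA by (simp add: pathfinish_def cs)
    show "proj P (c s) \<in> R" if "s \<in> {0<..<1}" for s using half_cell_in_R hc[OF that] by (auto simp: cs)
  qed
  fix r :: "real ^ 3 \<Rightarrow> ennreal"
  have sp: "2 * norm (vector_derivative c (at s)) / (1 - (norm (c s))\<^sup>2) = T / cos (T * s)" if s: "s \<in> {0<..<1}" for s
  proof -
    have z: "Complex t (T * s) \<in> strip" using st(1) s by auto
    have "((\<lambda>s. Complex t (T * s)) has_vector_derivative Complex 0 T) (at s)"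
    proof -
      have "(\<lambda>s. Complex t (T * s)) = (\<lambda>s. of_real t + s *\<^sub>R Complex 0 T)" by (auto simp: complex_eq_iff)
      then show ?thesis by (auto intro!: derivative_eq_intros)
    qed
    from field_vector_diff_chain_at[OF this D(1)[OF z]]
    have "(c has_vector_derivative (Complex 0 T * D (Complex t (T * s)))) (at s)"
      by (simp add: c_def o_def lp)
    then have vd: "vector_derivative c (at s) = Complex 0 T * D (Complex t (T * s))" by (rule vector_derivative_at)
    have nT: "norm (Complex 0 T) = T" using T(1) by (simp add: complex_norm)
    define q where "q = 1 - (norm (c s))\<^sup>2"
    have q: "q > 0" unfolding q_def cs by (rule hyp_pos[OF disc[OF z]])
    have "norm (D (Complex t (T * s))) = q / (2 * cos (T * s))" using D(2)[OF z] by (simp add: q_def cs)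
    then show ?thesis unfolding vd norm_mult nT q_def[symmetric] using q by simp
  qed
  show "rho_length P r c = (\<integral>\<^sup>+s\<in>{0<..<1}. r (proj P (\<Psi> (Complex t (T * s)))) * ennreal (T / cos (T * s)) \<partial>lborel)"
    unfolding rho_length_def
  proof (rule nn_integral_cong_AE)
    have "AE s in lborel. s \<noteq> (0::real)" "AE s in lborel. s \<noteq> (1::real)" by (rule AE_lborel_singleton)+
    then show "AE s in lborel. r (proj P (c s)) * ennreal (2 * norm (vector_derivative c (at s)) / (1 - (norm (c s))\<^sup>2)) * indicator {0..1} s
       = r (proj P (\<Psi> (Complex t (T * s)))) * ennreal (T / cos (T * s)) * indicator {0<..<1} s"
    proof eventually_elim
      fix s :: real assume "s \<noteq> 0" "s \<noteq> 1"
      then show "r (proj P (c s)) * ennreal (2 * norm (vector_derivative c (at s)) / (1 - (norm (c s))\<^sup>2)) * indicator {0..1} s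
       = r (proj P (\<Psi> (Complex t (T * s)))) * ennreal (T / cos (T * s)) * indicator {0<..<1} s"
        using sp[of s] by (auto simp: cs split: split_indicator)
    qed
  qed
qed

text \<open>
  Integrating the lengths of these segments over \<open>t\<close> gives an integral over the region that they sweep out, whose
  Euclidean area is at most a multiple of \<open>k\<close>; Cauchy-Schwarz does the rest.
\<close>

lemma length_area:
  assumes r [measurable]: "r \<in> borel_measurable borel"
  defines "I \<equiv> INF c\<in>connecting_curves P (bdry P 0) \<beta> R. rho_length P r c"
  shows "I\<^sup>2 \<le> ennreal (6 * cosh (1/2) * k) * rho_area P r R"
proof -
  define U where "U = {\<zeta> \<in> half_cell A k. Re \<zeta> < 1/2}"
  have "U = half_cell A k \<inter> {\<zeta>. Re \<zeta> < 1/2}" by (auto simp: U_def)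
  then have oU: "open U" by (auto intro!: open_Int open_half_cell open_Collect_less continuous_intros)
  then have Ub [measurable]: "U \<in> sets borel" by simp
  have Uh: "U \<subseteq> half_cell A k" by (auto simp: U_def)
  have Us: "U \<subseteq> strip" using Uh cell_strip(4) by blast
  have Uc: "U \<subseteq> cell A k" using Uh half_cell_subset open_cell_subset by blast
  note F = lift_set[OF Uh oU]
  define G where "G = (\<lambda>\<zeta>. r (proj P (\<Psi> \<zeta>)) * ennreal (1 / cos (Im \<zeta>)) * indicator U \<zeta>)"
  have G [measurable]: "G \<in> borel_measurable borel"
  proof -
    have "(\<lambda>\<zeta>. proj P (\<Psi> \<zeta>)) \<in> borel_measurable (restrict_space borel U)"
      by (intro borel_measurable_continuous_on_restrict
          continuous_on_compose2[OF proj_continuous continuous_on_subset[OF continuous_strip_map[OF w] Us]])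
        (use Uc cell_cover in auto)
    then have "(\<lambda>\<zeta>. r (proj P (\<Psi> \<zeta>))) \<in> borel_measurable (restrict_space borel U)"
      using r by (rule measurable_compose)
    then have "(\<lambda>\<zeta>. r (proj P (\<Psi> \<zeta>)) * indicator U \<zeta>) \<in> borel_measurable borel"
      using Ub by (subst (asm) borel_measurable_restrict_space_iff_ennreal) auto
    moreover have "(\<lambda>\<zeta>. ennreal (1 / cos (Im \<zeta>))) \<in> borel_measurable borel" by measurable
    ultimately have "(\<lambda>\<zeta>. ennreal (1 / cos (Im \<zeta>)) * (r (proj P (\<Psi> \<zeta>)) * indicator U \<zeta>)) \<in> borel_measurable borel"
      by (rule borel_measurable_times_ennreal[rotated])
    then show ?thesis by (simp add: G_def mult_ac)
  qed
  have area: "(\<integral>\<^sup>+\<zeta>. (G \<zeta>)\<^sup>2 \<partial>lborel) \<le> rho_area P r R"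
  proof -
    have "(\<integral>\<^sup>+\<zeta>. (G \<zeta>)\<^sup>2 \<partial>lborel) = (\<integral>\<^sup>+\<zeta>\<in>U. (r (proj P (\<Psi> \<zeta>)))\<^sup>2 * ennreal (1 / (cos (Im \<zeta>))\<^sup>2) \<partial>lborel)"
    proof (intro nn_integral_cong)
      fix \<zeta>
      have "(ennreal (1 / cos (Im \<zeta>)))\<^sup>2 = ennreal (1 / (cos (Im \<zeta>))\<^sup>2)" if "\<zeta> \<in> U"
        using strip_cos_pos[of \<zeta>] that Us by (subst ennreal_power) (auto simp: power_divide)
      then show "(G \<zeta>)\<^sup>2 = (r (proj P (\<Psi> \<zeta>)))\<^sup>2 * ennreal (1 / (cos (Im \<zeta>))\<^sup>2) * indicator U \<zeta>"
        by (auto simp: G_def power_mult_distrib split: split_indicator)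
    qed
    also have "\<dots> = (\<integral>\<^sup>+z\<in>\<Psi> ` U. (r (proj P z))\<^sup>2 * area_density z \<partial>lborel)"
      by (rule nn_integral_strip(1)[OF w Ub Us, symmetric], rule proj_measurable) (use F in auto)
    also have "\<dots> \<le> rho_area P r R"
      unfolding rho_area_def by (rule SUP_upper2[OF F]) (simp add: area_density_def)
    finally show ?thesis .
  qed
  have size: "(\<integral>\<^sup>+\<zeta>. (indicator U \<zeta>)\<^sup>2 \<partial>lborel) \<le> ennreal (3 / 2 * cosh (1/2) * k)"
  proof -
    have "(\<integral>\<^sup>+\<zeta>. (indicator U \<zeta>)\<^sup>2 \<partial>lborel) = (\<integral>\<^sup>+t. \<integral>\<^sup>+\<theta>. (indicator U (Complex t \<theta>))\<^sup>2 \<partial>lborel \<partial>lborel)"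
      by (rule nn_integral_complex_iterated) measurable
    also have "\<dots> \<le> (\<integral>\<^sup>+t. ennreal (3 * (k * cosh (1/2))) * indicator {0..1/2::real} t \<partial>lborel)"
    proof (rule nn_integral_mono)
      fix t :: real
      show "(\<integral>\<^sup>+\<theta>. (indicator U (Complex t \<theta>))\<^sup>2 \<partial>lborel) \<le> ennreal (3 * (k * cosh (1/2))) * indicator {0..1/2} t"
      proof (cases "t \<in> {0..1/2}")
        case True
        have "(\<integral>\<^sup>+\<theta>. (indicator U (Complex t \<theta>))\<^sup>2 \<partial>lborel) \<le> (\<integral>\<^sup>+\<theta>. indicator (cell A k) (Complex t \<theta>) \<partial>lborel)"
          using Uc by (intro nn_integral_mono) (auto split: split_indicator)
        also have "\<dots> \<le> ennreal (3 * (k * cosh t))" by (rule nn_integral_slice[OF A0 k kA])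
        also have "\<dots> \<le> ennreal (3 * (k * cosh (1/2)))"
          using k True cosh_abs_mono[of t "1/2"] by (intro ennreal_leI) auto
        finally show ?thesis using True by simp
      next
        case False
        then have "indicator U (Complex t \<theta>) = (0::ennreal)" for \<theta>
          by (auto simp: U_def half_cell_def indicator_def)
        then show ?thesis by simp
      qed
    qed
    also have "\<dots> = ennreal (3 * (k * cosh (1/2))) * ennreal (1/2)"
      by (subst nn_integral_cmult_indicator) auto
    also have "\<dots> = ennreal (3 / 2 * cosh (1/2) * k)"
      using k by (subst ennreal_mult[symmetric]) (auto simp: mult_ac)
    finally show ?thesis .
  qed
  have "I * ennreal (1/2) = (\<integral>\<^sup>+t. I * indicator {0<..<1/2::real} t \<partial>lborel)"
    by (subst nn_integral_cmult_indicator) auto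
  also have "\<dots> \<le> (\<integral>\<^sup>+t. \<integral>\<^sup>+\<theta>. G (Complex t \<theta>) \<partial>lborel \<partial>lborel)"
  proof (rule nn_integral_mono)
    fix t :: real
    show "I * indicator {0<..<1/2} t \<le> (\<integral>\<^sup>+\<theta>. G (Complex t \<theta>) \<partial>lborel)"
    proof (cases "t \<in> {0<..<1/2}")
      case True
      then have t: "0 < t" "t < 1/2" by auto
      define T where "T = arcsin (k * cosh t)"
      note vs = vertical_segment[OF t, folded T_def]
      have "I \<le> rho_length P r (\<Psi> \<circ> linepath (of_real t) (Complex t T))"
        unfolding I_def by (rule INF_lower[OF vs(1)])
      also have "\<dots> = (\<integral>\<^sup>+s\<in>{0<..<1}. r (proj P (\<Psi> (Complex t (T * s)))) * ennreal (T / cos (T * s)) \<partial>lborel)"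
        by (rule vs(4)[OF r])
      also have "\<dots> \<le> (\<integral>\<^sup>+s. ennreal T * G (Complex t (0 + T * s)) \<partial>lborel)"
      proof (rule nn_integral_mono)
        fix s :: real
        show "r (proj P (\<Psi> (Complex t (T * s)))) * ennreal (T / cos (T * s)) * indicator {0<..<1} s
           \<le> ennreal T * G (Complex t (0 + T * s))"
        proof (cases "s \<in> {0<..<1}")
          case True
          have u: "Complex t (T * s) \<in> U" using vs(3)[OF True] t by (simp add: U_def)
          have "ennreal (T / cos (T * s)) = ennreal T * ennreal (1 / cos (T * s))"
            using vs(2) strip_cos_pos[of "Complex t (T * s)"] u Us by (subst ennreal_mult[symmetric]) auto
          then show ?thesis using u True by (simp add: G_def mult_ac)
        qed simp
      qed
      also have "\<dots> = ennreal T * (\<integral>\<^sup>+s. G (Complex t (0 + T * s)) \<partial>lborel)"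
      proof (rule nn_integral_cmult)
        have "(\<lambda>s. Complex t (0 + T * s)) \<in> borel_measurable borel"
          unfolding Complex_eq by (intro borel_measurable_continuous_onI continuous_intros)
        then show "(\<lambda>s. G (Complex t (0 + T * s))) \<in> borel_measurable lborel"
          using measurable_compose[OF _ G] by simp
      qed
      also have "\<dots> = (\<integral>\<^sup>+\<theta>. G (Complex t \<theta>) \<partial>lborel)"
      proof -
        have "(\<lambda>\<theta>. Complex t \<theta>) \<in> borel_measurable borel"
          unfolding Complex_eq by (intro borel_measurable_continuous_onI continuous_intros)
        then have "(\<lambda>\<theta>. G (Complex t \<theta>)) \<in> borel_measurable borel"
          using measurable_compose[OF _ G] by simp
        then show ?thesis using nn_integral_real_affine[of "\<lambda>\<theta>. G (Complex t \<theta>)" T 0] vs(2) by simp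
      qed
      finally show ?thesis using True by simp
    qed simp
  qed
  also have "\<dots> = (\<integral>\<^sup>+\<zeta>. G \<zeta> \<partial>lborel)" by (rule nn_integral_complex_iterated[OF G, symmetric])
  also have "\<dots> = (\<integral>\<^sup>+\<zeta>. G \<zeta> * indicator U \<zeta> \<partial>lborel)"
    by (intro nn_integral_cong) (auto simp: G_def split: split_indicator)
  finally have "(I * ennreal (1/2))\<^sup>2 \<le> (\<integral>\<^sup>+\<zeta>. G \<zeta> * indicator U \<zeta> \<partial>lborel)\<^sup>2" by (rule power_mono) simp
  also have "\<dots> \<le> (\<integral>\<^sup>+\<zeta>. (G \<zeta>)\<^sup>2 \<partial>lborel) * (\<integral>\<^sup>+\<zeta>. (indicator U \<zeta>)\<^sup>2 \<partial>lborel)"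
    by (rule Cauchy_Schwarz_nn_integral) auto
  also have "\<dots> \<le> rho_area P r R * ennreal (3 / 2 * cosh (1/2) * k)" by (rule mult_mono[OF area size]) auto
  finally have "(I * ennreal (1/2))\<^sup>2 * ennreal 4 \<le> rho_area P r R * ennreal (3 / 2 * cosh (1/2) * k) * ennreal 4"
    by (rule mult_right_mono) simp
  moreover have "(I * ennreal (1/2))\<^sup>2 * ennreal 4 = I\<^sup>2"
  proof -
    have "(I * ennreal (1/2))\<^sup>2 * ennreal 4 = I\<^sup>2 * (ennreal ((1/2)\<^sup>2) * ennreal 4)"
    proof -
      have "(ennreal (1/2))\<^sup>2 = ennreal ((1/2)\<^sup>2)" by (rule ennreal_power) simp
      then show ?thesis by (simp only: power_mult_distrib mult.assoc)
    qed
    also have "ennreal ((1/2)\<^sup>2) * ennreal 4 = 1"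
      by (subst ennreal_mult[symmetric]) (auto simp: power2_eq_square)
    finally show ?thesis by simp
  qed
  moreover have "ennreal (3 / 2 * cosh (1/2) * k) * ennreal 4 = ennreal (6 * cosh (1/2) * k)"
    using k by (subst ennreal_mult[symmetric]) auto
  ultimately show ?thesis by (simp add: mult_ac)
qed

theorem extremal_length_upper: "extremal_length P (bdry P 0) \<beta> R \<le> ennreal (6 * cosh (1/2) * k)"
  unfolding extremal_length_def
proof (rule SUP_least)
  fix r :: "real ^ 3 \<Rightarrow> ennreal"
  assume "r \<in> {\<rho> \<in> borel_measurable borel. 0 < rho_area P \<rho> R \<and> rho_area P \<rho> R < \<infinity>}"
  then have r: "r \<in> borel_measurable borel" "rho_area P r R \<noteq> 0" "rho_area P r R \<noteq> \<infinity>" by auto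
  have "(INF c\<in>connecting_curves P (bdry P 0) \<beta> R. rho_length P r c)\<^sup>2 / rho_area P r R
     \<le> ennreal (6 * cosh (1/2) * k) * rho_area P r R / rho_area P r R"
    by (rule divide_right_mono_ennreal[OF length_area[OF r(1)]])
  also have "\<dots> = ennreal (6 * cosh (1/2) * k)"
    using r by (intro ennreal_mult_divide_eq) auto
  finally show "(INF c\<in>connecting_curves P (bdry P 0) \<beta> R. rho_length P r c)\<^sup>2 / rho_area P r R
     \<le> ennreal (6 * cosh (1/2) * k)" .
qed

end

section \<open>Minkowski geometry of lines\<close>

lemma mink_nondegenerate:
  assumes "\<And>y. mink r y = 0" shows "r = 0"
proof -
  have "mink r (- fst r, snd r) = fst r * fst r + snd r \<bullet> snd r" by (simp add: mink_def)
  then have "fst r * fst r + snd r \<bullet> snd r = 0" using assms by simp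
  moreover have "snd r \<bullet> snd r \<ge> 0" "fst r * fst r \<ge> 0" by simp_all
  ultimately have "fst r * fst r = 0" "snd r \<bullet> snd r = 0" by linarith+
  then show ?thesis by (simp add: prod_eq_iff)
qed

text \<open>Three orthonormal vectors span, since the space has dimension three.\<close>

lemma mink_expansion:
  assumes o: "mink p p = - 1" "mink v v = 1" "mink n n = 1" "mink p v = 0" "mink p n = 0" "mink v n = 0"
  shows "x = (- mink x p) *\<^sub>R p + mink x v *\<^sub>R v + mink x n *\<^sub>R n"
proof -
  have o': "mink v p = 0" "mink n p = 0" "mink n v = 0" using o by (auto simp: mink_commute)
  have d: "p \<noteq> v" "p \<noteq> n" "v \<noteq> n" using o o' by auto
  have ind: "independent {p, v, n}"
  proof (rule independent_if_scalars_zero)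
    fix f y assume s: "(\<Sum>y\<in>{p, v, n}. f y *\<^sub>R y) = 0" and y: "y \<in> {p, v, n}"
    have e: "f p *\<^sub>R p + f v *\<^sub>R v + f n *\<^sub>R n = 0" using s d by (simp add: add.assoc)
    have "mink (f p *\<^sub>R p + f v *\<^sub>R v + f n *\<^sub>R n) p = - f p"
      "mink (f p *\<^sub>R p + f v *\<^sub>R v + f n *\<^sub>R n) v = f v" "mink (f p *\<^sub>R p + f v *\<^sub>R v + f n *\<^sub>R n) n = f n"
      using o o' by simp_all
    then show "f y = 0" using y unfolding e by auto
  qed simp
  have "dim (UNIV :: (real \<times> complex) set) \<le> card {p, v, n}" using d by (simp add: dim_UNIV)
  then have sp: "UNIV \<subseteq> span {p, v, n}" by (intro card_ge_dim_independent[OF _ ind]) auto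
  define r where "r = x - ((- mink x p) *\<^sub>R p + mink x v *\<^sub>R v + mink x n *\<^sub>R n)"
  have r: "mink r p = 0" "mink r v = 0" "mink r n = 0" using o o' by (simp_all add: r_def)
  have "mink r y = 0" for y
  proof -
    have "y \<in> span {p, v, n}" using sp by blast
    then show ?thesis
    proof (induction rule: span_induct_alt)
      case (step c z y)
      then have "mink r z = 0" using r by auto
      then show ?case using step by simp
    qed simp
  qed
  then have "r = 0" by (rule mink_nondegenerate)
  then show ?thesis by (simp add: r_def)
qed

lemma coords_mink_le:
  assumes "hyp_coords Y" "norm z < 1" "norm z' < 1" shows "mink (Y z) (Y z') \<le> - 1"
proof -
  have "2 * (norm (z - z'))\<^sup>2 / ((1 - (norm z)\<^sup>2) * (1 - (norm z')\<^sup>2)) \<ge> 0"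
    using hyp_pos[OF assms(2)] hyp_pos[OF assms(3)] by simp
  then show ?thesis unfolding coords_mink[OF assms] mink_hyp_dist[OF assms(2,3)] by linarith
qed

lemma point_on_line:
  assumes Y: "hyp_coords Y" and l: "hyp_line Y h p v" and z: "norm z < 1" and e: "Y z = x *\<^sub>R p + y *\<^sub>R v"
  obtains \<sigma> where "h \<sigma> = z" "sinh \<sigma> = y" "cosh \<sigma> = x"
proof -
  have pv: "mink p p = - 1" "mink v v = 1" "mink p v = 0" "mink v p = 0"
    using l by (auto simp: hyp_line_def mink_commute)
  have "mink (Y z) (Y (h 0)) = - x" unfolding e hyp_line_0[OF l] by (simp add: pv)
  then have x: "x \<ge> 1" using coords_mink_le[OF Y z hyp_line_in_disc[OF l], of 0] by simp
  have "mink (Y z) (Y z) = - 1" by (rule coords_self[OF Y z])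
  then have xy: "x * x = 1 + y * y" unfolding e by (simp add: pv)
  define \<sigma> where "\<sigma> = arsinh y"
  have s: "sinh \<sigma> = y" by (simp add: \<sigma>_def)
  have "(cosh \<sigma>)\<^sup>2 = x\<^sup>2" unfolding cosh_square_eq s using xy by (simp add: power2_eq_square)
  then have c: "cosh \<sigma> = x" using x by (simp add: power2_eq_iff_nonneg)
  have "Y (h \<sigma>) = Y z" using hyp_line_at[OF l, of \<sigma>] by (simp add: s c e)
  then have "h \<sigma> = z" using coords_inject[OF Y hyp_line_in_disc[OF l] z] by blast
  then show ?thesis using that s c by blast
qed

context pants_surface
begin

lemma deck_mink:
  assumes "hyp_coords Y" "f \<in> deck P" "norm z < 1" "norm z' < 1"
  shows "mink (Y (f z)) (Y (f z')) = mink (Y z) (Y z')"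
proof -
  obtain \<theta> w where w: "norm w < 1" "\<And>z. norm z < 1 \<Longrightarrow> f z = Moebius_function \<theta> w z"
    using deck_moebius[OF assms(2)] by metis
  have "mink (Y (f z)) (Y (f z')) = mink (hyp (f z)) (hyp (f z'))"
    using coords_mink assms deck_in_disc by blast
  also have "\<dots> = mink (hyp z) (hyp z')"
    using w assms(3,4) by (simp add: hyp_moebius mink_lorentz)
  finally show ?thesis using coords_mink assms by metis
qed

lemma deck_geodesic:
  assumes "f \<in> deck P" "unit_geodesic h" shows "unit_geodesic (\<lambda>t. f (h t))"
proof -
  obtain \<theta> w where w: "norm w < 1" "\<And>z. norm z < 1 \<Longrightarrow> f z = Moebius_function \<theta> w z"
    using deck_moebius[OF assms(1)] by metis
  have "(\<lambda>t. f (h t)) = (\<lambda>t. Moebius_function \<theta> w (h t))"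
    using w(2) unit_geodesic_in_disc[OF assms(2)] by auto
  then show ?thesis using unit_geodesic_moebius[OF assms(2) w(1)] by simp
qed

lemma deck_point_line:
  assumes Y: "hyp_coords Y" and f: "f \<in> deck P" and z: "norm z < 1"
    and l: "hyp_line Y h p v" "hyp_line Y (\<lambda>t. f (h t)) p' v'"
  shows "mink (Y (f z)) p' = mink (Y z) p" "mink (Y (f z)) v' = mink (Y z) v"
proof -
  have e: "mink (Y (f z)) (Y (f (h t))) = mink (Y z) (Y (h t))" for t
    by (rule deck_mink[OF Y f z hyp_line_in_disc[OF l(1)]])
  show 1: "mink (Y (f z)) p' = mink (Y z) p" using e[of 0] hyp_line_0[OF l(1)] hyp_line_0[OF l(2)] by simp
  have "mink (Y (f z)) (cosh 1 *\<^sub>R p' + sinh 1 *\<^sub>R v') = mink (Y z) (cosh 1 *\<^sub>R p + sinh 1 *\<^sub>R v)"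
    using e[of 1] hyp_line_at[OF l(1), of 1] hyp_line_at[OF l(2), of 1] by simp
  then show "mink (Y (f z)) v' = mink (Y z) v" using 1 by simp
qed

lemma deck_line_line:
  assumes Y: "hyp_coords Y" and f: "f \<in> deck P"
    and l: "hyp_line Y h p v" "hyp_line Y (\<lambda>t. f (h t)) p' v'"
    and m: "hyp_line Y k q u" "hyp_line Y (\<lambda>t. f (k t)) q' u'"
  shows "mink v' u' = mink v u" "mink v' q' = mink v q" "mink p' q' = mink p q"
proof -
  have 1: "mink (Y (f (h t))) u' = mink (Y (h t)) u" "mink (Y (f (h t))) q' = mink (Y (h t)) q" for t
    using deck_point_line[OF Y f hyp_line_in_disc[OF l(1)] m] by blast+
  have 2: "mink p' u' = mink p u" "mink p' q' = mink p q"
    using 1[of 0] hyp_line_0[OF l(1)] hyp_line_0[OF l(2)] by simp_all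
  then show "mink p' q' = mink p q" by simp
  have "mink (cosh 1 *\<^sub>R p' + sinh 1 *\<^sub>R v') u' = mink (cosh 1 *\<^sub>R p + sinh 1 *\<^sub>R v) u"
    "mink (cosh 1 *\<^sub>R p' + sinh 1 *\<^sub>R v') q' = mink (cosh 1 *\<^sub>R p + sinh 1 *\<^sub>R v) q"
    using 1[of 1] hyp_line_at[OF l(1), of 1] hyp_line_at[OF l(2), of 1] by simp_all
  then show "mink v' u' = mink v u" "mink v' q' = mink v q" using 2 by simp_all
qed

text \<open>
  With points of the cover on both sides of a boundary geodesic, the convex hull of these points and the
  geodesic would be a neighbourhood of a point of the geodesic, which projects to a boundary circle.
\<close>

lemma one_sided:
  assumes l: "is_lift P i (Geod c)" and i: "i \<in> {0, 1, 2}" and Y: "hyp_coords Y" and h: "hyp_line Y c p v"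
    and n: "mink n n = 1" "mink p n = 0" "mink v n = 0" and z0: "z0 \<in> cover P" "mink (Y z0) n > 0"
    and z: "z \<in> cover P"
  shows "mink (Y z) n \<ge> 0"
proof (rule ccontr)
  assume "\<not> mink (Y z) n \<ge> 0"
  then have neg: "mink (Y z) n < 0" by simp
  have cc: "c t \<in> cover P" for t using l by auto
  have pv: "mink p p = - 1" "mink v v = 1" "mink p v = 0" using h by (auto simp: hyp_line_def)
  \<comment> \<open>\<open>F\<close> is positive near the geodesic; there \<open>y\<close> lies on a segment from the geodesic to \<open>z0\<close> or \<open>z\<close>.\<close>
  define b where "b = (\<lambda>y. if mink (Y y) n \<ge> 0 then z0 else z)"
  define \<beta> where "\<beta> = (\<lambda>y. if mink (Y y) n \<ge> 0 then mink (Y y) n / mink (Y z0) n else mink (Y y) n / mink (Y z) n)"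
  define M where "M = (\<bar>mink (Y z0) p\<bar> + \<bar>mink (Y z0) v\<bar>) / \<bar>mink (Y z0) n\<bar> + (\<bar>mink (Y z) p\<bar> + \<bar>mink (Y z) v\<bar>) / \<bar>mink (Y z) n\<bar>"
  define F where "F = (\<lambda>y. - mink (Y y) p - \<bar>mink (Y y) v\<bar> - \<bar>mink (Y y) n\<bar> * M)"
  have cY: "continuous_on hdisc (\<lambda>y. mink (Y y) q)" for q
    unfolding mink_def by (intro continuous_intros coords_continuous[OF Y])
  have cF: "continuous_on hdisc F" unfolding F_def by (intro continuous_intros cY)
  have "open (hdisc \<inter> F -` {0<..})" by (rule continuous_open_preimage[OF cF]) auto
  moreover have "c 0 \<in> hdisc \<inter> F -` {0<..}"
    using hyp_line_in_disc[OF h, of 0] pv n by (simp add: F_def hyp_line_0[OF h])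
  moreover have "hdisc \<inter> F -` {0<..} \<subseteq> cover P"
  proof
    fix y assume "y \<in> hdisc \<inter> F -` {0<..}"
    then have y: "norm y < 1" "F y > 0" by auto
    have bc: "b y \<in> cover P" using z0 z by (simp add: b_def)
    have bn: "mink (Y (b y)) n \<noteq> 0" using z0 neg by (auto simp: b_def)
    have \<beta>: "\<beta> y \<ge> 0" "\<beta> y = mink (Y y) n / mink (Y (b y)) n" "\<beta> y * \<bar>mink (Y (b y)) n\<bar> = \<bar>mink (Y y) n\<bar>"
      using z0 neg by (auto simp: \<beta>_def b_def divide_simps)
    define X where "X = Y y - \<beta> y *\<^sub>R Y (b y)"
    have Xn: "mink X n = 0" using bn by (simp add: X_def \<beta>(2))
    have "\<bar>\<beta> y * mink (Y (b y)) p\<bar> + \<bar>\<beta> y * mink (Y (b y)) v\<bar> \<le> \<bar>mink (Y y) n\<bar> * M"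
    proof -
      have "\<beta> y = \<bar>mink (Y y) n\<bar> / \<bar>mink (Y (b y)) n\<bar>" using \<beta>(3) bn by (simp add: field_simps)
      then have "\<bar>\<beta> y * mink (Y (b y)) p\<bar> + \<bar>\<beta> y * mink (Y (b y)) v\<bar>
        = \<bar>mink (Y y) n\<bar> * ((\<bar>mink (Y (b y)) p\<bar> + \<bar>mink (Y (b y)) v\<bar>) / \<bar>mink (Y (b y)) n\<bar>)"
        by (simp add: abs_mult add_divide_distrib distrib_left)
      also have "\<dots> \<le> \<bar>mink (Y y) n\<bar> * M"
        unfolding M_def by (intro mult_left_mono) (auto simp: b_def)
      finally show ?thesis .
    qed
    then have tl: "- mink X p > \<bar>mink X v\<bar>"
      using y(2) by (simp add: F_def X_def abs_le_iff)
    define s where "s = (mink X p)\<^sup>2 - (mink X v)\<^sup>2"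
    have "\<bar>mink X v\<bar>\<^sup>2 < (- mink X p)\<^sup>2" using tl by (intro power_strict_mono) auto
    then have s: "s > 0" by (simp add: s_def)
    define \<alpha> where "\<alpha> = sqrt s"
    have \<alpha>: "\<alpha> > 0" "\<alpha>\<^sup>2 = s" using s by (auto simp: \<alpha>_def)
    define \<sigma> where "\<sigma> = arsinh (mink X v / \<alpha>)"
    have sh: "\<alpha> * sinh \<sigma> = mink X v" using \<alpha> by (simp add: \<sigma>_def)
    have "(\<alpha> * cosh \<sigma>)\<^sup>2 = \<alpha>\<^sup>2 + (\<alpha> * sinh \<sigma>)\<^sup>2"
      unfolding power_mult_distrib cosh_square_eq by (simp add: algebra_simps)
    also have "\<dots> = (- mink X p)\<^sup>2" unfolding sh \<alpha>(2) s_def by simp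
    finally have ch: "\<alpha> * cosh \<sigma> = - mink X p" using \<alpha>(1) tl power2_eq_iff_nonneg[of "\<alpha> * cosh \<sigma>" "- mink X p"] by simp
    have "X = (- mink X p) *\<^sub>R p + mink X v *\<^sub>R v"
      using mink_expansion[OF pv(1,2) n(1) pv(3) n(2,3), of X] Xn by simp
    also have "\<dots> = \<alpha> *\<^sub>R Y (c \<sigma>)"
      unfolding hyp_line_at[OF h] ch[symmetric] sh[symmetric] by (simp add: scaleR_add_right)
    finally have "Y y = \<alpha> *\<^sub>R Y (c \<sigma>) + \<beta> y *\<^sub>R Y (b y)" by (simp add: X_def algebra_simps)
    then show "y \<in> cover P"
      by (rule hconvex_combination[OF cover_hconvex Y cc bc y(1)]) (use \<alpha> \<beta> in auto)
  qed
  ultimately have "c 0 \<in> interior (cover P)" by (meson interior_maximal subsetD)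
  then have "proj P (c 0) \<notin> bdry P i" by (rule bdry_not_interior[OF _ i])
  moreover have "proj P (c 0) \<in> bdry P i" using l by (auto simp: image_subset_iff)
  ultimately show False by blast
qed

text \<open>
  If the horoballs were not preserved, iterating the transformation or its inverse would push a point into
  arbitrarily small horoballs and thus, in the pants, arbitrarily close to the puncture; but all its
  translates have the same projection.
\<close>

lemma cusp_parabolic:
  assumes f: "f \<in> deck P" and cl: "cusp_lift P i \<xi>" and i: "i \<in> punct P" "i \<in> {0, 1, 2}" and l: "\<kappa> > 0"
    and sc: "\<And>z. norm z < 1 \<Longrightarrow>
      (norm (f z - \<xi>))\<^sup>2 / (1 - (norm (f z))\<^sup>2) = \<kappa> * ((norm (z - \<xi>))\<^sup>2 / (1 - (norm z)\<^sup>2))"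
  shows "\<kappa> = 1"
proof -
  have nx: "norm \<xi> = 1" using cl by (simp add: cusp_lift_def)
  obtain r where r: "0 < r" "r < 1" "horoball \<xi> r \<subseteq> cover P"
    "\<And>\<epsilon>. \<epsilon> > 0 \<Longrightarrow> \<exists>s. 0 < s \<and> s \<le> r \<and> proj P ` horoball \<xi> s \<subseteq> {x. dist x (ctr P i) < rad P i + \<epsilon>}"
    using cl unfolding cusp_lift_def by blast
  define \<phi> where "\<phi> = (\<lambda>z. (norm (z - \<xi>))\<^sup>2 / (1 - (norm z)\<^sup>2))"
  define z where "z = of_real (1 - r) * \<xi>"
  have "z \<in> horoball \<xi> r" using r by (simp add: z_def horoball_def)
  then have zc: "z \<in> cover P" using r by blast
  have zn: "norm z < 1" by (rule cover_norm[OF zc])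
  have contra: False if g: "g \<in> deck P" and \<mu>: "0 < \<mu>" "\<mu> < 1" and gs: "\<And>z. norm z < 1 \<Longrightarrow> \<phi> (g z) = \<mu> * \<phi> z" for g \<mu>
  proof -
    have it: "\<exists>h\<in>deck P. \<forall>z. norm z < 1 \<longrightarrow> \<phi> (h z) = \<mu> ^ m * \<phi> z" for m
    proof (induction m)
      case 0
      have "\<forall>z. norm z < 1 \<longrightarrow> \<phi> (restrict id hdisc z) = \<mu> ^ 0 * \<phi> z" by simp
      then show ?case using deck_id by blast
    next
      case (Suc m)
      then obtain h where h: "h \<in> deck P" "\<And>z. norm z < 1 \<Longrightarrow> \<phi> (h z) = \<mu> ^ m * \<phi> z" by blast
      obtain k where k: "k \<in> deck P" "\<And>z. norm z < 1 \<Longrightarrow> k z = g (h z)" using deck_compose[OF g h(1)] by metis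
      have "\<phi> (k z) = \<mu> ^ Suc m * \<phi> z" if "norm z < 1" for z
        using k(2)[OF that] gs[OF deck_in_disc[OF h(1) that]] h(2)[OF that] by simp
      then show ?case using k(1) by blast
    qed
    define \<epsilon> where "\<epsilon> = dist (ctr P i) (proj P z) - rad P i"
    have "\<epsilon> > 0" using pts_dist(2)[OF proj_in_pts[OF zc] i(2) i(1)] by (simp add: \<epsilon>_def)
    then obtain s where s: "0 < s" "s \<le> r" "proj P ` horoball \<xi> s \<subseteq> {x. dist x (ctr P i) < rad P i + \<epsilon>}"
      using r(4) by blast
    have "(\<lambda>m. \<mu> ^ m * \<phi> z) \<longlonglongrightarrow> 0 * \<phi> z" using \<mu> by (intro tendsto_intros LIMSEQ_power_zero) auto
    moreover have "0 < s / (1 - s)" using s r by simp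
    ultimately have "\<forall>\<^sub>F m in sequentially. \<mu> ^ m * \<phi> z < s / (1 - s)" by (intro order_tendstoD(2)) auto
    then obtain m where m: "\<mu> ^ m * \<phi> z < s / (1 - s)" by (auto simp: eventually_sequentially)
    obtain h where h: "h \<in> deck P" "\<phi> (h z) = \<mu> ^ m * \<phi> z" using it[of m] zn by blast
    have "h z \<in> horoball \<xi> s"
      using horoball_iff[OF nx s(1) _ deck_in_disc[OF h(1) zn]] s r h(2) m by (simp add: \<phi>_def)
    then have "dist (proj P (h z)) (ctr P i) < rad P i + \<epsilon>" using s(3) by blast
    then show False using proj_deck[OF h(1) zc] by (simp add: \<epsilon>_def dist_commute)
  qed
  have "\<not> \<kappa> < 1" using contra[OF f l] sc by (auto simp: \<phi>_def)
  moreover have "\<not> \<kappa> > 1"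
  proof
    assume "\<kappa> > 1"
    obtain g where g: "g \<in> deck P" "\<And>z. norm z < 1 \<Longrightarrow> f (g z) = z" using deck_inverse[OF f] by metis
    have "\<phi> (g z) = 1 / \<kappa> * \<phi> z" if "norm z < 1" for z
      using sc[OF deck_in_disc[OF g(1) that]] g(2)[OF that] l by (simp add: \<phi>_def field_simps)
    then show False using contra[OF g(1), of "1 / \<kappa>"] \<open>\<kappa> > 1\<close> by simp
  qed
  ultimately show ?thesis by linarith
qed

text \<open>
  Products with a null vector measure horoballs, so preserving the horoballs at a cusp means fixing the
  vector that represents it.
\<close>

lemma cusp_parabolic_vector:
  assumes f: "f \<in> deck P" and cl: "cusp_lift P i \<xi>" and i: "i \<in> punct P" "i \<in> {0, 1, 2}"
    and Y: "norm w < 1" "\<And>z. norm z < 1 \<Longrightarrow> Y z = lorentz \<theta> w (hyp z)"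
    and n: "n = C *\<^sub>R lorentz \<theta> w (1, \<xi>)" "C > 0" and l: "\<mu> > 0" "\<mu>' > 0"
    and sc: "\<And>z. norm z < 1 \<Longrightarrow> \<mu>' * mink (Y (f z)) n = \<mu> * mink (Y z) n"
  shows "\<mu>' = \<mu>"
proof -
  have nx: "norm \<xi> = 1" using cl by (simp add: cusp_lift_def)
  have m: "mink (Y z) n = - C * ((norm (z - \<xi>))\<^sup>2 / (1 - (norm z)\<^sup>2))" if "norm z < 1" for z
    using that Y n by (simp add: mink_lorentz mink_ideal[OF nx])
  have "\<mu> / \<mu>' = 1"
  proof (rule cusp_parabolic[OF f cl i])
    fix z :: complex assume z: "norm z < 1"
    define a b where "a = (norm (f z - \<xi>))\<^sup>2 / (1 - (norm (f z))\<^sup>2)" and "b = (norm (z - \<xi>))\<^sup>2 / (1 - (norm z)\<^sup>2)"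
    have "\<mu>' * (- C * a) = \<mu> * (- C * b)"
      using sc[OF z] unfolding m[OF z] m[OF deck_in_disc[OF f z]] a_def b_def by simp
    then have "C * (\<mu>' * a) = C * (\<mu> * b)" by (simp add: mult_ac)
    then have "\<mu>' * a = \<mu> * b" using n(2) by simp
    then show "a = \<mu> / \<mu>' * b" using l by (simp add: field_simps)
  qed (use l in auto)
  then show ?thesis using l by simp
qed

end

section \<open>Geometry in the strip of a boundary geodesic\<close>

text \<open>
  The hyperboloid coordinates in which the real axis of the strip is the standard geodesic through \<open>(1, 0)\<close>.
\<close>

definition strip_coords :: "real \<Rightarrow> complex \<Rightarrow> complex \<Rightarrow> real \<times> complex" where
  "strip_coords \<theta> w z = hyp (Moebius_function (- \<theta>) (- cis \<theta> * w) z)"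

lemma strip_coords: "norm w < 1 \<Longrightarrow> hyp_coords (strip_coords \<theta> w)"
  using coords_moebius_inverse unfolding strip_coords_def by blast

lemma strip_coords_map:
  assumes "norm w < 1" "\<zeta> \<in> strip"
  shows "strip_coords \<theta> w (strip_map \<theta> w \<zeta>)
    = (cosh (Re \<zeta>) / cos (Im \<zeta>), Complex (sinh (Re \<zeta>) / cos (Im \<zeta>)) (sin (Im \<zeta>) / cos (Im \<zeta>)))"
  unfolding strip_coords_def strip_map_coords[OF assms] by (simp add: complex_eq_iff)

lemma strip_coords_Im:
  assumes "norm w < 1" "norm z < 1"
  shows "0 \<le> Im (snd (strip_coords \<theta> w z)) \<longleftrightarrow> 0 \<le> Im (strip_inv \<theta> w z)"
    "0 < Im (snd (strip_coords \<theta> w z)) \<longleftrightarrow> 0 < Im (strip_inv \<theta> w z)"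
proof -
  define \<zeta> where "\<zeta> = strip_inv \<theta> w z"
  have \<zeta>: "\<zeta> \<in> strip" "strip_map \<theta> w \<zeta> = z" unfolding \<zeta>_def by (rule strip_map_inv[OF assms])+
  have Y: "Im (snd (strip_coords \<theta> w z)) = sin (Im \<zeta>) / cos (Im \<zeta>)"
    using strip_coords_map[OF assms(1) \<zeta>(1), of \<theta>] \<zeta>(2) by simp
  have c: "cos (Im \<zeta>) > 0" by (rule strip_cos_pos[OF \<zeta>(1)])
  have b: "- pi / 2 < Im \<zeta>" "Im \<zeta> < pi / 2" using \<zeta>(1) by (auto simp: strip_def abs_less_iff)
  have pos: "0 < sin (Im \<zeta>)" if "0 < Im \<zeta>" using that b by (intro sin_gt_zero) auto
  have neg: "sin (Im \<zeta>) < 0" if "Im \<zeta> < 0" using that b sin_gt_zero[of "- Im \<zeta>"] by auto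
  show "0 \<le> Im (snd (strip_coords \<theta> w z)) \<longleftrightarrow> 0 \<le> Im (strip_inv \<theta> w z)"
    unfolding Y \<zeta>_def[symmetric] using c pos neg by (cases "Im \<zeta>" "0::real" rule: linorder_cases) (auto simp: zero_le_divide_iff)
  show "0 < Im (snd (strip_coords \<theta> w z)) \<longleftrightarrow> 0 < Im (strip_inv \<theta> w z)"
    unfolding Y \<zeta>_def[symmetric] using c pos neg by (cases "Im \<zeta>" "0::real" rule: linorder_cases) (auto simp: zero_less_divide_iff)
qed

lemma strip_map_reverse:
  assumes "norm w < 1" shows "strip_map (\<theta> + pi) (- w) \<zeta> = strip_map \<theta> w (- \<zeta>)"
proof -
  have "cis (\<theta> + pi) = - cis \<theta>" by (simp flip: cis_mult)
  moreover have "(exp (- \<zeta>) - 1) / (exp (- \<zeta>) + 1) = - ((exp \<zeta> - 1) / (exp \<zeta> + 1))"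
  proof -
    define E where "E = exp \<zeta>"
    have E: "E \<noteq> 0" by (simp add: E_def)
    have "(inverse E - 1) / (inverse E + 1) = (E * (inverse E - 1)) / (E * (inverse E + 1))" using E by simp
    also have "E * (inverse E - 1) = - (E - 1)" using E by (simp add: algebra_simps)
    also have "E * (inverse E + 1) = E + 1" using E by (simp add: algebra_simps)
    also have "- (E - 1) / (E + 1) = - ((E - 1) / (E + 1))" by (rule minus_divide_left[symmetric])
    finally show ?thesis by (simp add: exp_minus E_def)
  qed
  ultimately show ?thesis
    by (simp add: strip_map_def Moebius_function_def algebra_simps flip: cis_conv_exp)
qed

lemma meets_perp_reparam:
  assumes "meets_perp h r a t" "unit_geodesic a" "\<bar>\<epsilon>\<bar> = 1"
  shows "meets_perp h r (\<lambda>\<tau>. a (t1 + \<epsilon> * \<tau>)) (\<epsilon> * (t - t1))"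
proof -
  have ee: "\<epsilon> * \<epsilon> = 1" using assms(3) by (metis abs_mult_self_eq mult_1)
  then have e: "t1 + \<epsilon> * (\<epsilon> * (t - t1)) = t" by (simp flip: mult.assoc)
  obtain a' where a': "(a has_vector_derivative a') (at t)" using unit_geodesic_deriv[OF assms(2)] .
  have "((\<lambda>\<tau>. t1 + \<epsilon> * \<tau>) has_vector_derivative \<epsilon>) (at (\<epsilon> * (t - t1)))"
    by (auto intro!: derivative_eq_intros)
  from vector_diff_chain_at[OF this, of a a'] a'
  have "((\<lambda>\<tau>. a (t1 + \<epsilon> * \<tau>)) has_vector_derivative \<epsilon> *\<^sub>R a') (at (\<epsilon> * (t - t1)))"
    by (simp add: e o_def)
  then have "vector_derivative (\<lambda>\<tau>. a (t1 + \<epsilon> * \<tau>)) (at (\<epsilon> * (t - t1))) = \<epsilon> *\<^sub>R vector_derivative a (at t)"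
    using a' by (simp add: vector_derivative_at)
  then show ?thesis using assms(1) e by (simp add: meets_perp_def)
qed

context pants_surface
begin

text \<open>
  The cover lies on one side of the boundary geodesic; if it is the wrong side, the direction \<open>\<epsilon>\<close> of the
  parametrization is reversed.
\<close>

lemma boundary_frame:
  assumes l: "is_lift P i (Geod a)" and i: "i \<in> {0, 1, 2}"
  obtains \<theta> w \<epsilon> where "norm w < 1" "\<bar>\<epsilon>\<bar> = 1" "\<And>t. strip_map \<theta> w (of_real t) = a (t1 + \<epsilon> * t)"
    "\<And>z. z \<in> cover P \<Longrightarrow> 0 \<le> Im (strip_inv \<theta> w z)"
proof -
  have a: "unit_geodesic a" "range a \<subseteq> cover P" "i \<notin> punct P" "proj P ` range a \<subseteq> bdry P i" using l by auto
  have "unit_geodesic (\<lambda>t. a (t + t1))" by (rule unit_geodesic_shift[OF a(1)])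
  then obtain \<theta> w where w: "norm w < 1" and eq: "(\<lambda>t. a (t + t1)) = (\<lambda>t. Moebius_function \<theta> w (of_real (tanh (t / 2))))"
    by (auto simp: unit_geodesic_def)
  have m: "strip_map \<theta> w (of_real t) = a (t + t1)" for t
    unfolding strip_map_real using fun_cong[OF eq, of t] by simp
  show ?thesis
  proof (cases "\<exists>z0\<in>cover P. 0 < Im (strip_inv \<theta> w z0)")
    case True
    then obtain z0 where z0: "z0 \<in> cover P" "0 < Im (strip_inv \<theta> w z0)" by blast
    show ?thesis
    proof (rule that[of w 1 \<theta>])
      fix z assume z: "z \<in> cover P"
      have line: "hyp_line (strip_coords \<theta> w) (\<lambda>t. a (t + t1)) (1, 0) (0, 1)"
        unfolding hyp_line_def
      proof (intro conjI allI)
        fix t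
        show "norm (a (t + t1)) < 1" by (rule unit_geodesic_in_disc[OF a(1)])
        show "strip_coords \<theta> w (a (t + t1)) = cosh t *\<^sub>R (1, 0) + sinh t *\<^sub>R (0, 1)"
          using strip_coords_map[OF w, of "of_real t" \<theta>] unfolding m by (simp add: strip_def complex_eq_iff)
      qed (simp_all add: mink_def)
      have "range (\<lambda>t. a (t + t1)) \<subseteq> range a" by blast
      then have lift: "is_lift P i (Geod (\<lambda>t. a (t + t1)))"
        unfolding is_lift.simps using a unit_geodesic_shift[OF a(1), of t1] by blast
      have "mink (strip_coords \<theta> w z) (0, \<i>) \<ge> 0"
      proof (rule one_sided[OF lift i strip_coords[OF w] line _ _ _ z0(1) _ z])
        show "mink (strip_coords \<theta> w z0) (0, \<i>) > 0"
          using z0(2) strip_coords_Im(2)[OF w cover_norm[OF z0(1)]] by (simp add: mink_def inner_complex_def)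
      qed (simp_all add: mink_def inner_complex_def)
      then show "0 \<le> Im (strip_inv \<theta> w z)"
        using strip_coords_Im(1)[OF w cover_norm[OF z]] by (simp add: mink_def inner_complex_def)
    qed (use w m in \<open>auto simp: add.commute\<close>)
  next
    case False
    have w': "norm (- w) < 1" using w by simp
    show ?thesis
    proof (rule that[OF w', of "- 1" "\<theta> + pi"])
      show "strip_map (\<theta> + pi) (- w) (of_real t) = a (t1 + - 1 * t)" for t
        unfolding strip_map_reverse[OF w] using m[of "- t"] by simp
      fix z assume z: "z \<in> cover P"
      define \<zeta> where "\<zeta> = strip_inv \<theta> w z"
      have \<zeta>: "\<zeta> \<in> strip" "strip_map \<theta> w \<zeta> = z" unfolding \<zeta>_def by (rule strip_map_inv[OF w cover_norm[OF z]])+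
      have "strip_map (\<theta> + pi) (- w) (- \<zeta>) = z" unfolding strip_map_reverse[OF w] using \<zeta> by simp
      moreover have "- \<zeta> \<in> strip" using \<zeta> by (simp add: strip_def)
      ultimately have "strip_inv (\<theta> + pi) (- w) z = - \<zeta>" using strip_inv_map[OF w'] by metis
      moreover have "Im \<zeta> \<le> 0" using False z by (auto simp: \<zeta>_def not_less)
      ultimately show "0 \<le> Im (strip_inv (\<theta> + pi) (- w) z)" by simp
    qed simp
  qed
qed

end

text \<open>The strip coordinates of a boundary geodesic, with the cover above it.\<close>

locale boundary_strip = pants_surface P for P :: pants +
  fixes \<theta> :: real and w :: complex
  assumes w: "norm w < 1"
    and side: "\<And>z. z \<in> cover P \<Longrightarrow> 0 \<le> Im (strip_inv \<theta> w z)"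
    and base: "\<And>t. strip_map \<theta> w (of_real t) \<in> cover P \<and> proj P (strip_map \<theta> w (of_real t)) \<in> bdry P 0"
begin

abbreviation "\<Psi> \<equiv> strip_map \<theta> w"
abbreviation "\<Omega> \<equiv> strip_inv \<theta> w"
abbreviation "Y \<equiv> strip_coords \<theta> w"

lemmas disc = strip_map_in_disc[OF w, where \<theta> = \<theta>]
  and inv_map = strip_inv_map[OF w, where \<theta> = \<theta>] and map_inv = strip_map_inv[OF w, where \<theta> = \<theta>]
  and open_image = strip_map_open_image[OF w, where \<theta> = \<theta>]
  and Y = strip_coords[OF w, where \<theta> = \<theta>] and Y_map = strip_coords_map[OF w, where \<theta> = \<theta>]

lemma side_Y: "z \<in> cover P \<Longrightarrow> 0 \<le> Im (snd (Y z))"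
  using side strip_coords_Im(1)[OF w cover_norm] by blast

lemma base_line: "hyp_line Y (\<lambda>t. \<Psi> (of_real t)) (1, 0) (0, 1)"
  unfolding hyp_line_def
proof (intro conjI allI)
  fix t
  have r: "complex_of_real t \<in> strip" by (simp add: strip_def)
  show "norm (\<Psi> (of_real t)) < 1" by (rule disc[OF r])
  show "Y (\<Psi> (of_real t)) = cosh t *\<^sub>R (1, 0) + sinh t *\<^sub>R (0, 1)"
    unfolding Y_map[OF r] by (simp add: complex_eq_iff)
qed (simp_all add: mink_def)

lemma base_geodesic: "unit_geodesic (\<lambda>t. \<Psi> (of_real t))"
  unfolding unit_geodesic_def strip_map_real using w by blast

definition vertical :: "(real \<Rightarrow> complex) \<Rightarrow> real \<Rightarrow> bool" where
  "vertical h \<tau> \<longleftrightarrow> unit_geodesic h \<and> hyp_line Y h (cosh \<tau>, of_real (sinh \<tau>)) (0, \<i>)"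

lemma vertical_at: 
  assumes "vertical h \<tau>" shows "Y (h s) = (cosh s * cosh \<tau>, Complex (cosh s * sinh \<tau>) (sinh s))"
  using assms hyp_line_at[of Y h _ _ s] by (auto simp: vertical_def complex_eq_iff)

text \<open>
  Two orthogonality conditions determine the unit velocity up to sign; it points upwards because the
  geodesic enters the cover.
\<close>

lemma perp_base_vertical:
  assumes h: "unit_geodesic h" and m: "meets_perp h 0 (\<lambda>t. \<Psi> (of_real t)) \<tau>" and s: "s > 0" "h s \<in> cover P"
  shows "vertical h \<tau>"
proof -
  obtain p v where l: "hyp_line Y h p v" using coords_line[OF Y h] .
  note pp = hyp_line_perp[OF Y h l base_geodesic base_line m]
  have p: "p = (cosh \<tau>, of_real (sinh \<tau>))"
    using hyp_line_0[OF l] pp(2) hyp_line_at[OF base_line, of \<tau>] by (simp add: scaleR_conv_of_real)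
  obtain v0 v1 v2 where v: "v = (v0, Complex v1 v2)" by (metis complex.exhaust prod.exhaust)
  have 1: "- v0 * cosh \<tau> + v1 * sinh \<tau> = 0"
    using l unfolding hyp_line_def p v by (simp add: mink_def inner_complex_def mult.commute)
  have 2: "- v0 * sinh \<tau> + v1 * cosh \<tau> = 0"
    using pp(1) unfolding p v by (simp add: mink_def inner_complex_def mult.commute)
  have e: "cosh \<tau> * cosh \<tau> - sinh \<tau> * sinh \<tau> = 1" using hyperbolic_pythagoras[of \<tau>] by (simp add: power2_eq_square)
  have "v0 * (cosh \<tau> * cosh \<tau> - sinh \<tau> * sinh \<tau>)
     = - cosh \<tau> * (- v0 * cosh \<tau> + v1 * sinh \<tau>) + sinh \<tau> * (- v0 * sinh \<tau> + v1 * cosh \<tau>)" by (simp add: algebra_simps)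
  then have v0: "v0 = 0" unfolding 1 2 e by simp
  then have v1: "v1 = 0" using 2 by simp
  have "mink v v = 1" using l by (simp add: hyp_line_def)
  then have "v2 * v2 = 1" by (simp add: v v0 v1 mink_def inner_complex_def)
  then have "v2 = 1 \<or> v2 = - 1" by (simp add: square_eq_1_iff)
  moreover have "v2 \<noteq> - 1"
  proof
    assume "v2 = - 1"
    then have "Im (snd (Y (h s))) = - sinh s" using hyp_line_at[OF l, of s] by (simp add: p v v0 v1)
    then show False using side_Y[OF s(2)] s(1) by simp
  qed
  ultimately have "v = (0, \<i>)" by (simp add: v v0 v1 complex_eq_iff)
  then show ?thesis using h l p by (simp add: vertical_def)
qed

lemma connected_strip: "connected strip"
proof -
  have "strip = {\<zeta>. Im \<zeta> < pi / 2} \<inter> {\<zeta>. Im \<zeta> > - pi / 2}" by (auto simp: strip_def abs_less_iff)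
  moreover have "convex ({\<zeta>. Im \<zeta> < pi / 2} \<inter> {\<zeta>. Im \<zeta> > - pi / 2})"
    by (rule convex_Int[OF convex_halfspace_Im_lt convex_halfspace_Im_gt])
  ultimately show ?thesis by (simp only: convex_connected)
qed

text \<open>Both sides are holomorphic in \<open>\<zeta>\<close> and agree on the real axis.\<close>

lemma deck_strip_translation:
  assumes f: "f \<in> deck P" and ft: "\<And>t. f (\<Psi> (of_real t)) = \<Psi> (of_real (t + c))" and z: "\<zeta> \<in> strip"
  shows "f (\<Psi> \<zeta>) = \<Psi> (\<zeta> + of_real c)"
proof -
  obtain D where D: "\<And>\<zeta>. \<zeta> \<in> strip \<Longrightarrow> (\<Psi> has_field_derivative D \<zeta>) (at \<zeta>)"
    using strip_map_deriv[OF w] by metis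
  have hol: "\<Psi> holomorphic_on strip" using D open_strip by (metis holomorphic_on_open)
  obtain \<theta>1 w1 where m: "norm w1 < 1" "\<And>z. norm z < 1 \<Longrightarrow> f z = Moebius_function \<theta>1 w1 z"
    using deck_moebius[OF f] by metis
  define G where "G = (\<lambda>\<zeta>. Moebius_function \<theta>1 w1 (\<Psi> \<zeta>) - \<Psi> (\<zeta> + of_real c))"
  have "(Moebius_function \<theta>1 w1 \<circ> \<Psi>) holomorphic_on strip"
    by (rule holomorphic_on_compose_gen[OF hol Moebius_function_holomorphic[OF m(1)]]) (use disc in auto)
  moreover have "(\<Psi> \<circ> (\<lambda>\<zeta>. \<zeta> + of_real c)) holomorphic_on strip"
    by (rule holomorphic_on_compose_gen[OF _ hol]) (auto intro!: holomorphic_intros simp: shift_strip)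
  ultimately have G: "G holomorphic_on strip"
    unfolding G_def by (intro holomorphic_on_diff) (simp_all add: o_def)
  have lim: "(0::complex) islimpt (of_real ` UNIV)"
    unfolding islimpt_approachable
  proof (intro allI impI)
    fix e :: real assume "e > 0"
    then show "\<exists>x'\<in>of_real ` UNIV. x' \<noteq> (0::complex) \<and> dist x' 0 < e"
      by (intro bexI[of _ "of_real (e / 2)"] imageI UNIV_I) auto
  qed
  have "G \<zeta> = 0"
  proof (rule analytic_continuation[OF G open_strip connected_strip _ _ lim _ z])
    show "of_real ` UNIV \<subseteq> strip" "(0::complex) \<in> strip" by (auto simp: strip_def)
    fix x :: complex assume "x \<in> of_real ` UNIV"
    then obtain t :: real where x: "x = of_real t" by auto
    have "norm (\<Psi> (of_real t)) < 1" by (rule disc) (simp add: strip_def)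
    then show "G x = 0" using ft[of t] m(2) by (simp add: G_def x)
  qed
  then show ?thesis using m(2)[OF disc[OF z]] by (simp add: G_def)
qed

text \<open>
  The image of the base line is orthogonal to a vertical line at its foot, so it is the base line again.
  Its direction cannot be reversed: a reflection of the base line has a fixed point, but the deck group
  acts freely.
\<close>

lemma deck_vertical_translation:
  assumes f: "f \<in> deck P" and d: "vertical d 0" and d': "vertical (\<lambda>t. f (d t)) c" and z: "\<zeta> \<in> strip"
  shows "f (\<Psi> \<zeta>) = \<Psi> (\<zeta> + of_real c)"
proof -
  let ?b = "\<lambda>t. \<Psi> (of_real t)"
  have l: "hyp_line Y d (1, 0) (0, \<i>)" "hyp_line Y (\<lambda>t. f (d t)) (cosh c, of_real (sinh c)) (0, \<i>)"
    using d d' by (auto simp: vertical_def)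
  have ug: "unit_geodesic (\<lambda>t. f (?b t))" by (rule deck_geodesic[OF f base_geodesic])
  obtain p v where lb: "hyp_line Y (\<lambda>t. f (?b t)) p v" using coords_line[OF Y ug] .
  have b0: "?b 0 = d 0"
    using coords_inject[OF Y hyp_line_in_disc[OF base_line] hyp_line_in_disc[OF l(1)]]
      hyp_line_0[OF base_line] hyp_line_0[OF l(1)] by metis
  have p: "p = (cosh c, of_real (sinh c))" using hyp_line_0[OF lb] hyp_line_0[OF l(2)] b0 by simp
  obtain v0 v1 v2 where v: "v = (v0, Complex v1 v2)" by (metis complex.exhaust prod.exhaust)
  have 1: "mink v (0, \<i>) = 0"
    using deck_line_line(1)[OF Y f base_line lb l] by (simp add: mink_def inner_complex_def)
  then have v2: "v2 = 0" by (simp add: v mink_def inner_complex_def)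
  have "mink p v = 0" "mink v v = 1" using lb by (auto simp: hyp_line_def)
  then have 2: "v0 * cosh c = v1 * sinh c" "v1 * v1 - v0 * v0 = 1"
    by (auto simp: p v v2 mink_def inner_complex_def algebra_simps)
  have e: "cosh c * cosh c - sinh c * sinh c = 1" using hyperbolic_pythagoras[of c] by (simp add: power2_eq_square)
  have "v1 * v1 = (cosh c * cosh c) * (v1 * v1 - v0 * v0) + ((v0 * cosh c) * (v0 * cosh c) - (v1 * v1) * (cosh c * cosh c - 1))"
    by (simp add: algebra_simps)
  also have "(v0 * cosh c) * (v0 * cosh c) = (v1 * v1) * (sinh c * sinh c)" unfolding 2(1) by simp
  also have "sinh c * sinh c = cosh c * cosh c - 1" using e by simp
  finally have "v1 * v1 = cosh c * cosh c" using 2(2) by simp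
  then have v1: "v1 = cosh c \<or> v1 = - cosh c" by (simp add: square_eq_iff)
  have v0: "v0 = r * sinh c" if "v1 = r * cosh c" for r
  proof -
    have "v0 * cosh c = (r * sinh c) * cosh c" using 2(1) that by simp
    then show ?thesis by (simp only: mult_right_cancel[OF cosh_real_nonzero])
  qed
  have "v = (sinh c, of_real (cosh c)) \<or> v = (- sinh c, - of_real (cosh c))"
    using v1 v0[of 1] v0[of "- 1"] by (auto simp: v v2 complex_eq_iff)
  moreover have "v \<noteq> (- sinh c, - of_real (cosh c))"
  proof
    assume vm: "v = (- sinh c, - of_real (cosh c))"
    have Yf: "Y (f (?b t)) = Y (?b (c - t))" for t
      unfolding hyp_line_at[OF lb] hyp_line_at[OF base_line] p vm
      by (simp add: cosh_diff sinh_diff scaleR_conv_of_real algebra_simps)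
    have fb: "f (?b t) = ?b (c - t)" for t
      by (rule coords_inject[OF Y hyp_line_in_disc[OF lb] hyp_line_in_disc[OF base_line] Yf])
    have "f (?b (c / 2)) = ?b (c / 2)" using fb[of "c / 2"] by simp
    then have "f (?b t) = ?b t" for t
      by (rule deck_free'[OF f hyp_line_in_disc[OF base_line] _ hyp_line_in_disc[OF base_line]])
    then have "?b (c / 2 + 1) = ?b (c - (c / 2 + 1))" using fb by metis
    then have "c / 2 + 1 = c - (c / 2 + 1)" by (rule hyp_line_inj[OF Y base_line])
    then show False by simp
  qed
  ultimately have vv: "v = (sinh c, of_real (cosh c))" by blast
  have Yf: "Y (f (?b t)) = Y (?b (t + c))" for t
    unfolding hyp_line_at[OF lb] hyp_line_at[OF base_line] p vv
    by (simp add: cosh_add sinh_add scaleR_conv_of_real algebra_simps)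
  have "f (?b t) = ?b (t + c)" for t
    by (rule coords_inject[OF Y hyp_line_in_disc[OF lb] hyp_line_in_disc[OF base_line] Yf])
  then show ?thesis by (rule deck_strip_translation[OF f _ z])
qed

text \<open>
  In the projective model the curves \<open>sin \<theta> = y cosh (t - \<tau>1)\<close> are chords joining two vertical lines.
\<close>

lemma quad_in_hull:
  assumes K: "hconvex K" and h1: "vertical h1 \<tau>1" and h2: "vertical h2 \<tau>2" and ne: "\<tau>1 \<noteq> \<tau>2"
    and z: "\<zeta> \<in> strip" "(Re \<zeta> - \<tau>1) * (\<tau>2 - Re \<zeta>) \<ge> 0"
    and s1: "tanh s1 * cosh (Re \<zeta> - \<tau>1) = sin (Im \<zeta>)" "h1 s1 \<in> K"
    and s2: "tanh s2 = tanh s1 * cosh (\<tau>2 - \<tau>1)" "h2 s2 \<in> K"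
  shows "\<Psi> \<zeta> \<in> K"
proof -
  define t D where "t = Re \<zeta>" and "D = sinh (\<tau>2 - \<tau>1)"
  define C where "C = cos (Im \<zeta>)"
  have C: "C > 0" unfolding C_def by (rule strip_cos_pos[OF z(1)])
  have D: "D \<noteq> 0" using ne by (simp add: D_def)
  define \<alpha> \<beta> where "\<alpha> = sinh (\<tau>2 - t) / D / C / cosh s1" and "\<beta> = sinh (t - \<tau>1) / D / C / cosh s2"
  have pos: "sinh (\<tau>2 - t) / D \<ge> 0 \<and> sinh (t - \<tau>1) / D \<ge> 0"
  proof (cases "\<tau>1 < \<tau>2")
    case True
    then have "t - \<tau>1 \<ge> 0" "\<tau>2 - t \<ge> 0" using z(2) by (auto simp: t_def zero_le_mult_iff)
    then show ?thesis using True by (auto simp: D_def intro!: divide_nonneg_nonneg)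
  next
    case False
    then have "t - \<tau>1 \<le> 0" "\<tau>2 - t \<le> 0" using z(2) ne by (auto simp: t_def zero_le_mult_iff)
    then show ?thesis using False ne by (auto simp: D_def intro!: divide_nonpos_nonpos)
  qed
  have ab: "\<alpha> \<ge> 0" "\<beta> \<ge> 0"
    unfolding \<alpha>_def \<beta>_def
    using divide_nonneg_pos[OF divide_nonneg_pos[OF conjunct1[OF pos] C] cosh_real_pos]
      divide_nonneg_pos[OF divide_nonneg_pos[OF conjunct2[OF pos] C] cosh_real_pos] by blast+
  have id: "sinh (\<tau>2 - t) * cosh \<tau>1 + sinh (t - \<tau>1) * cosh \<tau>2 = cosh t * D"
    "sinh (\<tau>2 - t) * sinh \<tau>1 + sinh (t - \<tau>1) * sinh \<tau>2 = sinh t * D"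
    "sinh (\<tau>2 - t) + sinh (t - \<tau>1) * cosh (\<tau>2 - \<tau>1) = cosh (t - \<tau>1) * D"
  proof -
    have e: "cosh y * cosh y = 1 + sinh y * sinh y" for y :: real
      using cosh_square_eq[of y] by (simp add: power2_eq_square)
    show "sinh (\<tau>2 - t) * cosh \<tau>1 + sinh (t - \<tau>1) * cosh \<tau>2 = cosh t * D"
      "sinh (\<tau>2 - t) * sinh \<tau>1 + sinh (t - \<tau>1) * sinh \<tau>2 = sinh t * D"
      by (simp_all add: D_def sinh_diff algebra_simps)
    have "sinh ((\<tau>2 - \<tau>1) - (t - \<tau>1)) = D * cosh (t - \<tau>1) - cosh (\<tau>2 - \<tau>1) * sinh (t - \<tau>1)"
      unfolding D_def by (rule sinh_diff)
    then show "sinh (\<tau>2 - t) + sinh (t - \<tau>1) * cosh (\<tau>2 - \<tau>1) = cosh (t - \<tau>1) * D"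
      by (simp add: algebra_simps)
  qed
  have ca: "\<alpha> * cosh s1 = sinh (\<tau>2 - t) / D / C" "\<beta> * cosh s2 = sinh (t - \<tau>1) / D / C"
    by (simp_all add: \<alpha>_def \<beta>_def)
  have sa: "\<alpha> * sinh s1 = sinh (\<tau>2 - t) / D / C * tanh s1" "\<beta> * sinh s2 = sinh (t - \<tau>1) / D / C * tanh s2"
    by (simp_all add: \<alpha>_def \<beta>_def tanh_def)
  have "Y (\<Psi> \<zeta>) = \<alpha> *\<^sub>R Y (h1 s1) + \<beta> *\<^sub>R Y (h2 s2)"
  proof -
    have "\<alpha> * (cosh s1 * cosh \<tau>1) + \<beta> * (cosh s2 * cosh \<tau>2)
        = (sinh (\<tau>2 - t) * cosh \<tau>1 + sinh (t - \<tau>1) * cosh \<tau>2) / D / C"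
      using ca by (simp add: add_divide_distrib flip: mult.assoc)
    then have 1: "\<alpha> * (cosh s1 * cosh \<tau>1) + \<beta> * (cosh s2 * cosh \<tau>2) = cosh t / C" unfolding id using D by simp
    have "\<alpha> * (cosh s1 * sinh \<tau>1) + \<beta> * (cosh s2 * sinh \<tau>2)
        = (sinh (\<tau>2 - t) * sinh \<tau>1 + sinh (t - \<tau>1) * sinh \<tau>2) / D / C"
      using ca by (simp add: add_divide_distrib flip: mult.assoc)
    then have 2: "\<alpha> * (cosh s1 * sinh \<tau>1) + \<beta> * (cosh s2 * sinh \<tau>2) = sinh t / C" unfolding id using D by simp
    have "\<alpha> * sinh s1 + \<beta> * sinh s2 = tanh s1 * (sinh (\<tau>2 - t) + sinh (t - \<tau>1) * cosh (\<tau>2 - \<tau>1)) / D / C"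
      unfolding sa s2(1) by (simp add: add_divide_distrib algebra_simps)
    then have 3: "\<alpha> * sinh s1 + \<beta> * sinh s2 = sin (Im \<zeta>) / C"
      unfolding id using D s1(1) by (simp add: t_def)
    show ?thesis
      unfolding Y_map[OF z(1)] vertical_at[OF h1] vertical_at[OF h2]
      using 1 2 3 by (simp add: complex_eq_iff t_def C_def)
  qed
  then show ?thesis
    by (rule hconvex_combination[OF K Y s1(2) s2(2) disc[OF z(1)]]) (use ab in auto)
qed

text \<open>The perpendicular to \<open>d\<close> at height \<open>x\<close> is the curve \<open>sin \<theta> = tanh x cosh t\<close>.\<close>

definition horizontal :: "(real \<Rightarrow> complex) \<Rightarrow> real \<Rightarrow> bool" where
  "horizontal p x \<longleftrightarrow> unit_geodesic p \<and> hyp_line Y p (cosh x, Complex 0 (sinh x)) (0, 1)"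

lemma perp_horizontal:
  assumes d: "vertical d 0" and p: "unit_geodesic p" and l0: "hyp_line Y p p0 v0"
    and pp: "mink (sinh m *\<^sub>R p0 + cosh m *\<^sub>R v0) (sinh x *\<^sub>R (1, 0) + cosh x *\<^sub>R (0, \<i>)) = 0" "p m = d x"
  obtains \<epsilon> where "\<bar>\<epsilon>\<bar> = 1" "horizontal (\<lambda>\<sigma>. p (m + \<epsilon> * \<sigma>)) x"
proof -
  have ld: "hyp_line Y d (1, 0) (0, \<i>)" using d by (auto simp: vertical_def)
  define q where "q = (\<lambda>\<sigma>. p (\<sigma> + m))"
  have uq: "unit_geodesic q" unfolding q_def by (rule unit_geodesic_shift[OF p])
  obtain v where l: "hyp_line Y q (cosh m *\<^sub>R p0 + sinh m *\<^sub>R v0) v" and v: "v = sinh m *\<^sub>R p0 + cosh m *\<^sub>R v0"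
    using hyp_line_shift[OF l0, of m] unfolding q_def by blast
  have pe: "cosh m *\<^sub>R p0 + sinh m *\<^sub>R v0 = (cosh x, Complex 0 (sinh x))"
  proof -
    have "cosh m *\<^sub>R p0 + sinh m *\<^sub>R v0 = Y (d x)" using hyp_line_at[OF l0, of m] pp(2) by simp
    also have "\<dots> = (cosh x, Complex 0 (sinh x))" using hyp_line_at[OF ld, of x] by (simp add: complex_eq_iff)
    finally show ?thesis .
  qed
  note l = l[unfolded pe]
  obtain v1 v2 v3 where v': "v = (v1, Complex v2 v3)" by (metis complex.exhaust prod.exhaust)
  have 1: "- v1 * cosh x + v3 * sinh x = 0"
    using l unfolding hyp_line_def v' by (simp add: mink_def inner_complex_def mult.commute)
  have 2: "- v1 * sinh x + v3 * cosh x = 0"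
    using pp(1) unfolding v[symmetric] v' by (simp add: mink_def inner_complex_def mult.commute)
  have e: "cosh x * cosh x - sinh x * sinh x = 1" using hyperbolic_pythagoras[of x] by (simp add: power2_eq_square)
  have "v1 * (cosh x * cosh x - sinh x * sinh x)
     = - cosh x * (- v1 * cosh x + v3 * sinh x) + sinh x * (- v1 * sinh x + v3 * cosh x)" by (simp add: algebra_simps)
  then have v1: "v1 = 0" unfolding 1 2 e by simp
  then have v3: "v3 = 0" using 2 by simp
  have "mink v v = 1" using l by (simp add: hyp_line_def)
  then have "v2 * v2 = 1" by (simp add: v' v1 v3 mink_def inner_complex_def)
  then have "v2 = 1 \<or> v2 = - 1" by (simp add: square_eq_1_iff)
  then show ?thesis
  proof
    assume "v2 = 1"
    then have "horizontal (\<lambda>\<sigma>. p (m + 1 * \<sigma>)) x"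
      using l uq by (simp add: horizontal_def q_def v' v1 v3 add.commute complex_eq_iff one_complex.code)
    then show ?thesis by (intro that[of 1]) auto
  next
    assume "v2 = - 1"
    then have "v = (0, - 1)" by (simp add: v' v1 v3 complex_eq_iff)
    then have "horizontal (\<lambda>\<sigma>. q (- \<sigma>)) x"
      using hyp_line_reverse[OF l] unit_geodesic_reverse[OF uq] by (simp add: horizontal_def)
    then have "horizontal (\<lambda>\<sigma>. p (m + (- 1) * \<sigma>)) x" by (simp add: q_def add.commute)
    then show ?thesis by (intro that[of "- 1"]) auto
  qed
qed

lemma horizontal_at:
  assumes "horizontal p x" shows "Y (p \<sigma>) = (cosh \<sigma> * cosh x, Complex (sinh \<sigma>) (cosh \<sigma> * sinh x))"
  using assms hyp_line_at[of Y p _ _ \<sigma>] by (auto simp: horizontal_def complex_eq_iff)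

lemma horizontal_graph:
  assumes p: "horizontal p x" and z: "\<zeta> \<in> strip" "\<Psi> \<zeta> = p \<sigma>"
  shows "sin (Im \<zeta>) = tanh x * cosh (Re \<zeta>)" "tanh (Re \<zeta>) = tanh \<sigma> / cosh x"
proof -
  define C where "C = cos (Im \<zeta>)"
  have C: "C > 0" unfolding C_def by (rule strip_cos_pos[OF z(1)])
  have e: "cosh (Re \<zeta>) / C = cosh \<sigma> * cosh x" "sinh (Re \<zeta>) / C = sinh \<sigma>" "sin (Im \<zeta>) / C = cosh \<sigma> * sinh x"
    using Y_map[OF z(1)] horizontal_at[OF p, of \<sigma>] z(2) by (auto simp: C_def complex_eq_iff)
  then have e': "cosh (Re \<zeta>) = C * (cosh \<sigma> * cosh x)" "sinh (Re \<zeta>) = C * sinh \<sigma>" "sin (Im \<zeta>) = C * (cosh \<sigma> * sinh x)"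
    using C by (auto simp: field_simps)
  show "sin (Im \<zeta>) = tanh x * cosh (Re \<zeta>)" unfolding e' by (simp add: tanh_def)
  show "tanh (Re \<zeta>) = tanh \<sigma> / cosh x" using C by (simp add: tanh_def e')
qed

lemma graph_horizontal:
  assumes p: "horizontal p x" and z: "\<zeta> \<in> strip" "sin (Im \<zeta>) = tanh x * cosh (Re \<zeta>)"
  obtains \<sigma> where "p \<sigma> = \<Psi> \<zeta>" "tanh (Re \<zeta>) = tanh \<sigma> / cosh x"
proof -
  define C where "C = cos (Im \<zeta>)"
  have C: "C > 0" unfolding C_def by (rule strip_cos_pos[OF z(1)])
  have l: "hyp_line Y p (cosh x, Complex 0 (sinh x)) (0, 1)" using p by (simp add: horizontal_def)
  have "Y (\<Psi> \<zeta>) = (cosh (Re \<zeta>) / C / cosh x) *\<^sub>R (cosh x, Complex 0 (sinh x)) + (sinh (Re \<zeta>) / C) *\<^sub>R (0, 1)"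
    unfolding Y_map[OF z(1)] using z(2) by (simp add: C_def complex_eq_iff tanh_def mult.commute)
  then obtain \<sigma> where s: "p \<sigma> = \<Psi> \<zeta>" using point_on_line[OF Y l disc[OF z(1)]] by metis
  then show ?thesis using that horizontal_graph(2)[OF p z(1), of \<sigma>] by metis
qed

end

section \<open>The two hexagons in the strip\<close>

lemma tanh_ext_le_1: "l > 0 \<Longrightarrow> tanh_ext l \<le> 1"
  using tanh_real_lt_1 by (auto simp: tanh_ext_def less_imp_le)

lemma tanh_ext_pos: "l > 0 \<Longrightarrow> tanh_ext l > 0"
  by (cases l) (auto simp: tanh_ext_def)

lemma tanh_less_ext:
  assumes "l > 0" "0 \<le> y" "y < tanh_ext l"
  obtains s where "tanh s = y" "0 \<le> s" "ereal s \<le> l"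
proof -
  have "\<bar>y\<bar> < 1" using assms tanh_ext_le_1[OF assms(1)] by linarith
  then obtain s where s: "tanh s = y" using tanh_surj by blast
  moreover have "0 \<le> s" using s assms(2) tanh_real_nonneg_iff by blast
  moreover have "ereal s \<le> l" using s assms by (cases l) (auto simp: tanh_ext_def)
  ultimately show ?thesis by (rule that)
qed

lemma tanh_ext_mono: "0 < x \<Longrightarrow> ereal x \<le> l \<Longrightarrow> tanh x \<le> tanh_ext l"
  using tanh_real_lt_1[of x] by (cases l) (auto simp: tanh_ext_def less_imp_le)

lemma abs_tanh_le_iff: "\<bar>tanh s\<bar> \<le> \<bar>tanh t\<bar> \<longleftrightarrow> \<bar>s\<bar> \<le> \<bar>t::real\<bar>"
  using tanh_real_le_iff[of "\<bar>s\<bar>" "\<bar>t\<bar>"] by (simp only: tanh_real_abs)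

context boundary_strip
begin

lemma vertical_strip:
  assumes "vertical h \<tau>"
  obtains \<phi> where "Complex \<tau> \<phi> \<in> strip" "h s = \<Psi> (Complex \<tau> \<phi>)" "sin \<phi> = tanh s"
proof -
  define \<phi> where "\<phi> = arcsin (tanh s)"
  have b: "- 1 < tanh s" "tanh s < 1" using tanh_real_lt_1 tanh_real_gt_neg1 by auto
  have \<phi>: "- pi / 2 < \<phi>" "\<phi> < pi / 2" "sin \<phi> = tanh s"
    using arcsin_lt_bounded[OF b] b by (auto simp: \<phi>_def)
  have "(cos \<phi>)\<^sup>2 = (1 / cosh s)\<^sup>2"
  proof -
    have "(cosh s)\<^sup>2 - (sinh s)\<^sup>2 = 1" by (rule hyperbolic_pythagoras)
    moreover have "1 - (tanh s)\<^sup>2 = ((cosh s)\<^sup>2 - (sinh s)\<^sup>2) / (cosh s)\<^sup>2"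
      by (simp add: tanh_def power_divide diff_divide_distrib)
    ultimately have "1 - (tanh s)\<^sup>2 = (1 / cosh s)\<^sup>2" by (simp only: power_divide power_one)
    then show ?thesis unfolding cos_squared_eq \<phi>(3) .
  qed
  moreover have "cos \<phi> > 0" using \<phi> by (intro cos_gt_zero_pi) auto
  ultimately have c: "cos \<phi> = 1 / cosh s" using power2_eq_iff_nonneg[of "cos \<phi>" "1 / cosh s"] by simp
  have st: "Complex \<tau> \<phi> \<in> strip" using \<phi> by (simp add: strip_def abs_less_iff)
  have "Y (h s) = Y (\<Psi> (Complex \<tau> \<phi>))"
    unfolding Y_map[OF st] vertical_at[OF assms] using \<phi>(3) c by (simp add: tanh_def mult.commute)
  then have "h s = \<Psi> (Complex \<tau> \<phi>)"
    using coords_inject[OF Y _ disc[OF st]] assms hyp_line_in_disc by (metis vertical_def)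
  then show ?thesis using that st \<phi>(3) by blast
qed

text \<open>
  A point of the region is on a chord \<open>sin \<theta> = y cosh (t - \<tau>1)\<close> between the two verticals; the bounds on \<open>\<kappa>\<close> ensure
  that the ends of the chord lie on the given arcs.
\<close>

lemma region_in_hull:
  assumes K: "hconvex K" and h1: "vertical h1 \<tau>1" "arc_of h1 0 l1 \<subseteq> K" "l1 > 0"
    and h2: "vertical h2 \<tau>2" "arc_of h2 0 l2 \<subseteq> K" "l2 > 0" and ne: "\<tau>1 \<noteq> \<tau>2"
    and \<kappa>: "\<kappa> \<le> tanh_ext l1" "\<kappa> * cosh (\<tau>2 - \<tau>1) \<le> tanh_ext l2"
    and z: "\<zeta> \<in> strip" "0 \<le> Im \<zeta>" "(Re \<zeta> - \<tau>1) * (\<tau>2 - Re \<zeta>) \<ge> 0" "sin (Im \<zeta>) < \<kappa> * cosh (Re \<zeta> - \<tau>1)"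
  shows "\<Psi> \<zeta> \<in> K"
proof -
  define y where "y = sin (Im \<zeta>) / cosh (Re \<zeta> - \<tau>1)"
  have "sin (Im \<zeta>) \<ge> 0" using z(1,2) by (intro sin_ge_zero) (auto simp: strip_def)
  then have y: "0 \<le> y" "y < \<kappa>" using z(4) by (auto simp: y_def divide_less_eq)
  obtain s1 where s1: "tanh s1 = y" "0 \<le> s1" "ereal s1 \<le> l1" using tanh_less_ext[OF h1(3) y(1)] y(2) \<kappa>(1) by force
  have "y * cosh (\<tau>2 - \<tau>1) < \<kappa> * cosh (\<tau>2 - \<tau>1)" using y(2) by simp
  then have "y * cosh (\<tau>2 - \<tau>1) < tanh_ext l2" using \<kappa>(2) by linarith
  moreover have "0 \<le> y * cosh (\<tau>2 - \<tau>1)" using y(1) by simp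
  ultimately obtain s2 where s2: "tanh s2 = y * cosh (\<tau>2 - \<tau>1)" "0 \<le> s2" "ereal s2 \<le> l2" using tanh_less_ext[OF h2(3)] by blast
  have "h1 s1 \<in> K" "h2 s2 \<in> K" using s1 s2 h1(2) h2(2) by (auto simp: arc_of_def params_def)
  then show ?thesis
    using s1(1) s2(1) by (intro quad_in_hull[OF K h1(1) h2(1) ne z(1,3)]) (auto simp: y_def)
qed

text \<open>
  The perpendicular from a point over \<open>\<tau>\<close> to \<open>d\<close> is one half of the upper side of a cell of half-width \<open>|\<tau>|\<close>; the
  height of the point determines the height \<open>x\<close> of the foot.
\<close>

lemma horizontal_arc:
  assumes \<epsilon>: "\<bar>\<epsilon>\<bar> = 1" and p: "horizontal (\<lambda>\<sigma>. p (m + \<epsilon> * \<sigma>)) x" and m: "m > 0"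
    and st: "Complex \<tau> \<phi> \<in> strip" "p 0 = \<Psi> (Complex \<tau> \<phi>)"
  shows "sin \<phi> = tanh x * cosh \<tau>" "\<tau> \<noteq> 0"
    "\<And>s. 0 \<le> s \<Longrightarrow> s \<le> m \<Longrightarrow> p s \<in> cover P \<Longrightarrow> \<exists>\<zeta>\<in>cell_top \<bar>\<tau>\<bar> (tanh x). p s = \<Psi> \<zeta>"
    "\<And>\<zeta>. \<zeta> \<in> cell_top \<bar>\<tau>\<bar> (tanh x) \<Longrightarrow> Re \<zeta> * \<tau> \<ge> 0 \<Longrightarrow> \<exists>s. 0 \<le> s \<and> s \<le> m \<and> p s = \<Psi> \<zeta>"
proof -
  have ee: "\<epsilon> * \<epsilon> = 1" using \<epsilon> by (metis abs_mult_self_eq mult_1)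
  define s0 where "s0 = - \<epsilon> * m"
  have es: "\<epsilon> * s0 = - m" using ee by (simp add: s0_def flip: mult.assoc)
  have p0: "p (m + \<epsilon> * s0) = \<Psi> (Complex \<tau> \<phi>)" using st(2) es by simp
  note hg = horizontal_graph[OF p st(1), of s0, OF p0[symmetric]]
  show "sin \<phi> = tanh x * cosh \<tau>" using hg(1) by simp
  have t0: "tanh \<tau> = tanh s0 / cosh x" using hg(2) by simp
  have "s0 \<noteq> 0" using m es by auto
  then show nz: "\<tau> \<noteq> 0" using t0 by auto
  have as0: "\<bar>s0\<bar> = m" using \<epsilon> m by (simp add: s0_def abs_mult)
  show "\<exists>\<zeta>\<in>cell_top \<bar>\<tau>\<bar> (tanh x). p s = \<Psi> \<zeta>" if s: "0 \<le> s" "s \<le> m" "p s \<in> cover P" for s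
  proof -
    define \<sigma> where "\<sigma> = \<epsilon> * (s - m)"
    have e: "m + \<epsilon> * \<sigma> = s" using ee by (simp add: \<sigma>_def flip: mult.assoc)
    define \<zeta> where "\<zeta> = \<Omega> (p s)"
    have z: "\<zeta> \<in> strip" "\<Psi> \<zeta> = p s" "0 \<le> Im \<zeta>"
      unfolding \<zeta>_def using map_inv[OF cover_norm[OF s(3)]] side[OF s(3)] by auto
    note h = horizontal_graph[OF p z(1), of \<sigma>, unfolded e, OF z(2)]
    have "\<bar>\<sigma>\<bar> \<le> \<bar>s0\<bar>" using s \<epsilon> unfolding as0 by (simp add: \<sigma>_def abs_mult)
    then have "\<bar>tanh \<sigma>\<bar> \<le> \<bar>tanh s0\<bar>" by (simp only: abs_tanh_le_iff)
    then have "\<bar>tanh (Re \<zeta>)\<bar> \<le> \<bar>tanh \<tau>\<bar>" unfolding h(2) t0 by (simp add: divide_right_mono)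
    then have "\<bar>Re \<zeta>\<bar> \<le> \<bar>\<tau>\<bar>" by (simp only: abs_tanh_le_iff)
    then have "\<zeta> \<in> cell_top \<bar>\<tau>\<bar> (tanh x)" using z h(1) by (simp add: cell_top_def)
    then show ?thesis using z(2) by force
  qed
  show "\<exists>s. 0 \<le> s \<and> s \<le> m \<and> p s = \<Psi> \<zeta>" if z: "\<zeta> \<in> cell_top \<bar>\<tau>\<bar> (tanh x)" "Re \<zeta> * \<tau> \<ge> 0" for \<zeta>
  proof -
    have zs: "\<zeta> \<in> strip" "sin (Im \<zeta>) = tanh x * cosh (Re \<zeta>)" "\<bar>Re \<zeta>\<bar> \<le> \<bar>\<tau>\<bar>" using z by (auto simp: cell_top_def)
    obtain \<sigma> where \<sigma>: "p (m + \<epsilon> * \<sigma>) = \<Psi> \<zeta>" "tanh (Re \<zeta>) = tanh \<sigma> / cosh x"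
      using graph_horizontal[OF p zs(1,2)] by metis
    have "\<bar>tanh (Re \<zeta>)\<bar> \<le> \<bar>tanh \<tau>\<bar>" using zs(3) by (simp only: abs_tanh_le_iff)
    then have "\<bar>tanh \<sigma>\<bar> \<le> \<bar>tanh s0\<bar>" unfolding \<sigma>(2) t0 by (simp add: divide_le_cancel)
    then have a: "\<bar>\<sigma>\<bar> \<le> m" unfolding abs_tanh_le_iff as0 .
    have "\<sigma> * s0 \<ge> 0"
    proof -
      have t: "tanh \<sigma> = cosh x * tanh (Re \<zeta>)" "tanh s0 = cosh x * tanh \<tau>" using \<sigma>(2) t0 by auto
      have cx: "\<not> cosh x \<le> 0" by (simp add: not_le)
      have sg: "0 \<le> tanh \<sigma> \<longleftrightarrow> 0 \<le> Re \<zeta>" "tanh \<sigma> \<le> 0 \<longleftrightarrow> Re \<zeta> \<le> 0" "0 \<le> tanh s0 \<longleftrightarrow> 0 \<le> \<tau>" "tanh s0 \<le> 0 \<longleftrightarrow> \<tau> \<le> 0"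
        unfolding t by (auto simp: zero_le_mult_iff mult_le_0_iff cx)
      then show ?thesis using z(2) by (auto simp: zero_le_mult_iff)
    qed
    moreover have "\<epsilon> * \<sigma> * m = - (\<epsilon> * \<epsilon>) * 0 + - (\<sigma> * s0)" using ee by (simp add: s0_def mult_ac)
    ultimately have "\<epsilon> * \<sigma> * m \<le> 0" by simp
    then have "\<epsilon> * \<sigma> \<le> 0" using m by (simp add: mult_le_0_iff)
    moreover have "\<bar>\<epsilon> * \<sigma>\<bar> \<le> m" using a \<epsilon> by (simp add: abs_mult)
    ultimately show ?thesis using \<sigma>(1) by (intro exI[of _ "m + \<epsilon> * \<sigma>"]) auto
  qed
qed

end

text \<open>
  The two adjacent hexagons in strip coordinates: the lifts \<open>d\<close>, \<open>g\<close>, \<open>d'\<close> stand over \<open>0\<close>, \<open>\<delta>\<close>, \<open>c\<close>, and \<open>f\<close> carries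
  \<open>d\<close> to \<open>d'\<close>.
\<close>

locale split_pants = boundary_strip P \<theta> w for P :: pants and \<theta> :: real and w :: complex +
  fixes L \<delta> c x :: real and d g :: "real \<Rightarrow> complex" and lg ld :: ereal
    and f :: "complex \<Rightarrow> complex" and Q Q' :: "complex set"
  assumes L: "L > 1"
    and per: "\<And>s t. proj P (\<Psi> (of_real s)) = proj P (\<Psi> (of_real t)) \<longleftrightarrow> (\<exists>n::int. s - t = of_int n * L)"
    and vd: "vertical d 0" and vg: "vertical g \<delta>" and f: "f \<in> deck P" and vd': "vertical (\<lambda>t. f (d t)) c"
    and Q: "hconvex Q" "Q \<subseteq> cover P" "hconvex Q'" "Q' \<subseteq> cover P"
    and arcs: "arc_of d 0 ld \<subseteq> Q" "arc_of g 0 lg \<subseteq> Q" "arc_of (\<lambda>t. f (d t)) 0 ld \<subseteq> Q'" "arc_of g 0 lg \<subseteq> Q'"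
    and int: "interior Q \<inter> interior Q' = {}" "inj_on (proj P) (interior Q \<union> interior Q')"
    and len: "0 < ld" "0 < lg" "0 < x" "ereal x \<le> ld"
begin

lemmas f_shift = deck_vertical_translation[OF f vd vd']

lemma c_multiple: "\<exists>n::int. c = of_int n * L"
proof -
  have "f (\<Psi> (of_real 0)) = \<Psi> (of_real c)" using f_shift[of 0] by (simp add: strip_def)
  then have "proj P (\<Psi> (of_real c)) = proj P (\<Psi> (of_real 0))" using proj_deck[OF f] base by metis
  then show ?thesis using per[of c 0] by simp
qed

definition quad :: "real \<Rightarrow> real \<Rightarrow> real \<Rightarrow> complex set" where
  "quad \<tau>1 \<tau>2 \<kappa> = {\<zeta> \<in> strip. 0 < Im \<zeta> \<and> (Re \<zeta> - \<tau>1) * (\<tau>2 - Re \<zeta>) > 0 \<and> sin (Im \<zeta>) < \<kappa> * cosh (Re \<zeta> - \<tau>1)}"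

lemma open_quad: "open (quad \<tau>1 \<tau>2 \<kappa>)"
proof -
  have "quad \<tau>1 \<tau>2 \<kappa> = strip \<inter> {\<zeta>. 0 < Im \<zeta>} \<inter> {\<zeta>. (Re \<zeta> - \<tau>1) * (\<tau>2 - Re \<zeta>) > 0} \<inter> {\<zeta>. sin (Im \<zeta>) < \<kappa> * cosh (Re \<zeta> - \<tau>1)}"
    by (auto simp: quad_def)
  then show ?thesis by (auto intro!: open_Int open_strip open_Collect_less continuous_intros)
qed

lemma quad_interior:
  assumes "\<kappa> \<le> tanh_ext ld" "\<kappa> * cosh \<delta> \<le> tanh_ext lg" "\<delta> \<noteq> 0" "\<zeta> \<in> quad 0 \<delta> \<kappa>"
  shows "\<Psi> \<zeta> \<in> interior Q"
proof -
  have "open (\<Psi> ` quad 0 \<delta> \<kappa>)" by (rule open_image[OF open_quad]) (auto simp: quad_def)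
  moreover have "\<Psi> ` quad 0 \<delta> \<kappa> \<subseteq> Q"
    using assms by (auto intro!: region_in_hull[OF Q(1) vd arcs(1) len(1) vg arcs(2) len(2)] simp: quad_def)
  ultimately show ?thesis using assms(4) by (meson imageI interior_maximal subsetD)
qed

lemma quad_interior':
  assumes "\<kappa> \<le> tanh_ext ld" "\<kappa> * cosh (\<delta> - c) \<le> tanh_ext lg" "\<delta> \<noteq> c" "\<zeta> \<in> quad c \<delta> \<kappa>"
  shows "\<Psi> \<zeta> \<in> interior Q'"
proof -
  have "open (\<Psi> ` quad c \<delta> \<kappa>)" by (rule open_image[OF open_quad]) (auto simp: quad_def)
  moreover have "\<Psi> ` quad c \<delta> \<kappa> \<subseteq> Q'"
    using assms by (auto intro!: region_in_hull[OF Q(3) vd' arcs(3) len(1) vg arcs(4) len(2)] simp: quad_def)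
  ultimately show ?thesis using assms(4) by (meson imageI interior_maximal subsetD)
qed

lemma low_point:
  assumes "\<kappa> > 0" obtains \<eta> where "0 < \<eta>" "\<eta> < pi / 2" "sin \<eta> < \<kappa>"
proof -
  define \<eta> where "\<eta> = min (\<kappa> / 2) 1"
  have e: "0 < \<eta>" "\<eta> < \<kappa>" "\<eta> \<le> 1" using assms by (auto simp: \<eta>_def)
  have "sin \<eta> \<le> \<eta>" using e by (intro sin_x_le_x) auto
  moreover have "\<eta> < pi / 2" using e pi_half_gt_zero pi_gt3 by linarith
  ultimately show ?thesis using that e by force
qed

lemma kappa_exists: obtains \<kappa> where "\<kappa> > 0" "\<kappa> \<le> tanh_ext ld" "\<kappa> * cosh \<delta> \<le> tanh_ext lg"
proof (rule that)
  let ?k = "min (tanh_ext ld) (tanh_ext lg / cosh \<delta>)"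
  show "?k > 0" "?k \<le> tanh_ext ld" using tanh_ext_pos len by auto
  have "?k * cosh \<delta> \<le> tanh_ext lg / cosh \<delta> * cosh \<delta>" by (intro mult_right_mono) auto
  then show "?k * cosh \<delta> \<le> tanh_ext lg" by simp
qed

context
  assumes \<delta>0: "\<delta> \<noteq> 0" and cosh_eq: "cosh \<delta> = cosh (\<delta> - c)"
begin

text \<open>
  The symmetry leaves \<open>c = 0\<close> and \<open>c = 2 \<delta>\<close>; in the first case both hexagons would
  contain the points just above the segment from 0 to \<open>\<delta>\<close>.
\<close>

lemma c_eq: "c = 2 * \<delta>"
proof -
  have "c \<noteq> 0"
  proof
    assume c0: "c = 0"
    obtain \<kappa> where k: "\<kappa> > 0" "\<kappa> \<le> tanh_ext ld" "\<kappa> * cosh \<delta> \<le> tanh_ext lg" using kappa_exists .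
    obtain \<eta> where e: "0 < \<eta>" "\<eta> < pi / 2" "sin \<eta> < \<kappa>" using low_point[OF k(1)] .
    define \<zeta> where "\<zeta> = Complex (\<delta> / 2) \<eta>"
    have "\<kappa> * 1 \<le> \<kappa> * cosh (\<delta> / 2)" using k(1) cosh_real_ge_1 by (intro mult_left_mono) auto
    then have z: "\<zeta> \<in> quad 0 \<delta> \<kappa>" using e \<delta>0 by (simp add: \<zeta>_def quad_def strip_def flip: power2_eq_square)
    have "\<Psi> \<zeta> \<in> interior Q" "\<Psi> \<zeta> \<in> interior Q'"
      using quad_interior[OF k(2,3) \<delta>0 z] quad_interior'[of \<kappa> \<zeta>] k \<delta>0 z by (auto simp: c0)
    then show False using int(1) by blast
  qed
  moreover have "\<bar>\<delta>\<bar> = \<bar>\<delta> - c\<bar>" using cosh_eq by simp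
  ultimately show ?thesis by (auto simp: abs_if split: if_splits)
qed

text \<open>
  Translating by \<open>c\<close> the half of the cell on the side opposite to \<open>\<delta>\<close> moves it into the second hexagon, and the
  interiors of the two hexagons embed in the pants.
\<close>

lemma open_cell_inj:
  assumes k: "\<kappa> \<le> tanh_ext ld" "\<kappa> * cosh \<delta> \<le> tanh_ext lg"
    and z: "\<zeta> \<in> open_cell \<bar>\<delta>\<bar> \<kappa>" "\<eta> \<in> open_cell \<bar>\<delta>\<bar> \<kappa>" and eq: "proj P (\<Psi> \<zeta>) = proj P (\<Psi> \<eta>)"
    and cov: "\<Psi> \<zeta> \<in> cover P" "\<Psi> \<eta> \<in> cover P"
  shows "\<zeta> = \<eta>"
proof -
  define M where "M = (\<lambda>\<zeta>. if Re \<zeta> * \<delta> > 0 then \<zeta> else \<zeta> + of_real c)"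
  have dc: "\<delta> \<noteq> c" using c_eq \<delta>0 by simp
  have M: "\<Psi> (M \<zeta>) \<in> interior Q \<union> interior Q' \<and> M \<zeta> \<in> strip \<and> proj P (\<Psi> (M \<zeta>)) = proj P (\<Psi> \<zeta>)"
    if z: "\<zeta> \<in> open_cell \<bar>\<delta>\<bar> \<kappa>" "\<Psi> \<zeta> \<in> cover P" for \<zeta>
  proof (cases "Re \<zeta> * \<delta> > 0")
    case True
    have "Re \<zeta> * (\<delta> - Re \<zeta>) > 0"
    proof (cases "Re \<zeta> > 0")
      case True then show ?thesis using \<open>Re \<zeta> * \<delta> > 0\<close> z by (auto simp: open_cell_def zero_less_mult_iff)
    next
      case False then show ?thesis using \<open>Re \<zeta> * \<delta> > 0\<close> z by (auto simp: open_cell_def zero_less_mult_iff)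
    qed
    then have "\<zeta> \<in> quad 0 \<delta> \<kappa>" using z by (auto simp: open_cell_def quad_def)
    then show ?thesis using quad_interior[OF k \<delta>0] True z by (auto simp: M_def open_cell_def)
  next
    case False
    have zs: "\<zeta> \<in> strip" using z by (simp add: open_cell_def)
    have "Re \<zeta> * (- \<delta> - Re \<zeta>) > 0"
    proof (cases "Re \<zeta> > 0")
      case True
      then show ?thesis using False z \<delta>0 by (auto simp: open_cell_def zero_less_mult_iff not_less mult_le_0_iff)
    next
      case False
      then show ?thesis using \<open>\<not> Re \<zeta> * \<delta> > 0\<close> z \<delta>0 by (auto simp: open_cell_def zero_less_mult_iff not_less mult_le_0_iff)
    qed
    then have "\<zeta> + of_real c \<in> quad c \<delta> \<kappa>"
      using z by (auto simp: open_cell_def quad_def strip_def c_eq algebra_simps)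
    then have "\<Psi> (\<zeta> + of_real c) \<in> interior Q'"
      using quad_interior'[OF k(1) _ dc] k(2) cosh_eq by simp
    moreover have "proj P (\<Psi> (\<zeta> + of_real c)) = proj P (\<Psi> \<zeta>)"
      using f_shift[OF zs] proj_deck[OF f z(2)] by simp
    moreover have "\<zeta> + of_real c \<in> strip" using zs by (simp only: shift_strip)
    ultimately show ?thesis using False by (simp add: M_def)
  qed
  have "\<Psi> (M \<zeta>) = \<Psi> (M \<eta>)" using M[OF z(1) cov(1)] M[OF z(2) cov(2)] eq int(2) by (auto simp: inj_on_def)
  then have "M \<zeta> = M \<eta>" using M[OF z(1) cov(1)] M[OF z(2) cov(2)] inv_map by metis
  then consider "\<zeta> = \<eta>" | "\<zeta> = \<eta> + of_real c" | "\<eta> = \<zeta> + of_real c" by (auto simp: M_def split: if_splits)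
  then show ?thesis
  proof cases
    case 2
    then have "Re \<zeta> = Re \<eta> + 2 * \<delta>" by (simp add: c_eq)
    then show ?thesis using z by (auto simp: open_cell_def abs_less_iff)
  next
    case 3
    then have "Re \<eta> = Re \<zeta> + 2 * \<delta>" by (simp add: c_eq)
    then show ?thesis using z by (auto simp: open_cell_def abs_less_iff)
  qed
qed

lemma cell_in_cover:
  assumes k: "\<kappa> \<le> tanh_ext ld" "\<kappa> * cosh \<delta> \<le> tanh_ext lg" and z: "\<zeta> \<in> cell \<bar>\<delta>\<bar> \<kappa>"
  shows "\<Psi> \<zeta> \<in> cover P"
proof -
  have zs: "\<zeta> \<in> strip" "0 \<le> Im \<zeta>" "\<bar>Re \<zeta>\<bar> \<le> \<bar>\<delta>\<bar>" "sin (Im \<zeta>) < \<kappa> * cosh (Re \<zeta>)" using z by (auto simp: cell_def)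
  have dc: "c \<noteq> \<delta>" using c_eq \<delta>0 by simp
  consider "Re \<zeta> * (\<delta> - Re \<zeta>) \<ge> 0" | "Re \<zeta> * (- \<delta> - Re \<zeta>) \<ge> 0"
  proof -
    have "Re \<zeta> * (\<delta> - Re \<zeta>) \<ge> 0 \<or> Re \<zeta> * (- \<delta> - Re \<zeta>) \<ge> 0"
      using zs(3) by (auto simp: zero_le_mult_iff abs_if split: if_splits)
    then show ?thesis using that by blast
  qed
  then show ?thesis
  proof cases
    case 1
    then have "\<Psi> \<zeta> \<in> Q"
      using zs k by (intro region_in_hull[OF Q(1) vd arcs(1) len(1) vg arcs(2) len(2) \<delta>0[symmetric], of \<kappa>]) auto
    then show ?thesis using Q(2) by blast
  next
    case 2
    have "\<Psi> (\<zeta> + of_real c) \<in> Q'"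
    proof (rule region_in_hull[OF Q(3) vd' arcs(3) len(1) vg arcs(4) len(2) dc k(1)])
      show "\<zeta> + of_real c \<in> strip" using zs(1) by (simp only: shift_strip)
      show "\<kappa> * cosh (\<delta> - c) \<le> tanh_ext lg" using k(2) cosh_eq by simp
      show "0 \<le> (Re (\<zeta> + of_real c) - c) * (\<delta> - Re (\<zeta> + of_real c))" using 2 by (simp add: c_eq algebra_simps)
    qed (use zs in auto)
    then have "f (\<Psi> \<zeta>) \<in> cover P" using Q(4) f_shift[OF zs(1)] by auto
    then show ?thesis using deck_cover_iff[OF f disc[OF zs(1)]] by simp
  qed
qed

text \<open>
  A shift by \<open>c\<close> is a multiple of \<open>L\<close>.  If it were a proper multiple, two points of the open cell at distance \<open>L\<close>
  would have the same projection.
\<close>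

lemma abs_c: "L = 2 * \<bar>\<delta>\<bar>"
proof -
  obtain n :: int where n: "c = of_int n * L" using c_multiple by blast
  have c0: "c \<noteq> 0" using c_eq \<delta>0 by simp
  have "\<not> 2 \<le> \<bar>n\<bar>"
  proof
    assume "2 \<le> \<bar>n\<bar>"
    then have "2 * L \<le> of_int \<bar>n\<bar> * L" using L by (intro mult_right_mono) auto
    then have "2 * L \<le> \<bar>c\<bar>" using n L by (simp add: abs_mult)
    then have Ld: "L \<le> \<bar>\<delta>\<bar>" by (simp add: c_eq abs_mult)
    obtain \<kappa> where k: "\<kappa> > 0" "\<kappa> \<le> tanh_ext ld" "\<kappa> * cosh \<delta> \<le> tanh_ext lg" using kappa_exists .
    obtain \<eta> where e: "0 < \<eta>" "\<eta> < pi / 2" "sin \<eta> < \<kappa>" using low_point[OF k(1)] .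
    have oc: "Complex t \<eta> \<in> open_cell \<bar>\<delta>\<bar> \<kappa> \<and> Complex t \<eta> \<in> cell \<bar>\<delta>\<bar> \<kappa> \<and> Complex t \<eta> \<in> strip"
      if "0 < \<bar>t\<bar>" "\<bar>t\<bar> < \<bar>\<delta>\<bar>" for t
    proof -
      have "\<kappa> * 1 \<le> \<kappa> * cosh t" using k(1) cosh_real_ge_1 by (intro mult_left_mono) auto
      then show ?thesis using that e by (auto simp: open_cell_def cell_def strip_def)
    qed
    let ?z = "Complex (- L / 3) \<eta>" and ?y = "Complex (2 * L / 3) \<eta>"
    have z: "?z \<in> open_cell \<bar>\<delta>\<bar> \<kappa> \<and> ?z \<in> cell \<bar>\<delta>\<bar> \<kappa> \<and> ?z \<in> strip" and y: "?y \<in> open_cell \<bar>\<delta>\<bar> \<kappa> \<and> ?y \<in> cell \<bar>\<delta>\<bar> \<kappa> \<and> ?y \<in> strip"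
      by (rule oc; use L Ld in simp)+
    have "proj P (\<Psi> (of_real (t + L))) = proj P (\<Psi> (of_real t))" for t
      unfolding per by (intro exI[of _ 1]) simp
    moreover have "range (\<lambda>t. \<Psi> (of_real t)) \<subseteq> cover P" using base by blast
    ultimately obtain h where h: "h \<in> deck P" "\<And>t. h (\<Psi> (of_real t)) = \<Psi> (of_real (t + L))"
      using deck_translation[OF base_geodesic] by metis
    have "?z + of_real L = ?y" by (simp add: complex_eq_iff)
    then have "h (\<Psi> ?z) = \<Psi> ?y" using deck_strip_translation[OF h(1) h(2), of ?z] z by simp
    then have "proj P (\<Psi> ?z) = proj P (\<Psi> ?y)" using proj_deck[OF h(1)] cell_in_cover[OF k(2,3)] z by metis
    then have "?z = ?y" using open_cell_inj[OF k(2,3)] cell_in_cover[OF k(2,3)] z y by blast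
    then show False using L by simp
  qed
  moreover have "n \<noteq> 0" using n c0 by auto
  ultimately have "\<bar>n\<bar> = 1" by linarith
  then have "\<bar>c\<bar> = L" using n L by (auto simp: abs_mult abs_if split: if_splits)
  then show ?thesis by (simp add: c_eq abs_mult)
qed

text \<open>
  The cell lies in the cover because its two halves lie in \<open>Q\<close> and, after translation, in \<open>Q'\<close>.  Its top may lie
  on the boundary of the hexagons, and belongs to the cover because the cover is closed.
\<close>

lemma collar:
  assumes lam: "tanh x * cosh \<delta> = tanh_ext lg"
    and base_onto: "\<And>z. z \<in> cover P \<Longrightarrow> proj P z \<in> bdry P 0 \<Longrightarrow> \<exists>f\<in>deck P. \<exists>t. f z = \<Psi> (of_real t)"
    and b1: "\<beta> \<subseteq> (\<lambda>\<zeta>. proj P (\<Psi> \<zeta>)) ` cell_top \<bar>\<delta>\<bar> (tanh x)"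
    and b2: "\<And>\<zeta>. \<zeta> \<in> cell_top \<bar>\<delta>\<bar> (tanh x) \<Longrightarrow> \<bar>Re \<zeta>\<bar> < \<bar>\<delta>\<bar> \<Longrightarrow> proj P (\<Psi> \<zeta>) \<in> \<beta>"
    and R: "R \<in> components (pts P - (bdry P 0 \<union> \<beta>))" "bdry P 0 \<union> \<beta> \<subseteq> closure R"
  shows "collar P \<theta> w (L / 2) (tanh x) \<beta> R"
proof -
  have L2: "L / 2 = \<bar>\<delta>\<bar>" using abs_c by simp
  have k: "tanh x \<le> tanh_ext ld" "tanh x * cosh \<delta> \<le> tanh_ext lg"
    using tanh_ext_mono[OF len(3,4)] lam by auto
  have kp: "tanh x > 0" using len(3) by simp
  have kA: "tanh x * cosh \<bar>\<delta>\<bar> \<le> 1" using lam tanh_ext_le_1[OF len(2)] by simp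
  have A0: "\<bar>\<delta>\<bar> > 0" using \<delta>0 by simp
  have cc: "\<Psi> \<zeta> \<in> cover P" if "\<zeta> \<in> cell \<bar>\<delta>\<bar> (tanh x)" for \<zeta> by (rule cell_in_cover[OF k that])
  have oc: "open_cell \<bar>\<delta>\<bar> (tanh x) \<subseteq> cell \<bar>\<delta>\<bar> (tanh x)" by (auto simp: open_cell_def cell_def)
  have ct: "\<Psi> \<zeta> \<in> cover P" if z: "\<zeta> \<in> cell_top \<bar>\<delta>\<bar> (tanh x)" for \<zeta>
  proof (rule ccontr)
    assume n: "\<Psi> \<zeta> \<notin> cover P"
    have "geodesic_region (cover P)" using pants unfolding geodesic_pants_def by (elim conjE)
    then have "closedin (top_of_set hdisc) (cover P)" by (simp add: geodesic_region_def)
    then have "openin (top_of_set hdisc) (hdisc - cover P)" by (metis openin_diff openin_topspace topspace_euclidean_subtopology)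
    then have o: "open (hdisc - cover P)" using openin_open_eq[OF open_ball] by blast
    have zs: "\<zeta> \<in> strip" using z by (simp add: cell_top_def)
    have "open (strip \<inter> \<Psi> -` (hdisc - cover P))"
      by (rule continuous_open_preimage[OF continuous_strip_map[OF w] open_strip o])
    moreover have "\<zeta> \<in> strip \<inter> \<Psi> -` (hdisc - cover P)" using zs n disc[OF zs] by simp
    moreover have "\<zeta> \<in> closure (open_cell \<bar>\<delta>\<bar> (tanh x))" using cell_subset_closure[OF A0 kp kA] z by blast
    ultimately obtain \<eta> where "\<eta> \<in> open_cell \<bar>\<delta>\<bar> (tanh x)" "\<eta> \<in> strip \<inter> \<Psi> -` (hdisc - cover P)"
      using closure_meets by metis
    then show False using cc oc by blast
  qed
  have tr: "\<exists>h\<in>deck P. \<forall>\<zeta>\<in>strip. h (\<Psi> \<zeta>) = \<Psi> (\<zeta> + of_real (2 * \<bar>\<delta>\<bar>))"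
  proof (cases "\<delta> > 0")
    case True
    then show ?thesis using f f_shift by (auto simp: c_eq)
  next
    case False
    obtain h where h: "h \<in> deck P" "\<And>z. norm z < 1 \<Longrightarrow> h (f z) = z" using deck_inverse[OF f] by metis
    have "h (\<Psi> \<zeta>) = \<Psi> (\<zeta> + of_real (2 * \<bar>\<delta>\<bar>))" if z: "\<zeta> \<in> strip" for \<zeta>
    proof -
      have z': "\<zeta> + of_real (2 * \<bar>\<delta>\<bar>) \<in> strip" using z by (simp only: shift_strip)
      have "f (\<Psi> (\<zeta> + of_real (2 * \<bar>\<delta>\<bar>))) = \<Psi> \<zeta>" using f_shift[OF z'] False by (simp add: c_eq)
      then show ?thesis using h(2)[OF disc[OF z']] by simp
    qed
    then show ?thesis using h(1) by blast
  qed
  show ?thesis unfolding L2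
  proof unfold_locales
    show "norm w < 1" by (rule w)
    show "1 / 2 < \<bar>\<delta>\<bar>" using L L2 by simp
    show "tanh x * cosh \<bar>\<delta>\<bar> \<le> 1" "0 < tanh x" by (rule kA, rule kp)
    show "\<And>z. z \<in> cover P \<Longrightarrow> 0 \<le> Im (strip_inv \<theta> w z)" by (rule side)
    show "\<And>t. \<Psi> (of_real t) \<in> cover P \<and> proj P (\<Psi> (of_real t)) \<in> bdry P 0" by (rule base)
    show "\<And>z. z \<in> cover P \<Longrightarrow> proj P z \<in> bdry P 0 \<Longrightarrow> \<exists>f\<in>deck P. \<exists>t. f z = \<Psi> (of_real t)" by (rule base_onto)
    show "\<exists>f\<in>deck P. \<forall>\<zeta>\<in>strip. f (\<Psi> \<zeta>) = \<Psi> (\<zeta> + of_real (2 * \<bar>\<delta>\<bar>))" by (rule tr)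
    show "\<And>\<zeta>. \<zeta> \<in> cell \<bar>\<delta>\<bar> (tanh x) \<union> cell_top \<bar>\<delta>\<bar> (tanh x) \<Longrightarrow> \<Psi> \<zeta> \<in> cover P" using cc ct by blast
    show "\<And>\<zeta> \<eta>. \<zeta> \<in> open_cell \<bar>\<delta>\<bar> (tanh x) \<Longrightarrow> \<eta> \<in> open_cell \<bar>\<delta>\<bar> (tanh x) \<Longrightarrow> proj P (\<Psi> \<zeta>) = proj P (\<Psi> \<eta>) \<Longrightarrow> \<zeta> = \<eta>"
      using open_cell_inj[OF k] cc oc by blast
    show "\<beta> \<subseteq> (\<lambda>\<zeta>. proj P (\<Psi> \<zeta>)) ` cell_top \<bar>\<delta>\<bar> (tanh x)" by (rule b1)
    show "\<And>\<zeta>. \<zeta> \<in> cell_top \<bar>\<delta>\<bar> (tanh x) \<Longrightarrow> \<bar>Re \<zeta>\<bar> < \<bar>\<delta>\<bar> \<Longrightarrow> proj P (\<Psi> \<zeta>) \<in> \<beta>" by (rule b2)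
    show "R \<in> components (pts P - (bdry P 0 \<union> \<beta>))" "bdry P 0 \<subseteq> closure R" using R by auto
  qed
qed

end

end

section \<open>The collar of a geodesic component\<close>

context split_pants
begin

text \<open>
  The point \<open>g r\<close> has the same height over \<open>\<delta>\<close> in both hexagons.  Transporting the second perpendicular by the
  inverse of \<open>f\<close> yields a perpendicular to \<open>d\<close> with the same foot \<open>d x\<close> from a point of that height over \<open>\<delta> - c\<close>.
\<close>

lemma geodesic_collar:
  assumes r: "lg = ereal r" and p: "perpendicular_in Q (g r) d ld p m x"
    and p': "perpendicular_in Q' (g r) (\<lambda>t. f (d t)) ld p' m' x'"
    and foot: "proj P (p m) = proj P (p' m')" and dinj: "inj_on (proj P \<circ> d) (params 0 ld)"
    and \<beta>: "\<beta> = proj P ` (arc_of p 0 m \<union> arc_of p' 0 m')"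
    and base_onto: "\<And>z. z \<in> cover P \<Longrightarrow> proj P z \<in> bdry P 0 \<Longrightarrow> \<exists>f\<in>deck P. \<exists>t. f z = \<Psi> (of_real t)"
    and R: "R \<in> components (pts P - (bdry P 0 \<union> \<beta>))" "bdry P 0 \<union> \<beta> \<subseteq> closure R"
  shows "tanh x * cosh (L / 2) = tanh_ext lg" "collar P \<theta> w (L / 2) (tanh x) \<beta> R"
proof -
  have pm: "unit_geodesic p" "0 < m" "arc_of p 0 m \<subseteq> Q" "p 0 = g r" "meets_perp p m d x"
    using p by (auto simp: perpendicular_in_def)
  have pm': "unit_geodesic p'" "0 < m'" "arc_of p' 0 m' \<subseteq> Q'" "p' 0 = g r" "0 < x'" "ereal x' \<le> ld"
    "meets_perp p' m' (\<lambda>t. f (d t)) x'"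
    using p' by (auto simp: perpendicular_in_def)
  have ud: "unit_geodesic d" and ld: "hyp_line Y d (1, 0) (0, \<i>)" using vd by (auto simp: vertical_def)
  have ud': "unit_geodesic (\<lambda>t. f (d t))" and ld': "hyp_line Y (\<lambda>t. f (d t)) (cosh c, of_real (sinh c)) (0, \<i>)"
    using vd' by (auto simp: vertical_def)
  have pc: "p s \<in> cover P" if "0 \<le> s" "s \<le> m" for s using that pm(3) Q(2) by (auto simp: arc_of_def params_def)
  have pc': "p' s \<in> cover P" if "0 \<le> s" "s \<le> m'" for s using that pm'(3) Q(4) by (auto simp: arc_of_def params_def)
  have dc: "d s \<in> cover P" if "0 \<le> s" "ereal s \<le> ld" for s using that arcs(1) Q(2) by (auto simp: arc_of_def params_def)
  have xx: "x' = x"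
  proof -
    have "p m = d x" "p' m' = f (d x')" using pm(5) pm'(7) by (auto simp: meets_perp_def)
    then have "proj P (d x) = proj P (d x')"
      using foot proj_deck[OF f dc[of x']] pm'(5,6) by simp
    moreover have "x \<in> params 0 ld" "x' \<in> params 0 ld" using len(3,4) pm'(5,6) by (auto simp: params_def)
    ultimately show ?thesis using dinj by (auto simp: inj_on_def)
  qed
  obtain p0 v0 where l0: "hyp_line Y p p0 v0" using coords_line[OF Y pm(1)] .
  note pp = hyp_line_perp[OF Y pm(1) l0 ud ld pm(5)]
  obtain \<epsilon> where \<epsilon>: "\<bar>\<epsilon>\<bar> = 1" "horizontal (\<lambda>\<sigma>. p (m + \<epsilon> * \<sigma>)) x"
    using perp_horizontal[OF vd pm(1) l0 pp] by metis
  obtain k where k: "k \<in> deck P" "\<And>z. norm z < 1 \<Longrightarrow> k (f z) = z" "\<And>z. norm z < 1 \<Longrightarrow> f (k z) = z"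
    using deck_inverse[OF f] by metis
  have kd: "(\<lambda>t. k (f (d t))) = d" using k(2) hyp_line_in_disc[OF ld] by auto
  define q where "q = (\<lambda>t. k (p' t))"
  have uq: "unit_geodesic q" unfolding q_def by (rule deck_geodesic[OF k(1) pm'(1)])
  obtain q0 u0 where lp': "hyp_line Y p' q0 u0" using coords_line[OF Y pm'(1)] .
  obtain q1 u1 where lq: "hyp_line Y q q1 u1" using coords_line[OF Y uq] .
  note qp = hyp_line_perp[OF Y pm'(1) lp' ud' ld' pm'(7)]
  have ldk: "hyp_line Y (\<lambda>t. k (f (d t))) (1, 0) (0, \<i>)" unfolding kd by (rule ld)
  note e1 = deck_line_line[OF Y k(1) lp' lq[unfolded q_def] ld' ldk]
  note e2 = deck_line_line[OF Y k(1) ld' ldk lp' lq[unfolded q_def]]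
  have e3: "mink q1 (0, \<i>) = mink q0 (0, \<i>)" using e2(2) by (simp add: mink_commute)
  have qq: "mink (sinh m' *\<^sub>R q1 + cosh m' *\<^sub>R u1) (sinh x *\<^sub>R (1, 0) + cosh x *\<^sub>R (0, \<i>)) = 0"
  proof -
    have "mink (sinh m' *\<^sub>R q1 + cosh m' *\<^sub>R u1) (sinh x *\<^sub>R (1, 0) + cosh x *\<^sub>R (0, \<i>))
      = mink (sinh m' *\<^sub>R q0 + cosh m' *\<^sub>R u0) (sinh x *\<^sub>R (cosh c, of_real (sinh c)) + cosh x *\<^sub>R (0, \<i>))"
      by (simp only: mink_add_left mink_add_right mink_scaleR_left mink_scaleR_right e1 e3)
    then show ?thesis using qp(1) unfolding xx by simp
  qed
  have qm: "q m' = d x"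
    using qp(2) k(2)[OF hyp_line_in_disc[OF ld]] by (simp add: q_def xx)
  obtain \<epsilon>' where \<epsilon>': "\<bar>\<epsilon>'\<bar> = 1" "horizontal (\<lambda>\<sigma>. q (m' + \<epsilon>' * \<sigma>)) x"
    using perp_horizontal[OF vd uq lq qq qm] by metis
  obtain \<phi> where \<phi>: "Complex \<delta> \<phi> \<in> strip" "g r = \<Psi> (Complex \<delta> \<phi>)" "sin \<phi> = tanh r"
    using vertical_strip[OF vg] .
  have st': "Complex (\<delta> - c) \<phi> \<in> strip" using \<phi>(1) by (simp add: strip_def)
  have sh: "Complex (\<delta> - c) \<phi> + of_real c = Complex \<delta> \<phi>" by (simp add: complex_eq_iff)
  have "f (\<Psi> (Complex (\<delta> - c) \<phi>)) = g r" using f_shift[OF st'] unfolding sh \<phi>(2) .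
  then have q0: "q 0 = \<Psi> (Complex (\<delta> - c) \<phi>)" using k(2)[OF disc[OF st']] pm'(4) by (simp add: q_def)
  have p0: "p 0 = \<Psi> (Complex \<delta> \<phi>)" using pm(4) \<phi>(2) by simp
  note hp = horizontal_arc[OF \<epsilon> pm(2) \<phi>(1) p0]
  note hq = horizontal_arc[OF \<epsilon>' pm'(2) st' q0]
  have \<delta>0: "\<delta> \<noteq> 0" by (rule hp(2))
  have "tanh x * cosh \<delta> = tanh x * cosh (\<delta> - c)" by (rule trans[OF hp(1)[symmetric] hq(1)])
  then have ce: "cosh \<delta> = cosh (\<delta> - c)" using len(3) by simp
  have c2: "c = 2 * \<delta>" by (rule c_eq[OF \<delta>0 ce])
  have dd: "\<delta> - c = - \<delta>" "\<bar>\<delta> - c\<bar> = \<bar>\<delta>\<bar>" using c2 by auto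
  have lam: "tanh x * cosh \<delta> = tanh_ext lg" using hp(1) \<phi>(3) by (simp add: r tanh_ext_def)
  have qc: "q s \<in> cover P \<and> proj P (q s) = proj P (p' s)" if "0 \<le> s" "s \<le> m'" for s
    using deck_cover[OF k(1) pc'[OF that]] proj_deck[OF k(1) pc'[OF that]] by (simp add: q_def)
  show "tanh x * cosh (L / 2) = tanh_ext lg"
    using lam abs_c[OF \<delta>0 ce] by simp
  show "collar P \<theta> w (L / 2) (tanh x) \<beta> R"
  proof (rule collar[OF \<delta>0 ce lam base_onto _ _ R])
    show "\<beta> \<subseteq> (\<lambda>\<zeta>. proj P (\<Psi> \<zeta>)) ` cell_top \<bar>\<delta>\<bar> (tanh x)"
    proof
      fix y assume "y \<in> \<beta>"
      then consider s where "0 \<le> s" "s \<le> m" "y = proj P (p s)" | s where "0 \<le> s" "s \<le> m'" "y = proj P (p' s)"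
        unfolding \<beta> by (auto simp: arc_of_def params_def)
      then show "y \<in> (\<lambda>\<zeta>. proj P (\<Psi> \<zeta>)) ` cell_top \<bar>\<delta>\<bar> (tanh x)"
      proof cases
        case 1
        then show ?thesis using hp(3)[OF 1(1,2) pc[OF 1(1,2)]] by auto
      next
        case 2
        obtain \<zeta> where "\<zeta> \<in> cell_top \<bar>\<delta>\<bar> (tanh x)" "q s = \<Psi> \<zeta>" using hq(3)[OF 2(1,2)] qc[OF 2(1,2)] dd(2) by auto
        then show ?thesis using qc[OF 2(1,2)] 2(3) by (metis imageI)
      qed
    qed
    show "proj P (\<Psi> \<zeta>) \<in> \<beta>" if z: "\<zeta> \<in> cell_top \<bar>\<delta>\<bar> (tanh x)" for \<zeta>
    proof (cases "Re \<zeta> * \<delta> \<ge> 0")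
      case True
      then obtain s where "0 \<le> s" "s \<le> m" "p s = \<Psi> \<zeta>" using hp(4)[OF z] by blast
      then show ?thesis unfolding \<beta> by (force simp: arc_of_def params_def)
    next
      case False
      then have "Re \<zeta> * (\<delta> - c) \<ge> 0" unfolding dd(1) by simp
      then obtain s where s: "0 \<le> s" "s \<le> m'" "q s = \<Psi> \<zeta>" using hq(4)[of \<zeta>] z dd(2) by auto
      then have "proj P (\<Psi> \<zeta>) = proj P (p' s)" using qc by metis
      moreover have "p' s \<in> arc_of p' 0 m'" using s by (auto simp: arc_of_def params_def)
      ultimately show ?thesis unfolding \<beta> by blast
    qed
  qed
qed

lemma deck_coords:
  assumes z: "norm z < 1"
  shows "Y (f z) = (cosh c * fst (Y z) + sinh c * Re (snd (Y z)),
    Complex (sinh c * fst (Y z) + cosh c * Re (snd (Y z))) (Im (snd (Y z))))"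
proof -
  define \<zeta> where "\<zeta> = \<Omega> z"
  have s: "\<zeta> \<in> strip" "\<Psi> \<zeta> = z" unfolding \<zeta>_def using map_inv[OF z] by auto
  have s': "\<zeta> + of_real c \<in> strip" using s(1) by (simp only: shift_strip)
  have "Y (f z) = Y (\<Psi> (\<zeta> + of_real c))" using f_shift[OF s(1)] s(2) by simp
  then show ?thesis unfolding Y_map[OF s'] s(2)[symmetric] Y_map[OF s(1)]
    by (simp add: cosh_add sinh_add add_divide_distrib mult_ac add_ac)
qed

end

section \<open>Orthogonal geodesics at a boundary component\<close>

context pants_surface
begin

text \<open>
  Both vectors are the velocities at which \<open>d\<close> and \<open>e\<close> arrive at the boundary geodesic; each is a unit normal of the
  plane through this geodesic, the one that points out of the cover.
\<close>

lemma outward_normal_unique: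
  assumes l: "is_lift P i (Geod a)" and i: "i \<in> {0, 1, 2}" and Y: "hyp_coords Y"
    and d: "unit_geodesic d" "hyp_line Y d p v" "meets_perp d r a t" "s < r" "d s \<in> cover P"
    and e: "unit_geodesic e" "hyp_line Y e p' v'" "meets_perp e r' a t'" "s' < r'" "e s' \<in> cover P"
  shows "sinh r *\<^sub>R p + cosh r *\<^sub>R v = sinh r' *\<^sub>R p' + cosh r' *\<^sub>R v'"
proof -
  have a: "unit_geodesic a" using l by simp
  obtain q u where la: "hyp_line Y a q u" using coords_line[OF Y a] .
  have qu: "mink q q = - 1" "mink u u = 1" "mink q u = 0" "mink u q = 0"
    using la by (auto simp: hyp_line_def mink_commute)
  have normal: "mink q n = 0 \<and> mink u n = 0 \<and> mink n n = 1 \<and> mink (Y (h \<sigma>)) n < 0"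
    if h: "unit_geodesic h" "hyp_line Y h p v" "meets_perp h r a t" "\<sigma> < r"
      and n: "n = sinh r *\<^sub>R p + cosh r *\<^sub>R v" for h p v r t \<sigma> n
  proof -
    have pv: "mink p p = - 1" "mink v v = 1" "mink p v = 0" "mink v p = 0"
      using h(2) by (auto simp: hyp_line_def mink_commute)
    have cs: "cosh r * cosh r = 1 + sinh r * sinh r" "cosh t * cosh t = 1 + sinh t * sinh t"
      using hyperbolic_pythagoras[of r] hyperbolic_pythagoras[of t] by (simp_all add: power2_eq_square)
    note pp = hyp_line_perp[OF Y h(1,2) a la h(3)]
    have pt: "cosh t *\<^sub>R q + sinh t *\<^sub>R u = cosh r *\<^sub>R p + sinh r *\<^sub>R v"
      using pp(2) hyp_line_at[OF h(2), of r] hyp_line_at[OF la, of t] by simp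
    have 1: "sinh t * mink q n + cosh t * mink u n = 0" using pp(1) unfolding n[symmetric] by (simp add: mink_commute)
    have "mink (cosh t *\<^sub>R q + sinh t *\<^sub>R u) n = 0" unfolding pt n by (simp add: pv)
    then have 2: "cosh t * mink q n + sinh t * mink u n = 0" by simp
    have "cosh t * (cosh t * mink q n + sinh t * mink u n) - sinh t * (sinh t * mink q n + cosh t * mink u n)
        = (cosh t * cosh t - sinh t * sinh t) * mink q n"
      by (simp add: algebra_simps)
    then have qn: "mink q n = 0" unfolding 1 2 cs(2) by simp
    have un: "mink u n = 0" using 1 qn cosh_real_nonzero[of t] by simp
    have "mink n n = 1" unfolding n using cs(1) by (simp add: pv algebra_simps)
    moreover have "mink (Y (h \<sigma>)) n = - sinh (r - \<sigma>)"
      unfolding hyp_line_at[OF h(2), of \<sigma>] n by (simp add: pv sinh_diff algebra_simps)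
    then have "mink (Y (h \<sigma>)) n < 0" using h(4) by simp
    ultimately show ?thesis using qn un by blast
  qed
  define n where "n = sinh r *\<^sub>R p + cosh r *\<^sub>R v"
  define n' where "n' = sinh r' *\<^sub>R p' + cosh r' *\<^sub>R v'"
  have n: "mink q n = 0" "mink u n = 0" "mink n n = 1" "mink (Y (d s)) n < 0" using normal[OF d(1-4) n_def] by auto
  have n': "mink q n' = 0" "mink u n' = 0" "mink n' n' = 1" "mink (Y (e s')) n' < 0" using normal[OF e(1-4) n'_def] by auto
  have z: "mink n' q = 0" "mink n' u = 0" using n'(1,2) by (simp_all add: mink_commute)
  have "n' = (- mink n' q) *\<^sub>R q + mink n' u *\<^sub>R u + mink n' n *\<^sub>R n"
    by (rule mink_expansion[OF qu(1,2) n(3) qu(3) n(1,2)])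
  then have eq: "n' = mink n' n *\<^sub>R n" unfolding z by simp
  then have "mink n' n' = mink n' n * mink n' n" using mink_scaleR_right[of n' "mink n' n" n] by simp
  then have sq: "mink n' n = 1 \<or> mink n' n = - 1" using n'(3) by (simp add: square_eq_1_iff)
  have "mink (Y (e s')) (- n) \<ge> 0"
    by (rule one_sided[OF l i Y la _ _ _ d(5) _ e(5)]) (simp_all add: n less_imp_le)
  then have "mink n' n \<noteq> - 1" using eq n'(4) by auto
  then have "n' = n" using sq eq by simp
  then show ?thesis by (simp add: n_def n'_def)
qed

end

context split_pants
begin

text \<open>
  The deck transformation \<open>f2\<close> carries \<open>e\<close> to another geodesic from the same cusp \<open>\<xi>\<close>, so it fixes \<open>\<xi>\<close>.
  Hence it is parabolic or trivial and fixes the null vector that represents \<open>\<xi>\<close>.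
\<close>

lemma cusp_start_scale:
  assumes cl: "cusp_lift P 1 \<xi>" and pu: "1 \<in> punct P" and g\<xi>: "(g \<longlongrightarrow> \<xi>) at_top"
    and e: "unit_geodesic e" "hyp_line Y e p v" "(e \<longlongrightarrow> \<xi>) at_bot" and f2: "f2 \<in> deck P"
    and e': "hyp_line Y (\<lambda>t. f2 (e t)) p' v'" "((\<lambda>t. f2 (e t)) \<longlongrightarrow> \<xi>) at_bot"
  obtains \<mu> where "\<mu> > 0" "p - v = \<mu> *\<^sub>R (cosh \<delta>, Complex (sinh \<delta>) 1)" "p' - v' = \<mu> *\<^sub>R (cosh \<delta>, Complex (sinh \<delta>) 1)"
proof -
  obtain \<theta>' w' where Y': "norm w' < 1" "\<And>z. norm z < 1 \<Longrightarrow> Y z = lorentz \<theta>' w' (hyp z)"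
    using coords_lorentz[OF Y] by metis
  have rev: "((\<lambda>t. h (- t)) \<longlongrightarrow> \<xi>) at_top" if "(h \<longlongrightarrow> \<xi>) at_bot" for h :: "real \<Rightarrow> complex"
    using filterlim_compose[OF that filterlim_uminus_at_bot_at_top] by simp
  have ug: "unit_geodesic g" and lg: "hyp_line Y g (cosh \<delta>, of_real (sinh \<delta>)) (0, \<i>)"
    using vg by (auto simp: vertical_def)
  define n where "n = (cosh \<delta>, Complex (sinh \<delta>) 1)"
  obtain C where C: "C > 0" "(cosh \<delta>, of_real (sinh \<delta>)) + (0, \<i>) = C *\<^sub>R lorentz \<theta>' w' (1, \<xi>)"
    using geodesic_end[OF Y' ug lg g\<xi>] by metis
  have n: "n = C *\<^sub>R lorentz \<theta>' w' (1, \<xi>)"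
    unfolding C(2)[symmetric] by (simp add: n_def complex_eq_iff)
  obtain C1 where C1: "C1 > 0" "p + - v = C1 *\<^sub>R lorentz \<theta>' w' (1, \<xi>)"
    using geodesic_end[OF Y' unit_geodesic_reverse[OF e(1)] hyp_line_reverse[OF e(2)] rev[OF e(3)]] by metis
  obtain C2 where C2: "C2 > 0" "p' + - v' = C2 *\<^sub>R lorentz \<theta>' w' (1, \<xi>)"
    using geodesic_end[OF Y' unit_geodesic_reverse[OF deck_geodesic[OF f2 e(1)]] hyp_line_reverse[OF e'(1)] rev[OF e'(2)]] by metis
  have 1: "p - v = (C1 / C) *\<^sub>R n" "p' - v' = (C2 / C) *\<^sub>R n" using C1 C2 C(1) by (simp_all add: n)
  have pos: "C1 / C > 0" "C2 / C > 0" using C C1 C2 by auto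
  have "(C2 / C) * mink (Y (f2 z)) n = (C1 / C) * mink (Y z) n" if z: "norm z < 1" for z
  proof -
    have "mink (Y (f2 z)) (p' - v') = mink (Y z) (p - v)"
      using deck_point_line[OF Y f2 z e(2) e'(1)] by simp
    then show ?thesis unfolding 1 by simp
  qed
  then have "C2 / C = C1 / C"
    by (intro cusp_parabolic_vector[OF f2 cl pu _ Y' n C(1) pos]) auto
  then show ?thesis using that[of "C1 / C"] pos 1 by (simp add: n_def)
qed

text \<open>
  Here \<open>f2\<close> followed by the inverse of \<open>f\<close> fixes the cusp \<open>\<xi>\<close> at which \<open>d\<close> and \<open>e\<close> meet.
\<close>

lemma cusp_end_scale:
  assumes cl: "cusp_lift P 2 \<xi>" and pu: "2 \<in> punct P" and d\<xi>: "(d \<longlongrightarrow> \<xi>) at_top" "((\<lambda>t. f (d t)) \<longlongrightarrow> \<xi>') at_top"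
    and e: "unit_geodesic e" "hyp_line Y e p v" "(e \<longlongrightarrow> \<xi>) at_top" and f2: "f2 \<in> deck P"
    and e': "hyp_line Y (\<lambda>t. f2 (e t)) p' v'" "((\<lambda>t. f2 (e t)) \<longlongrightarrow> \<xi>') at_top"
  obtains \<mu> where "\<mu> > 0" "p + v = \<mu> *\<^sub>R (1, \<i>)" "p' + v' = \<mu> *\<^sub>R (cosh c, Complex (sinh c) 1)"
proof -
  obtain \<theta>' w' where Y': "norm w' < 1" "\<And>z. norm z < 1 \<Longrightarrow> Y z = lorentz \<theta>' w' (hyp z)"
    using coords_lorentz[OF Y] by metis
  have ud: "unit_geodesic d" and ld: "hyp_line Y d (1, 0) (0, \<i>)" using vd by (auto simp: vertical_def)
  have ud': "unit_geodesic (\<lambda>t. f (d t))" and ld': "hyp_line Y (\<lambda>t. f (d t)) (cosh c, of_real (sinh c)) (0, \<i>)"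
    using vd' by (auto simp: vertical_def)
  define n n' where "n = (1::real, \<i>)" and "n' = (cosh c, Complex (sinh c) 1)"
  have nn: "(1, 0) + (0, \<i>) = n" "(cosh c, of_real (sinh c)) + (0, \<i>) = n'" by (simp_all add: n_def n'_def complex_eq_iff)
  obtain C where C: "C > 0" "n = C *\<^sub>R lorentz \<theta>' w' (1, \<xi>)"
    using geodesic_end[OF Y' ud ld d\<xi>(1)] nn by metis
  obtain C' where C': "C' > 0" "n' = C' *\<^sub>R lorentz \<theta>' w' (1, \<xi>')"
    using geodesic_end[OF Y' ud' ld' d\<xi>(2)] nn by metis
  obtain C1 where C1: "C1 > 0" "p + v = C1 *\<^sub>R lorentz \<theta>' w' (1, \<xi>)"
    using geodesic_end[OF Y' e] by metis
  obtain C2 where C2: "C2 > 0" "p' + v' = C2 *\<^sub>R lorentz \<theta>' w' (1, \<xi>')"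
    using geodesic_end[OF Y' deck_geodesic[OF f2 e(1)] e'] by metis
  have 1: "p + v = (C1 / C) *\<^sub>R n" "p' + v' = (C2 / C') *\<^sub>R n'" using C C1 C' C2 by simp_all
  have pos: "C1 / C > 0" "C2 / C' > 0" using C C1 C' C2 by auto
  obtain k where k: "k \<in> deck P" "\<And>z. norm z < 1 \<Longrightarrow> k (f z) = z" "\<And>z. norm z < 1 \<Longrightarrow> f (k z) = z"
    using deck_inverse[OF f] by metis
  obtain h where h: "h \<in> deck P" "\<And>z. norm z < 1 \<Longrightarrow> h z = k (f2 z)" using deck_compose[OF k(1) f2] by metis
  have "(C2 / C') * mink (Y (h z)) n = (C1 / C) * mink (Y z) n" if z: "norm z < 1" for z
  proof -
    have z2: "norm (f2 z) < 1" "norm (k (f2 z)) < 1" using deck_in_disc[OF f2 z] deck_in_disc[OF k(1)] by auto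
    have "mink (Y (f2 z)) (p' + v') = mink (Y z) (p + v)"
      using deck_point_line[OF Y f2 z e(2) e'(1)] by simp
    then have "(C2 / C') * mink (Y (f2 z)) n' = (C1 / C) * mink (Y z) n" unfolding 1 by simp
    moreover have "mink (Y (f (k (f2 z)))) n' = mink (Y (k (f2 z))) n"
      using deck_point_line[OF Y f z2(2) ld ld'] unfolding nn[symmetric] by (simp only: mink_add_right)
    ultimately show ?thesis using h(2)[OF z] k(3)[OF z2(1)] by simp
  qed
  then have "C2 / C' = C1 / C"
    by (intro cusp_parabolic_vector[OF h(1) cl pu _ Y' C(2,1) pos]) auto
  then show ?thesis using that[of "C1 / C"] pos 1 by (simp add: n_def n'_def)
qed

end

section \<open>The collar of a puncture\<close>

text \<open>
  The vector \<open>n\<close> represents the puncture 1 and \<open>W\<close>, \<open>W'\<close> represent the lifts of the component 2 in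
  the two hexagons: ideal points if it is a puncture, outward unit normals if it is a geodesic.
  Both \<open>n\<close> and \<open>W\<close> are combinations of the frame \<open>(q, v)\<close> of the side \<open>e\<close>, and \<open>n\<close>, \<open>W'\<close> are the
  same combinations of the frame of the other side.
\<close>

locale cusp_hexagons = split_pants +
  fixes e :: "real \<Rightarrow> complex" and f2 :: "complex \<Rightarrow> complex" and q v q' v' n W W' :: "real \<times> complex"
    and \<mu> a b w0 w2 :: real
  assumes f2: "f2 \<in> deck P" and e: "hyp_line Y e q v" and e': "hyp_line Y (\<lambda>t. f2 (e t)) q' v'"
    and n_def: "n = (cosh \<delta>, Complex (sinh \<delta>) 1)" and W_def: "W = (w0, Complex 0 w2)"
    and W'_def: "W' = (w0 * cosh c, Complex (w0 * sinh c) w2)"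
    and n: "q - v = \<mu> *\<^sub>R n" "q' - v' = \<mu> *\<^sub>R n" "\<mu> > 0"
    and W: "a *\<^sub>R q + b *\<^sub>R v = W" "a *\<^sub>R q' + b *\<^sub>R v' = W'" "a + b > 0"
    and w0: "0 < w0" "w0 \<le> w2" and w02: "w2 = w0 \<or> (\<exists>r\<ge>x. w0 = sinh r \<and> w2 = cosh r)"
begin

lemma mink_n_W: "mink n W = w2 - w0 * cosh \<delta>" "mink n W' = w2 - w0 * cosh (\<delta> - c)"
  by (simp_all add: mink_def n_def W_def W'_def inner_complex_def cosh_diff algebra_simps)

lemma mink_n_W_neg: "mink n W < 0" "mink n W' = mink n W"
proof -
  have qv: "mink q q = - 1" "mink v v = 1" "mink q v = 0" "mink v q = 0"
    and qv': "mink q' q' = - 1" "mink v' v' = 1" "mink q' v' = 0" "mink v' q' = 0"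
    using e e' by (auto simp: hyp_line_def mink_commute)
  have "\<mu> * mink n W = mink (q - v) (a *\<^sub>R q + b *\<^sub>R v)" unfolding n W by simp
  then have 1: "\<mu> * mink n W = - (a + b)" by (simp add: qv)
  have "\<mu> * mink n W' = mink (q' - v') (a *\<^sub>R q' + b *\<^sub>R v')" unfolding n W by simp
  then have 2: "\<mu> * mink n W' = - (a + b)" by (simp add: qv')
  show "mink n W < 0" using 1 n(3) W(3) by (metis mult_nonneg_nonneg less_imp_le neg_less_0_iff_less not_le)
  show "mink n W' = mink n W" using 1 2 n(3) by (metis mult_cancel_left less_irrefl)
qed

lemma cusp_cosh_eq: "cosh \<delta> = cosh (\<delta> - c)"
  using mink_n_W_neg(2) w0(1) unfolding mink_n_W by simp

lemma cusp_\<delta>_nonzero: "\<delta> \<noteq> 0"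
  using mink_n_W_neg(1) w0 unfolding mink_n_W by auto

lemmas c2 = c_eq[OF cusp_\<delta>_nonzero cusp_cosh_eq]

text \<open>
  If the perpendicular \<open>p\<close> rose above the puncture, it would cross the side \<open>e\<close>.  By symmetry the
  reflected point of \<open>p\<close> corresponds to the crossing of the other side, so \<open>p\<close> would not be simple.
\<close>

lemma perpendicular_not_above:
  assumes p: "horizontal p x" and cov: "range p \<subseteq> cover P" and inj: "inj (proj P \<circ> p)"
  shows "cosh \<delta> * sinh x \<le> cosh x"
proof (rule ccontr)
  assume above: "\<not> ?thesis"
  define \<beta> where "\<beta> = cosh \<delta> * sinh x - cosh x"
  have \<beta>: "\<beta> > 0" using above by (simp add: \<beta>_def)
  define \<alpha> where "\<alpha> = w2 * cosh x - w0 * sinh x"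
  have cs: "sinh x < cosh x" "0 < sinh x" using sinh_less_cosh_real len(3) by auto
  have "w0 * sinh x < w0 * cosh x" using w0(1) cs(1) by simp
  also have "\<dots> \<le> w2 * cosh x" using w0(2) by simp
  finally have \<alpha>: "\<alpha> > 0" by (simp add: \<alpha>_def)
  define M where "M = w0 * cosh \<delta> - w2"
  have M: "M > 0" using mink_n_W_neg(1) unfolding mink_n_W M_def by simp
  have timelike: "\<beta> * (w2 * w2 - w0 * w0) < 2 * (\<alpha> * M)"
    using w02
  proof
    assume "w2 = w0"
    then show ?thesis using \<alpha> M by simp
  next
    assume "\<exists>r\<ge>x. w0 = sinh r \<and> w2 = cosh r"
    then obtain r where r: "r \<ge> x" "w0 = sinh r" "w2 = cosh r" by blast
    have 1: "w2 * w2 - w0 * w0 = 1" using hyperbolic_pythagoras[of r] by (simp add: r power2_eq_square)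
    have "\<alpha> = cosh (r - x)" by (simp add: \<alpha>_def r cosh_diff)
    then have \<alpha>1: "\<alpha> \<ge> 1" by (simp add: cosh_real_ge_1)
    have "\<beta> \<le> M"
    proof -
      have i: "sinh r - sinh x \<ge> 0" using r(1) by simp
      have "cosh r - cosh x \<le> sinh r - sinh x"
        using r(1) by (simp add: cosh_def sinh_def field_simps)
      also have "\<dots> \<le> cosh \<delta> * (sinh r - sinh x)" using mult_right_mono[OF cosh_real_ge_1[of \<delta>] i] by simp
      finally show ?thesis by (simp add: \<beta>_def M_def r algebra_simps)
    qed
    also have "M \<le> \<alpha> * M" using mult_right_mono[OF \<alpha>1] M by simp
    finally show ?thesis using mult_pos_pos[OF \<alpha> M] 1 by simp
  qed
  define y y' where "y = \<alpha> *\<^sub>R n + \<beta> *\<^sub>R W" and "y' = \<alpha> *\<^sub>R n + \<beta> *\<^sub>R W'"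
  have nn: "mink n n = 0"
    using hyperbolic_pythagoras[of \<delta>] by (simp add: mink_def n_def inner_complex_def power2_eq_square)
  have WW: "mink W W = w2 * w2 - w0 * w0" by (simp add: mink_def W_def inner_complex_def)
  have WW': "mink W' W' = w2 * w2 - w0 * w0"
  proof -
    have "mink W' W' = w2 * w2 - w0 * w0 * ((cosh c)\<^sup>2 - (sinh c)\<^sup>2)"
      by (simp add: mink_def W'_def inner_complex_def power2_eq_square algebra_simps)
    then show ?thesis by (simp add: hyperbolic_pythagoras)
  qed
  have Wn: "mink W n = mink n W" "mink W' n = mink n W" "mink n W' = mink n W" "mink n W = - M"
    using mink_n_W_neg(2) mink_n_W(1) by (simp_all add: mink_commute M_def)
  have yy: "mink y y = \<beta> * (\<beta> * (w2 * w2 - w0 * w0) - 2 * (\<alpha> * M))" "mink y' y' = mink y y"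
    unfolding y_def y'_def by (simp_all add: nn WW WW' Wn algebra_simps)
  define \<kappa> where "\<kappa> = sqrt (- mink y y)"
  have neg: "mink y y < 0" unfolding yy(1) using \<beta> timelike by (intro mult_pos_neg) auto
  then have \<kappa>: "\<kappa> > 0" "\<kappa> * \<kappa> = - mink y y" by (auto simp: \<kappa>_def)
  have f0: "fst y > 0" "fst y' > 0"
    using \<alpha> \<beta> w0(1) by (auto simp: y_def y'_def n_def W_def W'_def intro!: add_pos_pos)
  have unit: "mink ((1 / \<kappa>) *\<^sub>R u) ((1 / \<kappa>) *\<^sub>R u) = - 1" if "mink u u = mink y y" for u
  proof -
    have "mink ((1 / \<kappa>) *\<^sub>R u) ((1 / \<kappa>) *\<^sub>R u) = mink y y / (\<kappa> * \<kappa>)" using that by simp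
    then show ?thesis unfolding \<kappa>(2) using neg by simp
  qed
  obtain z where z: "norm z < 1" "Y z = (1 / \<kappa>) *\<^sub>R y"
    by (rule coords_surj[OF Y unit[of y]]) (use f0 \<kappa>(1) in auto)
  obtain z' where z': "norm z' < 1" "Y z' = (1 / \<kappa>) *\<^sub>R y'"
    by (rule coords_surj[OF Y unit[of y']]) (use f0 \<kappa>(1) yy(2) in auto)
  \<comment> \<open>Both points have the same parameter on their sides.\<close>
  have split: "\<alpha> *\<^sub>R n + \<beta> *\<^sub>R (a *\<^sub>R q1 + b *\<^sub>R v1) = (\<alpha> / \<mu> + \<beta> * a) *\<^sub>R q1 + (\<beta> * b - \<alpha> / \<mu>) *\<^sub>R v1"
    if "q1 - v1 = \<mu> *\<^sub>R n" for q1 v1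
  proof -
    have e: "\<alpha> *\<^sub>R n = (\<alpha> / \<mu>) *\<^sub>R (q1 - v1)" using that n(3) by simp
    show ?thesis unfolding e by (simp add: algebra_simps)
  qed
  have "Y z = (1 / \<kappa> * (\<alpha> / \<mu> + \<beta> * a)) *\<^sub>R q + (1 / \<kappa> * (\<beta> * b - \<alpha> / \<mu>)) *\<^sub>R v"
    unfolding z(2) y_def W(1)[symmetric] split[OF n(1)] by (simp only: scaleR_add_right scaleR_scaleR)
  then obtain \<sigma>1 where \<sigma>1: "e \<sigma>1 = z" "sinh \<sigma>1 = 1 / \<kappa> * (\<beta> * b - \<alpha> / \<mu>)"
    using point_on_line[OF Y e z(1)] by metis
  have "Y z' = (1 / \<kappa> * (\<alpha> / \<mu> + \<beta> * a)) *\<^sub>R q' + (1 / \<kappa> * (\<beta> * b - \<alpha> / \<mu>)) *\<^sub>R v'"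
    unfolding z'(2) y'_def W(2)[symmetric] split[OF n(2)] by (simp only: scaleR_add_right scaleR_scaleR)
  then obtain \<sigma>2 where \<sigma>2: "f2 (e \<sigma>2) = z'" "sinh \<sigma>2 = 1 / \<kappa> * (\<beta> * b - \<alpha> / \<mu>)"
    using point_on_line[OF Y e' z'(1)] by metis
  have "\<sigma>1 = \<sigma>2" using \<sigma>1(2) \<sigma>2(2) by (metis arsinh_sinh_real)
  then have fz: "f2 z = z'" using \<sigma>1 \<sigma>2 by simp
  have lp: "hyp_line Y p (cosh x, Complex 0 (sinh x)) (0, 1)" using p by (simp add: horizontal_def)
  \<comment> \<open>The coefficients were chosen to make \<open>y\<close> orthogonal to the normal of \<open>p\<close>.\<close>
  have "cosh x * (\<alpha> + \<beta> * w2) = sinh x * (\<alpha> * cosh \<delta> + \<beta> * w0)"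
    by (simp add: \<alpha>_def \<beta>_def algebra_simps)
  then have "Y z = (1 / \<kappa> * (\<alpha> * cosh \<delta> + \<beta> * w0) / cosh x) *\<^sub>R (cosh x, Complex 0 (sinh x))
      + (1 / \<kappa> * (\<alpha> * sinh \<delta>)) *\<^sub>R (0, 1)"
    unfolding z(2) y_def n_def W_def using \<kappa>(1) by (simp add: complex_eq_iff field_simps)
  then obtain \<sigma> where \<sigma>: "p \<sigma> = z" "sinh \<sigma> = 1 / \<kappa> * (\<alpha> * sinh \<delta>)"
    using point_on_line[OF Y lp z(1)] by metis
  have pn: "norm (p \<tau>) < 1" for \<tau> by (rule hyp_line_in_disc[OF lp])
  have "Y (f (p (- \<sigma>))) = Y z'"
  proof -
    have 1: "cosh \<sigma> * cosh x = 1 / \<kappa> * (\<alpha> * cosh \<delta> + \<beta> * w0)" "cosh \<sigma> * sinh x = 1 / \<kappa> * (\<alpha> + \<beta> * w2)"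
      using horizontal_at[OF p, of \<sigma>] unfolding \<sigma>(1) z(2) y_def n_def W_def by (auto simp: complex_eq_iff)
    have t: "cosh c * cosh \<delta> - sinh c * sinh \<delta> = cosh \<delta>" "sinh c * cosh \<delta> - cosh c * sinh \<delta> = sinh \<delta>"
      using cosh_diff[of c \<delta>] sinh_diff[of c \<delta>] by (simp_all add: c2)
    have "Y (f (p (- \<sigma>))) = (cosh c * (cosh \<sigma> * cosh x) - sinh c * sinh \<sigma>,
        Complex (sinh c * (cosh \<sigma> * cosh x) - cosh c * sinh \<sigma>) (cosh \<sigma> * sinh x))"
      unfolding deck_coords[OF pn] horizontal_at[OF p] by simp
    also have "\<dots> = (1 / \<kappa> * (\<alpha> * (cosh c * cosh \<delta> - sinh c * sinh \<delta>) + \<beta> * (w0 * cosh c)),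
        Complex (1 / \<kappa> * (\<alpha> * (sinh c * cosh \<delta> - cosh c * sinh \<delta>) + \<beta> * (w0 * sinh c))) (1 / \<kappa> * (\<alpha> + \<beta> * w2)))"
      unfolding 1 \<sigma>(2) by (simp add: algebra_simps add_divide_distrib diff_divide_distrib)
    also have "\<dots> = Y z'"
      unfolding t z'(2) y'_def n_def W'_def by (simp add: complex_eq_iff)
    finally show ?thesis .
  qed
  then have "f (p (- \<sigma>)) = f2 (p \<sigma>)"
    unfolding \<sigma>(1) fz using coords_inject[OF Y deck_in_disc[OF f pn] z'(1)] by blast
  then have "proj P (p (- \<sigma>)) = proj P (p \<sigma>)"
    using proj_deck[OF f subsetD[OF cov rangeI]] proj_deck[OF f2 subsetD[OF cov rangeI]] by metis
  then have "- \<sigma> = \<sigma>" using injD[OF inj, of "- \<sigma>" \<sigma>] by simp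
  then have "\<alpha> * sinh \<delta> = 0" using \<sigma>(2) \<kappa>(1) by simp
  then show False using \<alpha> cusp_\<delta>_nonzero by simp
qed

text \<open>
  If \<open>p\<close> stayed below the puncture, it would meet both ends of the fundamental segment at equal
  heights, and these points are identified.
\<close>

lemma perpendicular_not_below:
  assumes p: "horizontal p x" and cov: "range p \<subseteq> cover P" and inj: "inj (proj P \<circ> p)"
  shows "cosh x \<le> cosh \<delta> * sinh x"
proof (rule ccontr)
  assume "\<not> ?thesis"
  then have lt: "tanh x * cosh \<delta> < 1" by (simp add: tanh_def divide_less_eq mult.commute)
  define \<phi> where "\<phi> = arcsin (tanh x * cosh \<delta>)"
  have "0 < tanh x * cosh \<delta>" using len(3) by simp
  then have b: "- 1 < tanh x * cosh \<delta>" by linarith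
  have \<phi>: "- pi / 2 < \<phi>" "\<phi> < pi / 2" "sin \<phi> = tanh x * cosh \<delta>"
    using arcsin_lt_bounded[OF b lt] b lt by (auto simp: \<phi>_def)
  have st: "Complex \<delta> \<phi> \<in> strip" "Complex (- \<delta>) \<phi> \<in> strip" using \<phi> by (auto simp: strip_def abs_less_iff)
  obtain \<sigma> where \<sigma>: "p \<sigma> = \<Psi> (Complex \<delta> \<phi>)" using graph_horizontal[OF p st(1)] \<phi>(3) by auto
  obtain \<sigma>' where \<sigma>': "p \<sigma>' = \<Psi> (Complex (- \<delta>) \<phi>)" using graph_horizontal[OF p st(2)] \<phi>(3) by auto
  have "Complex (- \<delta>) \<phi> + of_real c = Complex \<delta> \<phi>" by (simp add: complex_eq_iff c2)
  then have "f (p \<sigma>') = p \<sigma>" using f_shift[OF st(2)] \<sigma> \<sigma>' by simp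
  then have "proj P (p \<sigma>') = proj P (p \<sigma>)" using proj_deck[OF f subsetD[OF cov rangeI]] by metis
  then have "\<sigma>' = \<sigma>" using injD[OF inj, of \<sigma>' \<sigma>] by simp
  then have "Complex \<delta> \<phi> = Complex (- \<delta>) \<phi>" using \<sigma> \<sigma>' inv_map[OF st(1)] inv_map[OF st(2)] by metis
  then show False using cusp_\<delta>_nonzero by simp
qed

lemma puncture_collar:
  assumes lg: "lg = \<infinity>" and p: "unit_geodesic p" "range p \<subseteq> cover P" "inj (proj P \<circ> p)" "meets_perp p t d x"
    and \<beta>: "\<beta> = proj P ` range p"
    and base_onto: "\<And>z. z \<in> cover P \<Longrightarrow> proj P z \<in> bdry P 0 \<Longrightarrow> \<exists>f\<in>deck P. \<exists>t. f z = \<Psi> (of_real t)"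
    and R: "R \<in> components (pts P - (bdry P 0 \<union> \<beta>))" "bdry P 0 \<union> \<beta> \<subseteq> closure R"
  shows "tanh x * cosh (L / 2) = tanh_ext lg" "collar P \<theta> w (L / 2) (tanh x) \<beta> R"
proof -
  note ne = cusp_\<delta>_nonzero cusp_cosh_eq
  have ud: "unit_geodesic d" and ld: "hyp_line Y d (1, 0) (0, \<i>)" using vd by (auto simp: vertical_def)
  obtain p0 v0 where l0: "hyp_line Y p p0 v0" using coords_line[OF Y p(1)] .
  obtain \<epsilon> where \<epsilon>: "\<bar>\<epsilon>\<bar> = 1" "horizontal (\<lambda>\<sigma>. p (t + \<epsilon> * \<sigma>)) x"
    using perp_horizontal[OF vd p(1) l0 hyp_line_perp[OF Y p(1) l0 ud ld p(4)]] by metis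
  define h where "h = (\<lambda>\<sigma>. p (t + \<epsilon> * \<sigma>))"
  have ee: "\<epsilon> * \<epsilon> = 1" using \<epsilon>(1) by (metis abs_mult_self_eq mult_1)
  have ph: "p s = h (\<epsilon> * (s - t))" for s using ee by (simp add: h_def flip: mult.assoc)
  have hh: "horizontal h x" using \<epsilon>(2) by (simp add: h_def)
  have rh: "range h = range p"
  proof
    show "range p \<subseteq> range h" using ph by auto
  qed (auto simp: h_def)
  have hc: "range h \<subseteq> cover P" unfolding rh by (rule p(2))
  have "\<epsilon> \<noteq> 0" using \<epsilon>(1) by auto
  then have hi: "inj (proj P \<circ> h)" using p(3) unfolding inj_on_def h_def comp_def by fastforce
  have "cosh \<delta> * sinh x = cosh x"
    using perpendicular_not_above[OF hh hc hi] perpendicular_not_below[OF hh hc hi] by simp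
  then have one: "tanh x * cosh \<delta> = 1" by (simp add: tanh_def field_simps)
  then have lam: "tanh x * cosh \<delta> = tanh_ext lg" by (simp add: lg tanh_ext_def)
  show "tanh x * cosh (L / 2) = tanh_ext lg"
    using lam abs_c[OF ne] by simp
  show "collar P \<theta> w (L / 2) (tanh x) \<beta> R"
  proof (rule collar[OF ne lam base_onto _ _ R])
    show "\<beta> \<subseteq> (\<lambda>\<zeta>. proj P (\<Psi> \<zeta>)) ` cell_top \<bar>\<delta>\<bar> (tanh x)"
    proof
      fix y assume "y \<in> \<beta>"
      then obtain \<sigma> where y: "y = proj P (h \<sigma>)" unfolding \<beta> rh[symmetric] by blast
      have hc': "h \<sigma> \<in> cover P" using hc by blast
      define \<zeta> where "\<zeta> = \<Omega> (h \<sigma>)"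
      have z: "\<zeta> \<in> strip" "\<Psi> \<zeta> = h \<sigma>" "0 \<le> Im \<zeta>"
        unfolding \<zeta>_def using map_inv[OF cover_norm[OF hc']] side[OF hc'] by auto
      have s: "sin (Im \<zeta>) = tanh x * cosh (Re \<zeta>)" by (rule horizontal_graph(1)[OF hh z(1,2)])
      have "tanh x * cosh (Re \<zeta>) \<le> tanh x * cosh \<delta>" unfolding one s[symmetric] by simp
      then have "cosh \<bar>Re \<zeta>\<bar> \<le> cosh \<bar>\<delta>\<bar>" using len(3) by simp
      then have "\<bar>Re \<zeta>\<bar> \<le> \<bar>\<delta>\<bar>" using cosh_real_nonneg_le_iff[of "\<bar>Re \<zeta>\<bar>" "\<bar>\<delta>\<bar>"] by simp
      then have "\<zeta> \<in> cell_top \<bar>\<delta>\<bar> (tanh x)" using z s by (simp add: cell_top_def)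
      then show "y \<in> (\<lambda>\<zeta>. proj P (\<Psi> \<zeta>)) ` cell_top \<bar>\<delta>\<bar> (tanh x)" unfolding y z(2)[symmetric] by blast
    qed
    show "proj P (\<Psi> \<zeta>) \<in> \<beta>" if "\<zeta> \<in> cell_top \<bar>\<delta>\<bar> (tanh x)" for \<zeta>
    proof -
      obtain \<sigma> where "h \<sigma> = \<Psi> \<zeta>" using graph_horizontal[OF hh, of \<zeta>] \<open>\<zeta> \<in> _\<close> by (auto simp: cell_top_def)
      then show ?thesis unfolding \<beta> rh[symmetric] by (metis image_eqI rangeI)
    qed
  qed
qed

end

section \<open>Half-collars\<close>

text \<open>
  If \<open>\<alpha>\<^sub>2\<close> is a puncture, \<open>d\<close> and \<open>e\<close> end at the same cusp; if it is a geodesic, their velocities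
  on arrival are the same vector of Minkowski space.  In both cases the frame of \<open>e\<close> is tied to that of \<open>d\<close>.
\<close>

lemma (in split_pants) cusp_hexagons_exist:
  assumes pu: "1 \<in> punct P" and A1: "is_lift P 1 A1" and A2: "is_lift P 2 A2" "is_lift P 2 A2'"
    and so: "simple_orthogeodesic P A0 g 0 lg A1"
      "simple_orthogeodesic P A0 d 0 ld A2" "simple_orthogeodesic P A0 (\<lambda>t. f (d t)) 0 ld A2'"
      "simple_orthogeodesic P A1 e s u A2" "simple_orthogeodesic P A1 (\<lambda>t. f2 (e t)) s u A2'"
    and f2: "f2 \<in> deck P"
  shows "lg = \<infinity>" "\<exists>q v q' v' n W W' \<mu> a b w0 w2.
    cusp_hexagons P \<theta> w L \<delta> c x d g lg ld f Q Q' e f2 q v q' v' n W W' \<mu> a b w0 w2"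
proof -
  have ld: "hyp_line Y d (1, 0) (0, \<i>)" "hyp_line Y (\<lambda>t. f (d t)) (cosh c, of_real (sinh c)) (0, \<i>)"
    using vd vd' by (auto simp: vertical_def)
  obtain \<xi> where \<xi>: "A1 = Cusp \<xi>" "cusp_lift P 1 \<xi>" using A1 pu by (cases A1) auto
  have g: "ends_on g lg (Cusp \<xi>)" using so(1) \<xi> by (simp add: simple_orthogeodesic_def)
  then show "lg = \<infinity>" using len(2) by auto
  have g\<xi>: "(g \<longlongrightarrow> \<xi>) at_top" using g len(2) by auto
  have d: "unit_geodesic d" "arc_of d 0 ld \<subseteq> cover P" "ends_on d ld A2"
    using so(2) by (auto simp: simple_orthogeodesic_def)
  have d': "unit_geodesic (\<lambda>t. f (d t))" "arc_of (\<lambda>t. f (d t)) 0 ld \<subseteq> cover P" "ends_on (\<lambda>t. f (d t)) ld A2'"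
    using so(3) by (auto simp: simple_orthogeodesic_def)
  have e: "unit_geodesic e" "s < u" "arc_of e s u \<subseteq> cover P" "ends_on e s (Cusp \<xi>)" "ends_on e u A2"
    using so(4) \<xi> by (auto simp: simple_orthogeodesic_def)
  have e': "unit_geodesic (\<lambda>t. f2 (e t))" "arc_of (\<lambda>t. f2 (e t)) s u \<subseteq> cover P"
      "ends_on (\<lambda>t. f2 (e t)) s (Cusp \<xi>)" "ends_on (\<lambda>t. f2 (e t)) u A2'"
    using so(5) \<xi> by (auto simp: simple_orthogeodesic_def)
  have s: "s = - \<infinity>" "(e \<longlongrightarrow> \<xi>) at_bot" "((\<lambda>t. f2 (e t)) \<longlongrightarrow> \<xi>) at_bot" using e(2,4) e'(3) by auto
  obtain q v where le: "hyp_line Y e q v" using coords_line[OF Y e(1)] .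
  obtain q' v' where le': "hyp_line Y (\<lambda>t. f2 (e t)) q' v'" using coords_line[OF Y e'(1)] .
  define n where "n = (cosh \<delta>, Complex (sinh \<delta>) 1)"
  obtain \<mu> where \<mu>: "\<mu> > 0" "q - v = \<mu> *\<^sub>R n" "q' - v' = \<mu> *\<^sub>R n"
    unfolding n_def using cusp_start_scale[OF \<xi>(2) pu g\<xi> e(1) le s(2) f2 le' s(3)] by metis
  have "\<exists>a b w0 w2. a *\<^sub>R q + b *\<^sub>R v = (w0, Complex 0 w2) \<and>
      a *\<^sub>R q' + b *\<^sub>R v' = (w0 * cosh c, Complex (w0 * sinh c) w2) \<and> a + b > 0 \<and> 0 < w0 \<and> w0 \<le> w2 \<and>
      (w2 = w0 \<or> (\<exists>r\<ge>x. w0 = sinh r \<and> w2 = cosh r))"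
  proof (cases "2 \<in> punct P")
    case True
    obtain \<xi>2 where \<xi>2: "A2 = Cusp \<xi>2" "cusp_lift P 2 \<xi>2" using A2(1) True by (cases A2) auto
    obtain \<xi>2' where \<xi>2': "A2' = Cusp \<xi>2'" using A2(2) True by (cases A2') auto
    have lim: "(d \<longlongrightarrow> \<xi>2) at_top" "((\<lambda>t. f (d t)) \<longlongrightarrow> \<xi>2') at_top" using d(3) d'(3) len(1) \<xi>2 \<xi>2' by auto
    have lim': "(e \<longlongrightarrow> \<xi>2) at_top" "((\<lambda>t. f2 (e t)) \<longlongrightarrow> \<xi>2') at_top" using e(2,5) e'(4) \<xi>2 \<xi>2' by auto
    obtain \<nu> where \<nu>: "\<nu> > 0" "q + v = \<nu> *\<^sub>R (1, \<i>)" "q' + v' = \<nu> *\<^sub>R (cosh c, Complex (sinh c) 1)"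
      using cusp_end_scale[OF \<xi>2(2) True lim e(1) le lim'(1) f2 le' lim'(2)] by metis
    have "(1 / \<nu>) *\<^sub>R q + (1 / \<nu>) *\<^sub>R v = (1, Complex 0 1)" "(1 / \<nu>) *\<^sub>R q' + (1 / \<nu>) *\<^sub>R v' = (1 * cosh c, Complex (1 * sinh c) 1)"
      using \<nu> by (simp_all add: complex_eq_iff flip: scaleR_add_right)
    then show ?thesis using \<nu>(1) by (intro exI[of _ "1 / \<nu>"] exI[of _ 1]) auto
  next
    case False
    obtain k where k: "A2 = Geod k" using A2(1) False by (cases A2) auto
    obtain k' where k': "A2' = Geod k'" using A2(2) False by (cases A2') auto
    obtain r t where r: "ld = ereal r" "meets_perp d r k t" using d(3) k by auto
    obtain t' where r': "meets_perp (\<lambda>t. f (d t)) r k' t'" using d'(3) k' r(1) by auto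
    obtain \<sigma> \<tau> where \<sigma>: "u = ereal \<sigma>" "meets_perp e \<sigma> k \<tau>" using e(5) k by auto
    obtain \<tau>' where \<sigma>': "meets_perp (\<lambda>t. f2 (e t)) \<sigma> k' \<tau>'" using e'(4) k' \<sigma>(1) by auto
    have r0: "0 < r" "x \<le> r" using len r(1) by auto
    have c0: "d 0 \<in> cover P" "f (d 0) \<in> cover P" using d(2) d'(2) r0 r(1) by (auto simp: arc_of_def params_def)
    have c1: "e (\<sigma> - 1) \<in> cover P" "f2 (e (\<sigma> - 1)) \<in> cover P"
      using e(3) e'(2) s(1) \<sigma>(1) by (auto simp: arc_of_def params_def)
    have "sinh r *\<^sub>R (1, 0) + cosh r *\<^sub>R (0, \<i>) = sinh \<sigma> *\<^sub>R q + cosh \<sigma> *\<^sub>R v"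
      by (rule outward_normal_unique[OF A2(1)[unfolded k] _ Y d(1) ld(1) r(2) r0(1) c0(1) e(1) le \<sigma>(2) _ c1(1)]) auto
    moreover have "sinh r *\<^sub>R (cosh c, of_real (sinh c)) + cosh r *\<^sub>R (0, \<i>) = sinh \<sigma> *\<^sub>R q' + cosh \<sigma> *\<^sub>R v'"
      by (rule outward_normal_unique[OF A2(2)[unfolded k'] _ Y d'(1) ld(2) r' r0(1) c0(2) e'(1) le' \<sigma>' _ c1(2)]) auto
    ultimately have "sinh \<sigma> *\<^sub>R q + cosh \<sigma> *\<^sub>R v = (sinh r, Complex 0 (cosh r))"
      "sinh \<sigma> *\<^sub>R q' + cosh \<sigma> *\<^sub>R v' = (sinh r * cosh c, Complex (sinh r * sinh c) (cosh r))"
      by (auto simp: complex_eq_iff prod_eq_iff)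
    moreover have "sinh \<sigma> + cosh \<sigma> > 0" by (simp add: sinh_def cosh_def field_simps)
    moreover have "sinh r > 0" "sinh r \<le> cosh r" using r0(1) sinh_less_cosh_real[of r] by auto
    ultimately show ?thesis using r0(2) by metis
  qed
  then obtain a b w0 w2 where ab: "a *\<^sub>R q + b *\<^sub>R v = (w0, Complex 0 w2)"
      "a *\<^sub>R q' + b *\<^sub>R v' = (w0 * cosh c, Complex (w0 * sinh c) w2)" "a + b > 0" "0 < w0" "w0 \<le> w2"
      "w2 = w0 \<or> (\<exists>r\<ge>x. w0 = sinh r \<and> w2 = cosh r)"
    by metis
  have "cusp_hexagons P \<theta> w L \<delta> c x d g lg ld f Q Q' e f2 q v q' v' n
      (w0, Complex 0 w2) (w0 * cosh c, Complex (w0 * sinh c) w2) \<mu> a b w0 w2"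
    by unfold_locales (use f2 le le' n_def \<mu> ab in auto)
  then show "\<exists>q v q' v' n W W' \<mu> a b w0 w2.
    cusp_hexagons P \<theta> w L \<delta> c x d g lg ld f Q Q' e f2 q v q' v' n W W' \<mu> a b w0 w2" by blast
qed

text \<open>
  Hyperbolic convexity is preserved by intersections as long as there is a convex set containing \<open>S\<close>;
  otherwise the hull would be the whole plane.
\<close>

lemma hconvex_hull:
  assumes "S \<subseteq> K" "hconvex K"
  shows "hconvex (hconvex hull S)" "S \<subseteq> hconvex hull S" "hconvex hull S \<subseteq> K"
proof -
  show "S \<subseteq> hconvex hull S" by (rule hull_subset)
  show K: "hconvex hull S \<subseteq> K" using hull_minimal[of S K hconvex] assms by blast
  show "hconvex (hconvex hull S)"
    unfolding hconvex_def[of "hconvex hull S"]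
  proof (intro conjI allI impI)
    show "hconvex hull S \<subseteq> hdisc" using K hconvex_subset_disc[OF assms(2)] by blast
    fix g s t u assume a: "unit_geodesic g \<and> s \<le> t \<and> t \<le> u \<and> g s \<in> hconvex hull S \<and> g u \<in> hconvex hull S"
    show "g t \<in> hconvex hull S"
      unfolding hull_def
    proof (intro InterI)
      fix M assume "M \<in> {t. hconvex t \<and> S \<subseteq> t}"
      then have M: "hconvex M" "S \<subseteq> M" by auto
      have "g s \<in> M" "g u \<in> M" using a hull_minimal[of S M hconvex] M by auto
      then show "g t \<in> M" using a M(1) unfolding hconvex_def by blast
    qed
  qed
qed

text \<open>
  Any time can be reduced modulo \<open>L\<close> to the period interval, where the parametrization is injective.
\<close>

lemma closed_length_eq_iff:
  assumes "closed_length P a L"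
  shows "proj P (a s) = proj P (a t) \<longleftrightarrow> (\<exists>n::int. s - t = of_int n * L)"
proof -
  have L: "L > 0" and per: "\<And>t. proj P (a (t + L)) = proj P (a t)" and inj: "inj_on (proj P \<circ> a) {0..<L}"
    using assms by (auto simp: closed_length_def)
  have 1: "proj P (a (t + of_int n * L)) = proj P (a t)" for n t
  proof (induction n rule: int_induct[where k = 0])
    case (step1 i)
    then show ?case using per[of "t + of_int i * L"] by (simp add: algebra_simps)
  next
    case (step2 i)
    then show ?case using per[of "t + of_int (i - 1) * L"] by (simp add: algebra_simps)
  qed simp
  define r where "r = (\<lambda>t. t - of_int \<lfloor>t / L\<rfloor> * L)"
  have r: "r t \<in> {0..<L}" "proj P (a (r t)) = proj P (a t)" for t
  proof -
    show "r t \<in> {0..<L}"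
      using floor_divide_lower[OF L, of t] floor_divide_upper[OF L, of t] by (simp add: r_def algebra_simps)
    show "proj P (a (r t)) = proj P (a t)" using 1[of t "- \<lfloor>t / L\<rfloor>"] by (simp add: r_def)
  qed
  show ?thesis
  proof
    assume "proj P (a s) = proj P (a t)"
    then have "(proj P \<circ> a) (r s) = (proj P \<circ> a) (r t)" using r(2) by simp
    then have "r s = r t" by (rule inj_onD[OF inj _ r(1) r(1)])
    then have "s - t = of_int (\<lfloor>s / L\<rfloor> - \<lfloor>t / L\<rfloor>) * L" by (simp add: r_def algebra_simps)
    then show "\<exists>n::int. s - t = of_int n * L" by blast
  next
    assume "\<exists>n::int. s - t = of_int n * L"
    then obtain n :: int where "s = t + of_int n * L" by (auto simp: algebra_simps)
    then show "proj P (a s) = proj P (a t)" using 1 by simp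
  qed
qed

text \<open>
  The strip is laid along the lift \<open>a\<close> of \<open>\<alpha>\<close> with its origin at the foot of \<open>d\<close>; then all three orthogeodesics that
  start on \<open>\<alpha>\<close> are vertical.
\<close>

theorem half_collar_is_collar:
  assumes hc: "nonstandard_half_collar P L lg \<beta> x R" and L: "L > 1"
  obtains \<theta> w where "collar P \<theta> w (L / 2) (tanh x) \<beta> R" "tanh x * cosh (L / 2) = tanh_ext lg" "0 < x" "0 < lg"
proof -
  obtain a A1 g d d' ld Q Q' where P: "geodesic_pants P"
    and cl: "closed_length P a L" and cut: "cut_into_hexagons P a A1 g lg d d' ld Q Q'"
    and bt: "if 1 \<in> punct P then puncture_beta P d ld x \<beta> else geodesic_beta P g lg d d' ld Q Q' x \<beta>"
    and R: "R \<in> components (pts P - (bdry P 0 \<union> \<beta>))" "bdry P 0 \<union> \<beta> \<subseteq> closure R"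
    using hc unfolding nonstandard_half_collar_def by (elim conjE exE) (rule that)
  obtain A2 A2' e e' s u where h: "hexagon P (Geod a) A1 A2 g lg d ld e s u Q"
      "hexagon P (Geod a) A1 A2' g lg d' ld e' s u Q'"
    and ff: "\<exists>f\<in>deck P. \<forall>t. d' t = f (d t)" "\<exists>f\<in>deck P. \<forall>t. e' t = f (e t)"
    and int: "interior Q \<inter> interior Q' = {}" "inj_on (proj P) (interior Q \<union> interior Q')"
    using cut unfolding cut_into_hexagons_def by (elim conjE exE) (rule that)
  obtain f where f: "f \<in> deck P" "\<And>t. d' t = f (d t)" using ff(1) by blast
  obtain f2 where f2: "f2 \<in> deck P" "\<And>t. e' t = f2 (e t)" using ff(2) by blast
  have dd: "d' = (\<lambda>t. f (d t))" "e' = (\<lambda>t. f2 (e t))" using f(2) f2(2) by auto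
  interpret pants_surface P by unfold_locales (rule P)
  have la: "is_lift P 0 (Geod a)" "is_lift P 1 A1" "is_lift P 2 A2" "is_lift P 2 A2'"
    using h by (auto simp: hexagon_def)
  have so: "simple_orthogeodesic P (Geod a) g 0 lg A1" "simple_orthogeodesic P (Geod a) d 0 ld A2"
      "simple_orthogeodesic P (Geod a) (\<lambda>t. f (d t)) 0 ld A2'"
      "simple_orthogeodesic P A1 e s u A2" "simple_orthogeodesic P A1 (\<lambda>t. f2 (e t)) s u A2'"
    using h unfolding hexagon_def dd by auto
  have Qd: "Q = hconvex hull (arc_of g 0 lg \<union> arc_of d 0 ld \<union> arc_of e s u)"
      "Q' = hconvex hull (arc_of g 0 lg \<union> arc_of (\<lambda>t. f (d t)) 0 ld \<union> arc_of (\<lambda>t. f2 (e t)) s u)"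
    using h unfolding hexagon_def dd by auto
  have S: "arc_of g 0 lg \<union> arc_of d 0 ld \<union> arc_of e s u \<subseteq> cover P"
      "arc_of g 0 lg \<union> arc_of (\<lambda>t. f (d t)) 0 ld \<union> arc_of (\<lambda>t. f2 (e t)) s u \<subseteq> cover P"
    using so by (auto simp: simple_orthogeodesic_def)
  note hull = hconvex_hull[OF S(1) cover_hconvex, folded Qd(1)] hconvex_hull[OF S(2) cover_hconvex, folded Qd(2)]
  obtain t1 where t1: "meets_perp d 0 a t1" using so(2) by (auto simp: simple_orthogeodesic_def zero_ereal_def)
  obtain t2 where t2: "meets_perp g 0 a t2" using so(1) by (auto simp: simple_orthogeodesic_def zero_ereal_def)
  obtain t3 where t3: "meets_perp (\<lambda>t. f (d t)) 0 a t3" using so(3) by (auto simp: simple_orthogeodesic_def zero_ereal_def)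
  obtain \<theta> w \<epsilon> where frame: "norm w < 1" "\<bar>\<epsilon>\<bar> = 1" "\<And>t. strip_map \<theta> w (of_real t) = a (t1 + \<epsilon> * t)"
      "\<And>z. z \<in> cover P \<Longrightarrow> 0 \<le> Im (strip_inv \<theta> w z)"
    using boundary_frame[OF la(1), of t1] by (metis insertI1)
  have ua: "unit_geodesic a" "range a \<subseteq> cover P" "proj P ` range a \<subseteq> bdry P 0" using la(1) by auto
  interpret boundary_strip P \<theta> w
    by unfold_locales (use frame ua in \<open>auto simp: image_subset_iff\<close>)
  have ee: "\<epsilon> * \<epsilon> = 1" using frame(2) by (metis abs_mult_self_eq mult_1)
  have vert: "vertical k (\<epsilon> * (t - t1))"
    if k: "unit_geodesic k" "meets_perp k 0 a t" "0 < l" "arc_of k 0 l \<subseteq> cover P" for k t l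
  proof -
    obtain \<sigma> where \<sigma>: "0 < \<sigma>" "ereal \<sigma> \<le> l" using k(3) by (cases l) (auto intro: zero_less_one)
    then have "k \<sigma> \<in> cover P" using k(4) by (auto simp: arc_of_def params_def)
    moreover have "meets_perp k 0 (\<lambda>t. \<Psi> (of_real t)) (\<epsilon> * (t - t1))"
      unfolding frame(3) by (rule meets_perp_reparam[OF k(2) ua(1) frame(2)])
    ultimately show ?thesis using perp_base_vertical[OF k(1) _ \<sigma>(1)] by blast
  qed
  have vd: "vertical d 0" using vert[OF _ t1, of ld] so(2) by (auto simp: simple_orthogeodesic_def)
  have vg: "vertical g (\<epsilon> * (t2 - t1))" using vert[OF _ t2, of lg] so(1) by (auto simp: simple_orthogeodesic_def)
  have vd': "vertical (\<lambda>t. f (d t)) (\<epsilon> * (t3 - t1))" using vert[OF _ t3, of ld] so(3) by (auto simp: simple_orthogeodesic_def)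
  have per: "proj P (\<Psi> (of_real s)) = proj P (\<Psi> (of_real t)) \<longleftrightarrow> (\<exists>n::int. s - t = of_int n * L)" for s t
  proof -
    have "\<epsilon> = 1 \<or> \<epsilon> = - 1" using frame(2) by (auto simp: abs_if split: if_splits)
    then show ?thesis
    proof
      assume "\<epsilon> = - 1"
      then have "proj P (\<Psi> (of_real s)) = proj P (\<Psi> (of_real t)) \<longleftrightarrow> (\<exists>n::int. t - s = of_int n * L)"
        unfolding frame(3) closed_length_eq_iff[OF cl] by simp
      also have "\<dots> \<longleftrightarrow> (\<exists>n::int. s - t = of_int n * L)"
      proof -
        have "t - s = of_int n * L \<longleftrightarrow> s - t = of_int (- n) * L" for n :: int by auto
        then show ?thesis by (metis minus_minus)
      qed
      finally show ?thesis .
    qed (simp add: frame(3) closed_length_eq_iff[OF cl])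
  qed
  have len: "0 < ld" "0 < lg" using so(1,2) by (auto simp: simple_orthogeodesic_def)
  have x: "0 < x" "ereal x \<le> ld"
    using bt by (auto simp: puncture_beta_def geodesic_beta_def perpendicular_in_def split: if_splits)
  have base_onto: "\<exists>f\<in>deck P. \<exists>t. f z = \<Psi> (of_real t)" if z: "z \<in> cover P" "proj P z \<in> bdry P 0" for z
  proof -
    obtain f t where "f \<in> deck P" "f z = a t" using bdry_lift_point[OF la(1) cl _ z] by auto
    moreover have "\<Psi> (of_real (\<epsilon> * (t - t1))) = a t" unfolding frame(3) using ee by (simp flip: mult.assoc)
    ultimately show ?thesis by metis
  qed
  interpret split_pants P \<theta> w L "\<epsilon> * (t2 - t1)" "\<epsilon> * (t3 - t1)" x d g lg ld f Q Q'
    by unfold_locales (use L per vd vg f vd' hull int len x in auto)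
  have dinj: "inj_on (proj P \<circ> d) (params 0 ld)" using so(2) by (simp add: simple_orthogeodesic_def)
  have "tanh x * cosh (L / 2) = tanh_ext lg \<and> collar P \<theta> w (L / 2) (tanh x) \<beta> R"
  proof (cases "1 \<in> punct P")
    case True
    obtain p t where p: "unit_geodesic p" "range p \<subseteq> cover P" "inj (proj P \<circ> p)" "meets_perp p t d x" "\<beta> = proj P ` range p"
      using bt True by (auto simp: puncture_beta_def)
    note cusp = cusp_hexagons_exist[OF True la(2-4) so f2(1)]
    obtain q v q' v' n W W' \<mu> b0 b w0 w2 where "cusp_hexagons P \<theta> w L (\<epsilon> * (t2 - t1)) (\<epsilon> * (t3 - t1)) x d g lg ld f Q Q' e f2 q v q' v' n W W' \<mu> b0 b w0 w2"
      using cusp(2) by metis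
    then interpret cusp_hexagons P \<theta> w L "\<epsilon> * (t2 - t1)" "\<epsilon> * (t3 - t1)" x d g lg ld f Q Q' e f2 q v q' v' n W W' \<mu> b0 b w0 w2 .
    show ?thesis using puncture_collar[OF cusp(1) p base_onto R] by blast
  next
    case False
    then obtain r p m p' m' x' where "lg = ereal r" "perpendicular_in Q (g r) d ld p m x"
        "perpendicular_in Q' (g r) (\<lambda>t. f (d t)) ld p' m' x'" "proj P (p m) = proj P (p' m')"
        "\<beta> = proj P ` (arc_of p 0 m \<union> arc_of p' 0 m')"
      using bt unfolding geodesic_beta_def dd by auto
    then show ?thesis using geodesic_collar[OF _ _ _ _ dinj _ base_onto R] by blast
  qed
  then show ?thesis using that x(1) len(2) by blast
qed

text \<open>The mean value theorem bounds \<open>tanh x / x\<close> by values of the derivative \<open>1 - tanh\<^sup>2\<close>.\<close>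

lemma tanh_bounds:
  assumes "0 < (x::real)" shows "tanh x \<le> x" "(1 - (tanh x)\<^sup>2) * x \<le> tanh x"
proof -
  have "\<exists>z. z > 0 \<and> z < x \<and> tanh x - tanh 0 = (x - 0) * (1 - (tanh z)\<^sup>2)"
    by (rule MVT2[OF assms]) (auto intro!: derivative_eq_intros)
  then obtain z where z: "0 < z" "z < x" "tanh x = x * (1 - (tanh z)\<^sup>2)" by auto
  show "tanh x \<le> x" unfolding z(3) using assms by (simp add: mult_le_cancel_left1)
  have "tanh z \<le> tanh x" "0 \<le> tanh z" using z(1,2) by auto
  then have "(tanh z)\<^sup>2 \<le> (tanh x)\<^sup>2" by (rule power_mono)
  then have "x * (1 - (tanh x)\<^sup>2) \<le> x * (1 - (tanh z)\<^sup>2)" using assms by (intro mult_left_mono) auto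
  then show "(1 - (tanh x)\<^sup>2) * x \<le> tanh x" unfolding z(3)[symmetric] by (simp add: mult.commute)
qed

theorem theorem5p6:
  shows "\<exists>C\<ge>1. \<forall>P L lg \<beta> x R.
    nonstandard_half_collar P L lg \<beta> x R \<and> L > 1 \<longrightarrow>
      tanh x = tanh_ext lg / cosh (L / 2) \<and>
      ennreal (x / C) \<le> extremal_length P (bdry P 0) \<beta> R \<and>
      extremal_length P (bdry P 0) \<beta> R \<le> ennreal (C * x)"
proof -
  define c where "c = cosh (1 / 2 :: real)"
  define K where "K = 1 - (1 / c)\<^sup>2"
  have c: "c > 1" unfolding c_def using cosh_real_one_iff[of "1/2"] cosh_real_ge_1[of "1/2"] by linarith
  have "(1 / c)\<^sup>2 < 1" using c by (simp add: power_one_over one_less_power)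
  then have K: "K > 0" by (simp add: K_def)
  define C where "C = max (6 * c) (3 * pi / K)"
  have C: "C \<ge> 1" "6 * c \<le> C" "3 * pi / K \<le> C" using c by (auto simp: C_def)
  show ?thesis
  proof (intro exI[of _ C] conjI allI impI C(1); elim conjE)
    fix P L lg \<beta> x R assume h: "nonstandard_half_collar P L lg \<beta> x R" "L > 1"
    obtain \<theta> w where col: "collar P \<theta> w (L / 2) (tanh x) \<beta> R" and e: "tanh x * cosh (L / 2) = tanh_ext lg"
      and x: "0 < x" "0 < lg" by (rule half_collar_is_collar[OF h])
    show th: "tanh x = tanh_ext lg / cosh (L / 2)" unfolding e[symmetric] by simp
    have "c \<le> cosh (L / 2)" unfolding c_def using h(2) by (subst cosh_real_nonneg_le_iff) auto
    then have "tanh_ext lg / cosh (L / 2) \<le> 1 / c" using tanh_ext_le_1[OF x(2)] c by (intro frac_le) auto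
    then have "tanh x \<le> 1 / c" unfolding th .
    then have "(tanh x)\<^sup>2 \<le> (1 / c)\<^sup>2" using x(1) by (intro power_mono) auto
    then have "K * x \<le> (1 - (tanh x)\<^sup>2) * x" using x(1) by (intro mult_right_mono) (auto simp: K_def)
    also have "\<dots> \<le> tanh x" by (rule tanh_bounds[OF x(1)])
    finally have low: "K * x \<le> tanh x" .
    have "x / C \<le> x / (3 * pi / K)" using C K x(1) by (intro divide_left_mono) auto
    also have "\<dots> = K * x / (3 * pi)" by simp
    also have "\<dots> \<le> tanh x / (3 * pi)" using low by (intro divide_right_mono) auto
    finally have "ennreal (x / C) \<le> ennreal (tanh x / (3 * pi))" by (rule ennreal_leI)
    also have "\<dots> \<le> extremal_length P (bdry P 0) \<beta> R" by (rule collar.extremal_length_lower[OF col])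
    finally show "ennreal (x / C) \<le> extremal_length P (bdry P 0) \<beta> R" .
    have "6 * c * tanh x \<le> C * x" using C c tanh_bounds(1)[OF x(1)] x(1) by (intro mult_mono) auto
    then have "ennreal (6 * c * tanh x) \<le> ennreal (C * x)" by (rule ennreal_leI)
    then show "extremal_length P (bdry P 0) \<beta> R \<le> ennreal (C * x)"
      using order_trans[OF collar.extremal_length_upper[OF col]] unfolding c_def by blast
  qed
qed

end
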